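(* Let $(\Lambda,\Lambda_1)$ be a maximal pair of bivectors on a finite dimensional vector space $W$ over $\mathbb K$. Set $r=\mathrm{corank}(\Lambda,\Lambda_1)$. Let $L_0$ be the intersection of all the vector subspaces $\mathrm{Im}(\Lambda+t\Lambda_1)$, $t\in\mathbb K$, of codimension $r$, and let $L'_0$ be its annihilator in $W^*$. Then: (a) $L_0\subset\mathrm{Im}\,\Lambda_1$ and $\Lambda(L'_0,\cdot)=\Lambda_1(L'_0,\cdot)$ (as subspaces of $W$). Set $L_1=\Lambda(L'_0,\cdot)$. (b) The restrictions to $L_0$ of the $2$-forms associated to $\Lambda$ and $\Lambda_1$ respectively (which are unique since $L_0\subset\mathrm{Im}\,\Lambda\cap\mathrm{Im}\,\Lambda_1$) have $L_1$ as kernel. Therefore the projections on $L_0/L_1$ of these restricted $2$-forms, denoted by $\bar\omega$ and $\bar\omega_1$ respectively, are symplectic. (c) Setting $w(t)$ equal to the image of $\mathrm{Im}(\Lambda+t\Lambda_1)$ in $W/L_0$, $t\in\mathbb K$, defines a Veronese web $w$ (of codimension $r$) on $W/L_0$. (d) The elementary divisors of $(\bar\omega,\bar\omega_1)$ and the characteristic numbers $n_1\ge\dots\ge n_r$ of $w$ determine the algebraic structure of $(\Lambda,\Lambda_1)$ completely. More precisely $(\Lambda,\Lambda_1,W)$ is isomorphic to a product $\prod_{\ell=0}^r(\Lambda^\ell,\Lambda_1^\ell,W^\ell)$, where $(\Lambda^0,\Lambda^0_1,W^0)$ is isomorphic to the dual pair of $(\bar\omega,\bar\omega_1,L_0/L_1)$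 and every $(\Lambda^\ell,\Lambda^\ell_1,W^\ell)$, $\ell=1,\dots,r$, is the Kronecker elementary pair in dimension $2n_\ell-1$. (e) For $a\in\mathbb K$, $\mathrm{corank}(\Lambda+a\Lambda_1)>r$ if and only if $-a$ is a root of the characteristic polynomial of $(\bar\omega,\bar\omega_1)$.
   Context: $\mathbb K=\mathbb R$ or $\mathbb C$. For a bivector $\Lambda\in\Lambda^2W$, $\mathrm{Im}\,\Lambda=\Lambda(W^*,\cdot)\subset W$. The rank of a pair $(\Lambda,\Lambda_1)$ is the maximum of the ranks of $(1-t)\Lambda+t\Lambda_1$, $t\in\mathbb K$; its corank is $\dim W$ minus its rank. The pair is maximal if $\mathrm{rank}(\Lambda)=\mathrm{rank}(\Lambda_1)=\mathrm{rank}(\Lambda,\Lambda_1)$. Dual bivector of a symplectic form: if $\omega=\sum_je^*_{2j-1}\wedge e^*_{2j}$ in a basis $\{e_i\}$, then $\Lambda_\omega=\sum_je_{2j-1}\wedge e_{2j}$. Any bivector $\Lambda$ is, on $\mathrm{Im}\,\Lambda$, the dual of a unique symplectic form on $\mathrm{Im}\,\Lambda$, called the $2$-form associated to $\Lambda$. The dual pair of $(\omega,\omega_1)$ is $(\Lambda_\omega,\Lambda_{\omega_1})$. For symplectic forms $\omega,\omega_1$ on a space $E$, let $K\in\mathrm{End}(E)$ be defined by $\omega_1(u,v)=\omega(Ku,v)$; the characteristic polynomial and elementary divisors of $(\omega,\omega_1)$ are those of $K$. Veronese web on a vector space $V$ of codimension $r\ge1$: a family $w=\{w(t)\mid t\in\mathbb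 K\}$, $w(t)=\mathrm{Ker}\,\gamma(t)$, where $\gamma=\gamma_1\wedge\dots\wedge\gamma_r$ is a curve in $\Lambda^rV^*$ with $\gamma_j(t)=\sum_{i=1}^{n_j}t^{i-1}\beta_{ij}$ for some basis $\{\beta_{ij}\}$, $1\le i\le n_j$, $1\le j\le r$, of $V^*$. The numbers $n_1,\dots,n_r$ depend only on $w$ up to order and are its characteristic numbers. Kronecker elementary pair in dimension $2n-1$: take a vector space $E$ with basis $\{e_1,\dots,e_{2n}\}$, pairwise distinct nonzero scalars $b_1,\dots,b_n$, $\Omega=\sum_{j=1}^ne^*_{2j-1}\wedge e^*_{2j}$, $\Omega_1=\sum_{j=1}^nb_je^*_{2j-1}\wedge e^*_{2j}$, $e=-\sum_{j=1}^ne_{2j}$; the pair consists of the images in $E/\mathbb Ke$ of $\Lambda_\Omega,\Lambda_{\Omega_1}$. Up to isomorphism it depends only on $n$. When $r=0$ there are no Kronecker factors, $W/L_0=0$ and (c) is void. *)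

theory Defs
  imports "HOL-Algebra.AbelCoset" "Jordan_Normal_Form.VS_Connect" "Jordan_Normal_Form.Char_Poly"
begin

hide_const (open) Multiset.mult Polynomial.smult Modules.module

(* Isomorphic, as a field, to the reals or to the complex numbers; a single type class lets
   one statement cover both base fields. *)
class real_or_complex = field_char_0 +
  assumes real_or_complex:
    "(\<exists>f :: 'a \<Rightarrow> real. bij f \<and> (\<forall>x y. f (x + y) = f x + f y \<and> f (x * y) = f x * f y)) \<or>
     (\<exists>f :: 'a \<Rightarrow> complex. bij f \<and> (\<forall>x y. f (x + y) = f x + f y \<and> f (x * y) = f x * f y))"

instance real :: real_or_complex
  by standard (metis bij_id id_apply)

instance complex :: real_or_complex
  by standard (metis bij_id id_apply)


section \<open>Linear algebra on explicit carriers\<close>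

abbreviation vspace :: "('k::field, 'v) module \<Rightarrow> bool" where
  "vspace V \<equiv> vectorspace class_ring V"

abbreviation vfin_dim :: "('k::field, 'v) module \<Rightarrow> bool" where
  "vfin_dim V \<equiv> vectorspace.fin_dim class_ring V"

abbreviation vdim :: "('k::field, 'v) module \<Rightarrow> nat" where
  "vdim V \<equiv> vectorspace.dim class_ring V"

abbreviation on_subspace :: "('k, 'v) module \<Rightarrow> 'v set \<Rightarrow> ('k, 'v) module" where
  "on_subspace V U \<equiv> V\<lparr>carrier := U\<rparr>"

definition basis_family :: "('k::field, 'v) module \<Rightarrow> 'i set \<Rightarrow> ('i \<Rightarrow> 'v) \<Rightarrow> bool" where
  "basis_family V I e \<longleftrightarrow> inj_on e I \<and> vectorspace.basis class_ring V (e ` I)"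

(* Functionals are extensional on the carrier, so that equality of functionals is
   equality of functions.  The ring fields mult and one of a module record play no role
   for vector spaces. *)
definition dual_space :: "('k::field, 'v) module \<Rightarrow> ('k, 'v \<Rightarrow> 'k) module" where
  "dual_space V = \<lparr>
     carrier = {\<alpha> \<in> extensional (carrier V).
        (\<forall>x\<in>carrier V. \<forall>y\<in>carrier V. \<alpha> (x \<oplus>\<^bsub>V\<^esub> y) = \<alpha> x + \<alpha> y) \<and>
        (\<forall>c. \<forall>x\<in>carrier V. \<alpha> (c \<odot>\<^bsub>V\<^esub> x) = c * \<alpha> x)},
     mult = undefined, one = undefined,
     zero = (\<lambda>x\<in>carrier V. 0),
     add = (\<lambda>\<alpha> \<beta>. \<lambda>x\<in>carrier V. \<alpha> x + \<beta> x),
     smult = (\<lambda>c \<alpha>. \<lambda>x\<in>carrier V. c * \<alpha> x)\<rparr>"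

abbreviation functionals :: "('k::field, 'v) module \<Rightarrow> ('v \<Rightarrow> 'k) set" where
  "functionals V \<equiv> carrier (dual_space V)"

definition dual_basis ::
  "('k::field, 'v) module \<Rightarrow> 'i set \<Rightarrow> ('i \<Rightarrow> 'v) \<Rightarrow> 'i \<Rightarrow> 'v \<Rightarrow> 'k" where
  "dual_basis V I e i =
     (THE \<alpha>. \<alpha> \<in> functionals V \<and> (\<forall>j\<in>I. \<alpha> (e j) = (if j = i then 1 else 0)))"

definition annihilator :: "('k::field, 'v) module \<Rightarrow> 'v set \<Rightarrow> ('v \<Rightarrow> 'k) set" where
  "annihilator V U = {\<alpha> \<in> functionals V. \<forall>x\<in>U. \<alpha> x = 0}"

definition quotient_space :: "('k::field, 'v) module \<Rightarrow> 'v set \<Rightarrow> ('k, 'v set) module" where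
  "quotient_space V U = \<lparr>
     carrier = a_rcosets\<^bsub>V\<^esub> U,
     mult = undefined, one = undefined,
     zero = U,
     add = (\<lambda>X Y. X <+>\<^bsub>V\<^esub> Y),
     smult = (\<lambda>c X. \<Union>x\<in>X. U +>\<^bsub>V\<^esub> (c \<odot>\<^bsub>V\<^esub> x))\<rparr>"

abbreviation projection :: "('k::field, 'v) module \<Rightarrow> 'v set \<Rightarrow> 'v \<Rightarrow> 'v set" where
  "projection V U \<equiv> (\<lambda>x. U +>\<^bsub>V\<^esub> x)"

definition product_space ::
  "'i set \<Rightarrow> ('i \<Rightarrow> ('k::field, 'v) module) \<Rightarrow> ('k, 'i \<Rightarrow> 'v) module" where
  "product_space I V = \<lparr>
     carrier = (\<Pi>\<^sub>E i\<in>I. carrier (V i)),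
     mult = undefined, one = undefined,
     zero = (\<lambda>i\<in>I. \<zero>\<^bsub>V i\<^esub>),
     add = (\<lambda>x y. \<lambda>i\<in>I. x i \<oplus>\<^bsub>V i\<^esub> y i),
     smult = (\<lambda>c x. \<lambda>i\<in>I. c \<odot>\<^bsub>V i\<^esub> x i)\<rparr>"

definition inclusion :: "'i set \<Rightarrow> ('i \<Rightarrow> ('k::field, 'v) module) \<Rightarrow> 'i \<Rightarrow> 'v \<Rightarrow> ('i \<Rightarrow> 'v)" where
  "inclusion I V i x = (\<lambda>j\<in>I. if j = i then x else \<zero>\<^bsub>V j\<^esub>)"


section \<open>Alternating forms and bivectors\<close>

definition alternating_form :: "('k::field, 'v) module \<Rightarrow> ('v \<Rightarrow> 'v \<Rightarrow> 'k) \<Rightarrow> bool" where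
  "alternating_form V \<omega> \<longleftrightarrow>
     (\<forall>x\<in>carrier V. \<forall>y\<in>carrier V. \<forall>z\<in>carrier V.
        \<omega> (x \<oplus>\<^bsub>V\<^esub> y) z = \<omega> x z + \<omega> y z \<and> \<omega> z (x \<oplus>\<^bsub>V\<^esub> y) = \<omega> z x + \<omega> z y) \<and>
     (\<forall>c. \<forall>x\<in>carrier V. \<forall>y\<in>carrier V.
        \<omega> (c \<odot>\<^bsub>V\<^esub> x) y = c * \<omega> x y \<and> \<omega> x (c \<odot>\<^bsub>V\<^esub> y) = c * \<omega> x y) \<and>
     (\<forall>x\<in>carrier V. \<omega> x x = 0)"

definition form_kernel :: "('k::field, 'v) module \<Rightarrow> ('v \<Rightarrow> 'v \<Rightarrow> 'k) \<Rightarrow> 'v set" where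
  "form_kernel V \<omega> = {u \<in> carrier V. \<forall>v\<in>carrier V. \<omega> u v = 0}"

definition symplectic_form :: "('k::field, 'v) module \<Rightarrow> ('v \<Rightarrow> 'v \<Rightarrow> 'k) \<Rightarrow> bool" where
  "symplectic_form V \<omega> \<longleftrightarrow> alternating_form V \<omega> \<and> form_kernel V \<omega> = {\<zero>\<^bsub>V\<^esub>}"

(* For finite dimensional V, the second exterior power of V is identified with the space of
   alternating bilinear forms on the dual of V; here u \<and> v is the form
   (\<alpha>, \<beta>) \<mapsto> \<alpha> u * \<beta> v - \<alpha> v * \<beta> u.  Only the values on functionals matter. *)
type_synonym ('k, 'v) bivec = "('v \<Rightarrow> 'k) \<Rightarrow> ('v \<Rightarrow> 'k) \<Rightarrow> 'k"

definition bivector :: "('k::field, 'v) module \<Rightarrow> ('k, 'v) bivec \<Rightarrow> bool" where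
  "bivector V \<Lambda> \<longleftrightarrow> alternating_form (dual_space V) \<Lambda>"

(* The vector \<Lambda>(\<alpha>, _) of V, under the identification of V with its bidual. *)
definition sharp :: "('k::field, 'v) module \<Rightarrow> ('k, 'v) bivec \<Rightarrow> ('v \<Rightarrow> 'k) \<Rightarrow> 'v" where
  "sharp V \<Lambda> \<alpha> = (THE v. v \<in> carrier V \<and> (\<forall>\<beta>\<in>functionals V. \<beta> v = \<Lambda> \<alpha> \<beta>))"

definition bivector_image :: "('k::field, 'v) module \<Rightarrow> ('k, 'v) bivec \<Rightarrow> 'v set" where
  "bivector_image V \<Lambda> = sharp V \<Lambda> ` functionals V"

definition rank :: "('k::field, 'v) module \<Rightarrow> ('k, 'v) bivec \<Rightarrow> nat" where
  "rank V \<Lambda> = vdim (on_subspace V (bivector_image V \<Lambda>))"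

definition corank :: "('k::field, 'v) module \<Rightarrow> ('k, 'v) bivec \<Rightarrow> nat" where
  "corank V \<Lambda> = vdim V - rank V \<Lambda>"

definition pair_rank ::
  "('k::field, 'v) module \<Rightarrow> ('k, 'v) bivec \<Rightarrow> ('k, 'v) bivec \<Rightarrow> nat" where
  "pair_rank V \<Lambda> \<Lambda>\<^sub>1 = Max (range (\<lambda>t. rank V (\<lambda>\<alpha> \<beta>. (1 - t) * \<Lambda> \<alpha> \<beta> + t * \<Lambda>\<^sub>1 \<alpha> \<beta>)))"

definition pair_corank ::
  "('k::field, 'v) module \<Rightarrow> ('k, 'v) bivec \<Rightarrow> ('k, 'v) bivec \<Rightarrow> nat" where
  "pair_corank V \<Lambda> \<Lambda>\<^sub>1 = vdim V - pair_rank V \<Lambda> \<Lambda>\<^sub>1"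

definition maximal_pair ::
  "('k::field, 'v) module \<Rightarrow> ('k, 'v) bivec \<Rightarrow> ('k, 'v) bivec \<Rightarrow> bool" where
  "maximal_pair V \<Lambda> \<Lambda>\<^sub>1 \<longleftrightarrow>
     rank V \<Lambda> = pair_rank V \<Lambda> \<Lambda>\<^sub>1 \<and> rank V \<Lambda>\<^sub>1 = pair_rank V \<Lambda> \<Lambda>\<^sub>1"

definition pencil ::
  "('k::field, 'v) bivec \<Rightarrow> ('k, 'v) bivec \<Rightarrow> 'k \<Rightarrow> ('k, 'v) bivec" where
  "pencil \<Lambda> \<Lambda>\<^sub>1 t = (\<lambda>\<alpha> \<beta>. \<Lambda> \<alpha> \<beta> + t * \<Lambda>\<^sub>1 \<alpha> \<beta>)"

(* Image of a bivector on V under a linear map f defined on V. *)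
definition pushforward ::
  "('k::field, 'v) module \<Rightarrow> ('v \<Rightarrow> 'u) \<Rightarrow> ('k, 'v) bivec \<Rightarrow> ('k, 'u) bivec" where
  "pushforward V f \<Lambda> =
     (\<lambda>\<alpha> \<beta>. \<Lambda> (compose (carrier V) \<alpha> f) (compose (carrier V) \<beta> f))"

definition pair_isomorphic ::
  "('k::field, 'v) module \<Rightarrow> ('k, 'v) bivec \<Rightarrow> ('k, 'v) bivec \<Rightarrow>
   ('k, 'u) module \<Rightarrow> ('k, 'u) bivec \<Rightarrow> ('k, 'u) bivec \<Rightarrow> bool" where
  "pair_isomorphic V \<Lambda> \<Lambda>\<^sub>1 U \<Gamma> \<Gamma>\<^sub>1 \<longleftrightarrow>
     (\<exists>f. linear_map class_ring V U f \<and> bij_betw f (carrier V) (carrier U) \<and>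
        (\<forall>\<alpha>\<in>functionals U. \<forall>\<beta>\<in>functionals U.
           pushforward V f \<Lambda> \<alpha> \<beta> = \<Gamma> \<alpha> \<beta> \<and> pushforward V f \<Lambda>\<^sub>1 \<alpha> \<beta> = \<Gamma>\<^sub>1 \<alpha> \<beta>))"

definition direct_sum_bivector ::
  "('k::field, 'v) module \<Rightarrow> ('k, 'v) bivec \<Rightarrow> ('k, 'u) module \<Rightarrow> ('k, 'u) bivec \<Rightarrow>
   ('k, 'v \<times> 'u) bivec" where
  "direct_sum_bivector V \<Lambda> U \<Gamma> =
     (\<lambda>\<alpha> \<beta>. pushforward V (inj1 V U) \<Lambda> \<alpha> \<beta> + pushforward U (inj2 V U) \<Gamma> \<alpha> \<beta>)"

definition product_bivector ::
  "'i set \<Rightarrow> ('i \<Rightarrow> ('k::field, 'v) module) \<Rightarrow> ('i \<Rightarrow> ('k, 'v) bivec) \<Rightarrow>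
   ('k, 'i \<Rightarrow> 'v) bivec" where
  "product_bivector I V \<Lambda> = (\<lambda>\<alpha> \<beta>. \<Sum>i\<in>I. pushforward (V i) (inclusion I V i) (\<Lambda> i) \<alpha> \<beta>)"


section \<open>Duality between symplectic forms and bivectors\<close>

(* The sum of c j * (f (2j-1) \<and> f (2j)) over 1 \<le> j \<le> n.  It is used both for covectors f i
   and, with f i = (\<lambda>\<alpha>. \<alpha> (e i)), for vectors e i. *)
definition wedge_sum :: "nat \<Rightarrow> (nat \<Rightarrow> 'k) \<Rightarrow> (nat \<Rightarrow> 'x \<Rightarrow> 'k::field) \<Rightarrow> 'x \<Rightarrow> 'x \<Rightarrow> 'k" where
  "wedge_sum n c f x y =
     (\<Sum>j=1..n. c j * (f (2*j - 1) x * f (2*j) y - f (2*j) x * f (2*j - 1) y))"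

definition darboux_basis ::
  "('k::field, 'v) module \<Rightarrow> ('v \<Rightarrow> 'v \<Rightarrow> 'k) \<Rightarrow> nat \<Rightarrow> (nat \<Rightarrow> 'v) \<Rightarrow> bool" where
  "darboux_basis V \<omega> n e \<longleftrightarrow>
     basis_family V {1..2*n} e \<and>
     (\<forall>u\<in>carrier V. \<forall>v\<in>carrier V.
        \<omega> u v = wedge_sum n (\<lambda>_. 1) (dual_basis V {1..2*n} e) u v)"

(* The result does not depend on the chosen Darboux basis. *)
definition dual_bivector ::
  "('k::field, 'v) module \<Rightarrow> ('v \<Rightarrow> 'v \<Rightarrow> 'k) \<Rightarrow> ('k, 'v) bivec" where
  "dual_bivector V \<omega> =
     (let (n, e) = (SOME (n, e). darboux_basis V \<omega> n e)
      in wedge_sum n (\<lambda>_. 1) (\<lambda>i \<alpha>. \<alpha> (e i)))"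

(* Unique on the image of the bivector; the values outside are irrelevant. *)
definition associated_form ::
  "('k::field, 'v) module \<Rightarrow> ('k, 'v) bivec \<Rightarrow> 'v \<Rightarrow> 'v \<Rightarrow> 'k" where
  "associated_form V \<Lambda> =
     (let I = on_subspace V (bivector_image V \<Lambda>)
      in SOME \<omega>. symplectic_form I \<omega> \<and>
           (\<forall>\<alpha>\<in>functionals V. \<forall>\<beta>\<in>functionals V.
              \<Lambda> \<alpha> \<beta> = pushforward I (\<lambda>x. x) (dual_bivector I \<omega>) \<alpha> \<beta>))"

definition projected_form :: "('v \<Rightarrow> 'v \<Rightarrow> 'k) \<Rightarrow> 'v set \<Rightarrow> 'v set \<Rightarrow> 'k" where
  "projected_form \<omega> X Y = (THE c. \<forall>x\<in>X. \<forall>y\<in>Y. \<omega> x y = c)"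


section \<open>Characteristic polynomial and elementary divisors\<close>

definition endo_char_poly :: "('k::field, 'v) module \<Rightarrow> ('v \<Rightarrow> 'v) \<Rightarrow> 'k poly" where
  "endo_char_poly E K =
     (let (m, e) = (SOME (m, e). basis_family E {..<m} e)
      in char_poly (mat m m (\<lambda>(i, j). dual_basis E {..<m} e i (K (e j)))))"

definition poly_action :: "('k::field, 'v) module \<Rightarrow> ('v \<Rightarrow> 'v) \<Rightarrow> 'k poly \<Rightarrow> 'v \<Rightarrow> 'v" where
  "poly_action E K p v = (\<Oplus>\<^bsub>E\<^esub> i\<in>{..degree p}. Polynomial.coeff p i \<odot>\<^bsub>E\<^esub> (K ^^ i) v)"

(* E is the direct sum of K-stable subspaces K[x] v_i, with K[x] v_i isomorphic to
   K[x]/(q_i) and each q_i a power of a monic irreducible polynomial; the elementary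
   divisors are the q_i, counted with multiplicity. *)
definition has_elementary_divisors ::
  "('k::field, 'v) module \<Rightarrow> ('v \<Rightarrow> 'v) \<Rightarrow> 'k poly multiset \<Rightarrow> bool" where
  "has_elementary_divisors E K M \<longleftrightarrow>
     (\<exists>q v. M = mset q \<and>
        (\<forall>i<length q.
           (\<exists>p k. Factorial_Ring.irreducible p \<and> lead_coeff p = 1 \<and> 1 \<le> k \<and> q ! i = p ^ k) \<and>
           v i \<in> carrier E \<and> poly_action E K (q ! i) (v i) = \<zero>\<^bsub>E\<^esub>) \<and>
        basis_family E {(i, j). i < length q \<and> j < degree (q ! i)} (\<lambda>(i, j). (K ^^ j) (v i)))"

definition pair_operator ::
  "('k::field, 'v) module \<Rightarrow> ('v \<Rightarrow> 'v \<Rightarrow> 'k) \<Rightarrow> ('v \<Rightarrow> 'v \<Rightarrow> 'k) \<Rightarrow> 'v \<Rightarrow> 'v" where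
  "pair_operator E \<omega> \<omega>\<^sub>1 u =
     (THE x. x \<in> carrier E \<and> (\<forall>v\<in>carrier E. \<omega>\<^sub>1 u v = \<omega> x v))"


section \<open>Veronese webs\<close>

(* (\<gamma>_1 \<and> ... \<and> \<gamma>_r)(x_1, ..., x_r) as a determinant; matrix indices start at 0. *)
definition wedge_form :: "nat \<Rightarrow> (nat \<Rightarrow> 'v \<Rightarrow> 'k) \<Rightarrow> (nat \<Rightarrow> 'v) \<Rightarrow> 'k::field" where
  "wedge_form r \<gamma> x = det (mat r r (\<lambda>(i, j). \<gamma> (i + 1) (x (j + 1))))"

(* The vectors whose interior product with the r-form \<theta> vanishes (r \<ge> 1). *)
definition multiform_kernel ::
  "('k::field, 'v) module \<Rightarrow> nat \<Rightarrow> ((nat \<Rightarrow> 'v) \<Rightarrow> 'k) \<Rightarrow> 'v set" where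
  "multiform_kernel V r \<theta> =
     {v \<in> carrier V. \<forall>x. (\<forall>j\<in>{1..r}. x j \<in> carrier V) \<and> x 1 = v \<longrightarrow> \<theta> x = 0}"

definition veronese_web_with ::
  "('k::field, 'v) module \<Rightarrow> nat \<Rightarrow> ('k \<Rightarrow> 'v set) \<Rightarrow> (nat \<Rightarrow> nat) \<Rightarrow> bool" where
  "veronese_web_with V r w n \<longleftrightarrow>
     1 \<le> r \<and> (\<forall>j\<in>{1..r}. 1 \<le> n j) \<and>
     (\<exists>\<beta>. basis_family (dual_space V) {(i, j). j \<in> {1..r} \<and> i \<in> {1..n j}} (\<lambda>(i, j). \<beta> i j) \<and>
        (\<forall>t. w t = multiform_kernel V r
           (wedge_form r (\<lambda>j. \<lambda>x\<in>carrier V. \<Sum>i=1..n j. t ^ (i - 1) * \<beta> i j x))))"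

definition veronese_web :: "('k::field, 'v) module \<Rightarrow> nat \<Rightarrow> ('k \<Rightarrow> 'v set) \<Rightarrow> bool" where
  "veronese_web V r w \<longleftrightarrow> (\<exists>n. veronese_web_with V r w n)"


section \<open>Kronecker elementary pairs\<close>

definition kron_ambient :: "nat \<Rightarrow> ('k::field, 'k vec) module" where
  "kron_ambient n = module_vec TYPE('k) (2*n)"

(* e_1, ..., e_{2n}; the unit vectors of the library are indexed from 0. *)
definition kron_basis :: "nat \<Rightarrow> nat \<Rightarrow> 'k::field vec" where
  "kron_basis n i = unit_vec (2*n) (i - 1)"

definition kron_line :: "nat \<Rightarrow> 'k::field vec set" where
  "kron_line n =
     (let e = \<ominus>\<^bsub>kron_ambient n\<^esub> (\<Oplus>\<^bsub>kron_ambient n\<^esub> j\<in>{1..n}. kron_basis n (2*j))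
      in range (\<lambda>c. c \<odot>\<^bsub>kron_ambient n\<^esub> e))"

definition kron_form :: "nat \<Rightarrow> (nat \<Rightarrow> 'k) \<Rightarrow> 'k::field vec \<Rightarrow> 'k vec \<Rightarrow> 'k" where
  "kron_form n b = wedge_sum n b (dual_basis (kron_ambient n) {1..2*n} (kron_basis n))"

definition kron_space :: "nat \<Rightarrow> ('k::field, 'k vec set) module" where
  "kron_space n = quotient_space (kron_ambient n) (kron_line n)"

(* The Kronecker elementary pair in dimension 2n-1 built from the scalars b 1, ..., b n is
   (kron_bivector n (\<lambda>_. 1), kron_bivector n b) on kron_space n. *)
definition kron_bivector :: "nat \<Rightarrow> (nat \<Rightarrow> 'k) \<Rightarrow> ('k::field, 'k vec set) bivec" where
  "kron_bivector n b =
     pushforward (kron_ambient n) (projection (kron_ambient n) (kron_line n))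
       (dual_bivector (kron_ambient n) (kron_form n b))"


section \<open>The data attached to a pair of bivectors\<close>

definition L0 :: "('k::field, 'v) module \<Rightarrow> ('k, 'v) bivec \<Rightarrow> ('k, 'v) bivec \<Rightarrow> 'v set" where
  "L0 W \<Lambda> \<Lambda>\<^sub>1 =
     \<Inter> {bivector_image W (pencil \<Lambda> \<Lambda>\<^sub>1 t) | t.
          corank W (pencil \<Lambda> \<Lambda>\<^sub>1 t) = pair_corank W \<Lambda> \<Lambda>\<^sub>1}"

definition L1 :: "('k::field, 'v) module \<Rightarrow> ('k, 'v) bivec \<Rightarrow> ('k, 'v) bivec \<Rightarrow> 'v set" where
  "L1 W \<Lambda> \<Lambda>\<^sub>1 = sharp W \<Lambda> ` annihilator W (L0 W \<Lambda> \<Lambda>\<^sub>1)"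

definition symplectic_part ::
  "('k::field, 'v) module \<Rightarrow> ('k, 'v) bivec \<Rightarrow> ('k, 'v) bivec \<Rightarrow> ('k, 'v set) module" where
  "symplectic_part W \<Lambda> \<Lambda>\<^sub>1 = quotient_space (on_subspace W (L0 W \<Lambda> \<Lambda>\<^sub>1)) (L1 W \<Lambda> \<Lambda>\<^sub>1)"

definition reduced_form ::
  "('k::field, 'v) module \<Rightarrow> ('k, 'v) bivec \<Rightarrow> 'v set \<Rightarrow> 'v set \<Rightarrow> 'k" where
  "reduced_form W \<Lambda> = projected_form (associated_form W \<Lambda>)"

definition reduced_operator ::
  "('k::field, 'v) module \<Rightarrow> ('k, 'v) bivec \<Rightarrow> ('k, 'v) bivec \<Rightarrow> 'v set \<Rightarrow> 'v set" where
  "reduced_operator W \<Lambda> \<Lambda>\<^sub>1 =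
     pair_operator (symplectic_part W \<Lambda> \<Lambda>\<^sub>1) (reduced_form W \<Lambda>) (reduced_form W \<Lambda>\<^sub>1)"

definition kronecker_part ::
  "('k::field, 'v) module \<Rightarrow> ('k, 'v) bivec \<Rightarrow> ('k, 'v) bivec \<Rightarrow> ('k, 'v set) module" where
  "kronecker_part W \<Lambda> \<Lambda>\<^sub>1 = quotient_space W (L0 W \<Lambda> \<Lambda>\<^sub>1)"

definition pair_web ::
  "('k::field, 'v) module \<Rightarrow> ('k, 'v) bivec \<Rightarrow> ('k, 'v) bivec \<Rightarrow> 'k \<Rightarrow> 'v set set" where
  "pair_web W \<Lambda> \<Lambda>\<^sub>1 t =
     projection W (L0 W \<Lambda> \<Lambda>\<^sub>1) ` bivector_image W (pencil \<Lambda> \<Lambda>\<^sub>1 t)"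

(* When the corank r is 0 there is no web and no characteristic number: n is then unconstrained. *)
definition pair_char_numbers ::
  "('k::field, 'v) module \<Rightarrow> ('k, 'v) bivec \<Rightarrow> ('k, 'v) bivec \<Rightarrow> nat \<Rightarrow> (nat \<Rightarrow> nat) \<Rightarrow> bool" where
  "pair_char_numbers W \<Lambda> \<Lambda>\<^sub>1 r n \<longleftrightarrow>
     pair_corank W \<Lambda> \<Lambda>\<^sub>1 = r \<and>
     (\<forall>i j. 1 \<le> i \<and> i \<le> j \<and> j \<le> r \<longrightarrow> n j \<le> n i) \<and>
     (1 \<le> r \<longrightarrow> veronese_web_with (kronecker_part W \<Lambda> \<Lambda>\<^sub>1) r (pair_web W \<Lambda> \<Lambda>\<^sub>1) n)"

end

theory Submission
 imports Defs "HOL-Library.Function_Algebras" "HOL-Combinatorics.List_Permutation"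
begin

text \<open>Choose bases, so that the pair becomes a pencil \<open>A + t B\<close> of alternating forms on \<open>W\<close>-covectors with
 \<open>A\<close> of maximal rank. Chains \<open>A (bv j (i+1)) = - B (bv j i)\<close> starting in the radical of \<open>A\<close>, of minimal total
 length, are independent; they span the annihilator of \<open>L0\<close>, because the images of the regular members vary
 continuously. A dual system of chains splits off the Kronecker part, and on its complement both forms are
 nondegenerate. There the pair is a symplectic form with a self-adjoint operator, which is classified by
 splitting off cyclic pairs. Throughout, \<open>La\<close>, \<open>Lb\<close> are the two bivectors.\<close>

text \<open>The obstacle is that a chain started in the radical of \<open>A\<close> might never
  reach zero; this is where maximality of both bivectors enters. Call a vector descending if
  finitely many steps from x to y with B(x, .) = - A(y, .) lead to zero. For a descending y and all
  t other than 0 and -1 the covector A(y, .) lies in the image of B + t A. A bordered minor lets t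
  go to 0 by pure algebra, so A(y, .) lies in the image of B. Hence A and B have the same image on
  the descending vectors; these contain the radical of B, and a dimension count puts the radical of
  A among them too. A chain b is the same as a polynomial solution sum t^(i-1) b_i of the radical
  equation of A + t B. This is why a Veronese curve appears, and why the members of low rank are
  visible only on the complement. There the operator is T with A(s, .) = B(T s, .), the reduced
  operator seen on covectors. The classification runs on the dimensions of the kernels of p(T):
  elementary divisors determine them, and they subtract when a cyclic pair is split off.\<close>

section \<open>Indexed families, bases and functionals of finite dimensional subspaces\<close>

locale fam_space = vector_space scale
 for scale :: "'a::field => 'b::ab_group_add => 'b" (infixr "*s" 75)
begin

text \<open>Families instead of sets, because the index sets will be sums and dependent sums that
  label the blocks of a normal form. For a finite index set a repeated vector counts as a
  dependency.\<close>

definition indep_fam :: "'i set => ('i => 'b) => bool" where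
 "indep_fam I e \<longleftrightarrow> (ALL c. (SUM i:I. c i *s e i) = 0 --> (ALL i:I. c i = 0))"

definition basis_on :: "'b set => 'i set => ('i => 'b) => bool" where
 "basis_on D I e \<longleftrightarrow> finite I & (ALL i:I. e i : D) & indep_fam I e &
   (ALL x:D. EX c. x = (SUM i:I. c i *s e i))"

text \<open>The ambient type will be a whole function space, of infinite dimension in general, so
  finite dimension is carried by the subspace.\<close>

definition fin_sub :: "'b set => bool" where
 "fin_sub D \<longleftrightarrow> subspace D & (EX F. finite F & D <= span F)"

definition linfun :: "('b => 'a) => bool" where
 "linfun f \<longleftrightarrow> (ALL x y. f (x + y) = f x + f y) & (ALL c x. f (c *s x) = c * f x)"

lemma linfun_zero: "linfun f ==> f 0 = 0"
 unfolding linfun_def by (metis mult_zero_left scale_zero_left)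

lemma linfun_sum: "linfun f ==> f (SUM i:I. c i *s e i) = (SUM i:I. c i * f (e i))"
 by (induction I rule: infinite_finite_induct) (auto simp: linfun_zero linfun_def)

lemma linfun_minus: "linfun f ==> f (- x) = - f x"
 unfolding linfun_def by (metis add.right_inverse add_eq_0_iff linfun_def linfun_zero)

lemma linfun_diff: "linfun f ==> f (x - y) = f x - f y"
 unfolding linfun_def by (metis add_diff_cancel diff_add_cancel)

lemma indep_famD: "indep_fam I e ==> (SUM i:I. c i *s e i) = 0 ==> i : I ==> c i = 0"
 unfolding indep_fam_def by blast

lemma basis_onD:
 assumes "basis_on D I e"
 shows "finite I" "!!i. i : I ==> e i : D" "indep_fam I e"
  "!!x. x : D ==> EX c. x = (SUM i:I. c i *s e i)"
 using assms unfolding basis_on_def by blast+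

lemma indep_fam_iff:
 assumes "finite I"
 shows "indep_fam I e \<longleftrightarrow> inj_on e I & independent (e ` I)"
proof
 assume ind: "indep_fam I e"
 have inj: "inj_on e I"
 proof (rule inj_onI, rule ccontr)
  fix i j assume ij: "i : I" "j : I" "e i = e j" "i ~= j"
  let ?c = "%k. (if k = i then 1 else 0) - (if k = j then 1 else (0::'a))"
  have "(SUM k:I. ?c k *s e k) = (SUM k:I. (if k = i then e k else 0)) - (SUM k:I. (if k = j then e k else 0))"
   unfolding sum_subtractf[symmetric] by (rule sum.cong) (auto simp: scale_left_diff_distrib)
  also have "... = 0" using ij assms by simp
  finally show False using indep_famD[OF ind, of ?c i] ij by simp
 qed
 moreover have "independent (e ` I)"
 proof (rule independent_if_scalars_zero)
  show "finite (e ` I)" using assms by simp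
  fix f x assume f: "(SUM x:e ` I. f x *s x) = 0" and x: "x : e ` I"
  have "(SUM i:I. f (e i) *s e i) = 0" using f inj by (simp add: sum.reindex)
  with x show "f x = 0" using indep_famD[OF ind, of "%i. f (e i)"] by auto
 qed
 ultimately show "inj_on e I & independent (e ` I)" ..
next
 assume a: "inj_on e I & independent (e ` I)"
 show "indep_fam I e" unfolding indep_fam_def
 proof (intro allI impI ballI)
  fix c i assume s: "(SUM i:I. c i *s e i) = 0" and i: "i : I"
  have "(SUM x:e ` I. c (inv_into I e x) *s x) = (SUM i:I. c i *s e i)"
   using a by (simp add: sum.reindex inv_into_f_f)
  hence "c (inv_into I e (e i)) = 0"
   using independentD[of "e ` I" "e ` I" "%x. c (inv_into I e x)" "e i"] a assms s i by auto
  thus "c i = 0" using a i by (simp add: inv_into_f_f)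
 qed
qed

lemma span_fam: "finite I ==> span (e ` I) = range (%c. SUM i:I. c i *s e i)"
proof
 assume fin: "finite I"
 show "span (e ` I) <= range (%c. SUM i:I. c i *s e i)"
 proof (rule span_minimal)
  show "e ` I <= range (%c. SUM i:I. c i *s e i)"
  proof
   fix x assume "x : e ` I"
   then obtain i where i: "i : I" "x = e i" by auto
   have "x = (SUM j:I. (if j = i then 1 else 0) *s e j)"
    using i fin by (simp add: if_distrib[of "%a. a *s _"] cong: if_cong)
   thus "x : range (%c. SUM i:I. c i *s e i)"
    by (auto intro: image_eqI[where x = "%j. if j = i then 1 else 0"])
  qed
  show "subspace (range (%c. SUM i:I. c i *s e i))"
  proof (rule subspaceI)
   show "0 : range (%c. SUM i:I. c i *s e i)" by (rule image_eqI[where x = "%_. 0"]) auto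
  next
   fix x y assume "x : range (%c. SUM i:I. c i *s e i)" "y : range (%c. SUM i:I. c i *s e i)"
   then obtain c d where "x = (SUM i:I. c i *s e i)" "y = (SUM i:I. d i *s e i)" by auto
   hence "x + y = (SUM i:I. (c i + d i) *s e i)" by (simp add: scale_left_distrib sum.distrib)
   thus "x + y : range (%c. SUM i:I. c i *s e i)"
    by (intro image_eqI[where x = "%i. c i + d i"]) auto
  next
   fix a x assume "x : range (%c. SUM i:I. c i *s e i)"
   then obtain c where "x = (SUM i:I. c i *s e i)" by auto
   hence "a *s x = (SUM i:I. (a * c i) *s e i)" by (simp add: scale_sum_right)
   thus "a *s x : range (%c. SUM i:I. c i *s e i)"
    by (intro image_eqI[where x = "%i. a * c i"]) auto
  qed
 qed
 show "range (%c. SUM i:I. c i *s e i) <= span (e ` I)"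
  by (rule image_subsetI) (intro span_sum span_scale span_base imageI)
qed

lemma basis_on_iff:
 assumes "finite I" "subspace D"
 shows "basis_on D I e \<longleftrightarrow> inj_on e I & independent (e ` I) & span (e ` I) = D"
proof -
 have "basis_on D I e \<longleftrightarrow> e ` I <= D & indep_fam I e & D <= span (e ` I)"
  unfolding basis_on_def span_fam[OF assms(1)] using assms(1) by auto
 thus ?thesis
  using span_minimal[of "e ` I" D] assms indep_fam_iff[of I e] span_superset[of "e ` I"]
  by (metis subset_antisym order_refl)
qed

lemma basis_on_dim: "subspace D ==> basis_on D I e ==> dim D = card I"
proof -
 assume D: "subspace D" "basis_on D I e"
 hence fin: "finite I" using basis_onD(1) by blast
 hence *: "inj_on e I" "independent (e ` I)" "span (e ` I) = D" using D basis_on_iff by auto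
 hence "card (e ` I) = dim D" using basis_card_eq_dim[of "e ` I" D] span_superset by blast
 thus ?thesis using * by (simp add: card_image)
qed

lemma basis_on_fin_sub: "subspace D ==> basis_on D I e ==> fin_sub D"
 using basis_on_iff[of I D e] basis_onD(1)[of D I e] unfolding fin_sub_def by blast

lemma fin_sub_subset: "fin_sub D ==> subspace X ==> X <= D ==> fin_sub X"
 unfolding fin_sub_def by blast

text \<open>The given family stays as the left summand of the index set, so its elements keep their
  names inside the larger basis.\<close>

lemma basis_extend:
 assumes D: "fin_sub D" and J: "finite J" "indep_fam J x" "!!j. j : J ==> x j : D"
 obtains m y where "basis_on D (J <+> {..<m::nat}) (case_sum x y)"
proof -
 obtain F where F: "finite F" "D <= span F" "subspace D" using D by (auto simp: fin_sub_def)
 have xJ: "inj_on x J" "independent (x ` J)" "x ` J <= D" using J indep_fam_iff by auto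
 obtain B where B: "x ` J <= B" "B <= D" "independent B" "D <= span B"
  using maximal_independent_subset_extend[OF xJ(3,2)] by blast
 have fB: "finite B" using independent_span_bound[OF F(1) B(3)] B(2) F(2) by auto
 define C where "C = B - x ` J"
 have "finite C" using fB by (simp add: C_def)
 then obtain y where y: "bij_betw y {0..<card C} C" using ex_bij_betw_nat_finite by blast
 define m where "m = card C"
 have y: "bij_betw y {..<m} C" using y by (simp add: m_def lessThan_atLeast0)
 let ?e = "case_sum x y" and ?I = "J <+> {..<m}"
 have img: "?e ` ?I = B"
  using y B(1) by (auto simp: Plus_def image_Un image_image bij_betw_def C_def)
 have inj: "inj_on ?e ?I"
  using y xJ(1) by (auto simp: inj_on_def bij_betw_def C_def split: sum.splits)
 have "basis_on D ?I ?e"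
  using basis_on_iff[of ?I D ?e] img inj B span_subspace[OF B(2,4) F(3)] F(3) J(1) by auto
 thus thesis using that by blast
qed

lemma basis_on_reindex:
 assumes "basis_on D I e" "bij_betw g J I"
 shows "basis_on D J (e \<circ> g)"
proof -
 have s: "(SUM i:I. c i *s e i) = (SUM j:J. c (g j) *s e (g j))" for c
  using sum.reindex_bij_betw[OF assms(2), of "%i. c i *s e i"] by (rule sym)
 have fin: "finite J" using basis_onD(1)[OF assms(1)] bij_betw_finite[OF assms(2)] by simp
 have ind: "indep_fam J (e \<circ> g)" unfolding indep_fam_def
 proof (intro allI impI ballI)
  fix c j assume a: "(SUM j:J. c j *s (e \<circ> g) j) = 0" "j : J"
  let ?d = "%i. c (inv_into J g i)"
  have "(SUM j:J. ?d (g j) *s e (g j)) = (SUM j:J. c j *s (e \<circ> g) j)"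
   using inv_into_f_f[of g J] assms(2) by (intro sum.cong) (auto simp: bij_betw_def)
  hence "(SUM i:I. ?d i *s e i) = 0" unfolding s[of ?d] using a(1) by (simp only:)
  hence "?d (g j) = 0"
   by (rule indep_famD[OF basis_onD(3)[OF assms(1)]]) (use assms(2) a(2) in \<open>auto simp: bij_betw_def\<close>)
  thus "c j = 0" using inv_into_f_f[of g J j] assms(2) a(2) by (simp add: bij_betw_def)
 qed
 show ?thesis unfolding basis_on_def
 proof (intro conjI ballI)
  fix x assume "x : D"
  then obtain c where "x = (SUM i:I. c i *s e i)" using basis_onD(4)[OF assms(1)] by blast
  thus "EX c. x = (SUM j:J. c j *s (e \<circ> g) j)" unfolding s by (intro exI[of _ "%j. c (g j)"]) simp
 next
  fix j assume "j : J"
  thus "(e \<circ> g) j : D" using basis_onD(2)[OF assms(1)] assms(2) by (auto simp: bij_betw_def)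
 qed (use fin ind in simp_all)
qed

lemma basis_on_exists:
 assumes "fin_sub D" obtains N and e :: "nat => 'b" where "basis_on D {..<N} e"
proof -
 have "indep_fam {} (%_::nat. 0)" by (simp add: indep_fam_def)
 then obtain m y where b: "basis_on D ({} <+> {..<m::nat}) (case_sum (%_::nat. 0) y)"
  using basis_extend[OF assms, of "{}" "%_::nat. 0"] by auto
 have "bij_betw (Inr :: nat => nat + nat) {..<m} ({} <+> {..<m})" by (auto simp: bij_betw_def)
 from basis_on_reindex[OF b this] show thesis using that by blast
qed

lemma indep_fam_card_le:
 assumes D: "fin_sub D" and J: "finite J" "indep_fam J x" "!!j. j : J ==> x j : D"
 shows "card J <= dim D" "card J = dim D ==> basis_on D J x"
proof -
 obtain m y where b: "basis_on D (J <+> {..<m::nat}) (case_sum x y)" using basis_extend[OF assms] by blast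
 have d: "dim D = card J + m"
  using basis_on_dim[OF _ b] D J(1) by (auto simp: fin_sub_def card_Plus)
 show "card J <= dim D" using d by simp
 assume "card J = dim D"
 hence m: "m = 0" using d by simp
 have "bij_betw (Inl :: _ => _ + nat) J (J <+> {..<m})" using m by (auto simp: bij_betw_def)
 from basis_on_reindex[OF b this] show "basis_on D J x" by (simp add: o_def)
qed

lemma dim_le_subset:
 assumes "fin_sub D" "subspace X" "X <= D"
 shows "dim X <= dim D" "dim X = dim D ==> X = D"
proof -
 have X: "fin_sub X" using fin_sub_subset assms by blast
 obtain N and e :: "nat => 'b" where e: "basis_on X {..<N} e" using basis_on_exists[OF X] .
 have d: "dim X = N" using basis_on_dim[OF assms(2) e] by simp
 have *: "finite {..<N}" "indep_fam {..<N} e" "!!j. j : {..<N} ==> e j : D"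
  using basis_onD[OF e] assms(3) by auto
 show "dim X <= dim D" using indep_fam_card_le(1)[OF assms(1) *] d by simp
 assume "dim X = dim D"
 hence "basis_on D {..<N} e" using indep_fam_card_le(2)[OF assms(1) *] d by simp
 hence "D = span (e ` {..<N})" using basis_on_iff[of "{..<N}" D e] assms(1) fin_sub_def by auto
 moreover have "X = span (e ` {..<N})" using basis_on_iff[of "{..<N}" X e] e assms(2) by auto
 ultimately show "X = D" by simp
qed

lemma linfun_extend:
 assumes "finite I" "indep_fam I e"
 obtains f where "linfun f" "!!i. i : I ==> f (e i) = c i"
proof -
 interpret vp: vector_space_pair scale "(*) :: 'a => 'a => 'a"
  by unfold_locales (auto simp: algebra_simps)
 have *: "inj_on e I" "independent (e ` I)" using assms indep_fam_iff by auto
 obtain g where g: "Vector_Spaces.linear scale (*) g" "ALL x:e ` I. g x = c (inv_into I e x)"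
  using vp.linear_independent_extend[OF *(2), of "%x. c (inv_into I e x)"] by blast
 have "linfun g" using g(1) unfolding Vector_Spaces.linear_iff linfun_def by blast
 moreover have "g (e i) = c i" if "i : I" for i using g(2) that * by (simp add: inv_into_f_f)
 ultimately show thesis using that by blast
qed

lemma basis_on_coords:
 assumes "basis_on D I e"
 obtains f where "!!i. i : I ==> linfun (f i)" "!!i j. i : I ==> j : I ==> f i (e j) = (if j = i then 1 else 0)"
  "!!x. x : D ==> x = (SUM i:I. f i x *s e i)"
proof -
 have fin: "finite I" "indep_fam I e" using basis_onD[OF assms] by auto
 have "EX f. linfun f & (ALL j:I. f (e j) = (if j = i then 1 else 0))" for i
  using linfun_extend[OF fin, of "%j. if j = i then 1 else 0"] by metis
 then obtain f where f: "linfun (f i)" "!!j. j : I ==> f i (e j) = (if j = i then 1 else 0)" for i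
  by metis
 have "x = (SUM i:I. f i x *s e i)" if x: "x : D" for x
 proof -
  obtain c where c: "x = (SUM i:I. c i *s e i)" using basis_onD(4)[OF assms x] by blast
  have "f i x = c i" if "i : I" for i
  proof -
   have "f i x = (SUM j:I. c j * (if j = i then 1 else 0))"
    unfolding c linfun_sum[OF f(1)] using f(2) by (intro sum.cong) auto
   also have "... = c i" using that fin(1) by (simp add: if_distrib cong: if_cong)
   finally show ?thesis .
  qed
  hence "(SUM i:I. f i x *s e i) = (SUM i:I. c i *s e i)" by (intro sum.cong) auto
  thus ?thesis using c by simp
 qed
 with f show thesis using that by blast
qed

text \<open>Induction on the number of functionals. If \<open>f j\<close> vanishes on the common
  zeros of the others in \<open>D\<close>, it gets coefficient 0. Otherwise some common zero
  \<open>z\<close> of the others has \<open>f j z ~= 0\<close>, and subtracting the multiple of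
  \<open>f j\<close> that agrees with \<open>g\<close> at \<open>z\<close> reduces to the
  others.\<close>

lemma functional_in_span:
 assumes D: "subspace D" and "finite I" and "!!i. i : I ==> linfun (f i)" and "linfun g"
  and "!!x. x : D ==> (!!i. i : I ==> f i x = 0) ==> g x = 0"
 shows "EX c. ALL x:D. g x = (SUM i:I. c i * f i x)"
 using assms(2-5)
proof (induction I arbitrary: g rule: finite_induct)
 case empty
 thus ?case by auto
next
 case (insert j I)
 show ?case
 proof (cases "EX z:D. (ALL i:I. f i z = 0) & f j z ~= 0")
  case False
  have "EX c. ALL x:D. g x = (SUM i:I. c i * f i x)"
  proof (rule insert.IH)
   fix x assume "x : D" "!!i. i : I ==> f i x = 0"
   thus "g x = 0" using False by (intro insert.prems(3)) auto
  qed (use insert.prems in auto)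
  then obtain c where c: "ALL x:D. g x = (SUM i:I. c i * f i x)" ..
  show ?thesis
  proof (intro exI ballI)
   fix x assume "x : D"
   have "(SUM i:insert j I. (if i = j then 0 else c i) * f i x) = (SUM i:I. c i * f i x)"
    using insert.hyps by (auto intro!: sum.cong)
   thus "g x = (SUM i:insert j I. (if i = j then 0 else c i) * f i x)" using c `x : D` by simp
  qed
 next
  case True
  then obtain z where z: "z : D" "ALL i:I. f i z = 0" "f j z ~= 0" by blast
  define a where "a = g z / f j z"
  define h where "h = (%x. g x - a * f j x)"
  have lj: "linfun (f j)" and lg: "linfun g" using insert.prems by auto
  have lh: "linfun h" using lj lg by (auto simp: linfun_def h_def algebra_simps)
  have "h x = 0" if x: "x : D" "!!i. i : I ==> f i x = 0" for x
  proof -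
   \<comment> \<open>\<open>x\<close> is moved along \<open>z\<close> into the kernel of
     \<open>f j\<close>; the values of the other functionals do not change.\<close>
   define y where "y = x - (f j x / f j z) *s z"
   have yD: "y : D" unfolding y_def using D x z by (intro subspace_diff subspace_scale) auto
   have "f i y = 0" if "i : insert j I" for i
   proof -
    have "f i y = f i x - (f j x / f j z) * f i z"
     using insert.prems(1)[OF that] by (simp add: y_def linfun_diff) (simp add: linfun_def)
    thus ?thesis using that z x by auto
   qed
   hence "g y = 0" using insert.prems(3) yD by blast
   moreover have "g y = g x - (f j x / f j z) * g z"
    using lg by (simp add: y_def linfun_diff linfun_def)
   ultimately show ?thesis using z by (simp add: h_def a_def)
  qed
  hence "EX c. ALL x:D. h x = (SUM i:I. c i * f i x)"
   using lh insert.prems(1) by (intro insert.IH) auto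
  then obtain c where c: "ALL x:D. h x = (SUM i:I. c i * f i x)" ..
  show ?thesis
  proof (intro exI ballI)
   fix x assume "x : D"
   have "(SUM i:I. (if i = j then a else c i) * f i x) = (SUM i:I. c i * f i x)"
    using insert.hyps by (auto intro!: sum.cong)
   hence "(SUM i:insert j I. (if i = j then a else c i) * f i x) = a * f j x + (SUM i:I. c i * f i x)"
    using insert.hyps by simp
   thus "g x = (SUM i:insert j I. (if i = j then a else c i) * f i x)"
    using c `x : D` by (simp add: h_def algebra_simps)
  qed
 qed
qed

end

locale fam_space_pair = vs1: fam_space s1 + vs2: fam_space s2
 for s1 :: "'a::field => 'b::ab_group_add => 'b" and s2 :: "'a => 'c::ab_group_add => 'c"
begin

lemma rank_nullity_on:
 assumes Y: "vs1.fin_sub Y" and g: "!!x y. g (x + y) = g x + g y" "!!c x. g (s1 c x) = s2 c (g x)"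
 shows "vs1.dim Y = vs2.dim (g ` Y) + vs1.dim {y : Y. g y = 0}" and "vs2.fin_sub (g ` Y)"
proof -
 let ?K = "{y : Y. g y = 0}"
 have g0: "g 0 = 0" using g(2)[of 0 0] by simp
 have gs: "g (SUM i:I. s1 (c i) (e i)) = (SUM i:I. s2 (c i) (g (e i)))" for c e and I :: "nat set"
  by (induction I rule: infinite_finite_induct) (auto simp: g0 g)
 have sY: "vs1.subspace Y" using Y by (simp add: vs1.fin_sub_def)
 have sK: "vs1.subspace ?K"
  using sY by (intro vs1.subspaceI) (auto simp: g g0 vs1.subspace_0 vs1.subspace_add vs1.subspace_scale)
 have fK: "vs1.fin_sub ?K" using vs1.fin_sub_subset[OF Y sK] by auto
 obtain k and x :: "nat => 'b" where x: "vs1.basis_on ?K {..<k} x" using vs1.basis_on_exists[OF fK] .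
 obtain m y where y: "vs1.basis_on Y ({..<k} <+> {..<m::nat}) (case_sum x y)"
 proof (rule vs1.basis_extend[OF Y, of "{..<k}" x])
  show "vs1.indep_fam {..<k} x" "!!j. j : {..<k} ==> x j : Y" using vs1.basis_onD[OF x] by auto
 qed auto
 have spl: "(SUM i:{..<k} <+> {..<m}. s1 (c i) (case_sum x y i)) =
   (SUM i<k. s1 (c (Inl i)) (x i)) + (SUM i<m. s1 (c (Inr i)) (y i))" for c
  by (simp add: sum.Plus)
 have xK: "x i : ?K" if "i < k" for i using vs1.basis_onD(2)[OF x] that by auto
 have yY: "y i : Y" if "i < m" for i using vs1.basis_onD(2)[OF y, of "Inr i"] that by auto
 have sgY: "vs2.subspace (g ` Y)"
 proof (rule vs2.subspaceI)
  show "0 : g ` Y" using g0 vs1.subspace_0[OF sY] by (metis imageI)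
 next
  fix u v assume "u : g ` Y" "v : g ` Y"
  then obtain a b where "a : Y" "b : Y" "u = g a" "v = g b" by auto
  thus "u + v : g ` Y" using g(1)[of a b] vs1.subspace_add[OF sY] by (metis imageI)
 next
  fix c u assume "u : g ` Y"
  then obtain a where "a : Y" "u = g a" by auto
  thus "s2 c u : g ` Y" using g(2)[of c a] vs1.subspace_scale[OF sY] by (metis imageI)
 qed
 have gy: "vs2.basis_on (g ` Y) {..<m} (g \<circ> y)"
  unfolding vs2.basis_on_def vs2.indep_fam_def
 proof (intro conjI allI impI ballI)
  fix c i assume s: "(SUM i<m. s2 (c i) ((g \<circ> y) i)) = 0" and i: "i : {..<m}"
  have "(SUM i<m. s1 (c i) (y i)) : ?K"
   using s yY sY gs[of c y "{..<m}"] by (auto intro!: vs1.subspace_sum vs1.subspace_scale)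
  then obtain d where d: "(SUM i<m. s1 (c i) (y i)) = (SUM i<k. s1 (d i) (x i))"
   using vs1.basis_onD(4)[OF x] by blast
  have z: "(SUM j:{..<k} <+> {..<m}. s1 (case_sum (%i. - d i) c j) (case_sum x y j)) = 0"
   unfolding spl using d by (simp add: sum_negf)
  have ind: "vs1.indep_fam ({..<k} <+> {..<m}) (case_sum x y)" using vs1.basis_onD(3)[OF y] .
  have "case_sum (%i. - d i) c (Inr i :: nat + nat) = 0"
   by (rule vs1.indep_famD[OF ind z]) (use i in auto)
  thus "c i = 0" by simp
 next
  fix v assume "v : g ` Y"
  then obtain a where a: "a : Y" "v = g a" by auto
  then obtain c where c: "a = (SUM i:{..<k} <+> {..<m}. s1 (c i) (case_sum x y i))"
   using vs1.basis_onD(4)[OF y a(1)] by blast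
  have "g a = (SUM i<k. s2 (c (Inl i)) (g (x i))) + (SUM i<m. s2 (c (Inr i)) (g (y i)))"
   by (simp only: c spl g(1) gs)
  moreover have "(SUM i<k. s2 (c (Inl i)) (g (x i))) = 0" using xK by (intro sum.neutral) auto
  ultimately show "EX c. v = (SUM i<m. s2 (c i) ((g \<circ> y) i))"
   using a by (intro exI[of _ "%i. c (Inr i)"]) simp
 qed (use yY in auto)
 from vs2.basis_on_dim[OF sgY gy] vs1.basis_on_dim[OF sY y] vs1.basis_on_dim[OF sK x]
 show "vs1.dim Y = vs2.dim (g ` Y) + vs1.dim ?K" by (simp add: card_Plus)
 show "vs2.fin_sub (g ` Y)" by (rule vs2.basis_on_fin_sub[OF sgY gy])
qed

end

section \<open>Rank of a pencil of alternating forms for generic parameter\<close>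

lemma poly_det: "poly (det (mat n n (%(i, j). M i j))) t = det (mat n n (%(i, j). poly (M i j) t))"
 for t :: "'a::comm_ring_1"
proof -
 have s: "poly (signof p) t = signof p" for p :: "nat => nat"
  by (simp add: sign_def)
 show ?thesis
  unfolding det_def
  by (auto simp: poly_sum poly_prod s intro!: sum.cong prod.cong dest: permutes_in_image)
qed

lemma det_mat_0_iff:
 fixes F :: "nat \<times> nat => 'a::idom"
 shows "det (mat r r F) = 0 \<longleftrightarrow> (EX v. (EX j<r. v j ~= 0) & (ALL i<r. (SUM j<r. F (i, j) * v j) = 0))"
proof -
 have "det (mat r r F) = 0 \<longleftrightarrow> (EX v. dim_vec v = r & v ~= 0\<^sub>v r & mat r r F *\<^sub>v v = 0\<^sub>v r)"
  by (simp only: det_0_iff_vec_prod_zero[OF mat_carrier] carrier_vec_def mem_Collect_eq Bex_def)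
 also have "... \<longleftrightarrow> (EX v. dim_vec v = r & v ~= 0\<^sub>v r & (ALL i<r. (SUM j<r. F (i, j) * v $ j) = 0))"
  by (auto simp: vec_eq_iff scalar_prod_def atLeast0LessThan)
 also have "... \<longleftrightarrow> (EX v. (EX j<r. v j ~= 0) & (ALL i<r. (SUM j<r. F (i, j) * v j) = 0))"
 proof
  assume "EX v. dim_vec v = r & v ~= 0\<^sub>v r & (ALL i<r. (SUM j<r. F (i, j) * v $ j) = 0)"
  then obtain v where "dim_vec v = r" "v ~= 0\<^sub>v r" "ALL i<r. (SUM j<r. F (i, j) * v $ j) = 0" by blast
  thus "EX v. (EX j<r. v j ~= 0) & (ALL i<r. (SUM j<r. F (i, j) * v j) = 0)"
   by (intro exI[of _ "%j. v $ j"]) (auto simp: vec_eq_iff)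
 next
  assume "EX v. (EX j<r. v j ~= 0) & (ALL i<r. (SUM j<r. F (i, j) * v j) = 0)"
  then obtain v where "EX j<r. v j ~= 0" "ALL i<r. (SUM j<r. F (i, j) * v j) = 0" by blast
  thus "EX v. dim_vec v = r & v ~= 0\<^sub>v r & (ALL i<r. (SUM j<r. F (i, j) * v $ j) = 0)"
   by (intro exI[of _ "vec r v"]) (auto simp: vec_eq_iff)
 qed
 finally show ?thesis .
qed

text \<open>The determinant of the matrix is a polynomial in t that is nonzero at 0, hence has
  finitely many roots.\<close>

lemma independent_rows_cofinite:
 fixes M :: "nat => nat => 'a::field poly"
 assumes "!!v. (!!j. j < n ==> (SUM i<n. v i * poly (M i j) 0) = 0) ==> ALL i<n. v i = 0"
 shows "finite {t. \<not> (ALL v. (ALL j<n. (SUM i<n. v i * poly (M i j) t) = 0) --> (ALL i<n. v i = 0))}"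
proof -
 define d where "d = det (mat n n (%(j, i). M i j))"
 have dt: "poly d t = det (mat n n (%(j, i). poly (M i j) t))" for t
  unfolding d_def using poly_det[of n "%j i. M i j" t] by simp
 have nz: "poly d t ~= 0 \<longleftrightarrow> (ALL v. (ALL j<n. (SUM i<n. v i * poly (M i j) t) = 0) --> (ALL i<n. v i = 0))" for t
  unfolding dt det_mat_0_iff by (auto simp: mult.commute)
 have "poly d 0 ~= 0" unfolding nz using assms by blast
 hence "d ~= 0" by auto
 hence "finite {t. poly d t = 0}" by (rule poly_roots_finite)
 thus ?thesis by (simp only: nz[symmetric] not_not)
qed

context fam_space
begin

definition alt_bilin :: "('b => 'b => 'a) => bool" where
 "alt_bilin C \<longleftrightarrow> (ALL x. linfun (C x)) & (ALL x y z. C (x + y) z = C x z + C y z) &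
   (ALL c x y. C (c *s x) y = c * C x y) & (ALL x. C x x = 0)"

lemma alt_bilinD:
 assumes "alt_bilin C"
 shows "C (x + y) z = C x z + C y z" "C z (x + y) = C z x + C z y" "C (c *s x) y = c * C x y"
  "C x (c *s y) = c * C x y" "C x x = 0" "C x y = - C y x" "C 0 x = 0" "C x 0 = 0"
  "C (- x) y = - C x y" "C x (- y) = - C x y" "C (x - y) z = C x z - C y z" "C z (x - y) = C z x - C z y"
  "linfun (C x)" "linfun (%y. C y x)"
proof -
 have l: "linfun (C x)" "linfun (%y. C y x)" for x
  using assms by (auto simp: alt_bilin_def linfun_def)
 thus "linfun (C x)" "linfun (%y. C y x)" by blast+
 show a: "C (x + y) z = C x z + C y z" "C z (x + y) = C z x + C z y" "C (c *s x) y = c * C x y"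
  "C x (c *s y) = c * C x y" for x y z c
  using l[of x] l[of y] l[of z] by (auto simp: linfun_def)
 show "C x x = 0" using assms by (auto simp: alt_bilin_def)
 have "C (x + y) (x + y) = 0" "C x x = 0" "C y y = 0" using assms by (auto simp: alt_bilin_def)
 thus "C x y = - C y x" unfolding a by (simp add: eq_neg_iff_add_eq_0 add.commute)
 show "C 0 x = 0" "C x 0 = 0" using linfun_zero[OF l(2)[of x]] linfun_zero[OF l(1)[of x]] by simp_all
 show "C (- x) y = - C x y" "C x (- y) = - C x y"
  using linfun_minus[OF l(2)[of y]] linfun_minus[OF l(1)[of x]] by simp_all
 show "C (x - y) z = C x z - C y z" "C z (x - y) = C z x - C z y"
  using linfun_diff[OF l(2)[of z]] linfun_diff[OF l(1)[of z]] by simp_all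
qed

lemma alt_bilin_eq0: "alt_bilin C ==> C x y = 0 ==> C y x = 0"
 using alt_bilinD(6)[of C y x] by simp

lemma alt_bilin_sum:
 assumes "alt_bilin C"
 shows "C (SUM i:I. c i *s e i) y = (SUM i:I. c i * C (e i) y)" "C y (SUM i:I. c i *s e i) = (SUM i:I. c i * C y (e i))"
  "C (SUM i:I. e i) y = (SUM i:I. C (e i) y)" "C y (SUM i:I. e i) = (SUM i:I. C y (e i))"
 using linfun_sum[OF alt_bilinD(13)[OF assms]] linfun_sum[OF alt_bilinD(14)[OF assms]]
  linfun_sum[OF alt_bilinD(13)[OF assms], where c = "%_. 1"]
  linfun_sum[OF alt_bilinD(14)[OF assms], where c = "%_. 1"] by simp_all

lemma alt_bilin_comb: "alt_bilin C ==> alt_bilin C' ==> alt_bilin (%x y. a * C x y + b * C' x y)"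
 unfolding alt_bilin_def linfun_def by (auto simp: algebra_simps)

lemma alt_bilin_pencil: "alt_bilin C ==> alt_bilin C' ==> alt_bilin (%x y. C x y + b * C' x y)"
 unfolding alt_bilin_def linfun_def by (auto simp: algebra_simps)

definition rad :: "'b set => ('b => 'b => 'a) => 'b set" where
 "rad D C = {x : D. ALL y:D. C x y = 0}"

lemma rad_subspace: "subspace D ==> alt_bilin C ==> subspace (rad D C)"
 by (rule subspaceI) (auto simp: rad_def alt_bilinD(1,3,7) subspace_0 subspace_add subspace_scale)

lemma rad_fin_sub: "fin_sub D ==> alt_bilin C ==> fin_sub (rad D C)"
 by (rule fin_sub_subset[of D]) (auto simp: rad_subspace fin_sub_def, auto simp: rad_def)

text \<open>The functionals \<open>C (e i)\<close> on a basis of \<open>D\<close> have the radical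
  as their common zeros, since \<open>C\<close> is alternating; a functional vanishing there is a
  combination of them.\<close>

lemma fredholm:
 assumes D: "fin_sub D" and C: "alt_bilin C" and w: "linfun w" "!!z. z : rad D C ==> w z = 0"
 obtains x where "x : D" "!!y. y : D ==> w y = C x y"
proof -
 obtain N and e :: "nat => 'b" where e: "basis_on D {..<N} e" using basis_on_exists[OF D] .
 have sD: "subspace D" using D by (simp add: fin_sub_def)
 have "EX c. ALL y:D. w y = (SUM i<N. c i * C (e i) y)"
 proof (rule functional_in_span[OF sD])
  fix y assume y: "y : D" "!!i. i : {..<N} ==> C (e i) y = 0"
  have "C x y = 0" if xD: "x : D" for x
  proof -
   obtain c where "x = (SUM i<N. c i *s e i)" using basis_onD(4)[OF e xD] by blast
   thus ?thesis using y(2) by (simp add: alt_bilin_sum[OF C])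
  qed
  hence "y : rad D C" using y(1) alt_bilin_eq0[OF C, of _ y] by (simp add: rad_def)
  thus "w y = 0" by (rule w(2))
 qed (use w(1) C in \<open>simp_all add: alt_bilinD(13)\<close>)
 then obtain c where c: "!!y. y : D ==> w y = (SUM i<N. c i * C (e i) y)" by blast
 have "(SUM i<N. c i *s e i) : D" using basis_onD(2)[OF e] sD by (intro subspace_sum subspace_scale) auto
 thus thesis using that[of "SUM i<N. c i *s e i"] c by (simp add: alt_bilin_sum[OF C])
qed

text \<open>A nonsingular n by n minor makes the \<open>x i\<close> independent modulo the radical:
  pairing a relation with the \<open>y j\<close> kills the radical part and forces the coefficients
  of the \<open>x i\<close> to vanish.\<close>

lemma rad_dim_bound:
 assumes D: "fin_sub D" and C: "alt_bilin C" and x: "!!i. i < n ==> x i : D" and y: "!!i. i < n ==> y i : D"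
  and nd: "!!v. (!!j. j < n ==> (SUM i<n. v i * C (x i) (y j)) = 0) ==> ALL i<n. v i = 0"
 shows "dim (rad D C) + n <= dim D"
proof -
 have sD: "subspace D" using D by (simp add: fin_sub_def)
 obtain N and e :: "nat => 'b" where e: "basis_on (rad D C) {..<N} e"
  using basis_on_exists[OF rad_fin_sub[OF D C]] .
 have dN: "dim (rad D C) = N" using basis_on_dim[OF rad_subspace[OF sD C] e] by simp
 have eR: "e i : D" "!!y. y : D ==> C (e i) y = 0" if "i < N" for i
  using basis_onD(2)[OF e, of i] that by (auto simp: rad_def)
 have ind: "indep_fam ({..<N} <+> {..<n}) (case_sum e x)"
  unfolding indep_fam_def
 proof (intro allI impI)
  fix c :: "nat + nat => 'a"
  assume "(SUM i:{..<N} <+> {..<n}. c i *s case_sum e x i) = 0"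
  hence s: "(SUM i<N. c (Inl i) *s e i) + (SUM i<n. c (Inr i) *s x i) = 0"
   by (simp add: sum.Plus)
  have "(SUM i<n. c (Inr i) * C (x i) (y j)) = 0" if "j < n" for j
  proof -
   have "C ((SUM i<N. c (Inl i) *s e i) + (SUM i<n. c (Inr i) *s x i)) (y j) = 0"
    unfolding s using alt_bilinD(7)[OF C] by simp
   thus ?thesis using eR(2) y[OF that] by (simp add: alt_bilin_sum[OF C] alt_bilinD(1)[OF C])
  qed
  hence r: "ALL i<n. c (Inr i) = 0" by (rule nd)
  hence "(SUM i<N. c (Inl i) *s e i) = 0" using s by simp
  hence "!!i. i < N ==> c (Inl i) = 0" using indep_famD[OF basis_onD(3)[OF e]] by (metis lessThan_iff)
  thus "ALL i:{..<N} <+> {..<n}. c i = 0" using r by auto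
 qed
 have "card ({..<N} <+> {..<n}) <= dim D"
  by (rule indep_fam_card_le(1)[OF D _ ind]) (use eR x in auto)
 thus ?thesis using dN by (simp add: card_Plus)
qed

text \<open>Converse of \<open>rad_dim_bound\<close>: vectors completing a basis of the radical have
  a nonsingular Gram matrix, because a combination orthogonal to all of them would lie in the
  radical. Here the size of the minor is the rank.\<close>

lemma rad_complement:
 assumes D: "fin_sub D" and C: "alt_bilin C"
 obtains m and c :: "nat => 'b" where "dim D = dim (rad D C) + m" "!!i. i < m ==> c i : D"
  "ALL v. (ALL j<m. (SUM i<m. v i * C (c i) (c j)) = 0) --> (ALL i<m. v i = 0)"
proof -
 have sD: "subspace D" using D by (simp add: fin_sub_def)
 obtain N and e :: "nat => 'b" where e: "basis_on (rad D C) {..<N} e"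
  using basis_on_exists[OF rad_fin_sub[OF D C]] .
 have dN: "dim (rad D C) = N" using basis_on_dim[OF rad_subspace[OF sD C] e] by simp
 have eR: "e i : D" "!!y. y : D ==> C (e i) y = 0" if "i < N" for i
  using basis_onD(2)[OF e, of i] that by (auto simp: rad_def)
 obtain m and c :: "nat => 'b" where b: "basis_on D ({..<N} <+> {..<m}) (case_sum e c)"
 proof (rule basis_extend[OF D, of "{..<N}" e])
  show "indep_fam {..<N} e" "!!j. j : {..<N} ==> e j : D" using basis_onD(3)[OF e] eR by auto
 qed auto
 have cD: "c i : D" if "i < m" for i using basis_onD(2)[OF b, of "Inr i"] that by auto
 have nd: "ALL i<m. v i = 0" if v: "!!j. j < m ==> (SUM i<m. v i * C (c i) (c j)) = 0" for v
 proof -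
  define x where "x = (SUM i<m. v i *s c i)"
  have xD: "x : D" unfolding x_def using cD sD by (auto intro!: subspace_sum subspace_scale)
  have xc: "C x (c j) = 0" if "j < m" for j using v[OF that] by (simp add: x_def alt_bilin_sum[OF C])
  have xe: "C x (e j) = 0" if "j < N" for j using eR(2)[OF that xD] by (rule alt_bilin_eq0[OF C])
  have "C x y = 0" if yD: "y : D" for y
  proof -
   obtain d where "y = (SUM i:{..<N} <+> {..<m}. d i *s case_sum e c i)" using basis_onD(4)[OF b yD] by blast
   hence "y = (SUM i<N. d (Inl i) *s e i) + (SUM i<m. d (Inr i) *s c i)" by (simp add: sum.Plus)
   thus ?thesis using xc xe by (simp add: alt_bilinD(2)[OF C] alt_bilin_sum[OF C])
  qed
  hence "x : rad D C" using xD by (simp add: rad_def)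
  then obtain d where d: "x = (SUM i<N. d i *s e i)" using basis_onD(4)[OF e] by blast
  have z: "(SUM i:{..<N} <+> {..<m}. case_sum (%i. - d i) v i *s case_sum e c i) = 0"
   using d by (simp add: sum.Plus sum_negf x_def)
  have "v i = 0" if "i < m" for i
   using indep_famD[OF basis_onD(3)[OF b] z, of "Inr i"] that by auto
  thus ?thesis by blast
 qed
 have "dim D = dim (rad D C) + m" using basis_on_dim[OF sD b] dN by (simp add: card_Plus)
 thus thesis using that[of m c] cD nd by simp
qed

text \<open>Semicontinuity of the rank: a maximal minor that is nonsingular at t = 0 stays so off a
  finite set.\<close>

lemma rad_dim_cofinite:
 assumes D: "fin_sub D" and C: "alt_bilin C" "alt_bilin C'"
 shows "finite {t. dim (rad D C) < dim (rad D (%x y. C x y + t * C' x y))}"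
proof -
 obtain m and c :: "nat => 'b" where d: "dim D = dim (rad D C) + m" and cD: "!!i. i < m ==> c i : D"
  and nd0: "ALL v. (ALL j<m. (SUM i<m. v i * C (c i) (c j)) = 0) --> (ALL i<m. v i = 0)"
  by (rule rad_complement[OF D C(1)], rule that)
 hence nd: "!!v. (!!j. j < m ==> (SUM i<m. v i * C (c i) (c j)) = 0) ==> ALL i<m. v i = 0" by blast
 let ?M = "%i j. [:C (c i) (c j), C' (c i) (c j):]"
 have fin: "finite {t. \<not> (ALL v. (ALL j<m. (SUM i<m. v i * poly (?M i j) t) = 0) --> (ALL i<m. v i = 0))}"
  by (rule independent_rows_cofinite) (use nd in simp)
 have le: "dim (rad D (%x y. C x y + t * C' x y)) <= dim (rad D C)"
  if *: "ALL v. (ALL j<m. (SUM i<m. v i * poly (?M i j) t) = 0) --> (ALL i<m. v i = 0)" for t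
 proof -
  have "dim (rad D (%x y. C x y + t * C' x y)) + m <= dim D"
   by (rule rad_dim_bound[OF D alt_bilin_pencil[OF C], of m c c]) (use * cD in auto)
  thus ?thesis using d by simp
 qed
 show ?thesis
 proof (rule finite_subset[OF _ fin], intro subsetI CollectI notI)
  fix t assume "t : {t. dim (rad D C) < dim (rad D (%x y. C x y + t * C' x y))}"
   and "ALL v. (ALL j<m. (SUM i<m. v i * poly (?M i j) t) = 0) --> (ALL i<m. v i = 0)"
  from le[OF this(2)] this(1) show False by simp
 qed
qed

text \<open>An algebraic passage to the limit t = 0. If \<open>w\<close> failed to vanish at some
  \<open>z\<close> in the radical of \<open>C\<close>, a maximal minor of \<open>C\<close> bordered
  by the row \<open>w\<close> and the column \<open>z\<close> would be nonsingular at 0, hence at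
  some t in \<open>T\<close>. There \<open>w\<close> is itself a row of the form, so the rank at
  that t would exceed the rank of \<open>C\<close>, against the assumption on
  \<open>T\<close>.\<close>

lemma image_limit:
 fixes C C' :: "'b => 'b => 'a"
 assumes D: "fin_sub D" and C: "alt_bilin C" "alt_bilin C'" and w: "linfun w"
  and T: "infinite T" "!!t. t : T ==> dim (rad D C) <= dim (rad D (%x y. C x y + t * C' x y))"
   "!!t. t : T ==> EX x:D. ALL y:D. w y = C x y + t * C' x y"
 obtains x where "x : D" "!!y. y : D ==> w y = C x y"
proof -
 have "w z = 0" if z: "z : rad D C" for z
 proof (rule ccontr)
  assume wz: "w z ~= 0"
  have zD: "z : D" and Cz: "!!y. y : D ==> C y z = 0"
   using z alt_bilin_eq0[OF C(1), of z] by (auto simp: rad_def)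
  obtain m and c :: "nat => 'b" where d: "dim D = dim (rad D C) + m" and cD: "!!i. i < m ==> c i : D"
   and nd0: "ALL v. (ALL j<m. (SUM i<m. v i * C (c i) (c j)) = 0) --> (ALL i<m. v i = 0)"
   by (rule rad_complement[OF D C(1)], rule that)
  hence nd: "!!v. (!!j. j < m ==> (SUM i<m. v i * C (c i) (c j)) = 0) ==> ALL i<m. v i = 0" by blast
  \<comment> \<open>Column 0 is \<open>z\<close>, which every \<open>c i\<close> annihilates under
    \<open>C\<close>; row 0 of \<open>?M\<close> is the constant \<open>w\<close>. At t = 0 the
    bordered matrix is block triangular with diagonal blocks \<open>w z\<close> and the Gram matrix
    of the \<open>c i\<close>.\<close>
  let ?y = "case_nat z c"
  let ?M = "%i j. case i of 0 => [:w (?y j):] | Suc i => [:C (c i) (?y j), C' (c i) (?y j):]"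
  have fin: "finite {t. \<not> (ALL v. (ALL j<Suc m. (SUM i<Suc m. v i * poly (?M i j) t) = 0) --> (ALL i<Suc m. v i = 0))}"
  proof (rule independent_rows_cofinite)
   fix v assume v: "!!j. j < Suc m ==> (SUM i<Suc m. v i * poly (?M i j) 0) = 0"
   have v': "v 0 * w (?y j) + (SUM i<m. v (Suc i) * C (c i) (?y j)) = 0" if "j < Suc m" for j
    using v[OF that] by (simp add: sum.lessThan_Suc_shift del: sum.lessThan_Suc)
   have "(SUM i<m. v (Suc i) * C (c i) z) = 0" using Cz cD by (intro sum.neutral) auto
   hence v0: "v 0 = 0" using v'[of 0] wz by simp
   have "ALL i<m. v (Suc i) = 0"
   proof (rule nd)
    fix j assume "j < m"
    thus "(SUM i<m. v (Suc i) * C (c i) (c j)) = 0" using v'[of "Suc j"] v0 by simp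
   qed
   thus "ALL i<Suc m. v i = 0" using v0 by (auto simp: less_Suc_eq_0_disj)
  qed
  have "infinite (T - {t. \<not> (ALL v. (ALL j<Suc m. (SUM i<Suc m. v i * poly (?M i j) t) = 0) --> (ALL i<Suc m. v i = 0))})"
   using T(1) fin by (rule Diff_infinite_finite[rotated])
  then obtain t where t: "t : T"
   and ind: "!!v. (!!j. j < Suc m ==> (SUM i<Suc m. v i * poly (?M i j) t) = 0) ==> ALL i<Suc m. v i = 0"
   using infinite_imp_nonempty by blast
  obtain x where x: "x : D" "!!y. y : D ==> w y = C x y + t * C' x y" using T(3)[OF t] by blast
  have yD: "?y j : D" if "j < Suc m" for j using zD cD that by (cases j) auto
  have "dim (rad D (%x y. C x y + t * C' x y)) + Suc m <= dim D"
  proof (rule rad_dim_bound[OF D alt_bilin_pencil[OF C], of "Suc m" "case_nat x c" ?y])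
   fix v assume v: "!!j. j < Suc m ==> (SUM i<Suc m. v i * (C (case_nat x c i) (?y j) + t * C' (case_nat x c i) (?y j))) = 0"
   show "ALL i<Suc m. v i = 0"
   proof (rule ind)
    fix j assume j: "j < Suc m"
    show "(SUM i<Suc m. v i * poly (?M i j) t) = 0"
     using v[OF j] x(2)[OF yD[OF j]] by (simp add: sum.lessThan_Suc_shift del: sum.lessThan_Suc)
   qed
  next
   fix i assume "i < Suc m"
   thus "case_nat x c i : D" using x cD by (cases i) auto
  qed (use yD in blast)
  thus False using d T(2)[OF t] by simp
 qed
 thus thesis using fredholm[OF D C(1) w, of thesis] that by blast
qed

end

lemma fun_fam_space: "fam_space (%c f x. c * f x :: 'a::field)"
 by unfold_locales (auto simp: fun_eq_iff algebra_simps)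

context fam_space
begin

text \<open>The exchange step by which one starting vector of a chain is replaced.\<close>

lemma indep_fam_update:
 assumes I: "finite I" and e: "indep_fam I e" and j: "j : I" and a: "a j ~= 0"
  and v: "v = (SUM i:I. a i *s e i)"
 shows "indep_fam I (e(j := v))"
 unfolding indep_fam_def
proof (intro allI impI)
 fix d assume d: "(SUM i:I. d i *s (e(j := v)) i) = 0"
 let ?c = "%i. (if i = j then 0 else d i) + d j * a i"
 have "(SUM i:I. d i *s (e(j := v)) i) = d j *s v + (SUM i:I - {j}. d i *s e i)"
  using I j by (simp add: sum.remove[of I j])
 also have "(SUM i:I - {j}. d i *s e i) = (SUM i:I. (if i = j then 0 else d i) *s e i)"
  using I j by (simp add: sum.remove[of I j])
 also have "d j *s v + ... = (SUM i:I. ?c i *s e i)"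
  unfolding v by (simp add: scale_sum_right scale_left_distrib sum.distrib)
 finally have "(SUM i:I. ?c i *s e i) = 0" using d by simp
 hence c: "!!i. i : I ==> ?c i = 0" using indep_famD[OF e, of ?c] by blast
 have "d j = 0" using c[OF j] a by simp
 show "ALL i:I. d i = 0"
 proof
  fix i assume "i : I"
  thus "d i = 0" using c[of i] `d j = 0` by (cases "i = j") auto
 qed
qed

end

section \<open>Pencils of maximal rank at both generators, and their chains\<close>

locale alt_pencil = fam_space scale
 for scale :: "'k::field_char_0 => 'b::ab_group_add => 'b" (infixr "*s" 75) +
 fixes D :: "'b set" and A B :: "'b => 'b => 'k" and r :: nat
 assumes fin_D: "fin_sub D" and bil_A: "alt_bilin A" and bil_B: "alt_bilin B"
  and rad_A: "dim (rad D A) = r" and rad_B: "dim (rad D B) = r"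
  and rad_comb: "!!t. r <= dim (rad D (%x y. (1 - t) * A x y + t * B x y))"
begin

abbreviation pen :: "'k => 'b => 'b => 'k" where "pen t \<equiv> %x y. A x y + t * B x y"

lemma sub_D: "subspace D"
 using fin_D by (simp add: fin_sub_def)

lemmas A_simps = alt_bilinD(1-5,7-12)[OF bil_A] alt_bilin_sum[OF bil_A]
lemmas B_simps = alt_bilinD(1-5,7-12)[OF bil_B] alt_bilin_sum[OF bil_B]

lemma A_swap: "A x y = - A y x" and B_swap: "B x y = - B y x"
 using alt_bilinD(6)[OF bil_A] alt_bilinD(6)[OF bil_B] by blast+

lemma rad_scale: "a ~= 0 ==> rad D (%x y. a * C x y) = rad D C"
 by (auto simp: rad_def)

text \<open>Up to a nonzero factor 1 + t, the member \<open>pen t\<close> is the combination with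
  parameter t / (1 + t). The affine line through \<open>A\<close> and \<open>B\<close> misses only
  the direction A - B, that is t = -1, so nothing is known there yet.\<close>

lemma rad_AB: "t ~= -1 ==> r <= dim (rad D (pen t))"
proof -
 assume t: "t ~= -1"
 hence t1: "1 + t ~= 0" by (metis add_eq_0_iff)
 hence eq: "1 - t / (1 + t) = 1 / (1 + t)" by (simp add: field_simps)
 have "(%x y. (1 - t / (1 + t)) * A x y + t / (1 + t) * B x y) =
   (%x y. (1 / (1 + t)) * (A x y + t * B x y))"
  unfolding eq by (intro ext) (simp add: distrib_left add.commute)
 thus ?thesis using rad_comb[of "t / (1 + t)"] rad_scale[of "1 / (1 + t)" "%x y. A x y + t * B x y"] t1
  by simp
qed

lemma rad_BA: "t ~= -1 ==> r <= dim (rad D (%x y. B x y + t * A x y))"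
proof -
 assume t: "t ~= -1"
 hence t1: "1 + t ~= 0" by (metis add_eq_0_iff)
 hence eq: "1 - 1 / (1 + t) = (1 / (1 + t)) * t" by (simp add: field_simps)
 have "(%x y. (1 - 1 / (1 + t)) * A x y + 1 / (1 + t) * B x y) =
   (%x y. (1 / (1 + t)) * (B x y + t * A x y))"
  unfolding eq by (intro ext) (simp add: distrib_left add.commute)
 thus ?thesis using rad_comb[of "1 / (1 + t)"] rad_scale[of "1 / (1 + t)" "%x y. B x y + t * A x y"] t1
  by simp
qed

lemma generic: "finite {t. dim (rad D (pen t)) ~= r}"
proof (rule finite_subset)
 show "finite (insert (-1) {t. r < dim (rad D (pen t))})"
  using rad_dim_cofinite[OF fin_D bil_A bil_B] rad_A by simp
 show "{t. dim (rad D (pen t)) ~= r} <=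
   insert (-1) {t. r < dim (rad D (pen t))}"
 proof
  fix t assume "t : {t. dim (rad D (pen t)) ~= r}"
  thus "t : insert (-1) {t. r < dim (rad D (pen t))}"
   using rad_AB[of t] by (cases "t = -1") auto
 qed
qed

text \<open>The descending vectors: those from which at most k steps x to y with B(x, .) = - A(y, .)
  on \<open>D\<close> lead to zero. Level 1 is the radical of \<open>B\<close>.\<close>

primrec desc :: "nat => 'b set" where
 "desc 0 = {0}"
| "desc (Suc k) = {x : D. EX y:desc k. ALL d:D. B x d = - A y d}"

lemma desc_D: "desc k <= D"
 by (cases k) (auto simp: subspace_0[OF sub_D])

lemma desc_subspace: "subspace (desc k)"
proof (induction k)
 case 0
 thus ?case by simp
next
 case (Suc k)
 show ?case
 proof (rule subspaceI)
  show "0 : desc (Suc k)" using subspace_0[OF sub_D] subspace_0[OF Suc]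
   by (auto simp: A_simps B_simps intro!: bexI[of _ 0])
 next
  fix x x' assume "x : desc (Suc k)" "x' : desc (Suc k)"
  then obtain y y' where "x : D" "x' : D" "y : desc k" "y' : desc k" "ALL d:D. B x d = - A y d" "ALL d:D. B x' d = - A y' d"
   by auto
  thus "x + x' : desc (Suc k)" using subspace_add[OF sub_D] subspace_add[OF Suc]
   by (auto simp: A_simps B_simps intro!: bexI[of _ "y + y'"])
 next
  fix c x assume "x : desc (Suc k)"
  then obtain y where "x : D" "y : desc k" "ALL d:D. B x d = - A y d" by auto
  thus "c *s x : desc (Suc k)" using subspace_scale[OF sub_D] subspace_scale[OF Suc]
   by (auto simp: A_simps B_simps intro!: bexI[of _ "c *s y"])
 qed
qed

lemma desc_Suc: "desc k <= desc (Suc k)"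
proof (induction k)
 case 0
 thus ?case using subspace_0[OF sub_D] by (auto simp: A_simps B_simps)
next
 case (Suc k)
 thus ?case by auto
qed

lemma desc_mono: "k <= l ==> desc k <= desc l"
 using desc_Suc by (rule lift_Suc_mono_le)

text \<open>Along y = y_0, y_1, ... the weighted sum of the y_i with powers of t telescopes: B y_i
  cancels against the A-term of y_(i+1), and only t^k A y survives.\<close>

lemma desc_lift: "y : desc k ==> EX x:D. ALL d:D. B x d + t * A x d = t ^ k * A y d"
proof (induction k arbitrary: y)
 case 0
 thus ?case using subspace_0[OF sub_D] by (intro bexI[of _ 0]) (auto simp: A_simps B_simps)
next
 case (Suc k)
 then obtain y' where y': "y : D" "y' : desc k" "ALL d:D. B y d = - A y' d" by auto
 obtain x where x: "x : D" "ALL d:D. B x d + t * A x d = t ^ k * A y' d" using Suc.IH[OF y'(2)] by blast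
 show ?case
 proof (intro bexI ballI)
  show "x + t ^ k *s y : D" using x(1) y'(1) sub_D by (intro subspace_add subspace_scale)
  fix d assume d: "d : D"
  have "B (x + t ^ k *s y) d + t * A (x + t ^ k *s y) d =
    (B x d + t * A x d) + t ^ k * B y d + t ^ Suc k * A y d"
   by (simp add: A_simps B_simps algebra_simps)
  thus "B (x + t ^ k *s y) d + t * A (x + t ^ k *s y) d = t ^ Suc k * A y d"
   using x(2) y'(3) d by simp
 qed
qed

text \<open>Dividing \<open>desc_lift\<close> by t^k puts A(y, .) into the image of B + t A for
  almost all t; \<open>image_limit\<close> then carries it to t = 0.\<close>

lemma desc_image:
 assumes y: "y : desc k"
 shows "EX x:D. ALL d:D. A y d = B x d"
proof -
 \<comment> \<open>0 is removed for the division by t^k, -1 because it is the one member whose rank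
   the hypothesis \<open>rad_comb\<close> does not bound.\<close>
 have inf: "infinite (- {0, -1 :: 'k})" by (simp add: infinite_UNIV_char_0)
 have ex: "EX x:D. ALL d:D. A y d = B x d + t * A x d" if t: "t : - {0, -1}" for t
 proof -
  obtain x where x: "x : D" "ALL d:D. B x d + t * A x d = t ^ k * A y d" using desc_lift[OF y] by blast
  show ?thesis
  proof (intro bexI ballI)
   show "(1 / t ^ k) *s x : D" using x(1) sub_D by (rule subspace_scale[rotated])
   fix d assume "d : D"
   have "B ((1 / t ^ k) *s x) d + t * A ((1 / t ^ k) *s x) d = (B x d + t * A x d) / t ^ k"
    by (simp add: A_simps B_simps add_divide_distrib)
   thus "A y d = B ((1 / t ^ k) *s x) d + t * A ((1 / t ^ k) *s x) d"
    using x(2) `d : D` t by simp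
  qed
 qed
 have le: "dim (rad D B) <= dim (rad D (%x y. B x y + t * A x y))" if "t : - {0, -1}" for t
  using rad_BA[of t] rad_B that by simp
 show ?thesis by (rule image_limit[OF fin_D bil_B bil_A alt_bilinD(13)[OF bil_A] inf le ex]) blast+
qed

definition desc_all :: "'b set" where "desc_all = (\<Union>k. desc k)"

lemma desc_all_subspace: "subspace desc_all"
proof (rule subspaceI)
 show "0 : desc_all" unfolding desc_all_def using subspace_0[OF desc_subspace] by blast
next
 fix x y assume "x : desc_all" "y : desc_all"
 then obtain k l where "x : desc k" "y : desc l" by (auto simp: desc_all_def)
 hence "x : desc (max k l)" "y : desc (max k l)"
  using desc_mono[of k "max k l"] desc_mono[of l "max k l"] by auto
 thus "x + y : desc_all" unfolding desc_all_def using subspace_add[OF desc_subspace] by blast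
next
 fix c x assume "x : desc_all"
 thus "c *s x : desc_all" unfolding desc_all_def using subspace_scale[OF desc_subspace] by blast
qed

text \<open>The vector x supplied by \<open>desc_image\<close> is again descending, since - x lies
  one step above y.\<close>

lemma desc_all_A: "y : desc_all ==> EX x:desc_all. ALL d:D. A y d = B x d"
proof -
 assume "y : desc_all"
 then obtain k where k: "y : desc k" by (auto simp: desc_all_def)
 then obtain x where x: "x : D" "ALL d:D. A y d = B x d" using desc_image by blast
 have "- x : D" using x(1) by (rule subspace_neg[OF sub_D])
 hence "- x : desc (Suc k)" using k x(2) by (auto simp: B_simps intro!: bexI[of _ y])
 hence "- x : desc_all" unfolding desc_all_def by blast
 hence "x : desc_all" using subspace_neg[OF desc_all_subspace] by fastforce
 thus ?thesis using x(2) by blast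
qed

lemma desc_all_B: "x : desc_all ==> EX y:desc_all. ALL d:D. B x d = A y d"
proof -
 assume "x : desc_all"
 then obtain k where "x : desc k" by (auto simp: desc_all_def)
 hence "x : desc (Suc k)" using desc_Suc by blast
 then obtain y where y: "y : desc k" "ALL d:D. B x d = - A y d" by auto
 hence "- y : desc_all" unfolding desc_all_def using subspace_neg[OF desc_subspace] by blast
 thus ?thesis using y(2) by (intro bexI[of _ "- y"]) (auto simp: A_simps)
qed

text \<open>\<open>A\<close> and \<open>B\<close> map \<open>desc_all\<close> onto the same space of
  functionals, so by rank and nullity they have kernels of equal dimension in it. The kernel of
  \<open>B\<close> is its whole radical, of dimension \<open>r\<close>; so the kernel of
  \<open>A\<close> also has dimension \<open>r\<close> and exhausts the radical of
  \<open>A\<close>.\<close>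

lemma rad_A_desc: "rad D A <= desc_all"
proof -
 interpret F: fam_space "%c (f :: 'b => 'k) x. c * f x" by (rule fun_fam_space)
 interpret P: fam_space_pair scale "%c (f :: 'b => 'k) x. c * f x" by unfold_locales
 have sub: "desc_all <= D" unfolding desc_all_def using desc_D by blast
 have fin: "fin_sub desc_all" by (rule fin_sub_subset[OF fin_D desc_all_subspace sub])
 \<comment> \<open>Functionals on \<open>D\<close> are coded by functions cut off outside
   \<open>D\<close>, so that the kernel of \<open>?g C\<close> is the radical relative to
   \<open>D\<close>.\<close>
 let ?g = "%C y d. if d : D then C y d else (0::'k)"
 have lin: "?g C (x + y) = ?g C x + ?g C y" "?g C (c *s x) = (%d. c * ?g C x d)" if "alt_bilin C" for C x y c
  by (auto simp: fun_eq_iff alt_bilinD(1,3)[OF that])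
 have img: "?g A ` desc_all = ?g B ` desc_all"
 proof (intro equalityI image_subsetI)
  fix y assume "y : desc_all"
  then obtain x where "x : desc_all" "ALL d:D. A y d = B x d" using desc_all_A by blast
  thus "?g A y : ?g B ` desc_all" by (intro image_eqI[of _ _ x]) auto
 next
  fix y assume "y : desc_all"
  then obtain x where "x : desc_all" "ALL d:D. B y d = A x d" using desc_all_B by blast
  thus "?g B y : ?g A ` desc_all" by (intro image_eqI[of _ _ x]) auto
 qed
 have ker: "{y : desc_all. ?g C y = 0} = desc_all \<inter> rad D C" for C
  using sub by (auto simp: rad_def fun_eq_iff)
 have "rad D B <= desc 1" by (auto simp: rad_def A_simps)
 hence "rad D B <= desc_all" unfolding desc_all_def by blast
 hence kB: "desc_all \<inter> rad D B = rad D B" by blast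
 have "dim (desc_all \<inter> rad D A) = dim (desc_all \<inter> rad D B)"
  using P.rank_nullity_on(1)[OF fin, of "?g A"] P.rank_nullity_on(1)[OF fin, of "?g B"] lin[OF bil_A] lin[OF bil_B]
  unfolding img ker by simp
 hence "dim (desc_all \<inter> rad D A) = dim (rad D A)" using kB rad_A rad_B by simp
 hence "desc_all \<inter> rad D A = rad D A"
  by (intro dim_le_subset(2)[OF rad_fin_sub[OF fin_D bil_A]] subspace_inter desc_all_subspace
    rad_subspace[OF sub_D bil_A]) auto
 thus ?thesis by blast
qed

text \<open>Equivalently, the polynomial sum t^(i-1) b_i lies in the radical of \<open>pen t\<close>
  for all t. Prolonging the chain by zeros at 0 and beyond n makes the recursion hold at both ends
  without case distinctions.\<close>

definition chain :: "nat => (nat => 'b) => bool" where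
 "chain n b \<longleftrightarrow> (ALL i. b i : D) & b 0 = 0 & (ALL i>n. b i = 0) & (ALL i. ALL d:D. A (b (Suc i)) d = - B (b i) d)"

lemma desc_seq:
 "x : desc k ==> EX c. c 0 = x & (ALL i>=k. c i = 0) & (ALL i. c i : D) & (ALL i. ALL d:D. B (c i) d = - A (c (Suc i)) d)"
proof (induction k arbitrary: x)
 case 0
 thus ?case using subspace_0[OF sub_D] by (intro exI[of _ "%_. 0"]) (auto simp: A_simps B_simps)
next
 case (Suc k)
 then obtain y where y: "x : D" "y : desc k" "ALL d:D. B x d = - A y d" by auto
 obtain c where c: "c 0 = y" "ALL i>=k. c i = 0" "ALL i. c i : D" "ALL i. ALL d:D. B (c i) d = - A (c (Suc i)) d"
  using Suc.IH[OF y(2)] by blast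
 show ?case
 proof (intro exI conjI allI impI ballI)
  fix i assume "Suc k <= i" thus "case_nat x c i = 0" using c(2) by (cases i) auto
 next
  fix i show "case_nat x c i : D" using c(3) y(1) by (cases i) auto
 next
  fix i d assume "d : D" thus "B (case_nat x c i) d = - A (case_nat x c (Suc i)) d"
   using c(1,4) y(3) by (cases i) auto
 qed simp
qed

lemma chain_from: "z : rad D A ==> EX n b. chain n b & b 1 = z"
proof -
 assume z: "z : rad D A"
 then obtain k where "z : desc k" using rad_A_desc by (auto simp: desc_all_def)
 then obtain c where c: "c 0 = z" "ALL i>=k. c i = 0" "ALL i. c i : D" "ALL i. ALL d:D. B (c i) d = - A (c (Suc i)) d"
  using desc_seq by blast
 have "chain k (case_nat 0 c)" unfolding chain_def
 proof (intro conjI allI impI ballI)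
  fix i assume "k < i" thus "case_nat 0 c i = 0" using c(2) by (cases i) auto
 next
  fix i show "case_nat 0 c i : D" using c(3) subspace_0[OF sub_D] by (cases i) auto
 next
  fix i d assume "d : D" thus "A (case_nat 0 c (Suc i)) d = - B (case_nat 0 c i) d"
   using c(1,4) z by (cases i) (auto simp: rad_def B_simps)
 qed simp
 thus ?thesis using c(1) by (intro exI[of _ k] exI[of _ "case_nat 0 c"]) simp
qed

definition kfam :: "(nat => nat) => (nat => nat => 'b) => bool" where
 "kfam n bv \<longleftrightarrow> (ALL j:{1..r}. 1 <= n j & chain (n j) (bv j)) &
   indep_fam (SIGMA j:{1..r}. {1..n j}) (%(j, i). bv j i)"

text \<open>Chains may be shifted and added, which multiplies the polynomials they stand for by
  powers of t. The shifts are chosen so that the given relation becomes the k-th vector of the new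
  chain; it is zero, so the chain may be cut there.\<close>

lemma chain_shorten:
 assumes ch: "!!j. j : J ==> chain (n j) (bv j)" and k: "0 < k"
  and z: "(SUM j:J. SUM i=1..k. c j i *s bv j i) = 0"
 shows "EX b. chain (k - 1) b & (1 < k --> b 1 = (SUM j:J. c j k *s bv j 1))"
proof -
 \<comment> \<open>Chain j is shifted by s and weighted with \<open>c j (k - s)\<close>. For s > i
   the truncated difference yields \<open>bv j 0 = 0\<close>, as the shift requires.\<close>
 define de where "de i = (SUM j:J. SUM s<k. c j (k - s) *s bv j (i - s))" for i
 have bD: "bv j i : D" and b0: "bv j 0 = 0" and bA: "d : D ==> A (bv j (Suc i)) d = - B (bv j i) d"
  if "j : J" for j i d using ch[OF that] by (auto simp: chain_def)
 have deD: "de i : D" for i unfolding de_def using bD by (intro subspace_sum[OF sub_D] subspace_scale[OF sub_D])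
 have de0: "de 0 = 0" unfolding de_def using b0 by simp
 have deA: "A (de (Suc i)) d = - B (de i) d" if d: "d : D" for i d
 proof -
  have "A (bv j (Suc i - s)) d = - B (bv j (i - s)) d" if j: "j : J" for j s
   using bA[OF j d, of "i - s"] b0[OF j] by (cases "s <= i") (auto simp: Suc_diff_le A_simps B_simps)
  thus ?thesis unfolding de_def by (simp add: A_simps B_simps sum_negf)
 qed
 have "de k = (SUM j:J. SUM i=1..k. c j i *s bv j i)" unfolding de_def
 proof (rule sum.cong[OF refl])
  fix j show "(SUM s<k. c j (k - s) *s bv j (k - s)) = (SUM i=1..k. c j i *s bv j i)"
   by (rule sum.reindex_bij_witness[of _ "%i. k - i" "%i. k - i"]) auto
 qed
 hence dek: "de k = 0" using z by simp
 have "chain (k - 1) (%i. if i < k then de i else 0)" unfolding chain_def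
 proof (intro conjI allI impI ballI)
  fix i show "(if i < k then de i else 0) : D" using deD subspace_0[OF sub_D] by simp
 next
  fix i d assume d: "d : D"
  consider "Suc i < k" | "Suc i = k" | "k < Suc i" by linarith
  thus "A (if Suc i < k then de (Suc i) else 0) d = - B (if i < k then de i else 0) d"
   by cases (use deA[OF d, of i] dek in \<open>auto simp: A_simps B_simps\<close>)
 qed (use de0 k in auto)
 moreover have "de 1 = (SUM j:J. c j k *s bv j 1)" unfolding de_def
 proof (rule sum.cong[OF refl])
  fix j assume j: "j : J"
  have "(SUM s<k. c j (k - s) *s bv j (1 - s)) = (SUM s<k. if s = 0 then c j k *s bv j 1 else 0)"
   by (rule sum.cong) (auto simp: b0[OF j])
  thus "(SUM s<k. c j (k - s) *s bv j (1 - s)) = c j k *s bv j 1" using k by simp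
 qed
 ultimately show ?thesis by (intro exI[of _ "%i. if i < k then de i else 0"]) auto
qed

text \<open>Chains starting at a basis of the radical of \<open>A\<close>, of minimal total length, are independent:
 a dependency would allow one of them to be shortened.\<close>

lemma kfam_exists: "EX n bv. kfam n bv"
proof -
 define pre where "pre = (%(n, bv). (ALL j:{1..r}. chain (n j) (bv j)) & indep_fam {1..r} (%j. bv j 1))"
 obtain N and e :: "nat => 'b" where e: "basis_on (rad D A) {..<N} e"
  using basis_on_exists[OF rad_fin_sub[OF fin_D bil_A]] .
 have N: "N = r" using basis_on_dim[OF rad_subspace[OF sub_D bil_A] e] rad_A by simp
 have "bij_betw (%j. j - 1) {1..r} {..<N}"
  by (rule bij_betw_byWitness[where f' = Suc]) (auto simp: N)
 from basis_on_reindex[OF e this] have e': "basis_on (rad D A) {1..r} (e \<circ> (%j. j - 1))" .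
 have "EX n b. chain n b & b 1 = (e \<circ> (%j. j - 1)) j" if "j : {1..r}" for j
  using basis_onD(2)[OF e' that] by (rule chain_from)
 hence "ALL j. EX n b. j : {1..r} --> chain n b & b 1 = (e \<circ> (%j. j - 1)) j" by blast
 then obtain n0 where "ALL j. EX b. j : {1..r} --> chain (n0 j) b & b 1 = (e \<circ> (%j. j - 1)) j" by metis
 then obtain bv0 where b0: "!!j. j : {1..r} ==> chain (n0 j) (bv0 j) & bv0 j 1 = (e \<circ> (%j. j - 1)) j" by metis
 have "indep_fam {1..r} (%j. bv0 j 1) \<longleftrightarrow> indep_fam {1..r} (e \<circ> (%j. j - 1))"
  unfolding indep_fam_def using b0 by simp
 hence "pre (n0, bv0)" unfolding pre_def using b0 basis_onD(3)[OF e'] by auto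
 then obtain p where p: "pre p" "!!q. pre q ==> sum (fst p) {1..r} <= sum (fst q) {1..r}"
  using ex_has_least_nat[of pre _ "%p. sum (fst p) {1..r}"] by blast
 obtain n bv where [simp]: "p = (n, bv)" by (cases p)
 have ch: "chain (n j) (bv j)" if "j : {1..r}" for j using p(1) that by (auto simp: pre_def)
 have ind: "indep_fam {1..r} (%j. bv j 1)" using p(1) by (auto simp: pre_def)
 have min: "sum n {1..r} <= sum n' {1..r}" if "pre (n', bv')" for n' bv' using p(2)[OF that] by simp
 have n1: "1 <= n j" if j: "j : {1..r}" for j
 proof (rule ccontr)
  assume "\<not> 1 <= n j"
  hence "bv j 1 = 0" using ch[OF j] by (auto simp: chain_def)
  hence "(SUM i=1..r. (if i = j then 1 else 0) *s bv i 1) = 0" by (intro sum.neutral) auto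
  thus False using indep_famD[OF ind _ j, of "%i. if i = j then 1 else 0"] by simp
 qed
 have "indep_fam (SIGMA j:{1..r}. {1..n j}) (%(j, i). bv j i)"
  unfolding indep_fam_def
 proof (intro allI impI)
  fix c :: "nat \<times> nat => 'k"
  assume c0: "(SUM p:(SIGMA j:{1..r}. {1..n j}). c p *s (case p of (j, i) => bv j i)) = 0"
  have "(SUM p:(SIGMA j:{1..r}. {1..n j}). c p *s (case p of (j, i) => bv j i)) =
    (SUM j=1..r. SUM i=1..n j. c (j, i) *s bv j i)"
   by (subst sum.Sigma) (auto intro!: sum.cong)
  hence cz: "(SUM j=1..r. SUM i=1..n j. c (j, i) *s bv j i) = 0" using c0 by simp
  show "ALL p:(SIGMA j:{1..r}. {1..n j}). c p = 0"
  proof (rule ccontr)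
   assume neg: "\<not> ?thesis"
   define d where "d j i = (if j : {1..r} & i : {1..n j} then c (j, i) else 0)" for j i
   \<comment> \<open>The levels at which the relation has a nonzero coefficient. If k is the highest
     of them and \<open>d j0 k ~= 0\<close>, then chain \<open>j0\<close> has length at least k, so
     a replacement of length k - 1 is strictly shorter.\<close>
   define K where "K = {i. EX j. d j i ~= 0}"
   obtain j i where "j : {1..r}" "i : {1..n j}" "c (j, i) ~= 0" using neg by auto
   hence "i : K" unfolding K_def d_def by auto
   hence "K ~= {}" by blast
   have "K <= (\<Union>j\<in>{1..r}. {1..n j})" unfolding K_def d_def by (auto split: if_splits)
   hence "finite K" by (rule finite_subset) simp
   define k where "k = Max K"
   have "k : K" unfolding k_def using `finite K` `K ~= {}` by (rule Max_in)
   then obtain j0 where j0: "d j0 k ~= 0" by (auto simp: K_def)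
   hence j0r: "j0 : {1..r}" and k1: "1 <= k" and kn: "k <= n j0" by (auto simp: d_def split: if_splits)
   have dk: "d j i = 0" if "k < i" for i j
    using that Max_ge[OF `finite K`, of i] unfolding k_def[symmetric] by (auto simp: K_def)
   have "(SUM i=1..k. d j i *s bv j i) = (SUM i=1..n j. c (j, i) *s bv j i)" if j: "j : {1..r}" for j
   proof -
    have "(SUM i=1..k. d j i *s bv j i) = (SUM i=1..max k (n j). d j i *s bv j i)"
     by (rule sum.mono_neutral_left) (auto simp: dk)
    also have "... = (SUM i=1..n j. d j i *s bv j i)"
     by (rule sum.mono_neutral_right) (auto simp: d_def)
    also have "... = (SUM i=1..n j. c (j, i) *s bv j i)" using j by (intro sum.cong) (auto simp: d_def)
    finally show ?thesis .
   qed
   hence "(SUM j=1..r. SUM i=1..k. d j i *s bv j i) = 0" using cz by simp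
   then obtain b where b: "chain (k - 1) b" "1 < k --> b 1 = (SUM j=1..r. d j k *s bv j 1)"
    using chain_shorten[of "{1..r}" n bv k d] ch k1 by auto
   show False
   proof (cases "k = 1")
    \<comment> \<open>At level 1 the relation involves the starting vectors alone, and these are
      independent.\<close>
    case True
    hence "(SUM j=1..r. d j 1 *s bv j 1) = 0" using `(SUM j=1..r. SUM i=1..k. d j i *s bv j i) = 0` by simp
    hence "d j0 1 = 0" using indep_famD[OF ind _ j0r, of "%j. d j 1"] by simp
    thus False using j0 True by simp
   next
    case False
    hence b1: "b 1 = (SUM j=1..r. d j k *s bv j 1)" using b(2) k1 by simp
    have "indep_fam {1..r} ((%j. bv j 1)(j0 := b 1))"
     by (rule indep_fam_update[OF _ ind j0r j0 b1]) simp
    moreover have "(%j. bv j 1)(j0 := b 1) = (%j. (bv(j0 := b)) j 1)" by auto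
    ultimately have "pre (n(j0 := k - 1), bv(j0 := b))" unfolding pre_def using ch b(1) by auto
    from min[OF this] have "sum n {1..r} <= sum (n(j0 := k - 1)) {1..r}" .
    moreover have "sum (n(j0 := k - 1)) {1..r} < sum n {1..r}"
     by (rule sum_strict_mono_ex1) (use j0r kn k1 in auto)
    ultimately show False by simp
   qed
  qed
 qed
 hence "kfam n bv" unfolding kfam_def using ch n1 by simp
 thus ?thesis by blast
qed

end

section \<open>Isotropy of the chains and a dual system of chains\<close>

abbreviation idx :: "nat => (nat => nat) => (nat \<times> nat) set" where
 "idx r n \<equiv> SIGMA j:{1..r}. {1..n j}"

abbreviation cidx :: "nat => (nat => nat) => (nat \<times> nat) set" where
 "cidx r n \<equiv> SIGMA j:{1..r}. {1..<n j}"

abbreviation kidx :: "nat => (nat => nat) => nat => (nat \<times> nat + (nat \<times> nat + nat)) set" where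
 "kidx r n m \<equiv> idx r n <+> (cidx r n <+> {..<m})"

abbreviation kron_fam :: "(nat => nat => 'b) => (nat => nat => 'b) => (nat => 'b) => nat \<times> nat + (nat \<times> nat + nat) => 'b" where
 "kron_fam bv av sg \<equiv> case_sum (%(j, i). bv j i) (case_sum (%(l, k). av l k) sg)"

lemma sum_delta_pair:
 fixes f :: "nat => nat => 'a::semiring_1"
 assumes "finite J" "!!j. finite (I j)" "l : J" "k : I l"
 shows "(SUM j:J. SUM i:I j. f j i * (if j = l & i = k then 1 else 0)) = f l k"
proof -
 have "(SUM j:J. SUM i:I j. f j i * (if j = l & i = k then 1 else 0)) = (SUM j:J. if j = l then f l k else 0)"
 proof (rule sum.cong[OF refl])
  fix j assume "j : J"
  show "(SUM i:I j. f j i * (if j = l & i = k then 1 else 0)) = (if j = l then f l k else 0)"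
  proof (cases "j = l")
   case True
   hence "(SUM i:I j. f j i * (if j = l & i = k then 1 else 0)) = (SUM i:I l. if i = k then f l i else 0)"
    by (intro sum.cong) auto
   thus ?thesis using assms True by simp
  qed simp
 qed
 thus ?thesis using assms by simp
qed

context alt_pencil
begin

text \<open>Using both recursions and antisymmetry, B(b_i, b'_(k+1)) = B(b_(i+1), b'_k): weight
  moves from the second chain to the first until \<open>b' 0 = 0\<close> is reached.\<close>

lemma chain_isotropic:
 assumes "chain n b" "chain m b'"
 shows "A (b i) (b' k) = 0" "B (b i) (b' k) = 0"
proof -
 have b: "b i : D" "b 0 = 0" "d : D ==> A (b (Suc i)) d = - B (b i) d" for i d
  using assms(1) by (auto simp: chain_def)
 have b': "b' i : D" "b' 0 = 0" "d : D ==> A (b' (Suc i)) d = - B (b' i) d" for i d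
  using assms(2) by (auto simp: chain_def)
 have B0: "B (b i) (b' k) = 0" for i k
 proof (induction k arbitrary: i)
  case 0
  thus ?case by (simp add: b' B_simps)
 next
  case (Suc k)
  have "B (b i) (b' (Suc k)) = - A (b (Suc i)) (b' (Suc k))" using b(3)[OF b'(1)] by simp
  also have "... = A (b' (Suc k)) (b (Suc i))" using A_swap[of "b (Suc i)"] by simp
  also have "... = - B (b' k) (b (Suc i))" using b'(3)[OF b(1)] by simp
  also have "... = B (b (Suc i)) (b' k)" using B_swap[of "b (Suc i)"] by simp
  finally show ?case using Suc.IH by simp
 qed
 thus "B (b i) (b' k) = 0" .
 show "A (b i) (b' k) = 0"
 proof (cases i)
  case 0
  thus ?thesis by (simp add: b A_simps)
 next
  case (Suc i')
  thus ?thesis using b(3)[OF b'(1), of i' k] B0 by simp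
 qed
qed

text \<open>The normal form of the pair: for each chain, \<open>A\<close> pairs
  \<open>av j k\<close> with \<open>bv j (Suc k)\<close> and \<open>B\<close> pairs it with
  \<open>- bv j k\<close>; a further block lives on \<open>sg\<close>. A chain of length n has n - 1
  dual vectors, whence the dimension 2n - 1 of a Kronecker factor.\<close>

definition kron_basis :: "(nat => nat) => (nat => nat => 'b) => (nat => nat => 'b) => nat => (nat => 'b) => bool" where
 "kron_basis n bv av m sg \<longleftrightarrow>
   basis_on D (kidx r n m) (kron_fam bv av sg) &
   (ALL (j, i):idx r n. ALL (l, k):idx r n. A (bv j i) (bv l k) = 0 & B (bv j i) (bv l k) = 0) &
   (ALL (j, i):idx r n. ALL (l, k):cidx r n. A (bv j i) (av l k) = (if j = l & i = Suc k then 1 else 0) &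
    B (bv j i) (av l k) = - (if j = l & i = k then 1 else 0)) &
   (ALL (j, i):cidx r n. ALL (l, k):cidx r n. A (av j i) (av l k) = 0 & B (av j i) (av l k) = 0) &
   (ALL (j, i):idx r n. ALL q<m. A (bv j i) (sg q) = 0 & B (bv j i) (sg q) = 0) &
   (ALL (j, i):cidx r n. ALL q<m. A (av j i) (sg q) = 0 & B (av j i) (sg q) = 0)"

end

locale kron_family = alt_pencil scale D A B r
 for scale :: "'k::field_char_0 => 'b::ab_group_add => 'b" (infixr "*s" 75) and D A B r +
 fixes n :: "nat => nat" and bv :: "nat => nat => 'b"
 assumes kfam: "kfam n bv"
begin

definition U :: "'b set" where "U = span ((%(j, i). bv j i) ` idx r n)"

lemma n_pos: "j : {1..r} ==> 1 <= n j" and chain_beta: "j : {1..r} ==> chain (n j) (bv j)"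
 using kfam by (auto simp: kfam_def)

lemma beta_D: "j : {1..r} ==> bv j i : D" and beta_0: "j : {1..r} ==> bv j 0 = 0"
 and beta_gt: "j : {1..r} ==> n j < i ==> bv j i = 0"
 and beta_A: "j : {1..r} ==> d : D ==> A (bv j (Suc i)) d = - B (bv j i) d"
 and beta_B: "j : {1..r} ==> d : D ==> B (bv j i) d = - A (bv j (Suc i)) d"
 using chain_beta[of j] by (auto simp: chain_def)

lemma sum_idx: "(SUM p:idx r n. c p *s (case p of (j, i) => bv j i)) = (SUM j=1..r. SUM i=1..n j. c (j, i) *s bv j i)"
 by (subst sum.Sigma) (auto intro!: sum.cong)

lemma finite_idx: "finite (idx r n)" and finite_cidx: "finite (cidx r n)" by auto

lemma basis_U: "basis_on U (idx r n) (%(j, i). bv j i)"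
 unfolding basis_on_def U_def span_fam[OF finite_idx]
proof (intro conjI ballI finite_idx)
 fix p assume "p : idx r n"
 thus "(case p of (j, i) => bv j i) : range (%c. SUM p:idx r n. c p *s (case p of (j, i) => bv j i))"
  unfolding span_fam[OF finite_idx, symmetric] by (intro span_base imageI)
qed (use kfam in \<open>auto simp: kfam_def\<close>)

lemma sub_U: "subspace U"
 by (simp add: U_def)

lemma beta_U: "j : {1..r} ==> bv j i : U"
proof (cases "i : {1..n j}")
 case True
 moreover assume "j : {1..r}"
 ultimately show ?thesis using basis_onD(2)[OF basis_U, of "(j, i)"] by auto
next
 case False
 moreover assume "j : {1..r}"
 ultimately show ?thesis using beta_0[of j] beta_gt[of j i] subspace_0[OF sub_U] by (cases "i = 0") auto
qed

lemma U_repr: "u : U ==> EX c. u = (SUM j=1..r. SUM i=1..n j. c j i *s bv j i)"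
proof -
 assume "u : U"
 then obtain c where "u = (SUM p:idx r n. c p *s (case p of (j, i) => bv j i))"
  using basis_onD(4)[OF basis_U] by blast
 thus ?thesis unfolding sum_idx by (intro exI[of _ "%j i. c (j, i)"]) simp
qed

lemma U_I:
 fixes f :: "nat => nat"
 shows "(SUM j=1..r. SUM i=1..n j. c j i *s bv j (f i)) : U"
proof (rule subspace_sum[OF sub_U], rule subspace_sum[OF sub_U], rule subspace_scale[OF sub_U])
 fix j i assume "j : {1..r}"
 thus "bv j (f i) : U" by (rule beta_U)
qed

lemma U_coeff:
 assumes "(SUM j=1..r. SUM i=1..n j. c j i *s bv j i) = 0" "j : {1..r}" "i : {1..n j}"
 shows "c j i = 0"
proof -
 have "(SUM p:idx r n. (case p of (j, i) => c j i) *s (case p of (j, i) => bv j i)) = 0"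
  unfolding sum_idx using assms(1) by simp
 from indep_famD[OF basis_onD(3)[OF basis_U] this, of "(j, i)"] show ?thesis using assms by simp
qed

lemma U_D: "U <= D"
proof
 fix u assume "u : U"
 then obtain c where "u = (SUM j=1..r. SUM i=1..n j. c j i *s bv j i)" using U_repr by blast
 thus "u : D" using beta_D by (auto intro!: subspace_sum[OF sub_D] subspace_scale[OF sub_D])
qed

lemma isotropic: "u : U ==> v : U ==> A u v = 0" "u : U ==> v : U ==> B u v = 0"
proof -
 have "A u v = 0 & B u v = 0" if uv: "u : U" "v : U" for u v
 proof -
  obtain c d where "u = (SUM j=1..r. SUM i=1..n j. c j i *s bv j i)" "v = (SUM j=1..r. SUM i=1..n j. d j i *s bv j i)"
   using U_repr[OF uv(1)] U_repr[OF uv(2)] by blast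
  thus ?thesis using chain_isotropic[OF chain_beta chain_beta] by (simp add: A_simps B_simps)
 qed
 thus "u : U ==> v : U ==> A u v = 0" "u : U ==> v : U ==> B u v = 0" by blast+
qed

text \<open>Shifting every chain by one place exchanges \<open>A\<close> and - \<open>B\<close>.
  Together with \<open>image_BA\<close> this is the equality of subspaces in part (a), seen on
  covectors.\<close>

lemma image_AB: "u : U ==> EX u':U. ALL d:D. A u d = B u' d"
proof -
 assume "u : U"
 then obtain c where c: "u = (SUM j=1..r. SUM i=1..n j. c j i *s bv j i)" using U_repr by blast
 let ?v = "SUM j=1..r. SUM i=1..n j. (- c j i) *s bv j (i - 1)"
 have "A u d = B ?v d" if "d : D" for d
 proof -
  have "A (bv j i) d = - B (bv j (i - 1)) d" if "j : {1..r}" "i : {1..n j}" for j i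
   using beta_A[OF that(1) `d : D`, of "i - 1"] that by simp
  thus ?thesis unfolding c by (simp add: A_simps B_simps)
 qed
 moreover have "?v : U" by (rule U_I)
 ultimately show ?thesis by blast
qed

lemma image_BA: "u : U ==> EX u':U. ALL d:D. B u d = A u' d"
proof -
 assume "u : U"
 then obtain c where c: "u = (SUM j=1..r. SUM i=1..n j. c j i *s bv j i)" using U_repr by blast
 let ?v = "SUM j=1..r. SUM i=1..n j. (- c j i) *s bv j (Suc i)"
 have "B u d = A ?v d" if "d : D" for d
  unfolding c using beta_B[OF _ that] by (simp add: A_simps B_simps)
 moreover have "?v : U" by (rule U_I)
 ultimately show ?thesis by blast
qed

text \<open>The Veronese curve attached to chain j.\<close>

definition ga :: "'k => nat => 'b" where "ga t j = (SUM i=1..n j. t ^ (i - 1) *s bv j i)"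

lemma gamma_U: "j : {1..r} ==> ga t j : U"
 unfolding ga_def by (intro subspace_sum[OF sub_U] subspace_scale[OF sub_U] beta_U)

lemma gamma_pencil:
 assumes j: "j : {1..r}" and d: "d : D"
 shows "A (ga t j) d + t * B (ga t j) d = 0"
proof -
 define f where "f i = t ^ i * B (bv j i) d" for i
 have g: "ga t j = (SUM i<n j. t ^ i *s bv j (Suc i))"
  unfolding ga_def by (rule sum.reindex_bij_witness[of _ Suc "%i. i - 1"]) auto
 have "A (ga t j) d + t * B (ga t j) d = (SUM i<n j. f (Suc i) - f i)"
  unfolding g f_def by (simp add: A_simps B_simps beta_A[OF j d] sum_subtractf sum_distrib_left sum_negf mult.assoc)
 also have "... = f (n j) - f 0" by (rule sum_lessThan_telescope)
 also have "... = 0" using beta_B[OF j d, of "n j"] beta_gt[OF j, of "Suc (n j)"] beta_0[OF j]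
  by (simp add: f_def A_simps B_simps)
 finally show ?thesis .
qed

lemma gamma_rad: "j : {1..r} ==> ga t j : rad D (pen t)"
 using gamma_U U_D gamma_pencil unfolding rad_def by blast

lemma sum_gamma: "(SUM j=1..r. a j *s ga t j) = (SUM j=1..r. SUM i=1..n j. (a j * t ^ (i - 1)) *s bv j i)"
 unfolding ga_def by (simp add: scale_sum_right)

lemma gamma_indep: "indep_fam {1..r} (ga t)"
 unfolding indep_fam_def
proof (intro allI impI ballI)
 fix a j assume "(SUM j=1..r. a j *s ga t j) = 0" and j: "j : {1..r}"
 hence "(SUM j=1..r. SUM i=1..n j. (a j * t ^ (i - 1)) *s bv j i) = 0" by (simp only: sum_gamma)
 from U_coeff[OF this j, of 1] n_pos[OF j] show "a j = 0" by simp
qed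

lemma rad_generic:
 assumes "dim (rad D (pen t)) = r"
 shows "basis_on (rad D (pen t)) {1..r} (ga t)"
 by (rule indep_fam_card_le(2)[OF rad_fin_sub[OF fin_D alt_bilin_pencil[OF bil_A bil_B]]])
  (use gamma_indep gamma_rad assms in auto)

lemma rad_A_basis: "basis_on (rad D A) {1..r} (%j. bv j 1)"
proof (rule indep_fam_card_le(2)[OF rad_fin_sub[OF fin_D bil_A]])
 show "indep_fam {1..r} (%j. bv j 1)" unfolding indep_fam_def
 proof (intro allI impI ballI)
  fix a j assume a: "(SUM j=1..r. a j *s bv j 1) = 0" and j: "j : {1..r}"
  have "(SUM i=1..n l. (if i = 1 then a l else 0) *s bv l i) = a l *s bv l 1" if "l : {1..r}" for l
   using n_pos[OF that] by (simp add: if_distrib[of "%x. x *s _"] cong: if_cong)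
  hence "(SUM l=1..r. SUM i=1..n l. (if i = 1 then a l else 0) *s bv l i) = 0" using a by simp
  from U_coeff[OF this j, of 1] n_pos[OF j] show "a j = 0" by simp
 qed
 show "bv j 1 : rad D A" if "j : {1..r}" for j
  using beta_D[OF that] beta_A[OF that, of _ 0] beta_0[OF that] by (auto simp: rad_def B_simps)
qed (use rad_A in auto)

lemma rad_B_basis: "basis_on (rad D B) {1..r} (%j. bv j (n j))"
proof (rule indep_fam_card_le(2)[OF rad_fin_sub[OF fin_D bil_B]])
 show "indep_fam {1..r} (%j. bv j (n j))" unfolding indep_fam_def
 proof (intro allI impI ballI)
  fix a j assume a: "(SUM j=1..r. a j *s bv j (n j)) = 0" and j: "j : {1..r}"
  have "(SUM i=1..n l. (if i = n l then a l else 0) *s bv l i) = a l *s bv l (n l)" if "l : {1..r}" for l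
   using n_pos[OF that] by (simp add: if_distrib[of "%x. x *s _"] cong: if_cong)
  hence "(SUM l=1..r. SUM i=1..n l. (if i = n l then a l else 0) *s bv l i) = 0" using a by simp
  from U_coeff[OF this j, of "n j"] n_pos[OF j] show "a j = 0" by simp
 qed
 show "bv j (n j) : rad D B" if "j : {1..r}" for j
  using beta_D[OF that] beta_B[OF that, of _ "n j"] beta_gt[OF that] by (auto simp: rad_def A_simps)
qed (use rad_B in auto)

lemma rad_A_U: "rad D A <= U"
proof
 fix x assume "x : rad D A"
 then obtain a where "x = (SUM j=1..r. a j *s bv j 1)" using basis_onD(4)[OF rad_A_basis] by blast
 thus "x : U" using beta_U by (auto intro!: subspace_sum[OF sub_U] subspace_scale[OF sub_U])
qed

lemma rad_B_U: "rad D B <= U"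
proof
 fix x assume "x : rad D B"
 then obtain a where "x = (SUM j=1..r. a j *s bv j (n j))" using basis_onD(4)[OF rad_B_basis] by blast
 thus "x : U" using beta_U by (auto intro!: subspace_sum[OF sub_U] subspace_scale[OF sub_U])
qed

lemma rad_generic_U:
 assumes "dim (rad D (pen t)) = r"
 shows "rad D (pen t) <= U"
proof
 fix x assume "x : rad D (pen t)"
 then obtain a where "x = (SUM j=1..r. a j *s ga t j)" using basis_onD(4)[OF rad_generic[OF assms]] by blast
 thus "x : U" using gamma_U by (auto intro!: subspace_sum[OF sub_U] subspace_scale[OF sub_U])
qed

text \<open>This covers the exceptional t as well. The radical equation says that u minus t times
  its shift lies in the radical of \<open>A\<close>, which is spanned by the first vectors of the
  chains; hence along each chain the coefficients form a geometric progression with ratio t.\<close>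

lemma rad_in_U:
 assumes u: "u : U" and ru: "u : rad D (pen t)"
 shows "EX a. u = (SUM j=1..r. a j *s ga t j)"
proof -
 obtain c where c: "u = (SUM j=1..r. SUM i=1..n j. c j i *s bv j i)" using U_repr[OF u] by blast
 \<comment> \<open>t times the shift of u, so that A(v, .) = - t B(u, .).\<close>
 define v where "v = (SUM j=1..r. SUM i=1..n j. (t * c j i) *s bv j (Suc i))"
 have vU: "v : U" unfolding v_def by (rule U_I)
 have "A (u - v) d = 0" if d: "d : D" for d
 proof -
  have "A v d = - t * B u d" unfolding v_def c using beta_A[OF _ d]
   by (simp add: A_simps B_simps sum_distrib_left sum_negf mult.assoc)
  thus ?thesis using ru d by (simp add: rad_def A_simps)
 qed
 moreover have "u - v : D" using vU u U_D by (intro subspace_diff[OF sub_D]) auto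
 ultimately have "u - v : rad D A" by (simp add: rad_def)
 then obtain a where a: "u - v = (SUM j=1..r. a j *s bv j 1)" using basis_onD(4)[OF rad_A_basis] by blast
 \<comment> \<open>Coefficient 0 is set to zero so that the shifted sum may start at i = 1.\<close>
 define c' where "c' j i = (if i = 0 then 0 else c j i)" for j i
 have v': "v = (SUM j=1..r. SUM i=1..n j. (t * c' j (i - 1)) *s bv j i)"
  unfolding v_def
 proof (rule sum.cong[OF refl])
  fix j assume j: "j : {1..r}"
  have "(SUM i=1..n j. (t * c j i) *s bv j (Suc i)) = (SUM i=2..Suc (n j). (t * c' j (i - 1)) *s bv j i)"
   by (rule sum.reindex_bij_witness[of _ "%i. i - 1" Suc]) (auto simp: c'_def)
  also have "... = (SUM i=1..Suc (n j). (t * c' j (i - 1)) *s bv j i)"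
   by (rule sum.mono_neutral_left) (auto simp: c'_def Suc_le_eq not_le less_Suc_eq)
  also have "... = (SUM i=1..n j. (t * c' j (i - 1)) *s bv j i)"
   using beta_gt[OF j] by simp
  finally show "(SUM i=1..n j. (t * c j i) *s bv j (Suc i)) = (SUM i=1..n j. (t * c' j (i - 1)) *s bv j i)" .
 qed
 have a': "(SUM j=1..r. a j *s bv j 1) = (SUM j=1..r. SUM i=1..n j. (if i = 1 then a j else 0) *s bv j i)"
 proof (rule sum.cong[OF refl])
  fix j assume j: "j : {1..r}"
  show "a j *s bv j 1 = (SUM i=1..n j. (if i = 1 then a j else 0) *s bv j i)"
   using n_pos[OF j] by (simp add: if_distrib[of "%x. x *s _"] cong: if_cong)
 qed
 have "(SUM j=1..r. SUM i=1..n j. (c j i - t * c' j (i - 1) - (if i = 1 then a j else 0)) *s bv j i) =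
   u - v - (SUM j=1..r. a j *s bv j 1)"
  unfolding a' v' c by (simp add: scale_left_diff_distrib sum_subtractf)
 hence z: "(SUM j=1..r. SUM i=1..n j. (c j i - t * c' j (i - 1) - (if i = 1 then a j else 0)) *s bv j i) = 0"
  using a by simp
 have rec: "c j i = t * c' j (i - 1) + (if i = 1 then a j else 0)" if "j : {1..r}" "i : {1..n j}" for j i
  using U_coeff[OF z that] by (simp add: algebra_simps)
 have "c j i = a j * t ^ (i - 1)" if j: "j : {1..r}" and "i : {1..n j}" for j i
  using that(2)
 proof (induction i)
  case 0
  thus ?case by simp
 next
  case (Suc i)
  show ?case
  proof (cases i)
   case 0
   thus ?thesis using rec[OF j Suc.prems] by (simp add: c'_def)
  next
   case (Suc i')
   thus ?thesis using rec[OF j Suc.prems] Suc.IH Suc.prems by (simp add: c'_def)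
  qed
 qed
 hence "u = (SUM j=1..r. a j *s ga t j)" unfolding sum_gamma c by (intro sum.cong refl) auto
 thus ?thesis by (intro exI[of _ a])
qed

text \<open>The value of \<open>w\<close> on the curve \<open>ga t j\<close> is a polynomial in t
  whose coefficients are the values on the vectors of chain j; infinitely many zeros make it the
  zero polynomial.\<close>

lemma vanish_generic:
 assumes w: "linfun w" and T: "infinite T" and z: "!!t j. t : T ==> j : {1..r} ==> w (ga t j) = 0"
  and u: "u : U"
 shows "w u = 0"
proof -
 have wb: "w (bv j i) = 0" if j: "j : {1..r}" and i: "i : {1..n j}" for j i
 proof -
  define p where "p = (SUM i=1..n j. monom (w (bv j i)) (i - 1))"
  have "poly p t = w (ga t j)" for t
   unfolding p_def ga_def linfun_sum[OF w] by (simp add: poly_sum poly_monom mult.commute)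
  hence "T <= {t. poly p t = 0}" using z[OF _ j] by auto
  hence "p = 0" using T poly_roots_finite[of p] finite_subset by blast
  hence "coeff p (i - 1) = 0" by simp
  moreover have "coeff p (i - 1) = (SUM k=1..n j. if k = i then w (bv j k) else 0)"
   unfolding p_def coeff_sum using i by (intro sum.cong) auto
  ultimately show ?thesis using i by simp
 qed
 obtain c where "u = (SUM j=1..r. SUM i=1..n j. c j i *s bv j i)" using U_repr[OF u] by blast
 hence "w u = (SUM j=1..r. SUM i=1..n j. c j i * w (bv j i))"
  using linfun_sum[OF w, of "%_. 1" "%j. SUM i=1..n j. c j i *s bv j i" "{1..r}"] by (simp add: linfun_sum[OF w])
 thus ?thesis using wb by simp
qed

text \<open>The dual chain is built upward. Each new vector solves an equation for \<open>A\<close>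
  (first step) or for \<open>B\<close> (later steps), which is solvable once the right side vanishes
  on the radical, that is, on the first or the last vectors of the chains.\<close>

lemma alpha_exists:
 assumes l: "l : {1..r}"
 shows "EX av. ALL k:{1..<n l}. av k : D & (ALL j:{1..r}. ALL i. A (bv j i) (av k) = (if j = l & i = Suc k then 1 else 0)) &
   (Suc k < n l --> (ALL y:D. B y (av (Suc k)) = - A y (av k)))"
proof -
 have "K < n l ==> EX av. ALL k:{1..K}. av k : D &
   (ALL j:{1..r}. ALL i. A (bv j i) (av k) = (if j = l & i = Suc k then 1 else 0)) &
   (Suc k <= K --> (ALL y:D. B y (av (Suc k)) = - A y (av k)))" for K
 proof (induction K)
  case 0
  thus ?case by simp
 next
  case (Suc K)
  then obtain av where av: "!!k. k : {1..K} ==> av k : D"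
   "!!k j i. k : {1..K} ==> j : {1..r} ==> A (bv j i) (av k) = (if j = l & i = Suc k then 1 else 0)"
   "!!k y. k : {1..K} ==> Suc k <= K ==> y : D ==> B y (av (Suc k)) = - A y (av k)" by force
  have "EX x:D. (ALL j:{1..r}. ALL i. A (bv j i) x = (if j = l & i = Suc (Suc K) then 1 else 0)) &
    (1 <= K --> (ALL y:D. B y x = - A y (av K)))"
  proof (cases "K = 0")
   case True
   \<comment> \<open>The coordinate dual to \<open>bv l 2\<close>. It kills all
     \<open>bv j 1\<close>, hence the radical of \<open>A\<close>, and pairing 2 = Suc 1 is what the
     first vector of the dual chain must have.\<close>
   obtain w where w: "linfun w" "!!p. p : idx r n ==> w (case p of (j, i) => bv j i) = (if p = (l, 2) then 1 else 0)"
    using linfun_extend[OF finite_idx basis_onD(3)[OF basis_U], of "%p. if p = (l, 2) then 1 else 0"] by metis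
   have wz: "w z = 0" if zA: "z : rad D A" for z
   proof -
    obtain a where "z = (SUM j=1..r. a j *s bv j 1)" using basis_onD(4)[OF rad_A_basis zA] by blast
    moreover have "w (bv j 1) = 0" if "j : {1..r}" for j using w(2)[of "(j, 1)"] n_pos[OF that] that by auto
    ultimately show ?thesis by (simp add: linfun_sum[OF w(1)])
   qed
   obtain x where x: "x : D" "!!y. y : D ==> w y = A x y" using fredholm[OF fin_D bil_A w(1) wz] by blast
   show ?thesis
   proof (intro bexI conjI ballI allI)
    fix j i assume j: "j : {1..r}"
    have "A (bv j i) (- x) = w (bv j i)" using x(2)[OF beta_D[OF j]] A_swap[of "bv j i"] by (simp add: A_simps)
    also have "... = (if j = l & i = Suc (Suc K) then 1 else 0)"
    proof (cases "i : {1..n j}")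
     case i: True
     thus ?thesis using w(2)[of "(j, i)"] j True by auto
    next
     case False
     hence "bv j i = 0" using beta_0[OF j] beta_gt[OF j] by (cases "i = 0") auto
     thus ?thesis using False Suc.prems True linfun_zero[OF w(1)] by auto
    qed
    finally show "A (bv j i) (- x) = (if j = l & i = Suc (Suc K) then 1 else 0)" .
   qed (use True x(1) subspace_neg[OF sub_D] in auto)
  next
   case False
   hence K: "K : {1..K}" by auto
   let ?w = "%y. - A y (av K)"
   have w: "linfun ?w" by (simp add: linfun_def A_simps)
   \<comment> \<open>The last vector \<open>bv j (n j)\<close> pairs with \<open>av K\<close> only
     if j = l and n l = K + 1; the bound Suc K < n l excludes this. So the dual chain stops exactly
     at n l - 1.\<close>
   have wz: "?w z = 0" if zB: "z : rad D B" for z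
   proof -
    obtain a where "z = (SUM j=1..r. a j *s bv j (n j))" using basis_onD(4)[OF rad_B_basis zB] by blast
    moreover have "A (bv j (n j)) (av K) = 0" if "j : {1..r}" for j using av(2)[OF K that] Suc.prems by auto
    ultimately show ?thesis by (simp add: A_simps)
   qed
   obtain x where x: "x : D" "!!y. y : D ==> - A y (av K) = B x y" using fredholm[OF fin_D bil_B w wz] by blast
   have Bx: "B y (- x) = - A y (av K)" if "y : D" for y using x(2)[OF that] B_swap[of y] by (simp add: B_simps)
   have xD: "- x : D" using x(1) subspace_neg[OF sub_D] by blast
   show ?thesis
   proof (intro bexI conjI ballI allI impI)
    fix j i assume j: "j : {1..r}"
    show "A (bv j i) (- x) = (if j = l & i = Suc (Suc K) then 1 else 0)"
    proof (cases i)
     case 0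
     thus ?thesis using beta_0[OF j] by (simp add: A_simps)
    next
     case (Suc i')
     hence "A (bv j i) (- x) = A (bv j i') (av K)" using beta_A[OF j xD] Bx[OF beta_D[OF j]] by simp
     thus ?thesis using av(2)[OF K j] Suc by simp
    qed
   qed (use Bx xD in auto)
  qed
  then obtain x where x: "x : D" "!!j i. j : {1..r} ==> A (bv j i) x = (if j = l & i = Suc (Suc K) then 1 else 0)"
   "!!y. 1 <= K ==> y : D ==> B y x = - A y (av K)" by blast
  show ?case
  proof (intro exI ballI conjI allI impI)
   fix k assume k: "k : {1..Suc K}"
   show "(av(Suc K := x)) k : D" using av(1)[of k] x(1) k by (cases "k = Suc K") auto
   fix j i assume "j : {1..r}"
   thus "A (bv j i) ((av(Suc K := x)) k) = (if j = l & i = Suc k then 1 else 0)"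
    using av(2)[of k j i] x(2)[of j i] k by (cases "k = Suc K") auto
  next
   fix k y assume k: "k : {1..Suc K}" "Suc k <= Suc K" and y: "y : D"
   show "B y ((av(Suc K := x)) (Suc k)) = - A y ((av(Suc K := x)) k)"
    using av(3)[of k y] x(3)[OF _ y] k y by (cases "k = K") auto
  qed
 qed
 from this[of "n l - 1"] n_pos[OF l] show ?thesis
  by (simp add: atLeastLessThanSuc_atLeastAtMost[symmetric] Suc_le_eq less_diff_conv)
qed

end

locale kron_dual_chains = kron_family scale D A B r n bv
 for scale :: "'k::field_char_0 => 'b::ab_group_add => 'b" (infixr "*s" 75) and D A B r n bv +
 fixes av :: "nat => nat => 'b"
 assumes alpha_D: "l : {1..r} ==> k : {1..<n l} ==> av l k : D"
  and beta_alpha_A: "l : {1..r} ==> k : {1..<n l} ==> j : {1..r} ==>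
   A (bv j i) (av l k) = (if j = l & i = Suc k then 1 else 0)"
  and alpha_chain: "l : {1..r} ==> k : {1..<n l} ==> Suc k < n l ==> y : D ==>
   B y (av l (Suc k)) = - A y (av l k)"
begin

lemma beta_alpha_B:
 "l : {1..r} ==> k : {1..<n l} ==> j : {1..r} ==> B (bv j i) (av l k) = - (if j = l & i = k then 1 else 0)"
 using beta_B[of j "av l k" i] beta_alpha_A[of l k j "Suc i"] alpha_D[of l k] by simp

text \<open>Coefficients of a vector of \<open>U\<close> that cancels the pairings of y with all
  \<open>av l k\<close>, for \<open>A\<close> and \<open>B\<close> at once. \<open>A\<close>
  dictates the coefficients with i >= 2 and \<open>B\<close> the one with i = 1; the other
  \<open>B\<close>-pairings are then right because \<open>av l\<close> is a chain. The vector
  \<open>av j 1\<close> exists only for n j >= 2.\<close>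

definition xi :: "'b => nat => nat => 'k" where
 "xi y j i = (if i = 1 then (if 2 <= n j then B y (av j 1) else 0) else - A y (av j (i - 1)))"

definition corr :: "'b => 'b" where
 "corr y = (SUM j=1..r. SUM i=1..n j. xi y j i *s bv j i)"

lemma corr_U: "corr y : U"
 unfolding corr_def using U_I[of "xi y" "%i. i"] by simp

lemma corr_D: "corr y : D"
 using corr_U U_D by blast

lemma corr_A:
 assumes l: "l : {1..r}" and k: "k : {1..<n l}"
 shows "A (corr y) (av l k) = - A y (av l k)"
proof -
 have "A (corr y) (av l k) = (SUM j=1..r. SUM i=1..n j. xi y j i * (if j = l & i = Suc k then 1 else 0))"
  unfolding corr_def using beta_alpha_A[OF l k] by (simp add: A_simps)
 also have "... = xi y l (Suc k)" using l k by (intro sum_delta_pair) auto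
 also have "... = - A y (av l k)" using k by (simp add: xi_def)
 finally show ?thesis .
qed

lemma corr_B:
 assumes l: "l : {1..r}" and k: "k : {1..<n l}" and y: "y : D"
 shows "B (corr y) (av l k) = - B y (av l k)"
proof -
 have "B (corr y) (av l k) = - (SUM j=1..r. SUM i=1..n j. xi y j i * (if j = l & i = k then 1 else 0))"
  unfolding corr_def using beta_alpha_B[OF l k] by (simp add: B_simps sum_negf)
 also have "(SUM j=1..r. SUM i=1..n j. xi y j i * (if j = l & i = k then 1 else 0)) = xi y l k"
  using l k by (intro sum_delta_pair) auto
 also have "xi y l k = B y (av l k)"
 proof (cases "k = 1")
  case True
  thus ?thesis using k by (simp add: xi_def)
 next
  case False
  then obtain k' where k': "k = Suc k'" "k' : {1..<n l}" using k by (cases k) auto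
  thus ?thesis using alpha_chain[OF l k'(2) _ y] k by (simp add: xi_def)
 qed
 finally show ?thesis .
qed

text \<open>Half of the correction, because in a pairing of two such vectors both are corrected and
  each contributes half; \<open>U\<close> is isotropic, so the product of the two corrections
  vanishes and the pairings with \<open>U\<close> are kept.\<close>

definition av' :: "nat => nat => 'b" where
 "av' l k = av l k + (1/2) *s corr (av l k)"

lemma alpha'_D: "l : {1..r} ==> k : {1..<n l} ==> av' l k : D"
 unfolding av'_def using alpha_D corr_D by (intro subspace_add[OF sub_D] subspace_scale[OF sub_D]) auto

lemma U_alpha':
 assumes "u : U"
 shows "A u (av' l k) = A u (av l k)" "B u (av' l k) = B u (av l k)"
 unfolding av'_def using isotropic[OF assms corr_U] by (simp_all add: A_simps B_simps)

lemma alpha'_isotropic: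
 assumes l: "l : {1..r}" "k : {1..<n l}" and m: "m : {1..r}" "j : {1..<n m}"
 shows "A (av' l k) (av' m j) = 0" "B (av' l k) (av' m j) = 0"
proof -
 have "A (av' l k) (av' m j) = A (av l k) (av m j) + (1/2) * A (corr (av l k)) (av m j) - (1/2) * A (corr (av m j)) (av l k)"
  unfolding av'_def using isotropic(1)[OF corr_U corr_U] A_swap[of "av l k" "corr (av m j)"] by (simp add: A_simps)
 also have "... = A (av l k) (av m j) - (1/2) * A (av l k) (av m j) - (1/2) * A (av l k) (av m j)"
  using corr_A[OF m] corr_A[OF l] A_swap[of "av m j" "av l k"] by simp
 finally show "A (av' l k) (av' m j) = 0" by simp
 have "B (av' l k) (av' m j) = B (av l k) (av m j) + (1/2) * B (corr (av l k)) (av m j) - (1/2) * B (corr (av m j)) (av l k)"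
  unfolding av'_def using isotropic(2)[OF corr_U corr_U] B_swap[of "av l k" "corr (av m j)"] by (simp add: B_simps)
 also have "... = B (av l k) (av m j) - (1/2) * B (av l k) (av m j) - (1/2) * B (av l k) (av m j)"
  using corr_B[OF m alpha_D[OF l]] corr_B[OF l alpha_D[OF m]] B_swap[of "av m j" "av l k"] by simp
 finally show "B (av' l k) (av' m j) = 0" by simp
qed

text \<open>Stated with \<open>A\<close> only; since \<open>A\<close> and \<open>B\<close> have the
  same image on \<open>U\<close>, it is also the orthogonal of \<open>U\<close> for
  \<open>B\<close>.\<close>

definition Uperp :: "'b set" where "Uperp = {y : D. ALL u:U. A u y = 0}"

lemma Uperp_B: "y : Uperp ==> u : U ==> B u y = 0"
proof -
 assume y: "y : Uperp" and "u : U"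
 then obtain u' where "u' : U" "ALL d:D. B u d = A u' d" using image_BA by blast
 thus ?thesis using y by (auto simp: Uperp_def)
qed

lemma sub_Uperp: "subspace Uperp"
 by (rule subspaceI) (auto simp: Uperp_def A_simps subspace_0[OF sub_D] subspace_add[OF sub_D] subspace_scale[OF sub_D])

lemma Uperp_D: "Uperp <= D" by (auto simp: Uperp_def)

lemma U_Uperp: "U <= Uperp"
 using U_D isotropic by (auto simp: Uperp_def)

lemma Uperp_alpha':
 assumes "y : Uperp"
 shows "A y (av' l k) = A y (av l k)" "B y (av' l k) = B y (av l k)"
proof -
 have "A y (corr (av l k)) = 0"
  using assms corr_U alt_bilin_eq0[OF bil_A, of "corr (av l k)" y] by (auto simp: Uperp_def)
 thus "A y (av' l k) = A y (av l k)" by (simp add: av'_def A_simps)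
 have "B y (corr (av l k)) = 0"
  using Uperp_B[OF assms corr_U] alt_bilin_eq0[OF bil_B] by blast
 thus "B y (av' l k) = B y (av l k)" by (simp add: av'_def B_simps)
qed

text \<open>\<open>U\<close> is isotropic, hence lies in \<open>Uperp\<close>. A complement of
  \<open>U\<close> in \<open>Uperp\<close> gives the last block, and the \<open>av'\<close> give a
  complement of \<open>Uperp\<close> in \<open>D\<close>.\<close>

lemma kron_basis_exists': "EX m sg. kron_basis n bv av' m sg"
proof -
 let ?b = "%(j, i). bv j i"
 have fin_Uperp: "fin_sub Uperp" using fin_sub_subset[OF fin_D sub_Uperp Uperp_D] .
 obtain m and sg0 :: "nat => 'b" where s0: "basis_on Uperp (idx r n <+> {..<m}) (case_sum ?b sg0)"
 proof (rule basis_extend[OF fin_Uperp finite_idx basis_onD(3)[OF basis_U]])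
  show "!!p. p : idx r n ==> ?b p : Uperp" using basis_onD(2)[OF basis_U] U_Uperp by blast
 qed auto
 \<comment> \<open>The full correction this time: only one factor of the pairing with
   \<open>av'\<close> is moved.\<close>
 define sg where "sg q = sg0 q + corr (sg0 q)" for q
 have s0U: "sg0 q : Uperp" if "q < m" for q using basis_onD(2)[OF s0, of "Inr q"] that by auto
 have sU: "sg q : Uperp" if "q < m" for q
  unfolding sg_def using s0U[OF that] corr_U U_Uperp by (intro subspace_add[OF sub_Uperp]) auto
 have As: "A (av' l k) (sg q) = 0" and Bs: "B (av' l k) (sg q) = 0"
  if "q < m" "l : {1..r}" "k : {1..<n l}" for l k q
 proof -
  have "A (sg q) (av' l k) = A (sg0 q) (av l k) + A (corr (sg0 q)) (av l k)"
   unfolding Uperp_alpha'(1)[OF sU[OF that(1)]] by (simp add: sg_def A_simps)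
  thus "A (av' l k) (sg q) = 0" using corr_A[OF that(2,3)] alt_bilin_eq0[OF bil_A, of "sg q"] by simp
  have "B (sg q) (av' l k) = B (sg0 q) (av l k) + B (corr (sg0 q)) (av l k)"
   unfolding Uperp_alpha'(2)[OF sU[OF that(1)]] by (simp add: sg_def B_simps)
  moreover have "sg0 q : D" using s0U[OF that(1)] Uperp_D by blast
  ultimately show "B (av' l k) (sg q) = 0" using corr_B[OF that(2,3)] alt_bilin_eq0[OF bil_B, of "sg q"] by simp
 qed
 have Ab: "A (bv j i) (sg q) = 0" "B (bv j i) (sg q) = 0" if "q < m" "j : {1..r}" for j i q
  using sU[OF that(1)] beta_U[OF that(2)] Uperp_B[OF sU[OF that(1)]] by (auto simp: Uperp_def)
 have Aa: "A (bv j i) (av' l k) = (if j = l & i = Suc k then 1 else 0)"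
  "B (bv j i) (av' l k) = - (if j = l & i = k then 1 else 0)"
  if "j : {1..r}" "l : {1..r}" "k : {1..<n l}" for j i l k
  using U_alpha'[OF beta_U[OF that(1)]] beta_alpha_A[OF that(2,3,1)] beta_alpha_B[OF that(2,3,1)] by auto
 let ?I = "kidx r n m"
 let ?f = "case_sum ?b (case_sum (%(l, k). av' l k) sg)"
 have spl: "(SUM x:?I. c x *s ?f x) = (SUM p:idx r n. c (Inl p) *s ?b p) +
   ((SUM l=1..r. SUM k=1..<n l. c (Inr (Inl (l, k))) *s av' l k) + (SUM q<m. c (Inr (Inr q)) *s sg q))" for c
 proof -
  have "(SUM p:cidx r n. c (Inr (Inl p)) *s (case p of (l, k) => av' l k)) =
    (SUM l=1..r. SUM k=1..<n l. c (Inr (Inl (l, k))) *s av' l k)"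
   by (subst sum.Sigma) (auto intro!: sum.cong)
  thus ?thesis by (simp add: sum.Plus)
 qed
 have sig: "(SUM q<m. e q *s sg q) = (SUM q<m. e q *s sg0 q) + (SUM q<m. e q *s corr (sg0 q))" for e
  unfolding sg_def by (simp add: scale_right_distrib sum.distrib)
 have corrU: "(SUM q<m. e q *s corr (sg0 q)) : U" for e
  using corr_U by (auto intro!: subspace_sum[OF sub_U] subspace_scale[OF sub_U])
 have idxU: "(SUM p:idx r n. c p *s ?b p) : U" for c
  using basis_onD(2)[OF basis_U] by (intro subspace_sum[OF sub_U] subspace_scale[OF sub_U]) blast
 have ind: "indep_fam ?I ?f"
  unfolding indep_fam_def
 proof (intro allI impI)
  fix c assume "(SUM x:?I. c x *s ?f x) = 0"
  hence z: "(SUM p:idx r n. c (Inl p) *s ?b p) +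
   ((SUM l=1..r. SUM k=1..<n l. c (Inr (Inl (l, k))) *s av' l k) + (SUM q<m. c (Inr (Inr q)) *s sg q)) = 0"
   (is "?X + (?Y + ?Z) = 0") unfolding spl .
  have ca: "c (Inr (Inl (l, k))) = 0" if lk: "l : {1..r}" "k : {1..<n l}" for l k
  proof -
   have "A (bv l (Suc k)) (?X + (?Y + ?Z)) = 0" unfolding z by (simp add: A_simps)
   moreover have "A (bv l (Suc k)) ?X = 0" using isotropic(1)[OF beta_U[OF lk(1)] idxU] .
   moreover have "A (bv l (Suc k)) ?Z = 0" using Ab(1)[OF _ lk(1)] by (simp add: A_simps)
   moreover have "A (bv l (Suc k)) ?Y = (SUM l'=1..r. SUM k'=1..<n l'. c (Inr (Inl (l', k'))) * (if l' = l & k' = k then 1 else 0))"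
    unfolding A_simps using Aa(1)[OF lk(1)] by (intro sum.cong refl) auto
   moreover have "... = c (Inr (Inl (l, k)))" using lk by (intro sum_delta_pair) auto
   ultimately show ?thesis by (simp add: A_simps)
  qed
  hence "?Y = 0" by simp
  hence "?X + ?Z = 0" using z by simp
  hence xz: "(?X + (SUM q<m. c (Inr (Inr q)) *s corr (sg0 q))) + (SUM q<m. c (Inr (Inr q)) *s sg0 q) = 0"
   unfolding sig by (simp add: algebra_simps)
  have "?X + (SUM q<m. c (Inr (Inr q)) *s corr (sg0 q)) : U" using idxU corrU by (intro subspace_add[OF sub_U])
  then obtain d where d: "?X + (SUM q<m. c (Inr (Inr q)) *s corr (sg0 q)) = (SUM p:idx r n. d p *s ?b p)"
   using basis_onD(4)[OF basis_U] by blast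
  have "(SUM x:idx r n <+> {..<m}. case_sum d (%q. c (Inr (Inr q))) x *s case_sum ?b sg0 x) = 0"
   using xz unfolding d by (simp add: sum.Plus)
  note z' = indep_famD[OF basis_onD(3)[OF s0] this]
  have cs: "c (Inr (Inr q)) = 0" if "q < m" for q using z'[of "Inr q"] that by auto
  hence "?X = 0" using `?X + ?Z = 0` by simp
  hence "c (Inl p) = 0" if "p : idx r n" for p
   using indep_famD[OF basis_onD(3)[OF basis_U], of "%p. c (Inl p)" p] that by simp
  thus "ALL x:?I. c x = 0" using ca cs by auto
 qed
 have span: "EX c. y = (SUM x:?I. c x *s ?f x)" if y: "y : D" for y
 proof -
  \<comment> \<open>The component along the dual chains, read off from the pairings with
    \<open>bv l (Suc k)\<close>; what remains is orthogonal to \<open>U\<close>.\<close>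
  define Y where "Y = (SUM l=1..r. SUM k=1..<n l. A (bv l (Suc k)) y *s av' l k)"
  have YD: "Y : D" unfolding Y_def using alpha'_D by (intro subspace_sum[OF sub_D] subspace_scale[OF sub_D]) auto
  have Ay: "A (bv j i) (y - Y) = 0" if j: "j : {1..r}" for j i
  proof (cases "i : {2..n j}")
   case True
   then obtain k where k: "i = Suc k" "k : {1..<n j}" by (cases i) auto
   have "A (bv j i) Y = (SUM l=1..r. SUM k'=1..<n l. A (bv l (Suc k')) y * (if l = j & k' = k then 1 else 0))"
    unfolding Y_def A_simps using Aa(1)[OF j] k by (intro sum.cong refl) auto
   also have "... = A (bv j (Suc k)) y" using j k by (intro sum_delta_pair) auto
   finally show ?thesis using k by (simp add: A_simps)
  next
   case False
   have yYD: "y - Y : D" using y YD by (rule subspace_diff[OF sub_D])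
   \<comment> \<open>No dual vector is matched with these indices: \<open>bv j 1\<close> lies in the
     radical of \<open>A\<close>, the other vectors are zero.\<close>
   consider "i = 0" | "i = 1" | "n j < i" using False by force
   thus ?thesis
    by cases (use beta_0[OF j] beta_gt[OF j] beta_A[OF j yYD, of 0] in \<open>simp_all add: A_simps B_simps\<close>)
  qed
  have "A u (y - Y) = 0" if "u : U" for u
   using U_repr[OF that] Ay by (auto simp: A_simps(12,13,14))
  hence "y - Y : Uperp" using y YD subspace_diff[OF sub_D] by (auto simp: Uperp_def)
  then obtain c where "y - Y = (SUM x:idx r n <+> {..<m}. c x *s case_sum ?b sg0 x)"
   using basis_onD(4)[OF s0] by blast
  hence c: "y - Y = (SUM p:idx r n. c (Inl p) *s ?b p) + (SUM q<m. c (Inr q) *s sg0 q)"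
   by (simp add: sum.Plus)
  have "(SUM p:idx r n. c (Inl p) *s ?b p) - (SUM q<m. c (Inr q) *s corr (sg0 q)) : U"
   using idxU corrU by (intro subspace_diff[OF sub_U])
  then obtain d where d: "(SUM p:idx r n. c (Inl p) *s ?b p) - (SUM q<m. c (Inr q) *s corr (sg0 q)) = (SUM p:idx r n. d p *s ?b p)"
   using basis_onD(4)[OF basis_U] by blast
  have "y = (SUM p:idx r n. d p *s ?b p) + (Y + (SUM q<m. c (Inr q) *s sg q))"
   unfolding sig d[symmetric] using c by (simp add: algebra_simps)
  hence "y = (SUM x:?I. (case x of Inl p => d p | Inr (Inl (l, k)) => A (bv l (Suc k)) y | Inr (Inr q) => c (Inr q)) *s ?f x)"
   unfolding spl by (simp add: Y_def)
  thus ?thesis by (intro exI)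
 qed
 have mem: "?f x : D" if x: "x : ?I" for x
 proof -
  consider j i where "x = Inl (j, i)" "(j, i) : idx r n" | l k where "x = Inr (Inl (l, k))" "(l, k) : cidx r n"
   | q where "x = Inr (Inr q)" "q < m" using x by auto
  thus ?thesis
  proof cases
   case 1
   thus ?thesis using beta_D by simp
  next
   case 2
   thus ?thesis using alpha'_D by simp
  next
   case 3
   thus ?thesis using sU Uperp_D by auto
  qed
 qed
 have "basis_on D ?I ?f" unfolding basis_on_def
  by (intro conjI ballI mem ind span) auto
 moreover have "ALL (j, i):idx r n. ALL (l, k):idx r n. A (bv j i) (bv l k) = 0 & B (bv j i) (bv l k) = 0"
  using isotropic[OF beta_U beta_U] by auto
 moreover have "ALL (j, i):idx r n. ALL (l, k):cidx r n. A (bv j i) (av' l k) = (if j = l & i = Suc k then 1 else 0) &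
   B (bv j i) (av' l k) = - (if j = l & i = k then 1 else 0)"
  by (intro ballI, clarify) (intro conjI Aa; simp)
 moreover have "ALL (j, i):cidx r n. ALL (l, k):cidx r n. A (av' j i) (av' l k) = 0 & B (av' j i) (av' l k) = 0"
  by (intro ballI, clarify) (intro conjI alpha'_isotropic; simp)
 moreover have "ALL (j, i):idx r n. ALL q<m. A (bv j i) (sg q) = 0 & B (bv j i) (sg q) = 0"
  using Ab by auto
 moreover have "ALL (j, i):cidx r n. ALL q<m. A (av' j i) (sg q) = 0 & B (av' j i) (sg q) = 0"
  by (intro ballI, clarify) (intro conjI As Bs; simp)
 ultimately have "kron_basis n bv av' m sg"
  unfolding kron_basis_def by blast
 thus ?thesis by blast
qed

end

context kron_family
begin

theorem kron_basis_exists: "EX av m sg. kron_basis n bv av m sg"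
proof -
 have "ALL l. EX av. l : {1..r} --> (ALL k:{1..<n l}. av k : D &
   (ALL j:{1..r}. ALL i. A (bv j i) (av k) = (if j = l & i = Suc k then 1 else 0)) &
   (Suc k < n l --> (ALL y:D. B y (av (Suc k)) = - A y (av k))))"
  using alpha_exists by blast
 hence "EX av. ALL l. l : {1..r} --> (ALL k:{1..<n l}. av l k : D &
   (ALL j:{1..r}. ALL i. A (bv j i) (av l k) = (if j = l & i = Suc k then 1 else 0)) &
   (Suc k < n l --> (ALL y:D. B y (av l (Suc k)) = - A y (av l k))))"
  by (rule choice)
 then obtain av where av: "!!l k. l : {1..r} ==> k : {1..<n l} ==> av l k : D &
   (ALL j:{1..r}. ALL i. A (bv j i) (av l k) = (if j = l & i = Suc k then 1 else 0)) &
   (Suc k < n l --> (ALL y:D. B y (av l (Suc k)) = - A y (av l k)))" by blast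
 interpret kron_dual_chains scale D A B r n bv av
  by unfold_locales (use av in blast)+
 show ?thesis using kron_basis_exists' by blast
qed

end

context alt_pencil
begin

text \<open>A combination of the \<open>sg\<close> orthogonal to all \<open>sg\<close> is orthogonal
  to the whole basis, so it lies in the radical of \<open>C\<close> and thus in \<open>U\<close>; by
  independence of the basis it is zero.\<close>

lemma kron_basis_nondegenerate:
 assumes kf: "kfam n bv" and kb: "kron_basis n bv av m sg"
  and C: "C = A \<or> C = B" and c: "!!q. q < m ==> (SUM p<m. c p * C (sg p) (sg q)) = 0" and "p < m"
 shows "c p = 0"
proof -
 interpret kron_family scale D A B r n bv by unfold_locales (rule kf)
 let ?I = "kidx r n m"
 let ?f = "kron_fam bv av sg"
 have b: "basis_on D ?I ?f" using kb by (simp add: kron_basis_def)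
 have bC: "alt_bilin C" using C bil_A bil_B by blast
 define z where "z = (SUM p<m. c p *s sg p)"
 have sD: "sg q : D" if "q < m" for q using basis_onD(2)[OF b, of "Inr (Inr q)"] that by auto
 have zD: "z : D" unfolding z_def using sD by (auto intro!: subspace_sum[OF sub_D] subspace_scale[OF sub_D])
 have bs: "C (bv j i) (sg q) = 0" if "(j, i) : idx r n" "q < m" for j i q
  using kb C that unfolding kron_basis_def by blast
 have as: "C (av j i) (sg q) = 0" if "(j, i) : cidx r n" "q < m" for j i q
  using kb C that unfolding kron_basis_def by blast
 have zf: "C z (?f x) = 0" if x: "x : ?I" for x
 proof -
  have "C (?f x) z = 0 \<or> (EX q<m. x = Inr (Inr q))"
  proof -
   consider j i where "x = Inl (j, i)" "(j, i) : idx r n" | l k where "x = Inr (Inl (l, k))" "(l, k) : cidx r n"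
    | q where "x = Inr (Inr q)" "q < m" using x by auto
   thus ?thesis
   proof cases
    case 1
    thus ?thesis using bs[OF 1(2)] by (simp add: z_def alt_bilin_sum[OF bC])
   next
    case 2
    thus ?thesis using as[OF 2(2)] by (simp add: z_def alt_bilin_sum[OF bC])
   qed blast
  qed
  thus ?thesis
  proof
   assume "C (?f x) z = 0"
   thus ?thesis by (rule alt_bilin_eq0[OF bC])
  next
   assume "EX q<m. x = Inr (Inr q)"
   thus ?thesis using c by (auto simp: z_def alt_bilin_sum[OF bC])
  qed
 qed
 have "C z y = 0" if yD: "y : D" for y
 proof -
  obtain d where "y = (SUM x:?I. d x *s ?f x)" using basis_onD(4)[OF b yD] by blast
  thus ?thesis using zf by (simp add: alt_bilin_sum[OF bC])
 qed
 hence "z : rad D C" using zD by (simp add: rad_def)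
 hence "z : U" using C rad_A_U rad_B_U by blast
 then obtain d where d: "z = (SUM p:idx r n. d p *s (case p of (j, i) => bv j i))"
  using basis_onD(4)[OF basis_U] by blast
 have spl: "(SUM x:?I. e x *s ?f x) = (SUM p:idx r n. e (Inl p) *s (case p of (j, i) => bv j i)) +
   ((SUM p:cidx r n. e (Inr (Inl p)) *s (case p of (j, i) => av j i)) + (SUM q<m. e (Inr (Inr q)) *s sg q))" for e
  by (simp add: sum.Plus)
 have e1: "(SUM p:idx r n. (- d p) *s (case p of (j, i) => bv j i)) = - z"
  unfolding d by (simp add: sum_negf)
 have "(SUM x:?I. case_sum (%p. - d p) (case_sum (%_. 0) c) x *s ?f x) = 0"
  unfolding spl using e1 by (simp add: z_def)
 from indep_famD[OF basis_onD(3)[OF b] this, of "Inr (Inr p)"] show ?thesis using `p < m` by auto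
qed

end

section \<open>Orthogonal splitting and symplectic bases\<close>

context fam_space
begin

definition nondeg_on :: "'b set => ('b => 'b => 'a) => bool" where
 "nondeg_on S om \<longleftrightarrow> (ALL x:S. (ALL y:S. om x y = 0) --> x = 0)"

definition orth :: "'b set => ('b => 'b => 'a) => 'i set => ('i => 'b) => 'b set" where
 "orth S om I e = {x : S. ALL j:I. om x (e j) = 0}"

context
 fixes S :: "'b set" and om :: "'b => 'b => 'a" and I :: "'i set" and e :: "'i => 'b"
 assumes S: "fin_sub S" and w: "alt_bilin om" and I: "finite I" and e: "!!i. i : I ==> e i : S"
  and nd: "!!c. (!!j. j : I ==> (SUM i:I. c i * om (e i) (e j)) = 0) ==> ALL i:I. c i = 0"
begin

lemma orth_subspace: "subspace (orth S om I e)"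
 using S by (intro subspaceI) (auto simp: orth_def fin_sub_def alt_bilinD(1,3,7)[OF w] subspace_0 subspace_add subspace_scale)

lemma orth_fin_sub: "fin_sub (orth S om I e)"
 by (rule fin_sub_subset[OF S orth_subspace]) (auto simp: orth_def)

text \<open>On the span of \<open>e\<close> the form has zero radical by \<open>nd\<close>, so the
  functional \<open>om x\<close> is represented there by a vector of the span; subtracting it leaves
  the orthogonal part.\<close>

lemma orth_decomp:
 assumes x: "x : S"
 shows "EX c. x - (SUM i:I. c i *s e i) : orth S om I e"
proof -
 have fM: "fin_sub (span (e ` I))" using I by (auto simp: fin_sub_def)
 have wz: "om x z = 0" if z: "z : rad (span (e ` I)) om" for z
 proof -
  obtain c where c: "z = (SUM i:I. c i *s e i)" using z span_fam[OF I, of e] by (auto simp: rad_def)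
  have "(SUM i:I. c i * om (e i) (e j)) = 0" if "j : I" for j
  proof -
   have "om z (e j) = 0" using z that by (auto simp: rad_def intro: span_base)
   thus ?thesis by (simp add: c alt_bilin_sum[OF w])
  qed
  hence "ALL i:I. c i = 0" by (rule nd)
  hence "z = 0" unfolding c by simp
  thus ?thesis by (simp add: alt_bilinD(8)[OF w])
 qed
 have lw: "linfun (om x)" using alt_bilinD(13)[OF w] .
 obtain y where y: "y : span (e ` I)" "!!m. m : span (e ` I) ==> om x m = om y m"
  using fredholm[OF fM w lw wz] by blast
 obtain c where c: "y = (SUM i:I. c i *s e i)" using y(1) span_fam[OF I, of e] by auto
 have "y : S" unfolding c using e S by (auto simp: fin_sub_def intro!: subspace_sum subspace_scale)
 hence "x - y : S" using x S by (auto simp: fin_sub_def intro: subspace_diff)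
 hence "x - y : orth S om I e" using y(2) by (auto simp: orth_def alt_bilinD(11)[OF w] span_base)
 thus ?thesis unfolding c by blast
qed

lemma orth_nondeg:
 assumes "nondeg_on S om" shows "nondeg_on (orth S om I e) om"
 unfolding nondeg_on_def
proof (intro ballI impI)
 fix x assume x: "x : orth S om I e" and z: "ALL y:orth S om I e. om x y = 0"
 have "om x s = 0" if s: "s : S" for s
 proof -
  obtain c where c: "s - (SUM i:I. c i *s e i) : orth S om I e" using orth_decomp[OF s] by blast
  have "om x (SUM i:I. c i *s e i) = 0" using x by (simp add: orth_def alt_bilin_sum[OF w])
  moreover have "om x (s - (SUM i:I. c i *s e i)) = 0" using z c by blast
  ultimately show ?thesis by (simp add: alt_bilinD(12)[OF w])
 qed
 thus "x = 0" using assms x by (auto simp: nondeg_on_def orth_def)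
qed

lemma orth_indep: "indep_fam I e"
 unfolding indep_fam_def
proof (intro allI impI)
 fix c assume z: "(SUM i:I. c i *s e i) = 0"
 show "ALL i:I. c i = 0"
 proof (rule nd)
  fix j
  have "om (SUM i:I. c i *s e i) (e j) = 0" unfolding z by (rule alt_bilinD(7)[OF w])
  thus "(SUM i:I. c i * om (e i) (e j)) = 0" by (simp add: alt_bilin_sum[OF w])
 qed
qed

lemma orth_sum_eq0:
 assumes "s : orth S om I e" "(SUM i:I. c i *s e i) + s = 0"
 shows "ALL i:I. c i = 0"
proof (rule nd)
 fix j assume j: "j : I"
 have "om ((SUM i:I. c i *s e i) + s) (e j) = 0" unfolding assms(2) by (rule alt_bilinD(7)[OF w])
 thus "(SUM i:I. c i * om (e i) (e j)) = 0" using assms(1) j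
  by (simp add: orth_def alt_bilinD(1)[OF w] alt_bilin_sum[OF w])
qed

lemma orth_basis:
 assumes f: "basis_on (orth S om I e) J f"
 shows "basis_on S (I <+> J) (case_sum e f)"
proof -
 have fJ: "finite J" using basis_onD(1)[OF f] .
 have spl: "(SUM x:I <+> J. c x *s case_sum e f x) = (SUM i:I. c (Inl i) *s e i) + (SUM j:J. c (Inr j) *s f j)" for c
  using I fJ by (simp add: sum.Plus)
 show ?thesis unfolding basis_on_def indep_fam_def
 proof (intro conjI ballI allI impI)
  show "finite (I <+> J)" using I fJ by simp
 next
  fix x assume "x : I <+> J"
  thus "case_sum e f x : S" using e basis_onD(2)[OF f] by (auto simp: orth_def)
 next
  fix c x assume z: "(SUM x:I <+> J. c x *s case_sum e f x) = 0" and x: "x : I <+> J"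
  have "(SUM j:J. c (Inr j) *s f j) : orth S om I e"
   using basis_onD(2)[OF f] by (auto intro!: subspace_sum[OF orth_subspace] subspace_scale[OF orth_subspace])
  hence c: "ALL i:I. c (Inl i) = 0" using orth_sum_eq0[of _ "%i. c (Inl i)"] z unfolding spl by blast
  hence "(SUM j:J. c (Inr j) *s f j) = 0" using z unfolding spl by simp
  hence "c (Inr j) = 0" if "j : J" for j
   using indep_famD[OF basis_onD(3)[OF f], of "%j. c (Inr j)"] that by blast
  thus "c x = 0" using c x by auto
 next
  fix x assume "x : S"
  then obtain c where "x - (SUM i:I. c i *s e i) : orth S om I e" using orth_decomp by blast
  then obtain d where "x - (SUM i:I. c i *s e i) = (SUM j:J. d j *s f j)" using basis_onD(4)[OF f] by blast
  hence "x = (SUM i:I. c i *s e i) + (SUM j:J. d j *s f j)" by (simp add: algebra_simps)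
  thus "EX c. x = (SUM x:I <+> J. c x *s case_sum e f x)"
   unfolding spl by (intro exI[of _ "case_sum c d"]) simp
 qed
qed

end

text \<open>Induction on the dimension: a vector x and a y with \<open>om x y = 1\<close> span a
  hyperbolic plane, which is split off.\<close>

lemma symplectic_basis_exists:
 assumes w: "alt_bilin om"
 shows "fin_sub S ==> nondeg_on S om ==> EX (n::nat) e. basis_on S {1..2*n} e &
  (ALL j:{1..n}. ALL k:{1..n}. om (e (2*j-1)) (e (2*k)) = (if j = k then 1 else 0) &
    om (e (2*j-1)) (e (2*k-1)) = 0 & om (e (2*j)) (e (2*k)) = 0)"
proof (induction "dim S" arbitrary: S rule: less_induct)
 case less
 have sS: "subspace S" using less.prems by (simp add: fin_sub_def)
 show ?case
 proof (cases "S = {0}")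
  case True
  have "basis_on S {1..2*0::nat} (%_. 0)" unfolding basis_on_def indep_fam_def True by simp
  thus ?thesis by (intro exI[of _ 0] exI[of _ "%_. 0"]) simp
 next
  case False
  then obtain x where x: "x : S" "x ~= 0" using subspace_0[OF sS] by blast
  then obtain y' where y': "y' : S" "om x y' ~= 0" using less.prems(2) by (auto simp: nondeg_on_def)
  define y where "y = (1 / om x y') *s y'"
  have y: "y : S" "om x y = 1" using y' sS by (auto simp: y_def alt_bilinD(4)[OF w] subspace_scale)
  have yx: "om y x = -1" using y(2) alt_bilinD(6)[OF w, of y x] by simp
  let ?I = "{1, 2 :: nat}"
  define f where "f = (%i::nat. if i = 1 then x else y)"
  have fS: "f i : S" if "i : ?I" for i using x y by (simp add: f_def)
  have nd: "ALL i:?I. c i = 0" if "!!j. j : ?I ==> (SUM i:?I. c i * om (f i) (f j)) = 0" for c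
   using that[of 1] that[of 2] y yx by (simp add: f_def alt_bilinD(5)[OF w])
  have fI: "finite ?I" by simp
  note facts = less.prems(1) w fI fS nd
  let ?S1 = "orth S om ?I f"
  have fin1: "fin_sub ?S1" by (rule orth_fin_sub[OF facts])
  have "x \<notin> ?S1" using y by (auto simp: orth_def f_def)
  hence "?S1 ~= S" using x by blast
  moreover have sub1: "?S1 <= S" by (auto simp: orth_def)
  moreover have "subspace ?S1" using fin1 by (simp add: fin_sub_def)
  ultimately have "dim ?S1 < dim S" using dim_le_subset[OF less.prems(1)] le_neq_implies_less by blast
  from less.hyps[OF this fin1 orth_nondeg[OF facts less.prems(2)]]
  obtain n :: nat and e where e: "basis_on ?S1 {1..2*n} e"
   and g: "!!j k. j : {1..n} ==> k : {1..n} ==> om (e (2*j-1)) (e (2*k)) = (if j = k then 1 else 0) &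
    om (e (2*j-1)) (e (2*k-1)) = 0 & om (e (2*j)) (e (2*k)) = 0" by blast
  have b: "basis_on S (?I <+> {1..2*n}) (case_sum f e)" by (rule orth_basis[OF facts e])
  \<comment> \<open>The new pair takes the last two places, 2n + 1 and 2n + 2.\<close>
  define h where "h = (%i. if i <= 2*n then Inr i else Inl (i - 2*n) :: nat + nat)"
  have "bij_betw h {1..2*Suc n} (?I <+> {1..2*n})"
   by (rule bij_betw_byWitness[where f' = "case_sum (%i. i + 2*n) (%i. i)"]) (auto simp: h_def)
  from basis_on_reindex[OF b this] have b': "basis_on S {1..2*Suc n} (case_sum f e \<circ> h)" .
  define E where "E = case_sum f e \<circ> h"
  have e1: "E i = e i" if "i <= 2*n" for i using that by (simp add: E_def h_def)
  have e2: "E (2*Suc n - 1) = x" "E (2*Suc n) = y" by (simp_all add: E_def h_def f_def)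
  have eS: "e i : ?S1" if "i : {1..2*n}" for i using basis_onD(2)[OF e that] .
  have xe: "om (e i) x = 0" "om x (e i) = 0" "om (e i) y = 0" "om y (e i) = 0" if "i : {1..2*n}" for i
  proof -
   show "om (e i) x = 0" "om (e i) y = 0" using eS[OF that] by (auto simp: orth_def f_def)
   thus "om x (e i) = 0" "om y (e i) = 0" by (auto intro: alt_bilin_eq0[OF w])
  qed
  have "om (E (2*j-1)) (E (2*k)) = (if j = k then 1 else 0) &
    om (E (2*j-1)) (E (2*k-1)) = 0 & om (E (2*j)) (E (2*k)) = 0"
   if jk: "j : {1..Suc n}" "k : {1..Suc n}" for j k
  proof (cases "j = Suc n"; cases "k = Suc n")
   assume "j ~= Suc n" "k ~= Suc n"
   hence jk': "j : {1..n}" "k : {1..n}" using jk by auto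
   hence "E (2*j-1) = e (2*j-1)" "E (2*j) = e (2*j)" "E (2*k-1) = e (2*k-1)" "E (2*k) = e (2*k)"
    by (auto intro!: e1)
   thus ?thesis using g[OF jk'] by simp
  next
   assume a: "j ~= Suc n" "k = Suc n"
   hence "2*j-1 : {1..2*n}" "2*j : {1..2*n}" using jk by auto
   moreover have "E (2*j-1) = e (2*j-1)" "E (2*j) = e (2*j)" using calculation by (auto intro!: e1)
   ultimately show ?thesis using e2 xe a by (simp only: if_False)
  next
   assume a: "j = Suc n" "k ~= Suc n"
   hence "2*k-1 : {1..2*n}" "2*k : {1..2*n}" using jk by auto
   moreover have "E (2*k-1) = e (2*k-1)" "E (2*k) = e (2*k)" using calculation by (auto intro!: e1)
   ultimately show ?thesis using e2 xe a by (simp only: if_False) simp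
  next
   assume "j = Suc n" "k = Suc n"
   thus ?thesis using e2 y by (simp only: alt_bilinD(5)[OF w]) simp
  qed
  thus ?thesis using b' unfolding E_def[symmetric] by blast
 qed
qed

section \<open>Polynomials in an operator and their kernels\<close>

definition linop :: "('b => 'b) => bool" where
 "linop T \<longleftrightarrow> (ALL x y. T (x + y) = T x + T y) & (ALL c x. T (c *s x) = c *s T x)"

lemma linopD: "linop T ==> T (x + y) = T x + T y" "linop T ==> T (c *s x) = c *s T x"
 by (auto simp: linop_def)

lemma linop_0: "linop T ==> T 0 = 0"
 using linopD(2)[of T 0 0] by simp

lemma linop_sum: "linop T ==> T (SUM i:I. c i *s e i) = (SUM i:I. c i *s T (e i))"
 by (induction I rule: infinite_finite_induct) (auto simp: linop_0 linopD)

lemma linop_minus: "linop T ==> T (- x) = - T x"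
 using linopD(2)[of T "-1" x] by simp

lemma linop_diff: "linop T ==> T (x - y) = T x - T y"
 using linopD(1)[of T x "- y"] linop_minus[of T y] by simp

definition pact :: "('b => 'b) => 'a poly => 'b => 'b" where
 "pact T p x = (SUM i<=degree p. coeff p i *s (T ^^ i) x)"

lemma pact_bound: "degree p <= m ==> pact T p x = (SUM i<=m. coeff p i *s (T ^^ i) x)"
 unfolding pact_def by (rule sum.mono_neutral_left) (auto simp: coeff_eq_0)

lemma pact_0: "pact T 0 x = 0"
 by (simp add: pact_def)

lemma pact_pCons: "linop T ==> pact T (pCons a p) x = a *s x + T (pact T p x)"
proof -
 assume T: "linop T"
 have "pact T (pCons a p) x = (SUM i<=Suc (degree p). coeff (pCons a p) i *s (T ^^ i) x)"
  by (rule pact_bound) (rule degree_pCons_le)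
 also have "... = a *s x + (SUM i<=degree p. coeff p i *s (T ^^ Suc i) x)"
  by (subst sum.atMost_Suc_shift) simp
 also have "(SUM i<=degree p. coeff p i *s (T ^^ Suc i) x) = T (pact T p x)"
  by (simp add: pact_def linop_sum[OF T])
 finally show ?thesis .
qed

lemma pact_linop: "linop T ==> linop (pact T p)"
proof (induction p)
 case 0
 thus ?case by (simp add: linop_def pact_0)
next
 case (pCons a p)
 thus ?case by (simp add: linop_def pact_pCons scale_right_distrib algebra_simps scale_left_commute)
qed

lemma pact_add: "linop T ==> pact T (p + q) x = pact T p x + pact T q x"
proof (induction p q rule: poly_induct2)
 case (pCons a p b q)
 thus ?case by (simp add: pact_pCons linopD scale_left_distrib)
qed (simp add: pact_0)

lemma pact_smult: "linop T ==> pact T (Polynomial.smult c p) x = c *s pact T p x"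
 by (induction p) (simp_all add: pact_0 pact_pCons linopD scale_right_distrib)

lemma pact_mult: "linop T ==> pact T (p * q) x = pact T p (pact T q x)"
 by (induction p) (simp_all add: pact_0 pact_pCons pact_add pact_smult)

lemma pact_1: "pact T 1 x = x"
 by (simp add: pact_def)

lemma pact_T: "linop T ==> pact T p (T x) = T (pact T p x)"
 by (induction p) (simp_all add: pact_0 pact_pCons linopD linop_0)

lemma pact_funpow: "linop T ==> pact T p ((T ^^ i) x) = (T ^^ i) (pact T p x)"
 by (induction i) (simp_all add: pact_T)

lemma funpow_in: "(!!x. x : S ==> T x : S) ==> x : S ==> (T ^^ i) x : S"
 by (induction i) auto

lemma pact_in: "subspace S ==> (!!x. x : S ==> T x : S) ==> x : S ==> pact T p x : S"
 unfolding pact_def by (intro subspace_sum subspace_scale funpow_in) auto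

definition pker :: "'b set => ('b => 'b) => 'a poly => 'b set" where
 "pker S T p = {x : S. pact T p x = 0}"

lemma pker_subspace: "subspace S ==> linop T ==> subspace (pker S T p)"
 using pact_linop[of T p] by (intro subspaceI)
  (auto simp: pker_def linopD linop_0 subspace_0 subspace_add subspace_scale)

lemma pker_fin_sub: "fin_sub S ==> linop T ==> fin_sub (pker S T p)"
 by (rule fin_sub_subset[of S]) (auto simp: fin_sub_def pker_subspace, auto simp: pker_def)

end

context fam_space
begin

text \<open>Powers of a matrix over an arbitrary index set, rows holding the images of basis
  vectors. They show that p(T) depends, in coordinates, only on the matrix of T.\<close>

primrec mat_pow :: "'i set => ('i => 'i => 'a) => nat => 'i => 'i => 'a" where
 "mat_pow I t 0 = (%i j. if i = j then 1 else 0)"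
| "mat_pow I t (Suc m) = (%i j. SUM k:I. mat_pow I t m i k * t k j)"

lemma funpow_basis:
 assumes T: "linop T" and I: "finite I" and t: "!!i. i : I ==> T (e i) = (SUM j:I. t i j *s e j)" and i: "i : I"
 shows "(T ^^ m) (e i) = (SUM j:I. mat_pow I t m i j *s e j)"
proof (induction m)
 case 0
 have "(SUM j:I. mat_pow I t 0 i j *s e j) = (SUM j:I. if i = j then e j else 0)" by (rule sum.cong) auto
 thus ?case using I i by simp
next
 case (Suc m)
 have "(T ^^ Suc m) (e i) = (SUM k:I. mat_pow I t m i k *s (SUM j:I. t k j *s e j))"
  using Suc t by (simp add: linop_sum[OF T])
 also have "... = (SUM k:I. SUM j:I. (mat_pow I t m i k * t k j) *s e j)" by (simp add: scale_sum_right)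
 also have "... = (SUM j:I. SUM k:I. (mat_pow I t m i k * t k j) *s e j)" by (rule sum.swap)
 also have "... = (SUM j:I. mat_pow I t (Suc m) i j *s e j)" by (simp add: scale_sum_left)
 finally show ?case .
qed

lemma pact_basis:
 assumes T: "linop T" and I: "finite I" and t: "!!i. i : I ==> T (e i) = (SUM j:I. t i j *s e j)"
 shows "pact T p (SUM i:I. c i *s e i) =
  (SUM j:I. (SUM i:I. SUM m<=degree p. c i * coeff p m * mat_pow I t m i j) *s e j)"
proof -
 have "pact T p (SUM i:I. c i *s e i) = (SUM i:I. c i *s pact T p (e i))"
  by (rule linop_sum[OF pact_linop[OF T]])
 also have "... = (SUM i:I. SUM m<=degree p. SUM j:I. (c i * coeff p m * mat_pow I t m i j) *s e j)"
  unfolding pact_def using funpow_basis[OF T I t] by (intro sum.cong refl) (simp add: scale_sum_right mult.assoc)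
 also have "... = (SUM i:I. SUM j:I. SUM m<=degree p. (c i * coeff p m * mat_pow I t m i j) *s e j)"
  by (intro sum.cong refl sum.swap)
 also have "... = (SUM j:I. SUM i:I. SUM m<=degree p. (c i * coeff p m * mat_pow I t m i j) *s e j)"
  by (rule sum.swap)
 finally show ?thesis by (simp add: scale_sum_left)
qed

lemma basis_coords_eq:
 assumes "basis_on S I e" "(SUM i:I. c i *s e i) = (SUM i:I. d i *s e i)" "i : I"
 shows "c i = d i"
proof -
 have "(SUM i:I. (c i - d i) *s e i) = 0" using assms(2) by (simp add: scale_left_diff_distrib sum_subtractf)
 from indep_famD[OF basis_onD(3)[OF assms(1)] this assms(3)] show ?thesis by simp
qed

end

context fam_space_pair
begin

text \<open>A basis of \<open>X\<close> is carried over by its coordinates; the images remain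
  independent because a relation among them is a relation among coordinate vectors.\<close>

lemma dim_transfer:
 assumes b: "vs1.basis_on S I e" and b': "vs2.basis_on S' I e'"
  and P: "vs1.fin_sub X" "X <= S" "vs2.fin_sub X'" "X' <= S'"
  and XX: "!!c. (SUM i:I. s1 (c i) (e i)) : X ==> (SUM i:I. s2 (c i) (e' i)) : X'"
 shows "vs1.dim X <= vs2.dim X'"
proof -
 obtain k and x :: "nat => 'b" where x: "vs1.basis_on X {..<k} x" using vs1.basis_on_exists[OF P(1)] .
 have "ALL a. EX c. a < k --> x a = (SUM i:I. s1 (c i) (e i))"
  using vs1.basis_onD(2)[OF x] vs1.basis_onD(4)[OF b] P(2) by blast
 then obtain c where c: "!!a. a < k ==> x a = (SUM i:I. s1 (c a i) (e i))" by metis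
 define x' where "x' a = (SUM i:I. s2 (c a i) (e' i))" for a
 have "vs2.indep_fam {..<k} x'" unfolding vs2.indep_fam_def
 proof (intro allI impI ballI)
  fix d a assume z: "(SUM a<k. s2 (d a) (x' a)) = 0" and a: "a : {..<k}"
  have sw1: "(SUM a<k. s1 (d a) (x a)) = (SUM i:I. s1 (SUM a<k. d a * c a i) (e i))"
  proof -
   have "(SUM a<k. s1 (d a) (x a)) = (SUM a<k. SUM i:I. s1 (d a * c a i) (e i))"
    using c by (simp add: vs1.scale_sum_right)
   also have "... = (SUM i:I. SUM a<k. s1 (d a * c a i) (e i))" by (rule sum.swap)
   finally show ?thesis by (simp add: vs1.scale_sum_left)
  qed
  have sw2: "(SUM a<k. s2 (d a) (x' a)) = (SUM i:I. s2 (SUM a<k. d a * c a i) (e' i))"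
  proof -
   have "(SUM a<k. s2 (d a) (x' a)) = (SUM a<k. SUM i:I. s2 (d a * c a i) (e' i))"
    by (simp add: x'_def vs2.scale_sum_right)
   also have "... = (SUM i:I. SUM a<k. s2 (d a * c a i) (e' i))" by (rule sum.swap)
   finally show ?thesis by (simp add: vs2.scale_sum_left)
  qed
  have "(SUM a<k. d a * c a i) = 0" if "i : I" for i
   using vs2.indep_famD[OF vs2.basis_onD(3)[OF b'], of "%i. SUM a<k. d a * c a i" i] z that unfolding sw2 by blast
  hence "(SUM a<k. s1 (d a) (x a)) = 0" unfolding sw1 by simp
  from vs1.indep_famD[OF vs1.basis_onD(3)[OF x] this a] show "d a = 0" .
 qed
 moreover have "x' a : X'" if "a : {..<k}" for a
  unfolding x'_def using XX[of "c a"] vs1.basis_onD(2)[OF x that] c[of a] that by simp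
 ultimately have "card {..<k} <= vs2.dim X'" by (intro vs2.indep_fam_card_le(1)[OF P(3)]) auto
 moreover have "vs1.dim X = k" using vs1.basis_on_dim[OF _ x] P(1) by (simp add: vs1.fin_sub_def)
 ultimately show ?thesis by simp
qed

lemma pker_transfer_le:
 assumes S: "vs1.fin_sub S" "vs2.fin_sub S'" and b: "vs1.basis_on S I e" and b': "vs2.basis_on S' I e'"
  and T: "vs1.linop T" "vs2.linop T'"
  and t: "!!i. i : I ==> T (e i) = (SUM j:I. s1 (t i j) (e j))" "!!i. i : I ==> T' (e' i) = (SUM j:I. s2 (t i j) (e' j))"
 shows "vs1.dim (vs1.pker S T p) <= vs2.dim (vs2.pker S' T' p)"
proof (rule dim_transfer[OF b b' vs1.pker_fin_sub[OF S(1) T(1)] _ vs2.pker_fin_sub[OF S(2) T(2)]])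
 have fI: "finite I" using vs1.basis_onD(1)[OF b] .
 fix c assume "(SUM i:I. s1 (c i) (e i)) : vs1.pker S T p"
 hence z: "(SUM j:I. s1 (SUM i:I. SUM m<=degree p. c i * coeff p m * vs1.mat_pow I t m i j) (e j)) = 0"
  using vs1.pact_basis[OF T(1) fI t(1), of p c] by (simp add: vs1.pker_def)
 have "(SUM i:I. SUM m<=degree p. c i * coeff p m * vs1.mat_pow I t m i j) = 0" if "j : I" for j
  by (rule vs1.indep_famD[OF vs1.basis_onD(3)[OF b] z that])
 hence "vs2.pact T' p (SUM i:I. s2 (c i) (e' i)) = 0"
  using vs2.pact_basis[where e = e' and t = t, OF T(2) fI t(2), of p c] by simp
 moreover have "(SUM i:I. s2 (c i) (e' i)) : S'"
  using vs2.basis_onD(2)[OF b'] S(2) by (auto simp: vs2.fin_sub_def intro!: vs2.subspace_sum vs2.subspace_scale)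
 ultimately show "(SUM i:I. s2 (c i) (e' i)) : vs2.pker S' T' p" by (simp add: vs2.pker_def)
qed (auto simp: vs1.pker_def vs2.pker_def)

end

text \<open>With equal matrices the condition p(T) x = 0 is the same system of equations in
  coordinates, so the inequality holds in both directions.\<close>

lemma (in fam_space_pair) pker_transfer:
 assumes S: "vs1.fin_sub S" "vs2.fin_sub S'" and b: "vs1.basis_on S I e" and b': "vs2.basis_on S' I e'"
  and T: "vs1.linop T" "vs2.linop T'"
  and t: "!!i. i : I ==> T (e i) = (SUM j:I. s1 (t i j) (e j))" "!!i. i : I ==> T' (e' i) = (SUM j:I. s2 (t i j) (e' j))"
 shows "vs1.dim (vs1.pker S T p) = vs2.dim (vs2.pker S' T' p)"
proof -
 interpret sw: fam_space_pair s2 s1 by unfold_locales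
 show ?thesis
  using pker_transfer_le[OF S b b' T t, of p] sw.pker_transfer_le[OF S(2,1) b' b T(2,1) t(2,1), of p]
  by (rule antisym)
qed

section \<open>Symplectic forms with a self-adjoint operator: cyclic pairs\<close>

context fam_space
begin

definition sympl_op :: "'b set => ('b => 'b => 'a) => ('b => 'b) => bool" where
 "sympl_op S om T \<longleftrightarrow> fin_sub S & alt_bilin om & nondeg_on S om & linop T & (ALL x:S. T x : S) &
   (ALL x:S. ALL y:S. om (T x) y = om x (T y))"

lemma sympl_opD:
 assumes "sympl_op S om T"
 shows "fin_sub S" "subspace S" "alt_bilin om" "nondeg_on S om" "linop T" "!!x. x : S ==> T x : S"
  "!!x y. x : S ==> y : S ==> om (T x) y = om x (T y)"
  "!!x i. x : S ==> (T ^^ i) x : S" "!!x p. x : S ==> pact T p x : S"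
 using assms funpow_in[of S T] pact_in[of S T] by (auto simp: sympl_op_def fin_sub_def)

lemma adj_funpow:
 assumes s: "sympl_op S om T" and "x : S" "y : S"
 shows "om ((T ^^ i) x) y = om x ((T ^^ i) y)"
 using assms(2,3)
proof (induction i arbitrary: x y)
 case (Suc i)
 have "om (T ((T ^^ i) x)) y = om ((T ^^ i) x) (T y)"
  by (rule sympl_opD(7)[OF s sympl_opD(8)[OF s Suc.prems(1)] Suc.prems(2)])
 also have "... = om x ((T ^^ i) (T y))" using Suc.IH[OF Suc.prems(1) sympl_opD(6)[OF s Suc.prems(2)]] .
 finally show ?case by (simp add: funpow_swap1)
qed simp

lemma adj_pact:
 assumes s: "sympl_op S om T" and "x : S" "y : S"
 shows "om (pact T p x) y = om x (pact T p y)"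
 unfolding pact_def alt_bilin_sum[OF sympl_opD(3)[OF s]] using adj_funpow[OF assms] by simp

end

text \<open>Self-adjointness gives om(T^k u, u) = om(u, T^k u), antisymmetry gives the opposite
  sign; 2 is invertible.\<close>

lemma (in fam_space) cyclic_isotropic:
 fixes om :: "'b => 'b => 'a"
 assumes s: "sympl_op S om T" and "u : S" and two: "(2::'a) ~= 0"
 shows "om ((T ^^ i) u) ((T ^^ j) u) = 0"
proof -
 note w = sympl_opD(3)[OF s]
 have "om ((T ^^ k) u) u = 0" for k
 proof -
  have "om ((T ^^ k) u) u = om u ((T ^^ k) u)" using adj_funpow[OF s assms(2,2)] .
  also have "... = - om ((T ^^ k) u) u" by (rule alt_bilinD(6)[OF w])
  finally have "om ((T ^^ k) u) u + om ((T ^^ k) u) u = 0" by (simp only: eq_neg_iff_add_eq_0)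
  hence "2 * om ((T ^^ k) u) u = 0" by (simp only: mult_2)
  thus ?thesis using two by simp
 qed
 hence "om ((T ^^ (j + i)) u) u = 0" .
 moreover have "om ((T ^^ j) ((T ^^ i) u)) u = om ((T ^^ i) u) ((T ^^ j) u)"
  using adj_funpow[OF s sympl_opD(8)[OF s assms(2)] assms(2)] .
 ultimately show ?thesis by (simp add: funpow_add)
qed

lemma sum_lessThan_split: "(SUM i<m + n. f i) = (SUM i<m. f i) + (SUM i<n. f (m + i))" for f :: "nat => 'a::comm_monoid_add"
 by (induction n) (simp_all add: add.assoc)

text \<open>The Hankel matrix h(i + m) has zeros above its antidiagonal and ones on it, so the
  system is solved from the last unknown downward.\<close>

lemma hankel_triangular:
 fixes h :: "nat => 'a::field"
 assumes h: "!!i. i < d ==> h i = (if Suc i = d then 1 else 0)"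
  and z: "!!m. m < d ==> (SUM i<d. a i * h (i + m)) = 0"
 shows "ALL i<d. a i = 0"
proof -
 have "i < d ==> a (d - 1 - i) = 0" for i
 proof (induction i rule: less_induct)
  case (less i)
  have "(SUM l<d. a l * h (l + i)) = (SUM l<d. if l = d - 1 - i then a l else 0)"
  proof (rule sum.cong[OF refl])
   fix l assume "l : {..<d}"
   hence l: "l < d" by simp
   consider "l + i < d - 1" | "l = d - 1 - i" | "d - 1 < l + i" by linarith
   thus "a l * h (l + i) = (if l = d - 1 - i then a l else 0)"
   proof cases
    case 1
    thus ?thesis using h[of "l + i"] by auto
   next
    case 2
    thus ?thesis using h[of "l + i"] less.prems by auto
   next
    case 3
    hence "a (d - 1 - (d - 1 - l)) = 0" using less.IH[of "d - 1 - l"] l by linarith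
    moreover have "l ~= d - 1 - i" using 3 less.prems by linarith
    ultimately show ?thesis using l by simp
   qed
  qed
  also have "... = a (d - 1 - i)" using less.prems by simp
  finally show ?case using z[OF less.prems] by simp
 qed
 note claim = this
 show ?thesis
 proof (intro allI impI)
  fix i assume "i < d"
  thus "a i = 0" using claim[of "d - 1 - i"] by simp
 qed
qed

definition coeff_poly :: "nat => (nat => 'a::comm_ring_1) => 'a poly" where
 "coeff_poly d c = (SUM i<d. monom (c i) i)"

lemma coeff_coeff_poly: "coeff (coeff_poly d c) i = (if i < d then c i else 0)"
 unfolding coeff_poly_def coeff_sum by simp

lemma degree_coeff_poly: "0 < d ==> degree (coeff_poly d c) < d"
 by (rule le_less_trans[OF degree_le[of "d - 1"]]) (auto simp: coeff_coeff_poly)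

context fam_space
begin

lemma dim_0_iff: "fin_sub X ==> dim X = 0 \<longleftrightarrow> X = {0}"
proof
 assume X: "fin_sub X" "dim X = 0"
 have "subspace {0}" by simp
 moreover have "dim {0} = 0" using dim_span_eq_card_independent[OF independent_empty] by simp
 ultimately show "X = {0}" using dim_le_subset(2)[OF X(1), of "{0}"] X subspace_0 by (auto simp: fin_sub_def)
next
 assume "X = {0}"
 thus "dim X = 0" using dim_span_eq_card_independent[OF independent_empty] by simp
qed

lemma pact_coeff_poly: "0 < d ==> pact T (coeff_poly d c) x = (SUM i<d. c i *s (T ^^ i) x)"
proof -
 assume d: "0 < d"
 hence "pact T (coeff_poly d c) x = (SUM i<=d - 1. coeff (coeff_poly d c) i *s (T ^^ i) x)"
  using degree_coeff_poly[OF d, of c] by (intro pact_bound) simp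
 also have "... = (SUM i<d. c i *s (T ^^ i) x)" using d
  by (intro sum.cong) (auto simp: coeff_coeff_poly)
 finally show ?thesis .
qed

lemma pker_mono: "linop T ==> pker S T p <= pker S T (q * p)"
 by (auto simp: pker_def pact_mult linop_0[OF pact_linop])

text \<open>The polynomial \<open>p\<close> below plays the role of an irreducible factor of the minimal polynomial,
 in the form in which it is used: polynomials of smaller degree act injectively.\<close>

context
 fixes S :: "'b set" and om T p k u and q :: "'a poly" and d :: nat
 assumes s: "sympl_op S om T" and p: "lead_coeff p = 1" "0 < degree p"
  and inj: "!!a. a ~= 0 ==> degree a < degree p ==> pker S T a = {0}"
  and k: "0 < k" "pker S T (p ^ k) = pker S T (p ^ Suc k)"
  and u: "u : pker S T (p ^ k)" "u \<notin> pker S T (p ^ (k - 1))"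
  and q: "q = p ^ k" and d: "d = degree q" and two: "(2::'a) ~= 0"
begin

lemma lin: "linop T" and w: "alt_bilin om" and uS: "u : S" and qu: "pact T q u = 0" and fS: "fin_sub S"
 using sympl_opD[OF s] u q by (auto simp: pker_def)

lemma monic_q: "lead_coeff q = 1"
 unfolding q by (induction k) (simp_all add: lead_coeff_mult p)

lemma d_pos: "0 < d"
proof -
 have "p ~= 0" using p by auto
 hence "degree q = k * degree p" unfolding q by (simp add: degree_power_eq)
 thus ?thesis using p k d by simp
qed

text \<open>If a(T) u = 0, powers of p are split off a one at a time. With a = p^i c' and v =
  p^(k-1)(T) u nonzero, c'(T) v = 0; as p(T) v = 0, also (c' mod p)(T) v = 0, and the injectivity in
  low degree forces p to divide c'. Finally q divides a, while the degree of a is smaller.\<close>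

lemma cyclic_indep: "indep_fam {..<d} (%i. (T ^^ i) u)"
 unfolding indep_fam_def
proof (intro allI impI)
 fix c assume z: "(SUM i<d. c i *s (T ^^ i) u) = 0"
 define a where "a = coeff_poly d c"
 have au: "pact T a u = 0" unfolding a_def pact_coeff_poly[OF d_pos] using z .
 have "i <= k ==> p ^ i dvd a" for i
 proof (induction i)
  case 0
  thus ?case by simp
 next
  case (Suc i)
  hence "p ^ i dvd a" by simp
  then obtain c' where c': "a = p ^ i * c'" by (rule dvdE)
  define v where "v = pact T (p ^ (k - 1)) u"
  have vS: "v : S" unfolding v_def using sympl_opD(9)[OF s uS] .
  have v0: "v ~= 0" using u uS by (auto simp: v_def pker_def)
  have "p ^ (k - 1 - i) * a = c' * p ^ (k - 1)"
   unfolding c' using Suc.prems by (simp add: mult.assoc[symmetric] power_add[symmetric] mult.commute)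
  hence "pact T c' v = 0" unfolding v_def pact_mult[OF lin, symmetric]
   using au by (metis pact_mult[OF lin] linop_0[OF pact_linop[OF lin]])
  moreover have "pact T c' v = pact T (c' div p * p) v + pact T (c' mod p) v"
   unfolding pact_add[OF lin, symmetric] by simp
  moreover have "pact T (c' div p * p) v = pact T (c' div p) (pact T (p * p ^ (k - 1)) u)"
   unfolding v_def pact_mult[OF lin] ..
  moreover have "p * p ^ (k - 1) = q" unfolding q using k(1) by (cases k) auto
  ultimately have "pact T (c' mod p) v = 0" using qu linop_0[OF pact_linop[OF lin]] by simp
  hence "v : pker S T (c' mod p)" using vS by (simp add: pker_def)
  moreover have "p ~= 0" using p by auto
  ultimately have "c' mod p = 0" using inj[of "c' mod p"] v0 degree_mod_less'[of p c'] by blast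
  hence "p dvd c'" by (simp add: mod_eq_0_iff_dvd)
  thus ?case unfolding c' by (simp add: mult_dvd_mono mult.commute)
 qed
 hence "q dvd a" unfolding q by simp
 have "a = 0"
 proof (rule ccontr)
  assume "a ~= 0"
  hence "degree q <= degree a" using `q dvd a` by (rule dvd_imp_degree_le[rotated])
  thus False using degree_coeff_poly[OF d_pos, of c] d by (simp add: a_def)
 qed
 hence "coeff (coeff_poly d c) i = 0" for i by (simp add: a_def)
 thus "ALL i:{..<d}. c i = 0" unfolding coeff_coeff_poly by (metis lessThan_iff)
qed

text \<open>Once two successive kernels agree, all later ones do. In particular q and its square
  have the same kernel.\<close>

lemma pker_stable: "pker S T (p ^ (k + i)) = pker S T q"
proof (induction i)
 case 0
 thus ?case by (simp add: q)
next
 case (Suc i)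
 have "pker S T (p ^ (k + Suc i)) <= pker S T (p ^ (k + i))"
 proof
  fix x assume "x : pker S T (p ^ (k + Suc i))"
  moreover have "p ^ (k + Suc i) = p ^ Suc k * p ^ i" by (simp add: power_add mult.left_commute)
  ultimately have x: "x : S" "pact T (p ^ Suc k * p ^ i) x = 0" by (simp_all only: pker_def mem_Collect_eq)
  hence "pact T (p ^ i) x : pker S T (p ^ Suc k)"
   using sympl_opD(9)[OF s] by (simp only: pker_def mem_Collect_eq pact_mult[OF lin])
  hence "pact T (p ^ i) x : pker S T (p ^ k)" using k(2) by simp
  thus "x : pker S T (p ^ (k + i))" using x(1) by (simp add: pker_def pact_mult[OF lin] power_add)
 qed
 moreover have "pker S T (p ^ (k + i)) <= pker S T (p ^ (k + Suc i))"
  using pker_mono[OF lin, of S "p ^ (k + i)" p] by simp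
 ultimately show ?case using Suc.IH by blast
qed

text \<open>Nondegeneracy gives a vector \<open>v0\<close> with the required pairings, but perhaps
  outside the kernel of q(T). Subtracting a vector of the image of q(T) brings it into the kernel
  and leaves the pairings alone, because q(T) is self-adjoint and kills the cyclic space of
  u.\<close>

lemma dual_cyclic: "EX v:S. pact T q v = 0 & (ALL i<d. om ((T ^^ i) u) v = (if Suc i = d then 1 else 0))"
proof -
 obtain f where f: "linfun f" "!!i. i : {..<d} ==> f ((T ^^ i) u) = (if Suc i = d then 1 else 0)"
  using linfun_extend[OF _ cyclic_indep, of "%i. if Suc i = d then 1 else 0"] by blast
 have fz: "f z = 0" if "z : rad S om" for z
  using that sympl_opD(4)[OF s] linfun_zero[OF f(1)] by (auto simp: rad_def nondeg_on_def)
 obtain x where x: "x : S" "!!y. y : S ==> f y = om x y" using fredholm[OF fS w f(1) fz] by blast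
 \<comment> \<open>The sign passes from om(x, y), as \<open>fredholm\<close> delivers it, to a
   pairing with the unknown in the second place.\<close>
 define v0 where "v0 = - x"
 have v0: "v0 : S" "!!y. y : S ==> om y v0 = f y"
  using x subspace_neg[OF sympl_opD(2)[OF s]] alt_bilinD(6)[OF w, of x] by (auto simp: v0_def alt_bilinD(10)[OF w])
 interpret P: fam_space_pair scale scale by unfold_locales
 let ?g = "pact T q"
 have lg: "linop ?g" by (rule pact_linop[OF lin])
 have gS: "?g ` S <= S" using sympl_opD(9)[OF s] by blast
 have fI: "fin_sub (?g ` S)" by (rule P.rank_nullity_on(2)[OF fS]) (auto simp: linopD[OF lg])
 have fI2: "fin_sub (?g ` (?g ` S))" by (rule P.rank_nullity_on(2)[OF fI]) (auto simp: linopD[OF lg])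
 have rn: "dim (?g ` S) = dim (?g ` (?g ` S)) + dim {y : ?g ` S. ?g y = 0}"
  by (rule P.rank_nullity_on(1)[OF fI]) (auto simp: linopD[OF lg])
 \<comment> \<open>Fitting's argument: q and its square have the same kernel, so q(T) is injective
   on its image and therefore maps the image onto itself.\<close>
 have "{y : ?g ` S. ?g y = 0} = {0}"
 proof
  show "{y : ?g ` S. ?g y = 0} <= {0}"
  proof
   fix y assume "y : {y : ?g ` S. ?g y = 0}"
   then obtain z where z: "z : S" "y = ?g z" "?g (?g z) = 0" by auto
   hence "z : pker S T (p ^ (k + k))" by (simp add: pker_def pact_mult[OF lin, symmetric] q power_add)
   thus "y : {0}" using z unfolding pker_stable by (simp add: pker_def)
  qed
  show "{0} <= {y : ?g ` S. ?g y = 0}" using subspace_0[OF sympl_opD(2)[OF s]] linop_0[OF lg]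
   by (auto intro!: image_eqI[of _ _ 0])
 qed
 hence "dim {y : ?g ` S. ?g y = 0} = 0" using dim_span_eq_card_independent[OF independent_empty] by simp
 hence "?g ` (?g ` S) = ?g ` S"
  using dim_le_subset(2)[OF fI, of "?g ` (?g ` S)"] rn fI2 gS by (auto simp: fin_sub_def)
 then obtain y where y: "y : S" "?g v0 = ?g (?g y)" using v0(1) by (metis imageE imageI)
 define v where "v = v0 - ?g y"
 have "v : S" unfolding v_def using v0 y gS subspace_diff[OF sympl_opD(2)[OF s]] by blast
 moreover have "?g v = 0" using y by (simp add: v_def linop_diff[OF lg])
 moreover have "om ((T ^^ i) u) v = (if Suc i = d then 1 else 0)" if "i < d" for i
 proof -
  have Tu: "(T ^^ i) u : S" using sympl_opD(8)[OF s uS] .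
  have "om ((T ^^ i) u) (?g y) = om (?g ((T ^^ i) u)) y" using adj_pact[OF s Tu y(1)] by simp
  also have "(T ^^ i) 0 = 0" by (induction i) (simp_all add: linop_0[OF lin])
  hence "om (?g ((T ^^ i) u)) y = 0" using pact_funpow[OF lin, of q i u] qu by (simp add: alt_bilinD(7)[OF w])
  finally show ?thesis using v0(2)[OF Tu] f(2) that by (simp add: v_def alt_bilinD(12)[OF w])
 qed
 ultimately show ?thesis by blast
qed

end

definition cyc_fam :: "('b => 'b) => nat => 'b => 'b => nat => 'b" where
 "cyc_fam T d u v i = (if i < d then (T ^^ i) u else (T ^^ (i - d)) v)"

text \<open>Two companion blocks of q, one for u and one for v, with rows as images.\<close>

definition cyc_mat :: "'a poly => nat => nat => nat => 'a" where
 "cyc_mat q d i j =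
   (if Suc i = d then (if j < d then - coeff q j else 0)
   else if Suc i = d + d then (if d <= j then - coeff q (j - d) else 0)
   else if j = Suc i then 1 else 0)"

text \<open>The pairing is normalised to be 0 before the last power and 1 there: this makes the Gram
  matrix triangular, and it leaves no freedom in the later pairings.\<close>

definition cyc_pair :: "'b set => ('b => 'b => 'a) => ('b => 'b) => 'a poly => nat => 'b => 'b => bool" where
 "cyc_pair S om T q d u v \<longleftrightarrow> sympl_op S om T & lead_coeff q = 1 & degree q = d & 0 < d & u : S & v : S &
   pact T q u = 0 & pact T q v = 0 & (ALL i<d. om ((T ^^ i) u) v = (if Suc i = d then 1 else 0)) & (2::'a) ~= 0"

lemma monic_pact_0:
 assumes "linop T" "lead_coeff q = 1" "degree q = d" "pact T q x = 0"
 shows "(T ^^ d) x = (SUM l<d. (- coeff q l) *s (T ^^ l) x)"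
proof -
 have "(SUM l<d. coeff q l *s (T ^^ l) x) + (T ^^ d) x = 0"
  using assms by (simp add: pact_def lessThan_Suc_atMost[symmetric])
 hence "(T ^^ d) x = - (SUM l<d. coeff q l *s (T ^^ l) x)" by (simp add: eq_neg_iff_add_eq_0 add.commute)
 thus ?thesis by (simp add: sum_negf)
qed

context
 fixes S :: "'b set" and om T u v and q :: "'a poly" and d :: nat
 assumes c: "cyc_pair S om T q d u v"
begin

abbreviation "cf \<equiv> cyc_fam T d u v"
abbreviation "cspan \<equiv> span (cf ` {..<d + d})"
abbreviation "corth \<equiv> orth S om {..<d + d} cf"

lemma cp: "sympl_op S om T" "lead_coeff q = 1" "degree q = d" "0 < d" "u : S" "v : S" "pact T q u = 0" "pact T q v = 0"
 "!!i. i < d ==> om ((T ^^ i) u) v = (if Suc i = d then 1 else 0)" "(2::'a) ~= 0" "linop T" "alt_bilin om" "fin_sub S"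
 using c sympl_opD(1,3,5)[of S om T] by (auto simp: cyc_pair_def)

lemma cyc_in: "cf i : S"
 using sympl_opD(8)[OF cp(1)] cp(5,6) by (simp add: cyc_fam_def)

lemma cyc_T: "i < d + d ==> T (cf i) = (SUM j<d + d. cyc_mat q d i j *s cf j)"
proof -
 assume i: "i < d + d"
 have one: "(SUM j<d + d. (if j = Suc i then 1 else 0) *s cf j) = cf (Suc i)" if "Suc i < d + d"
 proof -
  have "(SUM j<d + d. (if j = Suc i then 1 else 0) *s cf j) = (SUM j<d + d. if j = Suc i then cf (Suc i) else 0)"
   by (rule sum.cong) auto
  thus ?thesis using that by simp
 qed
 consider "Suc i = d" | "Suc i = d + d" | "Suc i < d + d" "Suc i ~= d" using i by linarith
 thus ?thesis
 proof cases
  case 1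
  hence "T (cf i) = (T ^^ d) u" by (auto simp: cyc_fam_def)
  also have "... = (SUM l<d. (- coeff q l) *s (T ^^ l) u)" by (rule monic_pact_0[OF cp(11,2,3,7)])
  also have "... = (SUM j<d + d. cyc_mat q d i j *s cf j)"
   unfolding sum_lessThan_split using 1 by (simp add: cyc_mat_def cyc_fam_def)
  finally show ?thesis .
 next
  case 2
  hence "T (cf i) = (T ^^ Suc (i - d)) v" using cp(4) by (auto simp: cyc_fam_def)
  also have "Suc (i - d) = d" using 2 cp(4) by linarith
  also have "(T ^^ d) v = (SUM l<d. (- coeff q l) *s (T ^^ l) v)" by (rule monic_pact_0[OF cp(11,2,3,8)])
  also have "... = (SUM j<d + d. cyc_mat q d i j *s cf j)"
   unfolding sum_lessThan_split using 2 cp(4) by (simp add: cyc_mat_def cyc_fam_def)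
  finally show ?thesis .
 next
  case 3
  hence "T (cf i) = cf (Suc i)"
   by (cases "i < d") (auto simp: cyc_fam_def Suc_diff_le)
  thus ?thesis using 3 one by (simp add: cyc_mat_def)
 qed
qed

text \<open>By self-adjointness all powers of T move to one side, so the mixed pairings form a
  Hankel matrix in h(m) = om(T^m u, v), and the two halves are isotropic.\<close>

lemma cyc_gram:
 "i < d ==> j < d ==> om (cf i) (cf j) = 0"
 "i < d ==> d <= j ==> om (cf i) (cf j) = om ((T ^^ (i + (j - d))) u) v"
 "d <= i ==> j < d ==> om (cf i) (cf j) = - om ((T ^^ (j + (i - d))) u) v"
 "d <= i ==> d <= j ==> om (cf i) (cf j) = 0"
proof -
 have uv: "om ((T ^^ a) u) ((T ^^ b) v) = om ((T ^^ (a + b)) u) v" for a b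
 proof -
  have "om ((T ^^ b) ((T ^^ a) u)) v = om ((T ^^ a) u) ((T ^^ b) v)"
   by (rule adj_funpow[OF cp(1) sympl_opD(8)[OF cp(1,5)] cp(6)])
  moreover have "(T ^^ (a + b)) u = (T ^^ b) ((T ^^ a) u)" by (subst add.commute) (simp add: funpow_add)
  ultimately show ?thesis by simp
 qed
 show "i < d ==> j < d ==> om (cf i) (cf j) = 0"
  using cyclic_isotropic[OF cp(1,5,10)] by (simp add: cyc_fam_def)
 show "d <= i ==> d <= j ==> om (cf i) (cf j) = 0"
  using cyclic_isotropic[OF cp(1,6,10)] by (simp add: cyc_fam_def)
 show "i < d ==> d <= j ==> om (cf i) (cf j) = om ((T ^^ (i + (j - d))) u) v"
  using uv by (simp add: cyc_fam_def)
 show "d <= i ==> j < d ==> om (cf i) (cf j) = - om ((T ^^ (j + (i - d))) u) v"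
  using uv[of j "i - d"] alt_bilinD(6)[OF cp(12), of "(T ^^ (i - d)) v"] by (simp add: cyc_fam_def)
qed

text \<open>Testing a relation against the v-half gives a triangular Hankel system for the
  coefficients of the u-half, and conversely.\<close>

lemma cyc_nd:
 assumes z: "!!j. j : {..<d + d} ==> (SUM i:{..<d + d}. a i * om (cf i) (cf j)) = 0"
 shows "ALL i:{..<d + d}. a i = 0"
proof -
 let ?h = "%i. om ((T ^^ i) u) v"
 have a1: "ALL i<d. a i = 0"
 proof (rule hankel_triangular[of d ?h])
  fix m assume m: "m < d"
  have "(SUM i<d + d. a i * om (cf i) (cf (d + m))) = 0" using z[of "d + m"] m by simp
  thus "(SUM i<d. a i * ?h (i + m)) = 0"
   unfolding sum_lessThan_split using cyc_gram(2)[of _ "d + m"] cyc_gram(4)[of _ "d + m"] by simp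
 qed (use cp(9) in blast)
 have "ALL i<d. a (d + i) = 0"
 proof (rule hankel_triangular[of d ?h])
  fix m assume m: "m < d"
  have "(SUM i<d + d. a i * om (cf i) (cf m)) = 0" using z[of m] m by simp
  thus "(SUM i<d. a (d + i) * ?h (i + m)) = 0"
   unfolding sum_lessThan_split using cyc_gram(3)[of "d + _" m] cyc_gram(1)[of _ m] m
   by (simp add: sum_negf add.commute)
 qed (use cp(9) in blast)
 hence "a i = 0" if "d <= i" "i < d + d" for i
  using that by (metis add_diff_inverse_nat add_less_cancel_left not_le)
 thus ?thesis using a1 by (metis lessThan_iff not_le)
qed

lemmas cyc_facts = cp(13) cp(12) finite_lessThan[of "d + d"] cyc_in cyc_nd

text \<open>The orthogonal complement of a T-stable space is T-stable, since T is
  self-adjoint.\<close>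

lemma cyc_orth_sympl_op: "sympl_op corth om T"
 unfolding sympl_op_def
proof (intro conjI ballI)
 show "fin_sub corth" by (rule orth_fin_sub[OF cyc_facts])
 show "nondeg_on corth om"
  by (rule orth_nondeg[OF cyc_facts sympl_opD(4)[OF cp(1)]])
next
 fix x assume x: "x : corth"
 have "om (T x) (cf j) = 0" if "j < d + d" for j
 proof -
  have "om (T x) (cf j) = om x (T (cf j))"
   using x sympl_opD(7)[OF cp(1) _ cyc_in] by (auto simp: orth_def)
  thus ?thesis using x by (simp add: cyc_T[OF that] alt_bilin_sum[OF cp(12)] orth_def)
 qed
 thus "T x : corth" using x sympl_opD(6)[OF cp(1)] by (auto simp: orth_def)
qed (use cp sympl_opD(7)[OF cp(1)] in \<open>auto simp: orth_def\<close>)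

lemma cyc_span_basis: "basis_on cspan {..<d + d} cf"
 using orth_indep[OF cyc_facts] indep_fam_iff[of "{..<d+d}" "cf"] by (simp add: basis_on_iff)

lemma cyc_span_T: "x : cspan ==> T x : cspan"
proof -
 assume "x : cspan"
 then obtain c where c: "x = (SUM i<d + d. c i *s cf i)" by (auto simp: span_fam)
 have "T (cf i) : cspan" if "i < d + d" for i
  unfolding cyc_T[OF that] by (intro span_sum span_scale span_base) auto
 thus ?thesis unfolding c linop_sum[OF cp(11)] by (intro span_sum span_scale) auto
qed

text \<open>Both summands are T-stable, so a vector killed by a(T) has both components killed. The
  kernel dimensions of the complement can hence be found by subtraction.\<close>

lemma cyc_pker_dim:
 "dim (pker S T a) = dim (pker cspan T a) +
   dim (pker corth T a)"
proof -
 let ?E = "cf" and ?I = "{..<d + d}"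
 let ?M = "span (?E ` ?I)" and ?O = "orth S om ?I ?E"
 have fM: "fin_sub ?M" by (auto simp: fin_sub_def)
 have fO: "fin_sub ?O" by (rule orth_fin_sub[OF cyc_facts])
 note so = sympl_opD[OF cyc_orth_sympl_op]
 obtain k and x :: "nat => 'b" where x: "basis_on (pker ?M T a) {..<k} x"
  using basis_on_exists[OF pker_fin_sub[OF fM cp(11)]] .
 obtain l and y :: "nat => 'b" where y: "basis_on (pker ?O T a) {..<l} y"
  using basis_on_exists[OF pker_fin_sub[OF fO cp(11)]] .
 have MS: "?M <= S" using cyc_in sympl_opD(2)[OF cp(1)] by (intro span_minimal) auto
 have OS: "?O <= S" by (auto simp: orth_def)
 have MO: "m = 0 & s = 0" if m1: "m : ?M" and m2: "s : ?O" and m3: "m + s = 0" for m s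
 proof -
  obtain c where c: "m = (SUM i:?I. c i *s ?E i)" using m1 by (auto simp: span_fam)
  have "ALL i:?I. c i = 0" using orth_sum_eq0[OF cyc_facts m2] m3 unfolding c by blast
  thus ?thesis using m3 unfolding c by simp
 qed
 have sM: "subspace (pker ?M T a)" "subspace (pker ?O T a)" "subspace (pker S T a)"
  using pker_subspace[OF _ cp(11)] so(2) sympl_opD(2)[OF cp(1)] by auto
 have spl: "(SUM i:{..<k} <+> {..<l}. c i *s case_sum x y i) = (SUM i<k. c (Inl i) *s x i) + (SUM i<l. c (Inr i) *s y i)" for c
  by (simp add: sum.Plus)
 have xs: "(SUM i<k. c i *s x i) : pker ?M T a" for c
  using basis_onD(2)[OF x] by (auto intro!: subspace_sum[OF sM(1)] subspace_scale[OF sM(1)])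
 have ys: "(SUM i<l. c i *s y i) : pker ?O T a" for c
  using basis_onD(2)[OF y] by (auto intro!: subspace_sum[OF sM(2)] subspace_scale[OF sM(2)])
 have "basis_on (pker S T a) ({..<k} <+> {..<l}) (case_sum x y)"
  unfolding basis_on_def indep_fam_def
 proof (intro conjI ballI allI impI)
  fix i assume "i : {..<k} <+> {..<l}"
  thus "case_sum x y i : pker S T a"
   using basis_onD(2)[OF x] basis_onD(2)[OF y] MS OS by (auto simp: pker_def)
 next
  fix c i assume z: "(SUM i:{..<k} <+> {..<l}. c i *s case_sum x y i) = 0" and i: "i : {..<k} <+> {..<l}"
  have "(SUM i<k. c (Inl i) *s x i) : ?M" "(SUM i<l. c (Inr i) *s y i) : ?O"
   using xs[of "%i. c (Inl i)"] ys[of "%i. c (Inr i)"] by (auto simp: pker_def)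
  from MO[OF this z[unfolded spl]]
  have z1: "(SUM i<k. c (Inl i) *s x i) = 0" and z2: "(SUM i<l. c (Inr i) *s y i) = 0" by auto
  have "c (Inl j) = 0" if "j < k" for j using indep_famD[OF basis_onD(3)[OF x] z1] that by simp
  moreover have "c (Inr j) = 0" if "j < l" for j using indep_famD[OF basis_onD(3)[OF y] z2] that by simp
  ultimately show "c i = 0" using i by auto
 next
  fix z assume "z : pker S T a"
  hence z: "z : S" "pact T a z = 0" by (auto simp: pker_def)
  obtain c where c: "z - (SUM i:?I. c i *s ?E i) : ?O" by (rule exE[OF orth_decomp[OF cyc_facts z(1)]])
  define m where "m = (SUM i:?I. c i *s ?E i)"
  have mM: "m : ?M" unfolding m_def by (intro span_sum span_scale span_base imageI)
  have pm: "pact T a m : ?M" by (rule pact_in[OF _ cyc_span_T mM]) simp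
  have ps: "pact T a (z - m) : ?O" using so(9) c by (simp add: m_def)
  have "pact T a m + pact T a (z - m) = 0" using z(2) by (simp add: linop_diff[OF pact_linop[OF cp(11)]])
  from MO[OF pm ps this] have "m : pker ?M T a" "z - m : pker ?O T a"
   using mM c by (auto simp: pker_def m_def)
  then obtain c1 c2 where m12: "m = (SUM i<k. c1 i *s x i)" "z - m = (SUM i<l. c2 i *s y i)"
   using basis_onD(4)[OF x] basis_onD(4)[OF y] by blast
  have "z = m + (z - m)" by simp
  also have "... = (SUM i<k. c1 i *s x i) + (SUM i<l. c2 i *s y i)"
   by (rule arg_cong2[where f = "(+)", OF m12])
  finally have "z = (SUM i<k. c1 i *s x i) + (SUM i<l. c2 i *s y i)" .
  thus "EX c. z = (SUM i:{..<k} <+> {..<l}. c i *s case_sum x y i)"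
   unfolding spl by (intro exI[of _ "case_sum c1 c2"]) simp
 qed simp
 from basis_on_dim[OF sM(3) this] basis_on_dim[OF sM(1) x] basis_on_dim[OF sM(2) y]
 show ?thesis by (simp add: card_Plus)
qed

end

end

context fam_space
begin

text \<open>The powers T^i x of a nonzero vector are dependent, so some nonzero polynomial has a
  nonzero kernel; p is one of least degree, made monic.\<close>

lemma minimal_poly_exists:
 assumes s: "sympl_op S om T" and S: "S ~= {0}"
 shows "EX p. lead_coeff p = 1 & 0 < degree p & pker S T p ~= {0} &
  (ALL a. a ~= 0 --> degree a < degree p --> pker S T a = {0})"
proof -
 note sp = sympl_opD[OF s]
 have k0: "0 : pker S T a" for a using subspace_0[OF pker_subspace[OF sp(2,5)]] .
 obtain x where x: "x : S" "x ~= 0" using S subspace_0[OF sp(2)] by blast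
 have "\<not> indep_fam {..<Suc (dim S)} (%i. (T ^^ i) x)"
  using indep_fam_card_le(1)[OF sp(1), of "{..<Suc (dim S)}" "%i. (T ^^ i) x"] sp(8)[OF x(1)] by auto
 then obtain c i where c: "(SUM i<Suc (dim S). c i *s (T ^^ i) x) = 0" "i < Suc (dim S)" "c i ~= 0"
  unfolding indep_fam_def by auto
 let ?a = "coeff_poly (Suc (dim S)) c"
 have "?a ~= 0" using c(2,3) coeff_coeff_poly[of "Suc (dim S)" c i] by (metis coeff_0)
 moreover have "x : pker S T ?a" using x(1) c(1) by (simp add: pker_def pact_coeff_poly del: sum.lessThan_Suc)
 ultimately have ex: "EX a. a ~= 0 & pker S T a ~= {0}" using x(2) by blast
 obtain p where p: "p ~= 0" "pker S T p ~= {0}" and min: "!!a. a ~= 0 & pker S T a ~= {0} ==> degree p <= degree a"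
  using ex_has_least_nat[of "%a. a ~= 0 & pker S T a ~= {0}" _ degree] ex by blast
 define p' where "p' = Polynomial.smult (inverse (lead_coeff p)) p"
 have lc: "inverse (lead_coeff p) ~= 0" using p(1) by simp
 have "pker S T p' = pker S T p" using lc by (simp add: pker_def p'_def pact_smult[OF sp(5)])
 moreover have dg: "degree p' = degree p" using lc by (simp add: p'_def)
 moreover have "lead_coeff p' = 1" using p(1) by (simp add: p'_def)
 moreover have "0 < degree p"
 proof (rule ccontr)
  assume "\<not> 0 < degree p"
  hence "pact T p x = coeff p 0 *s x" for x by (simp add: pact_def)
  moreover have "coeff p 0 ~= 0" using p(1) `\<not> 0 < degree p` by (metis leading_coeff_0_iff neq0_conv)
  ultimately have "pker S T p <= {0}" by (auto simp: pker_def)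
  thus False using p(2) k0 by blast
 qed
 moreover have "pker S T a = {0}" if "a ~= 0" "degree a < degree p" for a using min[of a] that by force
 ultimately show ?thesis using p(2) by (intro exI[of _ p']) simp
qed

lemma pker_power_stable_exists:
 assumes s: "sympl_op S om T"
 shows "EX k. pker S T (p ^ k) = pker S T (p ^ Suc k)"
proof (rule ccontr)
 note sp = sympl_opD[OF s]
 assume neg: "\<nexists>k. pker S T (p ^ k) = pker S T (p ^ Suc k)"
 have "k <= dim (pker S T (p ^ k))" for k
 proof (induction k)
  case (Suc k)
  have "pker S T (p ^ k) <= pker S T (p ^ Suc k)" using pker_mono[OF sp(5)] by simp
  note le = dim_le_subset[OF pker_fin_sub[OF sp(1,5)] pker_subspace[OF sp(2,5)] this]
  have "dim (pker S T (p ^ k)) ~= dim (pker S T (p ^ Suc k))" using le(2) neg by blast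
  thus ?case using Suc le(1) by linarith
 qed simp
 from this[of "Suc (dim S)"] have "Suc (dim S) <= dim (pker S T (p ^ Suc (dim S)))" .
 moreover have "dim (pker S T (p ^ Suc (dim S))) <= dim S"
  by (rule dim_le_subset(1)[OF sp(1) pker_subspace[OF sp(2,5)]]) (auto simp: pker_def)
 ultimately show False by simp
qed

text \<open>The kernels are nested, so stabilisation can be read off from dimensions, hence at the
  same power for two operators with the same kernel dimensions.\<close>

lemma pker_power_stable_iff:
 assumes s: "sympl_op S om T"
 shows "pker S T (p ^ k) = pker S T (p ^ Suc k) \<longleftrightarrow> dim (pker S T (p ^ k)) = dim (pker S T (p ^ Suc k))"
proof -
 note sp = sympl_opD[OF s]
 have "pker S T (p ^ k) <= pker S T (p ^ Suc k)" using pker_mono[OF sp(5)] by simp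
 thus ?thesis
  using dim_le_subset(2)[OF pker_fin_sub[OF sp(1,5)] pker_subspace[OF sp(2,5)]] by metis
qed

text \<open>Minimality of k leaves a vector u killed by p^k but not by p^(k-1);
  \<open>dual_cyclic\<close> supplies its partner.\<close>

lemma cyc_pair_exists:
 assumes s: "sympl_op S om T" and p: "lead_coeff p = 1" "0 < degree p" "pker S T p ~= {0}"
  and inj: "!!a. a ~= 0 ==> degree a < degree p ==> pker S T a = {0}"
  and k: "pker S T (p ^ k) = pker S T (p ^ Suc k)" "!!l. l < k ==> pker S T (p ^ l) ~= pker S T (p ^ Suc l)"
  and two: "(2::'a) ~= 0"
 shows "EX u v. cyc_pair S om T (p ^ k) (degree (p ^ k)) u v"
proof -
 note sp = sympl_opD[OF s]
 have k0: "0 < k"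
 proof (rule ccontr)
  assume "\<not> 0 < k"
  hence "pker S T p = pker S T 1" using k(1) by simp
  also have "... = {0}" using subspace_0[OF sp(2)] by (auto simp: pker_def pact_1)
  finally show False using p(3) by simp
 qed
 have "pker S T (p ^ (k - 1)) ~= pker S T (p ^ k)" using k(2)[of "k - 1"] k0 by simp
 moreover have "pker S T (p ^ (k - 1)) <= pker S T (p ^ k)"
  using pker_mono[OF sp(5), of S "p ^ (k - 1)" p] k0 by (cases k) auto
 ultimately obtain u where u: "u : pker S T (p ^ k)" "u \<notin> pker S T (p ^ (k - 1))" by blast
 note facts = s p(1,2) inj k0 k(1) u refl refl two
 obtain v where v: "v : S" "pact T (p ^ k) v = 0"
  "ALL i<degree (p ^ k). om ((T ^^ i) u) v = (if Suc i = degree (p ^ k) then 1 else 0)"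
  using dual_cyclic[OF facts] by blast
 have "cyc_pair S om T (p ^ k) (degree (p ^ k)) u v"
  unfolding cyc_pair_def using s monic_q[OF facts] d_pos[OF facts] uS[OF facts] qu[OF facts] v two by simp
 thus ?thesis by blast
qed

text \<open>The relation q(T) u = 0 is a linear recurrence of order d for h(m) = om(T^m u,
  v).\<close>

lemma cyc_hankel_rec:
 assumes c: "cyc_pair S om T q d u v" and "d <= m"
 shows "om ((T ^^ m) u) v = (SUM l<d. - coeff q l * om ((T ^^ (l + (m - d))) u) v)"
proof -
 note cp = cp[OF c]
 have "(T ^^ (m - d + d)) u = (T ^^ (m - d)) ((T ^^ d) u)" by (simp only: funpow_add o_apply)
 hence "(T ^^ m) u = (T ^^ (m - d)) ((T ^^ d) u)" using assms(2) by simp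
 also have "... = (SUM l<d. (- coeff q l) *s (T ^^ (m - d)) ((T ^^ l) u))"
 proof -
  have "linop (T ^^ k)" for k using cp(11) by (induction k) (simp_all add: linop_def)
  thus ?thesis unfolding monic_pact_0[OF cp(11,2,3,7)] by (rule linop_sum)
 qed
 also have "... = (SUM l<d. (- coeff q l) *s (T ^^ (l + (m - d))) u)"
 proof (rule sum.cong[OF refl])
  fix l
  have "(T ^^ (l + (m - d))) u = (T ^^ (m - d)) ((T ^^ l) u)"
   by (subst add.commute) (simp only: funpow_add o_apply)
  thus "(- coeff q l) *s (T ^^ (m - d)) ((T ^^ l) u) = (- coeff q l) *s (T ^^ (l + (m - d))) u" by simp
 qed
 finally have e: "(T ^^ m) u = (SUM l<d. (- coeff q l) *s (T ^^ (l + (m - d))) u)" .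
 show ?thesis unfolding e by (simp only: alt_bilin_sum[OF cp(12)])
qed

lemma dim_orth_less:
 assumes c: "cyc_pair S om T q d u v"
 shows "dim (orth S om {..<d + d} (cyc_fam T d u v)) < dim S"
proof -
 note cp = cp[OF c]
 note so = sympl_opD[OF cyc_orth_sympl_op[OF c]]
 let ?O = "orth S om {..<d + d} (cyc_fam T d u v)"
 have sub: "?O <= S" by (auto simp: orth_def)
 have "cyc_fam T d u v 0 ~= 0"
  using orth_indep[OF cyc_facts[OF c]] cp(4) indep_famD[of "{..<d+d}" "cyc_fam T d u v" "%i. if i = 0 then 1 else 0" 0]
  by (auto simp: if_distrib[of "%x. x *s _"] cong: if_cong)
 moreover have "cyc_fam T d u v 0 \<notin> ?O \<or> cyc_fam T d u v 0 = 0"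
 proof -
  have "om (cyc_fam T d u v 0) (cyc_fam T d u v (d + (d - 1))) = 1"
   using cyc_gram(2)[OF c, of 0 "d + (d - 1)"] cp(4) cp(9)[of "d - 1"] by simp
  moreover have "d + (d - 1) : {..<d + d}" using cp(4) by simp
  ultimately show ?thesis unfolding orth_def by force
 qed
 ultimately have "?O ~= S" using cyc_in[OF c, of 0] by auto
 thus ?thesis
  using dim_le_subset[OF cp(13) so(2) sub] le_neq_implies_less by blast
qed

end

context fam_space_pair
begin

text \<open>The first d values are normalised and the recurrence depends on q alone, so the whole
  sequence does.\<close>

lemma cyc_hankel_eq:
 assumes c: "vs1.cyc_pair S om T q d u v" and c': "vs2.cyc_pair S' om' T' q d u' v'"
 shows "om ((T ^^ m) u) v = om' ((T' ^^ m) u') v'"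
proof (induction m rule: less_induct)
 case (less m)
 note cp = vs1.cp[OF c] and cp' = vs2.cp[OF c']
 show ?case
 proof (cases "m < d")
  case True
  thus ?thesis using cp(9) cp'(9) by simp
 next
  case False
  hence "d <= m" by simp
  show ?thesis unfolding vs1.cyc_hankel_rec[OF c `d <= m`] vs2.cyc_hankel_rec[OF c' `d <= m`]
   using less.IH `d <= m` by (intro sum.cong refl) (auto intro!: arg_cong2[where f = "(*)"])
 qed
qed

lemma cyc_gram_eq:
 assumes c: "vs1.cyc_pair S om T q d u v" and c': "vs2.cyc_pair S' om' T' q d u' v'"
 shows "om (vs1.cyc_fam T d u v i) (vs1.cyc_fam T d u v j) = om' (vs2.cyc_fam T' d u' v' i) (vs2.cyc_fam T' d u' v' j)"
 using vs1.cyc_gram[OF c, of i j] vs2.cyc_gram[OF c', of i j] cyc_hankel_eq[OF c c']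
 by (cases "i < d"; cases "j < d") (simp_all add: not_less)

lemma cyc_gram_T_eq:
 assumes c: "vs1.cyc_pair S om T q d u v" and c': "vs2.cyc_pair S' om' T' q d u' v'" and i: "i < d + d"
 shows "om (T (vs1.cyc_fam T d u v i)) (vs1.cyc_fam T d u v j) = om' (T' (vs2.cyc_fam T' d u' v' i)) (vs2.cyc_fam T' d u' v' j)"
 unfolding vs1.cyc_T[OF c i] vs2.cyc_T[OF c' i] vs1.alt_bilin_sum[OF vs1.cp(12)[OF c]] vs2.alt_bilin_sum[OF vs2.cp(12)[OF c']]
  cyc_gram_eq[OF c c'] vs1.cyc_mat_def vs2.cyc_mat_def ..

text \<open>Induction on the dimension. The polynomial p and the exponent k are found from kernel
  dimensions, so they serve both operators; cyclic pairs for p^k have equal Gram matrices, and their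
  orthogonal complements again satisfy the hypothesis.\<close>

theorem sympl_op_classification:
 assumes two: "(2::'a) ~= 0"
 shows "vs1.sympl_op S om T ==> vs2.sympl_op S' om' T' ==>
  (!!p. vs1.dim (vs1.pker S T p) = vs2.dim (vs2.pker S' T' p)) ==>
  EX N e e'. vs1.basis_on S {..<N::nat} e & vs2.basis_on S' {..<N} e' &
   (ALL i<N. ALL j<N. om (e i) (e j) = om' (e' i) (e' j) & om (T (e i)) (e j) = om' (T' (e' i)) (e' j))"
proof (induction "vs1.dim S" arbitrary: S S' rule: less_induct)
 case less
 note s = less.prems(1) and s' = less.prems(2) and dm = less.prems(3)
 note sp = vs1.sympl_opD[OF s] and sp' = vs2.sympl_opD[OF s']
 have k0: "vs1.pker S T a = {0} \<longleftrightarrow> vs2.pker S' T' a = {0}" for a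
  using vs1.dim_0_iff[OF vs1.pker_fin_sub[OF sp(1,5)]] vs2.dim_0_iff[OF vs2.pker_fin_sub[OF sp'(1,5)]] dm by metis
 show ?case
 proof (cases "S = {0}")
  case True
  have "vs1.pker S T 0 = S" "vs2.pker S' T' 0 = S'" by (auto simp: vs1.pker_def vs2.pker_def vs1.pact_0 vs2.pact_0)
  hence S': "S' = {0}" using k0[of 0] True by simp
  have "vs1.basis_on S {..<0::nat} (%_. 0)" "vs2.basis_on S' {..<0::nat} (%_. 0)"
   unfolding vs1.basis_on_def vs2.basis_on_def vs1.indep_fam_def vs2.indep_fam_def True S' by simp_all
  thus ?thesis by (intro exI[of _ 0] exI[of _ "%_. 0"]) simp
 next
  case False
  obtain p where p: "lead_coeff p = 1" "0 < degree p" "vs1.pker S T p ~= {0}"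
   and inj: "!!a. a ~= 0 ==> degree a < degree p ==> vs1.pker S T a = {0}"
   using vs1.minimal_poly_exists[OF s False] by blast
  have p': "vs2.pker S' T' p ~= {0}" using p(3) k0 by simp
  have inj': "!!a. a ~= 0 ==> degree a < degree p ==> vs2.pker S' T' a = {0}" using inj k0 by simp
  define k where "k = (LEAST k. vs1.pker S T (p ^ k) = vs1.pker S T (p ^ Suc k))"
  have k: "vs1.pker S T (p ^ k) = vs1.pker S T (p ^ Suc k)"
   unfolding k_def using vs1.pker_power_stable_exists[OF s, of p] by (rule LeastI_ex)
  have kl: "vs1.pker S T (p ^ l) ~= vs1.pker S T (p ^ Suc l)" if "l < k" for l
   using that unfolding k_def by (rule not_less_Least)
  have st: "vs1.pker S T (p ^ l) = vs1.pker S T (p ^ Suc l) \<longleftrightarrow> vs2.pker S' T' (p ^ l) = vs2.pker S' T' (p ^ Suc l)" for l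
   unfolding vs1.pker_power_stable_iff[OF s] vs2.pker_power_stable_iff[OF s'] dm ..
  define q where "q = p ^ k"
  define d where "d = degree q"
  obtain u v where c: "vs1.cyc_pair S om T q d u v"
   using vs1.cyc_pair_exists[OF s p inj k kl two] unfolding q_def d_def by blast
  obtain u' v' where c': "vs2.cyc_pair S' om' T' q d u' v'"
   using vs2.cyc_pair_exists[OF s' p(1,2) p' inj' _ _ two, of k] k kl unfolding st q_def d_def by blast
  define E where "E = vs1.cyc_fam T d u v"
  define E' where "E' = vs2.cyc_fam T' d u' v'"
  let ?I = "{..<d + d}"
  let ?O = "vs1.orth S om ?I E" and ?O' = "vs2.orth S' om' ?I E'"
  have lt: "vs1.dim ?O < vs1.dim S" unfolding E_def by (rule vs1.dim_orth_less[OF c])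
  have sO: "vs1.sympl_op ?O om T" unfolding E_def by (rule vs1.cyc_orth_sympl_op[OF c])
  have sO': "vs2.sympl_op ?O' om' T'" unfolding E'_def by (rule vs2.cyc_orth_sympl_op[OF c'])
  have mats: "vs1.cyc_mat q d = vs2.cyc_mat q d" by (intro ext) (simp add: vs1.cyc_mat_def vs2.cyc_mat_def)
  have dM: "vs1.dim (vs1.pker (vs1.span (E ` ?I)) T a) = vs2.dim (vs2.pker (vs2.span (E' ` ?I)) T' a)" for a
  proof (rule pker_transfer[where t = "vs1.cyc_mat q d"])
   show "vs1.fin_sub (vs1.span (E ` ?I))" "vs2.fin_sub (vs2.span (E' ` ?I))"
    by (auto simp: vs1.fin_sub_def vs2.fin_sub_def)
   show "vs1.basis_on (vs1.span (E ` ?I)) ?I E" unfolding E_def by (rule vs1.cyc_span_basis[OF c])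
   show "vs2.basis_on (vs2.span (E' ` ?I)) ?I E'" unfolding E'_def by (rule vs2.cyc_span_basis[OF c'])
  next
   fix i assume "i : ?I"
   thus "T (E i) = (SUM j:?I. s1 (vs1.cyc_mat q d i j) (E j))" unfolding E_def by (intro vs1.cyc_T[OF c]) simp
  next
   fix i assume "i : ?I"
   thus "T' (E' i) = (SUM j:?I. s2 (vs1.cyc_mat q d i j) (E' j))" unfolding E'_def
    using vs2.cyc_T[OF c', of i] by (simp add: vs1.cyc_mat_def vs2.cyc_mat_def)
  qed (use sp(5) sp'(5) in auto)
  \<comment> \<open>Subtract the equal contributions of the two cyclic spaces, on which T and T'
    have the same matrix.\<close>
  have dO: "vs1.dim (vs1.pker ?O T a) = vs2.dim (vs2.pker ?O' T' a)" for a
   using vs1.cyc_pker_dim[OF c, of a] vs2.cyc_pker_dim[OF c', of a] dM[of a] dm[of a]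
   unfolding E_def[symmetric] E'_def[symmetric] by simp
  obtain N :: nat and e e' where e: "vs1.basis_on ?O {..<N} e" and e': "vs2.basis_on ?O' {..<N} e'"
   and g: "!!i j. i < N ==> j < N ==> om (e i) (e j) = om' (e' i) (e' j) & om (T (e i)) (e j) = om' (T' (e' i)) (e' j)"
   using less.hyps[OF lt sO sO' dO] by blast
  have b: "vs1.basis_on S (?I <+> {..<N}) (case_sum E e)"
   unfolding E_def by (rule vs1.orth_basis[OF vs1.cyc_facts[OF c] e[unfolded E_def]])
  have b': "vs2.basis_on S' (?I <+> {..<N}) (case_sum E' e')"
   unfolding E'_def by (rule vs2.orth_basis[OF vs2.cyc_facts[OF c'] e'[unfolded E'_def]])
  have eO: "e j : ?O" "T (e j) : ?O" if "j < N" for j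
   using vs1.basis_onD(2)[OF e, of j] vs1.sympl_opD(6)[OF sO] that by auto
  have eO': "e' j : ?O'" "T' (e' j) : ?O'" if "j < N" for j
   using vs2.basis_onD(2)[OF e', of j] vs2.sympl_opD(6)[OF sO'] that by auto
  have O0: "om x (E i) = 0" "om (E i) x = 0" if "x : ?O" "i < d + d" for x i
  proof -
   show "om x (E i) = 0" using that by (auto simp: vs1.orth_def)
   thus "om (E i) x = 0" by (rule vs1.alt_bilin_eq0[OF sp(3)])
  qed
  have O0': "om' x (E' i) = 0" "om' (E' i) x = 0" if "x : ?O'" "i < d + d" for x i
  proof -
   show "om' x (E' i) = 0" using that by (auto simp: vs2.orth_def)
   thus "om' (E' i) x = 0" by (rule vs2.alt_bilin_eq0[OF sp'(3)])
  qed
  have ES: "E i : S" "E' i : S'" for i unfolding E_def E'_def by (rule vs1.cyc_in[OF c], rule vs2.cyc_in[OF c'])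
  have TE: "om (T (E i)) x = 0" if "x : ?O" "T x : ?O" "i < d + d" for x i
   using sp(7)[OF ES(1), of x i] O0[OF that(2,3)] that(1) by (auto simp: vs1.orth_def)
  have TE': "om' (T' (E' i)) x = 0" if "x : ?O'" "T' x : ?O'" "i < d + d" for x i
   using sp'(7)[OF ES(2), of x i] O0'[OF that(2,3)] that(1) by (auto simp: vs2.orth_def)
  have gram: "om (case_sum E e x) (case_sum E e y) = om' (case_sum E' e' x) (case_sum E' e' y) &
    om (T (case_sum E e x)) (case_sum E e y) = om' (T' (case_sum E' e' x)) (case_sum E' e' y)"
   if x: "x : ?I <+> {..<N}" and y: "y : ?I <+> {..<N}" for x y
  proof (cases x; cases y)
   fix i j assume "x = Inl i" "y = Inl j"
   thus ?thesis using cyc_gram_eq[OF c c'] cyc_gram_T_eq[OF c c', of i j] x by (auto simp: E_def E'_def)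
  next
   fix i j assume "x = Inl i" "y = Inr j"
   thus ?thesis using x y O0(2) O0'(2) TE TE' eO eO' by auto
  next
   fix i j assume "x = Inr i" "y = Inl j"
   thus ?thesis using x y O0(1) O0'(1) eO eO' by auto
  next
   fix i j assume "x = Inr i" "y = Inr j"
   thus ?thesis using x y g by auto
  qed
  define h where "h = (%i. if i < d + d then Inl i else Inr (i - (d + d)) :: nat + nat)"
  have h: "bij_betw h {..<d + d + N} (?I <+> {..<N})"
   by (rule bij_betw_byWitness[where f' = "case_sum (%i. i) (%i. i + (d + d))"]) (auto simp: h_def)
  have hI: "h i : ?I <+> {..<N}" if "i < d + d + N" for i using that h by (auto simp: bij_betw_def)
  show ?thesis
   using vs1.basis_on_reindex[OF b h] vs2.basis_on_reindex[OF b' h] gram[OF hI hI]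
   by (intro exI[of _ "d + d + N"] exI[of _ "case_sum E e \<circ> h"] exI[of _ "case_sum E' e' \<circ> h"]) simp
 qed
qed

end

section \<open>Functionals and coordinate systems on spaces with explicit carrier\<close>

definition fscale :: "'k::times => ('v => 'k) => 'v => 'k" where
 "fscale c f = (%x. c * f x)"

lemma fscale_apply [simp]: "fscale c f x = c * f x"
 by (simp add: fscale_def)

interpretation fs: fam_space "fscale :: 'k::field => ('v => 'k) => 'v => 'k"
 by unfold_locales (auto simp: fun_eq_iff algebra_simps)

lemma sum_fun_apply: "(SUM i:I. f i) x = (SUM i:I. f i x)" for f :: "'i => 'v => 'k::comm_monoid_add"
 by (induction I rule: infinite_finite_induct) auto

definition zfun :: "('k::field, 'v) module => ('v => 'k) set" where
 "zfun V = {f. (ALL x. x \<notin> carrier V --> f x = 0) &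
   (ALL x:carrier V. ALL y:carrier V. f (x \<oplus>\<^bsub>V\<^esub> y) = f x + f y) & (ALL c. ALL x:carrier V. f (c \<odot>\<^bsub>V\<^esub> x) = c * f x)}"

text \<open>Functionals extended by zero, rather than extensionally, form a subspace of the function
 space with its pointwise operations.\<close>

definition zx :: "('k::field, 'v) module => ('v => 'k) => 'v => 'k" where
 "zx V av = (%x. if x : carrier V then av x else 0)"

abbreviation res :: "('k::field, 'v) module => ('v => 'k) => 'v => 'k" where
 "res V f \<equiv> restrict f (carrier V)"

lemma zfunI:
 "[|!!x. x \<notin> carrier V ==> f x = 0; !!x y. x : carrier V ==> y : carrier V ==> f (x \<oplus>\<^bsub>V\<^esub> y) = f x + f y;
  !!c x. x : carrier V ==> f (c \<odot>\<^bsub>V\<^esub> x) = c * f x|] ==> f : zfun V"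
 by (auto simp: zfun_def)

lemma zfunD:
 assumes "f : zfun V"
 shows "x \<notin> carrier V ==> f x = 0" "x : carrier V ==> y : carrier V ==> f (x \<oplus>\<^bsub>V\<^esub> y) = f x + f y"
  "x : carrier V ==> f (c \<odot>\<^bsub>V\<^esub> x) = c * f x"
 using assms by (auto simp: zfun_def)

lemma zfun_subspace: "fs.subspace (zfun V)"
 by (rule fs.subspaceI) (auto simp: zfun_def algebra_simps)

lemma zx_apply: "x : carrier V ==> zx V av x = av x"
 by (simp add: zx_def)

lemma functionals_iff: "av : functionals V \<longleftrightarrow> av : extensional (carrier V) &
  (ALL x:carrier V. ALL y:carrier V. av (x \<oplus>\<^bsub>V\<^esub> y) = av x + av y) & (ALL c. ALL x:carrier V. av (c \<odot>\<^bsub>V\<^esub> x) = c * av x)"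
 by (simp add: dual_space_def)

lemma vspaceD:
 assumes "vspace V"
 shows "\<zero>\<^bsub>V\<^esub> : carrier V" "x : carrier V ==> y : carrier V ==> x \<oplus>\<^bsub>V\<^esub> y : carrier V"
  "x : carrier V ==> c \<odot>\<^bsub>V\<^esub> x : carrier V"
proof -
 interpret vectorspace class_ring V by fact
 show "\<zero>\<^bsub>V\<^esub> : carrier V" "x : carrier V ==> y : carrier V ==> x \<oplus>\<^bsub>V\<^esub> y : carrier V" by auto
 show "x : carrier V ==> c \<odot>\<^bsub>V\<^esub> x : carrier V" using smult_closed[of c x] by simp
qed

lemma zx_zfun: "vspace V ==> av : functionals V ==> zx V av : zfun V"
 using vspaceD[of V] by (intro zfunI) (auto simp: zx_def functionals_iff)

lemma res_functional: "vspace V ==> f : zfun V ==> res V f : functionals V"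
 using vspaceD[of V] by (auto simp: functionals_iff zfun_def)

lemma res_zx: "av : functionals V ==> res V (zx V av) = av"
 unfolding functionals_iff by (auto simp: fun_eq_iff zx_def extensional_def)

lemma zfun_zero: "vspace V ==> f : zfun V ==> f \<zero>\<^bsub>V\<^esub> = 0"
proof -
 assume V: "vspace V" and f: "f : zfun V"
 interpret vectorspace class_ring V by fact
 have "f (\<zero>\<^bsub>V\<^esub> \<oplus>\<^bsub>V\<^esub> \<zero>\<^bsub>V\<^esub>) = f \<zero>\<^bsub>V\<^esub> + f \<zero>\<^bsub>V\<^esub>" using f by (intro zfunD) auto
 hence "f \<zero>\<^bsub>V\<^esub> = f \<zero>\<^bsub>V\<^esub> + f \<zero>\<^bsub>V\<^esub>" by simp
 thus ?thesis by (metis add_cancel_right_right)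
qed

lemma zfun_finsum:
 assumes V: "vspace V" and "finite I" "!!i. i : I ==> g i : carrier V"
 shows "finsum V g I : carrier V" "f : zfun V ==> f (finsum V g I) = (SUM i:I. f (g i))"
proof -
 interpret vectorspace class_ring V by fact
 show cl: "finsum V g I : carrier V" using assms(3) by (intro finsum_closed) auto
 show "f (finsum V g I) = (SUM i:I. f (g i))" if f: "f : zfun V"
  using assms(2,3)
 proof (induction I rule: finite_induct)
  case empty
  thus ?case using zfun_zero[OF V f] by simp
 next
  case (insert i I)
  hence "finsum V g (insert i I) = g i \<oplus>\<^bsub>V\<^esub> finsum V g I" by (intro finsum_insert) auto
  moreover have "finsum V g I : carrier V" using insert.prems by (intro finsum_closed) auto
  ultimately show ?case using insert f by (simp add: zfunD(2))
 qed
qed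

text \<open>The vector space axioms are equations, and they hold after the embedding x |-> (f |-> f
  x) into a function space.\<close>

lemma vspace_sep:
 fixes V :: "('k::field, 'v) module"
 assumes z: "\<zero>\<^bsub>V\<^esub> : carrier V" and a: "!!x y. x : carrier V ==> y : carrier V ==> x \<oplus>\<^bsub>V\<^esub> y : carrier V"
  and m: "!!c x. x : carrier V ==> c \<odot>\<^bsub>V\<^esub> x : carrier V"
  and F: "!!f. f : F ==> f : zfun V" "!!f. f : F ==> f \<zero>\<^bsub>V\<^esub> = 0"
  and sep: "!!x y. x : carrier V ==> y : carrier V ==> (!!f. f : F ==> f x = f y) ==> x = y"
 shows "vspace V"
proof -
 define E where "E x = (%f. if f : F then f x else 0)" for x
 have E: "E (x \<oplus>\<^bsub>V\<^esub> y) = E x + E y" "E (c \<odot>\<^bsub>V\<^esub> x) = fscale c (E x)" "E \<zero>\<^bsub>V\<^esub> = 0"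
  if "x : carrier V" "y : carrier V" for x y c
  using zfunD(2,3)[OF F(1)] F(2) that by (auto simp: E_def fun_eq_iff)
 have E1: "E (c \<odot>\<^bsub>V\<^esub> x) = fscale c (E x)" if "x : carrier V" for x c using E(2)[OF that that] .
 have E0: "E \<zero>\<^bsub>V\<^esub> = 0" using E(3)[OF z z] .
 have inj: "x = y" if "E x = E y" "x : carrier V" "y : carrier V" for x y
  using that by (intro sep) (auto simp: E_def fun_eq_iff split: if_splits)
 show ?thesis
 proof (rule vs_criteria[OF class_field])
  show "ALL v:carrier V. EX neg_v:carrier V. v \<oplus>\<^bsub>V\<^esub> neg_v = \<zero>\<^bsub>V\<^esub>"
  proof
   fix v assume v: "v : carrier V"
   have "v \<oplus>\<^bsub>V\<^esub> ((-1) \<odot>\<^bsub>V\<^esub> v) = \<zero>\<^bsub>V\<^esub>"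
    using v z a m by (intro inj) (auto simp: E(1) E1 E0 fun_eq_iff)
   thus "EX neg_v:carrier V. v \<oplus>\<^bsub>V\<^esub> neg_v = \<zero>\<^bsub>V\<^esub>" using m[OF v] by blast
  qed
 qed (use z a m in \<open>auto intro!: inj simp: E(1) E1 E0 fun_eq_iff algebra_simps\<close>)
qed

text \<open>A finite coordinate system: the joint map of the functionals \<open>f i\<close> is a
  bijection of the carrier onto all families of scalars on I. It stands for a basis of the space and
  a basis of its dual at once.\<close>

definition frame :: "('k::field, 'v) module => 'i set => ('i => 'v => 'k) => bool" where
 "frame V I f \<longleftrightarrow> finite I & (ALL i:I. f i : zfun V) &
   (ALL x:carrier V. ALL y:carrier V. (ALL i:I. f i x = f i y) --> x = y) & (ALL c. EX x:carrier V. ALL i:I. f i x = c i)"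

lemma frameD:
 assumes "frame V I f"
 shows "finite I" "i : I ==> f i : zfun V"
  "x : carrier V ==> y : carrier V ==> (!!i. i : I ==> f i x = f i y) ==> x = y"
  "EX x:carrier V. ALL i:I. f i x = c i"
 using assms unfolding frame_def by blast+

lemma frame_dual:
 assumes "frame V I f"
 shows "EX e. ALL i:I. e i : carrier V & (ALL j:I. f j (e i) = (if j = i then 1 else 0))"
proof -
 have "EX x. x : carrier V & (ALL j:I. f j x = (if j = i then 1 else 0))" for i
  using frameD(4)[OF assms, of "%j. if j = i then 1 else 0"] by blast
 thus ?thesis by metis
qed

lemma frame_expand:
 assumes V: "vspace V" and f: "frame V I f" and e: "!!i. i : I ==> e i : carrier V"
  "!!i j. i : I ==> j : I ==> f j (e i) = (if j = i then 1 else 0)"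
  and g: "g : zfun V" and x: "x : carrier V"
 shows "g x = (SUM i:I. f i x * g (e i))" "x = (\<Oplus>\<^bsub>V\<^esub>i\<in>I. f i x \<odot>\<^bsub>V\<^esub> e i)"
proof -
 let ?y = "\<Oplus>\<^bsub>V\<^esub>i\<in>I. f i x \<odot>\<^bsub>V\<^esub> e i"
 have cl: "f i x \<odot>\<^bsub>V\<^esub> e i : carrier V" if "i : I" for i using vspaceD(3)[OF V e(1)[OF that]] .
 have h: "h ?y = (SUM i:I. f i x * h (e i))" if "h : zfun V" for h
  using zfun_finsum(2)[OF V frameD(1)[OF f] cl that] zfunD(3)[OF that e(1)] by simp
 show "x = ?y"
 proof (rule frameD(3)[OF f x zfun_finsum(1)[OF V frameD(1)[OF f] cl]])
  fix j assume j: "j : I"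
  have "f j ?y = (SUM i:I. if i = j then f j x else 0)"
   unfolding h[OF frameD(2)[OF f j]] using e(2)[OF _ j] by (intro sum.cong) auto
  thus "f j x = f j ?y" using j frameD(1)[OF f] by simp
 qed
 thus "g x = (SUM i:I. f i x * g (e i))" using h[OF g] by simp
qed

lemma frame_basis_on:
 assumes V: "vspace V" and f: "frame V I f"
 shows "fs.basis_on (zfun V) I f"
proof -
 obtain e where e: "!!i. i : I ==> e i : carrier V" "!!i j. i : I ==> j : I ==> f j (e i) = (if j = i then 1 else 0)"
  using frame_dual[OF f] by blast
 show ?thesis unfolding fs.basis_on_def fs.indep_fam_def
 proof (intro conjI ballI allI impI)
  fix c i assume z: "(SUM i:I. fscale (c i) (f i)) = 0" and i: "i : I"
  have "(SUM j:I. fscale (c j) (f j)) (e i) = (SUM j:I. if j = i then c i else 0)"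
   unfolding sum_fun_apply using e(2)[OF i] by (intro sum.cong) auto
  thus "c i = 0" using z i frameD(1)[OF f] by simp
 next
  fix g assume g: "g : zfun V"
  have "g = (SUM i:I. fscale (g (e i)) (f i))"
  proof
   fix x show "g x = (SUM i:I. fscale (g (e i)) (f i)) x"
    using frame_expand(1)[OF V f e g] zfunD(1)[OF g] zfunD(1)[OF frameD(2)[OF f]]
    by (cases "x : carrier V") (simp_all add: sum_fun_apply mult.commute)
  qed
  thus "EX c. g = (SUM i:I. fscale (c i) (f i))" by (intro exI[of _ "%i. g (e i)"])
 qed (use frameD[OF f] in auto)
qed

text \<open>The point with coordinates \<open>ph (f i)\<close> represents \<open>ph\<close>, because
  the frame spans the functionals.\<close>

lemma bidual:
 assumes V: "vspace V" and f: "frame V I f" and ph: "fs.linfun ph"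
 shows "EX x:carrier V. ALL g:zfun V. g x = ph g"
proof -
 obtain x where x: "x : carrier V" "ALL i:I. f i x = ph (f i)" using frameD(4)[OF f, of "%i. ph (f i)"] by blast
 have "g x = ph g" if g: "g : zfun V" for g
 proof -
  obtain c where "g = (SUM i:I. fscale (c i) (f i))" using fs.basis_onD(4)[OF frame_basis_on[OF V f] g] by blast
  thus ?thesis using x by (simp add: sum_fun_apply fs.linfun_sum[OF ph])
 qed
 thus ?thesis using x(1) by blast
qed

lemma zfun_separates:
 assumes "frame V I f" "x : carrier V" "y : carrier V" "!!g. g : zfun V ==> g x = g y"
 shows "x = y"
 using frameD(3)[OF assms(1-3)] frameD(2)[OF assms(1)] assms(4) by blast

text \<open>Arbitrary values on the basis extend to a functional on functionals, and by reflexivity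
  that is evaluation at a point. The frame \<open>h\<close> provides the finite dimension.\<close>

lemma basis_on_frame:
 assumes V: "vspace V" and h: "frame V J h" and f: "fs.basis_on (zfun V) I f"
 shows "frame V I f"
 unfolding frame_def
proof (intro conjI ballI allI impI)
 fix x y assume xy: "x : carrier V" "y : carrier V" "ALL i:I. f i x = f i y"
 show "x = y"
 proof (rule zfun_separates[OF h xy(1,2)])
  fix g assume "g : zfun V"
  then obtain c where "g = (SUM i:I. fscale (c i) (f i))" using fs.basis_onD(4)[OF f] by blast
  thus "g x = g y" using xy(3) by (simp add: sum_fun_apply)
 qed
next
 fix c
 obtain ph where ph: "fs.linfun ph" "!!i. i : I ==> ph (f i) = c i"
  using fs.linfun_extend[OF fs.basis_onD(1,3)[OF f], of c] by blast
 obtain x where "x : carrier V" "ALL g:zfun V. g x = ph g" using bidual[OF V h ph(1)] by blast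
 thus "EX x:carrier V. ALL i:I. f i x = c i" using ph(2) fs.basis_onD(2)[OF f] by auto
qed (use fs.basis_onD[OF f] in auto)

lemma basis_family_frame:
 assumes V: "vspace V" and I: "finite I" and e: "basis_family V I e"
 shows "EX f. frame V I f & (ALL i:I. e i : carrier V & (ALL j:I. f j (e i) = (if j = i then 1 else 0)))"
proof -
 interpret vectorspace class_ring V by fact
 have b: "basis (e ` I)" and inj: "inj_on e I" using e by (auto simp: basis_family_def)
 have eV: "e i : carrier V" if "i : I" for i using b that by (auto simp: basis_def)
 have fin: "finite (e ` I)" using I by simp
 define L where "L a = lincomb a (e ` I)" for a
 have ex: "EX! a. a : e ` I \<rightarrow>\<^sub>E UNIV & L a = v" if "v : carrier V" for v
 proof -
  have "e ` I <= carrier V" using eV by auto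
  from basis_criterion[OF fin this] show ?thesis using b that unfolding L_def by simp
 qed
 have Lc: "L a : carrier V" for a unfolding L_def using eV by (intro lincomb_closed) auto
 define co where "co v = (THE a. a : e ` I \<rightarrow>\<^sub>E UNIV & L a = v)" for v
 have co: "co v : e ` I \<rightarrow>\<^sub>E UNIV" "L (co v) = v" if "v : carrier V" for v
  using theI'[OF ex[OF that]] by (auto simp: co_def)
 have co_eq: "co v x = a x" if "v : carrier V" "L a = v" "x : e ` I" for v a x
 proof -
  have "L (restrict a (e ` I)) = L a" unfolding L_def
   using eV by (intro lincomb_cong refl) auto
  hence "restrict a (e ` I) : e ` I \<rightarrow>\<^sub>E UNIV & L (restrict a (e ` I)) = v" using that(2) by auto
  hence "co v = restrict a (e ` I)" using ex[OF that(1)] co[OF that(1)] by blast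
  thus ?thesis using that(3) by simp
 qed
 have Ladd: "L (%x. a x + b x) = L a \<oplus>\<^bsub>V\<^esub> L b" for a b
  using lincomb_sum[OF fin _ , of a b] eV unfolding L_def by (auto simp: image_subset_iff Pi_iff)
 have Lsm: "L (%x. c * a x) = c \<odot>\<^bsub>V\<^esub> L a" for a c
  using lincomb_smult[of "e ` I" a c] eV unfolding L_def by (auto simp: image_subset_iff Pi_iff)
 define f where "f i v = (if v : carrier V then co v (e i) else 0)" for i v
 have fz: "f i : zfun V" if i: "i : I" for i
 proof (rule zfunI)
  fix x y assume xy: "x : carrier V" "y : carrier V"
  have "co (x \<oplus>\<^bsub>V\<^esub> y) (e i) = co x (e i) + co y (e i)"
   by (rule co_eq) (use xy i Ladd co in auto)
  thus "f i (x \<oplus>\<^bsub>V\<^esub> y) = f i x + f i y" using xy by (simp add: f_def)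
 next
  fix c x assume x: "x : carrier V"
  have "co (c \<odot>\<^bsub>V\<^esub> x) (e i) = c * co x (e i)"
   by (rule co_eq) (use x i Lsm co smult_closed[of c x] in auto)
  thus "f i (c \<odot>\<^bsub>V\<^esub> x) = c * f i x" using x smult_closed[of c x] by (simp add: f_def)
 qed (simp add: f_def)
 have fe: "f j (e i) = (if j = i then 1 else 0)" if ij: "i : I" "j : I" for i j
 proof -
  have "L (%x. if x = e i then 1 else 0) = e i"
   unfolding L_def lincomb_def
  proof -
   have "(\<Oplus>\<^bsub>V\<^esub>v\<in>e ` I. (if v = e i then 1 else 0) \<odot>\<^bsub>V\<^esub> v) = (\<Oplus>\<^bsub>V\<^esub>v\<in>e ` I. if e i = v then v else \<zero>\<^bsub>V\<^esub>)"
    using eV lmult_0 smult_one by (intro finsum_cong') auto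
   also have "... = e i" by (rule finsum_singleton) (use ij fin eV in auto)
   finally show "(\<Oplus>\<^bsub>V\<^esub>v\<in>e ` I. (if v = e i then 1 else 0) \<odot>\<^bsub>V\<^esub> v) = e i" .
  qed
  hence "co (e i) (e j) = (if e j = e i then 1 else 0)" using eV ij by (intro co_eq) auto
  thus ?thesis using inj ij eV by (auto simp: f_def inj_on_def)
 qed
 have "frame V I f" unfolding frame_def
 proof (intro conjI ballI allI impI)
  fix x y assume xy: "x : carrier V" "y : carrier V" "ALL i:I. f i x = f i y"
  have "co x = co y" using co(1)[OF xy(1)] co(1)[OF xy(2)] xy
   by (intro extensionalityI[of _ "e ` I"]) (auto simp: f_def PiE_def)
  thus "x = y" using co(2) xy by metis
 next
  fix c
  have "f i (L (%x. c (inv_into I e x))) = c i" if "i : I" for i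
   using co_eq[OF Lc refl, of "e i" "%x. c (inv_into I e x)"] that Lc inj by (simp add: f_def)
  thus "EX x:carrier V. ALL i:I. f i x = c i" using Lc by blast
 qed (use I fz in auto)
 thus ?thesis using fe eV by blast
qed

lemma frame_basis_family:
 assumes V: "vspace V" and f: "frame V I f" and e: "!!i. i : I ==> e i : carrier V"
  "!!i j. i : I ==> j : I ==> f j (e i) = (if j = i then 1 else 0)"
 shows "basis_family V I e"
proof -
 interpret vectorspace class_ring V by fact
 have fin: "finite I" using frameD(1)[OF f] .
 have inj: "inj_on e I" by (rule inj_onI) (metis e(2) zero_neq_one)
 have fl: "g (lincomb a (e ` I)) = (SUM i:I. a (e i) * g (e i))" if "g : zfun V" for g a
 proof -
  have "g (lincomb a (e ` I)) = (SUM x:e ` I. g (a x \<odot>\<^bsub>V\<^esub> x))"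
   unfolding lincomb_def using fin vspaceD(3)[OF V e(1)] that by (intro zfun_finsum[OF V]) auto
  also have "... = (SUM i:I. a (e i) * g (e i))"
   using inj e(1) zfunD(3)[OF that] by (simp add: sum.reindex)
  finally show ?thesis .
 qed
 have fj: "f j (lincomb a (e ` I)) = a (e j)" if j: "j : I" for j a
 proof -
  have "f j (lincomb a (e ` I)) = (SUM i:I. if i = j then a (e j) else 0)"
   unfolding fl[OF frameD(2)[OF f j]] using e(2)[OF _ j] by (intro sum.cong) auto
  thus ?thesis using j fin by simp
 qed
 have cl: "lincomb a (e ` I) : carrier V" for a using e(1) by (intro lincomb_closed) auto
 have "basis (e ` I)"
 proof (subst basis_criterion)
  show "ALL v. v : carrier V --> (EX! a. a : e ` I \<rightarrow>\<^sub>E carrier class_ring & lincomb a (e ` I) = v)"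
  proof (intro allI impI)
   fix v assume v: "v : carrier V"
   let ?a = "\<lambda>x\<in>e ` I. f (inv_into I e x) v"
   have "lincomb ?a (e ` I) = v"
    by (rule frameD(3)[OF f cl v]) (simp add: fj inj)
   moreover have "b = ?a" if "b : e ` I \<rightarrow>\<^sub>E carrier class_ring" "lincomb b (e ` I) = v" for b
    using that fj[of _ b] inj by (intro extensionalityI[of _ "e ` I"]) (auto simp: PiE_def)
   ultimately show "EX! a. a : e ` I \<rightarrow>\<^sub>E carrier class_ring & lincomb a (e ` I) = v"
    by (intro ex1I[of _ ?a]) auto
  qed
 qed (use fin e(1) in auto)
 thus ?thesis using inj by (simp add: basis_family_def)
qed

lemma frame_dim:
 assumes V: "vspace V" and f: "frame V I f"
 shows "vdim V = card I" "vfin_dim V"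
proof -
 interpret vectorspace class_ring V by fact
 obtain e where e: "!!i. i : I ==> e i : carrier V" "!!i j. i : I ==> j : I ==> f j (e i) = (if j = i then 1 else 0)"
  using frame_dual[OF f] by blast
 have b: "inj_on e I" "basis (e ` I)" using frame_basis_family[OF V f e] by (auto simp: basis_family_def)
 have fin: "finite (e ` I)" using frameD(1)[OF f] by simp
 show "vdim V = card I" using dim_basis[OF fin b(2)] b(1) by (simp add: card_image)
 show "vfin_dim V" using fin b(2) unfolding fin_dim_def basis_def by blast
qed

lemma fin_dim_frame:
 assumes V: "vspace V" and "vfin_dim V"
 shows "EX N f. frame V {..<N::nat} f"
proof -
 interpret vectorspace class_ring V by fact
 obtain A where A: "finite A" "basis A" using finite_basis_exists assms(2) by blast
 have "basis_family V A (%x. x)" using A by (simp add: basis_family_def)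
 then obtain f where f: "frame V A f" using basis_family_frame[OF V A(1)] by blast
 have "fs.fin_sub (zfun V)" by (rule fs.basis_on_fin_sub[OF zfun_subspace frame_basis_on[OF V f]])
 then obtain N and g :: "nat => _" where "fs.basis_on (zfun V) {..<N} g" by (rule fs.basis_on_exists)
 thus ?thesis using basis_on_frame[OF V f] by blast
qed

lemma zfun_fin_sub: "vspace V ==> vfin_dim V ==> fs.fin_sub (zfun V)"
 using fin_dim_frame fs.basis_on_fin_sub[OF zfun_subspace frame_basis_on] by blast

lemma dual_space_simps [simp]:
 "\<zero>\<^bsub>dual_space V\<^esub> = (\<lambda>x\<in>carrier V. 0)" "av \<oplus>\<^bsub>dual_space V\<^esub> bv = (\<lambda>x\<in>carrier V. av x + bv x)"
 "c \<odot>\<^bsub>dual_space V\<^esub> av = (\<lambda>x\<in>carrier V. c * av x)"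
 by (simp_all add: dual_space_def)

lemma functional_eqI:
 "av : functionals V ==> bv : functionals V ==> (!!x. x : carrier V ==> av x = bv x) ==> av = bv"
 unfolding functionals_iff by (rule extensionalityI) auto

definition eval_fun :: "('k::field, 'v) module => 'v => ('v => 'k) => 'k" where
 "eval_fun V x av = (if av : functionals V then av x else 0)"

lemma dual_closed:
 assumes "vspace V"
 shows "\<zero>\<^bsub>dual_space V\<^esub> : functionals V"
  "av : functionals V ==> bv : functionals V ==> av \<oplus>\<^bsub>dual_space V\<^esub> bv : functionals V"
  "av : functionals V ==> c \<odot>\<^bsub>dual_space V\<^esub> av : functionals V"
 using vspaceD[OF assms] by (auto simp: functionals_iff algebra_simps)

lemma eval_fun_zfun: "vspace V ==> x : carrier V ==> eval_fun V x : zfun (dual_space V)"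
 using dual_closed[of V] by (intro zfunI) (auto simp: eval_fun_def)

lemma dual_vspace: "vspace V ==> vspace (dual_space V)"
proof (rule vspace_sep[where F = "eval_fun V ` carrier V"])
 assume V: "vspace V"
 show "\<zero>\<^bsub>dual_space V\<^esub> : functionals V" using dual_closed(1)[OF V] .
 show "!!f. f : eval_fun V ` carrier V ==> f : zfun (dual_space V)" using eval_fun_zfun[OF V] by auto
 show "f \<zero>\<^bsub>dual_space V\<^esub> = 0" if "f : eval_fun V ` carrier V" for f
  using that dual_closed(1)[OF V] by (auto simp: eval_fun_def)
 fix av bv assume ab: "av : functionals V" "bv : functionals V" "!!f. f : eval_fun V ` carrier V ==> f av = f bv"
 show "av = bv"
 proof (rule functional_eqI[OF ab(1,2)])
  fix x assume "x : carrier V"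
  thus "av x = bv x" using ab(3)[of "eval_fun V x"] ab(1,2) by (simp add: eval_fun_def)
 qed
qed (use dual_closed in blast)+

lemma dual_frame:
 assumes V: "vspace V" and f: "frame V I f" and e: "!!i. i : I ==> e i : carrier V"
  "!!i j. i : I ==> j : I ==> f j (e i) = (if j = i then 1 else 0)"
 shows "frame (dual_space V) I (%i. eval_fun V (e i))"
 unfolding frame_def
proof (intro conjI ballI allI impI)
 fix av bv assume ab: "av : functionals V" "bv : functionals V" "ALL i:I. eval_fun V (e i) av = eval_fun V (e i) bv"
 show "av = bv"
 proof (rule functional_eqI[OF ab(1,2)])
  fix x assume x: "x : carrier V"
  have "zx V ga x = (SUM i:I. f i x * ga (e i))" if "ga : functionals V" for ga
   using frame_expand(1)[OF V f e zx_zfun[OF V that] x] e(1) by (simp add: zx_apply)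
  note ex = this
  have "(SUM i:I. f i x * av (e i)) = (SUM i:I. f i x * bv (e i))"
   using ab by (intro sum.cong) (auto simp: eval_fun_def)
  thus "av x = bv x" using ex[OF ab(1)] ex[OF ab(2)] x by (simp add: zx_apply)
 qed
next
 fix c
 let ?g = "SUM i:I. fscale (c i) (f i)"
 have g: "?g : zfun V" using frameD(2)[OF f] by (auto intro!: fs.subspace_sum[OF zfun_subspace] fs.subspace_scale[OF zfun_subspace])
 have "eval_fun V (e i) (res V ?g) = c i" if i: "i : I" for i
 proof -
  have "eval_fun V (e i) (res V ?g) = (SUM j:I. c j * f j (e i))"
   using res_functional[OF V g] e(1)[OF i] by (simp add: eval_fun_def sum_fun_apply)
  also have "... = (SUM j:I. if j = i then c i else 0)" using e(2)[OF i] by (intro sum.cong) auto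
  finally show ?thesis using i frameD(1)[OF f] by simp
 qed
 thus "EX av:functionals V. ALL i:I. eval_fun V (e i) av = c i" using res_functional[OF V g] by blast
qed (use frameD(1)[OF f] eval_fun_zfun[OF V e(1)] in auto)

lemma frame_dual_basis_family:
 assumes V: "vspace V" and f: "frame V I f"
 shows "basis_family (dual_space V) I (%i. res V (f i))"
proof -
 obtain e where e: "!!i. i : I ==> e i : carrier V" "!!i j. i : I ==> j : I ==> f j (e i) = (if j = i then 1 else 0)"
  using frame_dual[OF f] by blast
 show ?thesis
  by (rule frame_basis_family[OF dual_vspace[OF V] dual_frame[OF V f e]])
   (use e res_functional[OF V frameD(2)[OF f]] in \<open>auto simp: eval_fun_def\<close>)
qed

text \<open>Converse of \<open>frame_dual_basis_family\<close>. It turns the basis of covectors in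
  the definition of a Veronese web into coordinates on the space itself.\<close>

lemma dual_basis_family_frame:
 assumes V: "vspace V" and h: "frame V J h" and I: "finite I" and g: "basis_family (dual_space V) I g"
 shows "frame V I (%i. zx V (g i))"
proof -
 note Vd = dual_vspace[OF V]
 obtain F where F: "frame (dual_space V) I F" and gF: "!!i. i : I ==> g i : functionals V"
  "!!i j. i : I ==> j : I ==> F j (g i) = (if j = i then 1 else 0)"
  using basis_family_frame[OF Vd I g] by blast
 have sc: "c \<odot>\<^bsub>dual_space V\<^esub> g i : functionals V" if "i : I" for c i by (rule vspaceD(3)[OF Vd gF(1)[OF that]])
 have cl: "(\<Oplus>\<^bsub>dual_space V\<^esub>i\<in>I. c i \<odot>\<^bsub>dual_space V\<^esub> g i) : functionals V" for c
  by (rule zfun_finsum(1)[OF Vd I sc])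
 have ev: "(\<Oplus>\<^bsub>dual_space V\<^esub>i\<in>I. c i \<odot>\<^bsub>dual_space V\<^esub> g i) x = (SUM i:I. c i * g i x)" if x: "x : carrier V" for c x
 proof -
  have "eval_fun V x (\<Oplus>\<^bsub>dual_space V\<^esub>i\<in>I. c i \<odot>\<^bsub>dual_space V\<^esub> g i) = (SUM i:I. eval_fun V x (c i \<odot>\<^bsub>dual_space V\<^esub> g i))"
   by (rule zfun_finsum(2)[OF Vd I sc eval_fun_zfun[OF V x]])
  also have "... = (SUM i:I. c i * g i x)" using sc x by (intro sum.cong) (auto simp: eval_fun_def)
  finally show ?thesis using cl[of c] by (simp add: eval_fun_def)
 qed
 have "fs.basis_on (zfun V) I (%i. zx V (g i))"
  unfolding fs.basis_on_def fs.indep_fam_def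
 proof (intro conjI ballI allI impI)
  fix c j assume z: "(SUM i:I. fscale (c i) (zx V (g i))) = 0" and j: "j : I"
  let ?a = "\<Oplus>\<^bsub>dual_space V\<^esub>i\<in>I. c i \<odot>\<^bsub>dual_space V\<^esub> g i"
  have "?a x = 0" if x: "x : carrier V" for x
   using fun_cong[OF z, of x] x unfolding ev[OF x] by (simp add: sum_fun_apply zx_apply)
  hence "?a = \<zero>\<^bsub>dual_space V\<^esub>" by (intro functional_eqI[OF cl dual_closed(1)[OF V]]) simp
  hence "F j ?a = 0" using zfun_zero[OF Vd frameD(2)[OF F j]] by simp
  moreover have "F j ?a = (SUM i:I. F j (c i \<odot>\<^bsub>dual_space V\<^esub> g i))"
   by (rule zfun_finsum(2)[OF Vd I sc frameD(2)[OF F j]])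
  moreover have "... = (SUM i:I. if i = j then c j else 0)"
  proof (rule sum.cong[OF refl])
   fix i assume i: "i : I"
   have "F j (c i \<odot>\<^bsub>dual_space V\<^esub> g i) = c i * F j (g i)" by (rule zfunD(3)[OF frameD(2)[OF F j] gF(1)[OF i]])
   thus "F j (c i \<odot>\<^bsub>dual_space V\<^esub> g i) = (if i = j then c j else 0)" using gF(2)[OF i j] by auto
  qed
  ultimately show "c j = 0" using j I by simp
 next
  fix f assume f: "f : zfun V"
  note rf = res_functional[OF V f]
  have rfe: "res V f = (\<Oplus>\<^bsub>dual_space V\<^esub>i\<in>I. F i (res V f) \<odot>\<^bsub>dual_space V\<^esub> g i)"
   by (rule frame_expand(2)[OF Vd F gF eval_fun_zfun[OF V vspaceD(1)[OF V]] rf])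
  have fx: "f x = (SUM i:I. F i (res V f) * g i x)" if "x : carrier V" for x
   using fun_cong[OF rfe, of x] that unfolding ev[OF that] by simp
  have "f = (SUM i:I. fscale (F i (res V f)) (zx V (g i)))"
  proof
   fix x show "f x = (SUM i:I. fscale (F i (res V f)) (zx V (g i))) x"
    using fx[of x] zfunD(1)[OF f, of x] by (cases "x : carrier V") (simp_all add: sum_fun_apply zx_def)
  qed
  thus "EX c. f = (SUM i:I. fscale (c i) (zx V (g i)))" by (intro exI[of _ "%i. F i (res V f)"])
 qed (use I zx_zfun[OF V gF(1)] in auto)
 thus ?thesis by (rule basis_on_frame[OF V h])
qed

lemma dual_basis_eq:
 assumes V: "vspace V" and f: "frame V I f" and e: "!!i. i : I ==> e i : carrier V"
  "!!i j. i : I ==> j : I ==> f j (e i) = (if j = i then 1 else 0)" and i: "i : I"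
 shows "dual_basis V I e i = res V (f i)"
 unfolding dual_basis_def
proof (rule the_equality)
 show "res V (f i) : functionals V & (ALL j:I. res V (f i) (e j) = (if j = i then 1 else 0))"
  using res_functional[OF V frameD(2)[OF f i]] e i by auto
 fix av assume a: "av : functionals V & (ALL j:I. av (e j) = (if j = i then 1 else 0))"
 show "av = res V (f i)"
 proof (rule functional_eqI)
  fix x assume x: "x : carrier V"
  have "zx V av x = (SUM j:I. f j x * av (e j))"
   using frame_expand(1)[OF V f e zx_zfun[OF V] x] a e(1) by (simp add: zx_apply)
  also have "... = (SUM j:I. if j = i then f i x else 0)" using a by (intro sum.cong) auto
  finally show "av x = res V (f i) x" using x i frameD(1)[OF f] by (simp add: zx_apply)
 qed (use a res_functional[OF V frameD(2)[OF f i]] in auto)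
qed

definition ann :: "('k::field, 'v) module => ('v => 'k) set => 'v set" where
 "ann V X = {w : carrier V. ALL u:X. u w = 0}"

definition cut :: "'v set => ('v => 'k::zero) => 'v => 'k" where
 "cut S f = (%x. if x : S then f x else 0)"

lemma cut_zfun:
 assumes "f : zfun V" "S <= carrier V" "!!x y. x : S ==> y : S ==> x \<oplus>\<^bsub>V\<^esub> y : S" "!!c x. x : S ==> c \<odot>\<^bsub>V\<^esub> x : S"
 shows "cut S f : zfun (on_subspace V S)"
proof (rule zfunI)
 fix x y assume "x : carrier (on_subspace V S)" "y : carrier (on_subspace V S)"
 thus "cut S f (x \<oplus>\<^bsub>on_subspace V S\<^esub> y) = cut S f x + cut S f y"
  using assms(2,3) zfunD(2)[OF assms(1), of x y] by (auto simp: cut_def)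
next
 fix c x assume "x : carrier (on_subspace V S)"
 thus "cut S f (c \<odot>\<^bsub>on_subspace V S\<^esub> x) = c * cut S f x"
  using assms(2,4) zfunD(3)[OF assms(1), of x c] by (auto simp: cut_def)
qed (simp add: cut_def)

lemma on_subspace_vspace:
 assumes V: "vspace V" and h: "frame V J h" and S: "S <= carrier V" "\<zero>\<^bsub>V\<^esub> : S"
  "!!x y. x : S ==> y : S ==> x \<oplus>\<^bsub>V\<^esub> y : S" "!!c x. x : S ==> c \<odot>\<^bsub>V\<^esub> x : S"
 shows "vspace (on_subspace V S)"
proof (rule vspace_sep[where F = "cut S ` (h ` J)"])
 show "!!f. f : cut S ` h ` J ==> f : zfun (on_subspace V S)" using cut_zfun[OF frameD(2)[OF h] S(1,3,4)] by auto
 show "!!f. f : cut S ` h ` J ==> f \<zero>\<^bsub>on_subspace V S\<^esub> = 0"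
  using zfun_zero[OF V frameD(2)[OF h]] by (auto simp: cut_def)
 fix x y assume xy: "x : carrier (on_subspace V S)" "y : carrier (on_subspace V S)"
  "!!f. f : cut S ` h ` J ==> f x = f y"
 have "h i x = h i y" if "i : J" for i using xy(3)[of "cut S (h i)"] xy(1,2) that by (simp add: cut_def)
 thus "x = y" using xy(1,2) S(1) by (intro frameD(3)[OF h]) auto
qed (use S in auto)

lemma ann_closed:
 assumes V: "vspace V" and X: "X <= zfun V"
 shows "ann V X <= carrier V" "\<zero>\<^bsub>V\<^esub> : ann V X" "!!x y. x : ann V X ==> y : ann V X ==> x \<oplus>\<^bsub>V\<^esub> y : ann V X"
  "!!c x. x : ann V X ==> c \<odot>\<^bsub>V\<^esub> x : ann V X"
 using vspaceD[OF V] zfun_zero[OF V] X by (auto simp: ann_def subset_iff zfunD)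

lemma ann_vspace: "vspace V ==> frame V J h ==> X <= zfun V ==> vspace (on_subspace V (ann V X))"
 using ann_closed[of V X] on_subspace_vspace[of V J h "ann V X"] by blast

text \<open>In coordinates adapted to X the annihilator is the zero set of the first block, so the
  second block gives coordinates on it.\<close>

lemma ann_frame:
 assumes V: "vspace V" and X: "X <= zfun V" and u: "fs.basis_on X J u"
  and g: "frame V (J <+> K) (case_sum u g)" and K: "finite K"
 shows "frame (on_subspace V (ann V X)) K (%i. cut (ann V X) (g i))"
 unfolding frame_def
proof (intro conjI ballI allI impI)
 fix i assume "i : K"
 hence "g i : zfun V" using frameD(2)[OF g, of "Inr i"] by auto
 thus "cut (ann V X) (g i) : zfun (on_subspace V (ann V X))"
  by (rule cut_zfun[OF _ ann_closed(1,3,4)[OF V X]])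
next
 fix x y assume xy: "x : carrier (on_subspace V (ann V X))" "y : carrier (on_subspace V (ann V X))"
  "ALL i:K. cut (ann V X) (g i) x = cut (ann V X) (g i) y"
 show "x = y"
 proof (rule frameD(3)[OF g])
  fix k assume k: "k : J <+> K"
  have "u j z = 0" if "j : J" "z : ann V X" for j z using fs.basis_onD(2)[OF u that(1)] that(2) by (simp add: ann_def)
  thus "case_sum u g k x = case_sum u g k y" using xy k by (auto simp: cut_def)
 qed (use xy in \<open>auto simp: ann_def\<close>)
next
 fix c
 obtain x where x: "x : carrier V" "ALL k:J <+> K. case_sum u g k x = (case k of Inl _ => 0 | Inr i => c i)"
  using frameD(4)[OF g, of "case_sum (%_. 0) c"] by blast
 have "u j x = 0" if "j : J" for j using x(2)[rule_format, of "Inl j"] that by auto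
 hence "x : ann V X" using x(1) fs.basis_onD(4)[OF u] by (force simp: ann_def sum_fun_apply)
 moreover have "g i x = c i" if "i : K" for i using x(2)[rule_format, of "Inr i"] that by auto
 ultimately show "EX x:carrier (on_subspace V (ann V X)). ALL i:K. cut (ann V X) (g i) x = c i"
  by (intro bexI[of _ x]) (auto simp: cut_def)
qed (rule K)

lemma frame_extend:
 assumes V: "vspace V" "vfin_dim V" and X: "fs.subspace X" "X <= zfun V"
 obtains k u m g where "fs.basis_on X {..<k::nat} u" "frame V ({..<k} <+> {..<m::nat}) (case_sum u g)"
proof -
 obtain N :: nat and h where h: "frame V {..<N} h" using fin_dim_frame[OF V] by blast
 note fD = zfun_fin_sub[OF V]
 obtain k and u :: "nat => _" where u: "fs.basis_on X {..<k} u"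
  by (rule fs.basis_on_exists[OF fs.fin_sub_subset[OF fD X]])
 obtain m and g :: "nat => _" where "fs.basis_on (zfun V) ({..<k} <+> {..<m}) (case_sum u g)"
 proof (rule fs.basis_extend[OF fD _ fs.basis_onD(3)[OF u]])
  show "!!j. j : {..<k} ==> u j : zfun V" using fs.basis_onD(2)[OF u] X(2) by auto
 qed auto
 hence "frame V ({..<k} <+> {..<m}) (case_sum u g)" by (rule basis_on_frame[OF V(1) h])
 with u show thesis by (rule that)
qed

text \<open>In coordinates adapted to X, a nonzero coefficient of f outside X would be detected by a
  dual vector, and that vector lies in \<open>ann V X\<close>.\<close>

lemma ann_ann:
 assumes V: "vspace V" "vfin_dim V" and X: "fs.subspace X" "X <= zfun V" and f: "f : zfun V" "!!w. w : ann V X ==> f w = 0"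
 shows "f : X"
proof -
 obtain k u m g where u: "fs.basis_on X {..<k::nat} u" and g: "frame V ({..<k} <+> {..<m::nat}) (case_sum u g)"
  by (rule frame_extend[OF V X])
 obtain c where c: "f = (SUM i:{..<k} <+> {..<m}. fscale (c i) (case_sum u g i))"
  using fs.basis_onD(4)[OF frame_basis_on[OF V(1) g] f(1)] by blast
 have c0: "c (Inr j) = 0" if j: "j < m" for j
 proof -
  obtain x where x: "x : carrier V" "ALL i:{..<k} <+> {..<m}. case_sum u g i x = (if i = Inr j then 1 else 0)"
   using frameD(4)[OF g, of "%i. if i = Inr j then 1 else 0"] by blast
  have "u i x = 0" if "i < k" for i using x(2)[rule_format, of "Inl i"] that by auto
  hence "x : ann V X" using x(1) fs.basis_onD(4)[OF u] by (force simp: ann_def sum_fun_apply)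
  hence "f x = 0" by (rule f(2))
  moreover have "f x = (SUM i:{..<k} <+> {..<m}. c i * (if i = Inr j then 1 else 0))"
   unfolding c sum_fun_apply using x(2) by (intro sum.cong) auto
  moreover have "... = (SUM i:{..<k} <+> {..<m}. if i = Inr j then c i else 0)" by (rule sum.cong) auto
  ultimately show ?thesis using j by (simp add: InrI)
 qed
 have "f = (SUM i<k. fscale (c (Inl i)) (u i))"
  unfolding c using c0 by (simp add: sum.Plus)
 thus ?thesis using fs.basis_onD(2)[OF u] X(1) by (auto intro!: fs.subspace_sum fs.subspace_scale)
qed

lemma ann_dim:
 assumes V: "vspace V" "vfin_dim V" and X: "fs.subspace X" "X <= zfun V"
 shows "vdim (on_subspace V (ann V X)) + fs.dim X = vdim V" "vdim V = fs.dim (zfun V)"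
proof -
 obtain k u m g where u: "fs.basis_on X {..<k::nat} u" and g: "frame V ({..<k} <+> {..<m::nat}) (case_sum u g)"
  by (rule frame_extend[OF V X])
 have "frame (on_subspace V (ann V X)) {..<m} (%i. cut (ann V X) (g i))"
  by (rule ann_frame[OF V(1) X(2) u g]) simp
 from frame_dim(1)[OF ann_vspace[OF V(1) g X(2)] this]
 have "vdim (on_subspace V (ann V X)) = m" by simp
 moreover have "fs.dim X = k" using fs.basis_on_dim[OF X(1) u] by simp
 moreover have "vdim V = k + m" using frame_dim(1)[OF V(1) g] by (simp add: card_Plus)
 ultimately show "vdim (on_subspace V (ann V X)) + fs.dim X = vdim V" by simp
 show "vdim V = fs.dim (zfun V)"
  using frame_dim(1)[OF V(1) g] fs.basis_on_dim[OF zfun_subspace frame_basis_on[OF V(1) g]] by simp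
qed

lemma functionals_res: "vspace V ==> functionals V = res V ` zfun V"
proof (intro equalityI subsetI)
 fix av assume V: "vspace V" and a: "av : functionals V"
 hence "av = res V (zx V av)" using res_zx[of av V] by simp
 thus "av : res V ` zfun V" using zx_zfun[OF V a] by blast
qed (use res_functional in blast)

lemma annihilator_res:
 assumes V: "vspace V" and S: "S <= carrier V"
 shows "annihilator V S = res V ` {f : zfun V. ALL x:S. f x = 0}"
proof -
 have "res V f x = f x" if "x : S" for f x using S that by auto
 thus ?thesis unfolding annihilator_def functionals_res[OF V] by auto
qed

section \<open>Bivectors as alternating forms on functionals\<close>

text \<open>The linear algebra above asks for forms that are bilinear on the whole function type,
  while a bivector is controlled only on functionals; A is such a global extension.\<close>

definition represents :: "('k::field, 'v) module => ('k, 'v) bivec => (('v => 'k) => ('v => 'k) => 'k) => bool" where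
 "represents V La A \<longleftrightarrow> fs.alt_bilin A & (ALL f:zfun V. ALL g:zfun V. La (res V f) (res V g) = A f g)"

lemma bivector_represented:
 assumes V: "vspace V" "vfin_dim V" and b: "bivector V La"
 shows "EX A. represents V La A"
proof -
 obtain N :: nat and h where h: "frame V {..<N} h" using fin_dim_frame[OF V] by blast
 obtain e where e: "!!i. i : {..<N} ==> e i : carrier V"
  "!!i j. i : {..<N} ==> j : {..<N} ==> h j (e i) = (if j = i then 1 else 0)"
  using frame_dual[OF h] by blast
 \<comment> \<open>A linear projection of all functions onto \<open>zfun V\<close>: it keeps only
   the values at the dual vectors \<open>e i\<close>. Composing with it extends the bivector
   bilinearly.\<close>
 define P where "P g = (SUM i<N. fscale (g (e i)) (h i))" for g
 have Pz: "P g : zfun V" for g unfolding P_def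
  using frameD(2)[OF h] by (auto intro!: fs.subspace_sum[OF zfun_subspace] fs.subspace_scale[OF zfun_subspace])
 have Pid: "P g = g" if g: "g : zfun V" for g
 proof
  fix x
  show "P g x = g x"
   using frame_expand(1)[OF V(1) h e g, of x] zfunD(1)[OF g, of x] zfunD(1)[OF Pz, of x g]
   by (cases "x : carrier V") (auto simp: P_def sum_fun_apply mult.commute)
 qed
 have Padd: "P (f + g) = P f + P g" and Psc: "P (fscale c f) = fscale c (P f)" for f g c
  unfolding P_def by (auto simp: fun_eq_iff sum_fun_apply algebra_simps sum.distrib sum_distrib_left)
 define A where "A f g = La (res V (P f)) (res V (P g))" for f g
 have radd: "res V (f + g) = res V f \<oplus>\<^bsub>dual_space V\<^esub> res V g" and rsc: "res V (fscale c f) = c \<odot>\<^bsub>dual_space V\<^esub> res V f" for f g c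
  by (auto simp: fun_eq_iff)
 note rP = res_functional[OF V(1) Pz]
 have L: "La (av \<oplus>\<^bsub>dual_space V\<^esub> bv) ga = La av ga + La bv ga" "La ga (av \<oplus>\<^bsub>dual_space V\<^esub> bv) = La ga av + La ga bv"
  "La (c \<odot>\<^bsub>dual_space V\<^esub> av) bv = c * La av bv" "La av (c \<odot>\<^bsub>dual_space V\<^esub> bv) = c * La av bv" "La av av = 0"
  if "av : functionals V" "bv : functionals V" "ga : functionals V" for av bv ga c
  using b that unfolding bivector_def alternating_form_def by blast+
 have "fs.alt_bilin A"
  unfolding fs.alt_bilin_def fs.linfun_def A_def Padd Psc radd rsc
  using L(1)[OF rP rP rP] L(2)[OF rP rP rP] L(3)[OF rP rP rP] L(4)[OF rP rP rP] L(5)[OF rP rP rP]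
  by (auto simp del: dual_space_simps)
 moreover have "La (res V f) (res V g) = A f g" if "f : zfun V" "g : zfun V" for f g
  using that by (simp add: A_def Pid)
 ultimately show ?thesis unfolding represents_def by blast
qed

lemma sharp_res:
 assumes V: "vspace V" "vfin_dim V" and A: "represents V La A" and f: "f : zfun V"
 shows "sharp V La (res V f) : carrier V" "g : zfun V ==> g (sharp V La (res V f)) = A f g"
proof -
 obtain N :: nat and h where h: "frame V {..<N} h" using fin_dim_frame[OF V] by blast
 have lA: "fs.linfun (A f)" using A by (auto simp: represents_def fs.alt_bilin_def)
 obtain x where x: "x : carrier V" "ALL g:zfun V. g x = A f g" using bidual[OF V(1) h lA] by blast
 have "sharp V La (res V f) = x"
  unfolding sharp_def
 proof (rule the_equality)
  have "bv x = La (res V f) bv" if "bv : functionals V" for bv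
  proof -
   have "zx V bv x = A f (zx V bv)" using x(2) zx_zfun[OF V(1) that] by blast
   moreover have "La (res V f) (res V (zx V bv)) = A f (zx V bv)"
    using A f zx_zfun[OF V(1) that] unfolding represents_def by blast
   ultimately show ?thesis unfolding res_zx[OF that] using x(1) by (simp add: zx_apply)
  qed
  thus "x : carrier V & (ALL bv:functionals V. bv x = La (res V f) bv)" using x(1) by blast
  fix v assume v: "v : carrier V & (ALL bv:functionals V. bv v = La (res V f) bv)"
  show "v = x"
  proof (rule zfun_separates[OF h])
   fix g assume g: "g : zfun V"
   have "res V g v = La (res V f) (res V g)" using v res_functional[OF V(1) g] by blast
   thus "g v = g x" using A f g x v by (simp add: represents_def)
  qed (use v x in auto)
 qed
 thus "sharp V La (res V f) : carrier V" "g : zfun V ==> g (sharp V La (res V f)) = A f g" using x by auto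
qed

text \<open>The image of a skew map is the annihilator of its kernel: one inclusion is antisymmetry,
  the other is \<open>fredholm\<close> applied to evaluation at w.\<close>

lemma bivector_image_ann:
 assumes V: "vspace V" "vfin_dim V" and A: "represents V La A"
 shows "bivector_image V La = ann V (fs.rad (zfun V) A)"
proof -
 obtain N :: nat and h where h: "frame V {..<N} h" using fin_dim_frame[OF V] by blast
 have bA: "fs.alt_bilin A" using A by (simp add: represents_def)
 show ?thesis unfolding bivector_image_def functionals_res[OF V(1)] image_image
 proof (intro equalityI subsetI)
  fix w assume "w : (%f. sharp V La (res V f)) ` zfun V"
  then obtain f where f: "f : zfun V" "w = sharp V La (res V f)" by auto
  have "u w = 0" if "u : fs.rad (zfun V) A" for u
   using sharp_res(2)[OF V A f(1), of u] that f fs.alt_bilin_eq0[OF bA, of u f] by (auto simp: fs.rad_def)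
  thus "w : ann V (fs.rad (zfun V) A)" using sharp_res(1)[OF V A f(1)] f(2) by (simp add: ann_def)
 next
  fix w assume w: "w : ann V (fs.rad (zfun V) A)"
  define ew where "ew g = g w" for g :: "'b => 'a"
  have lw: "fs.linfun ew" by (simp add: fs.linfun_def ew_def)
  have z: "ew g = 0" if "g : fs.rad (zfun V) A" for g using w that by (simp add: ann_def ew_def)
  obtain f where f: "f : zfun V" "!!g. g : zfun V ==> g w = A f g"
   using fs.fredholm[OF zfun_fin_sub[OF V] bA lw z] unfolding ew_def by blast
  have "w = sharp V La (res V f)"
   by (rule zfun_separates[OF h]) (use w f sharp_res[OF V A f(1)] in \<open>auto simp: ann_def\<close>)
  thus "w : (%f. sharp V La (res V f)) ` zfun V" using f(1) by blast
 qed
qed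

lemma rank_rad:
 assumes V: "vspace V" "vfin_dim V" and A: "represents V La A"
 shows "rank V La + fs.dim (fs.rad (zfun V) A) = vdim V"
 unfolding rank_def bivector_image_ann[OF assms]
 by (rule ann_dim(1)[OF V fs.rad_subspace[OF zfun_subspace]]) (use A in \<open>auto simp: represents_def fs.rad_def\<close>)

lemma (in fam_space) basis_on_mem: "basis_on D I e ==> i : I ==> e i : D"
 by (rule basis_onD(2))

section \<open>Transport along linear isomorphisms\<close>

context fam_space
begin

text \<open>The bridge between the two formalisms: a linear bijection from a subspace of a type with
  global operations onto a space with explicit carrier.\<close>

definition lin_iso :: "'b set => ('b => 'v) => ('a, 'v) module => bool" where
 "lin_iso S pz E \<longleftrightarrow> (ALL x:S. pz x : carrier E) & (ALL x:S. ALL y:S. pz (x + y) = pz x \<oplus>\<^bsub>E\<^esub> pz y) &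
   (ALL c. ALL x:S. pz (c *s x) = c \<odot>\<^bsub>E\<^esub> pz x) & (ALL x:S. ALL y:S. pz x = pz y --> x = y) & (ALL v:carrier E. EX x:S. v = pz x)"

lemma lin_isoD:
 assumes "lin_iso S pz E"
 shows "x : S ==> pz x : carrier E" "x : S ==> y : S ==> pz (x + y) = pz x \<oplus>\<^bsub>E\<^esub> pz y"
  "x : S ==> pz (c *s x) = c \<odot>\<^bsub>E\<^esub> pz x" "x : S ==> y : S ==> pz x = pz y ==> x = y"
  "v : carrier E ==> EX x:S. v = pz x"
 using assms unfolding lin_iso_def by blast+

lemma lin_iso_zero: "vspace E ==> subspace S ==> lin_iso S pz E ==> pz 0 = \<zero>\<^bsub>E\<^esub>"
proof -
 assume E: "vspace E" and S: "subspace S" and i: "lin_iso S pz E"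
 interpret E: vectorspace class_ring E by fact
 have "pz (0 *s 0) = 0 \<odot>\<^bsub>E\<^esub> pz 0" using lin_isoD(3)[OF i subspace_0[OF S]] .
 thus ?thesis using E.lmult_0[of "pz 0"] lin_isoD(1)[OF i subspace_0[OF S]] by simp
qed

lemma lin_iso_sum:
 assumes E: "vspace E" and S: "subspace S" and i: "lin_iso S pz E" and "finite I" "!!i. i : I ==> g i : S"
 shows "pz (SUM i:I. g i) = (\<Oplus>\<^bsub>E\<^esub>i\<in>I. pz (g i))"
proof -
 interpret E: vectorspace class_ring E by fact
 show ?thesis using assms(4,5)
 proof (induction I rule: finite_induct)
  case empty
  thus ?case using lin_iso_zero[OF E S i] by simp
 next
  case (insert k I)
  have "(SUM i:I. g i) : S" using insert.prems by (intro subspace_sum[OF S]) auto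
  hence "pz (SUM i:insert k I. g i) = pz (g k) \<oplus>\<^bsub>E\<^esub> pz (SUM i:I. g i)"
   using insert by (simp add: lin_isoD(2)[OF i])
  also have "... = (\<Oplus>\<^bsub>E\<^esub>i\<in>insert k I. pz (g i))"
   using insert lin_isoD(1)[OF i] by (subst E.finsum_insert) auto
  finally show ?case .
 qed
qed

lemma lin_iso_frame:
 assumes E: "vspace E" and S: "subspace S" and i: "lin_iso S pz E" and e: "basis_on S J e"
 shows "EX f. frame E J f & (ALL j:J. pz (e j) : carrier E & (ALL k:J. f k (pz (e j)) = (if k = j then 1 else 0)))"
proof -
 obtain ph where ph: "!!j. j : J ==> linfun (ph j)" "!!j k. j : J ==> k : J ==> ph j (e k) = (if k = j then 1 else 0)"
  "!!x. x : S ==> x = (SUM j:J. ph j x *s e j)"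
  by (rule basis_on_coords[OF e], rule that)
 define ka where "ka v = (SOME x. x : S & v = pz x)" for v
 have ka: "ka v : S" "pz (ka v) = v" if "v : carrier E" for v
 proof -
  have "EX x. x : S & v = pz x" using lin_isoD(5)[OF i that] by blast
  hence "ka v : S & v = pz (ka v)" unfolding ka_def by (rule someI_ex)
  thus "ka v : S" "pz (ka v) = v" by auto
 qed
 have kapz: "ka (pz x) = x" if "x : S" for x
  using lin_isoD(4)[OF i ka(1)[OF lin_isoD(1)[OF i that]] that] ka(2)[OF lin_isoD(1)[OF i that]] by simp
 define f where "f j v = (if v : carrier E then ph j (ka v) else 0)" for j v
 have "frame E J f" unfolding frame_def
 proof (intro conjI ballI allI impI)
  fix j assume j: "j : J"
  show "f j : zfun E"
  proof (rule zfunI)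
   fix x y assume xy: "x : carrier E" "y : carrier E"
   have "ka (x \<oplus>\<^bsub>E\<^esub> y) = ka (pz (ka x + ka y))" using xy ka by (simp add: lin_isoD(2)[OF i])
   also have "... = ka x + ka y" using xy ka by (intro kapz subspace_add[OF S])
   finally show "f j (x \<oplus>\<^bsub>E\<^esub> y) = f j x + f j y" using xy vspaceD(2)[OF E] ph(1)[OF j] by (simp add: f_def linfun_def)
  next
   fix c x assume x: "x : carrier E"
   have "ka (c \<odot>\<^bsub>E\<^esub> x) = ka (pz (c *s ka x))" using x ka by (simp add: lin_isoD(3)[OF i])
   also have "... = c *s ka x" using x ka by (intro kapz subspace_scale[OF S])
   finally show "f j (c \<odot>\<^bsub>E\<^esub> x) = c * f j x" using x vspaceD(3)[OF E] ph(1)[OF j] by (simp add: f_def linfun_def)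
  qed (simp add: f_def)
 next
  fix x y assume xy: "x : carrier E" "y : carrier E" "ALL j:J. f j x = f j y"
  have "ka x = (SUM j:J. ph j (ka x) *s e j)" using ph(3)[OF ka(1)[OF xy(1)]] .
  also have "... = (SUM j:J. ph j (ka y) *s e j)" using xy by (intro sum.cong) (auto simp: f_def)
  also have "... = ka y" using ph(3)[OF ka(1)[OF xy(2)]] by simp
  finally show "x = y" using ka(2) xy by metis
 next
  fix c
  let ?x = "SUM k:J. c k *s e k"
  have xS: "?x : S" using basis_on_mem[OF e] by (intro subspace_sum[OF S] subspace_scale[OF S])
  have "f j (pz ?x) = c j" if j: "j : J" for j
  proof -
   have "ph j ?x = (SUM k:J. if k = j then c j else 0)"
    unfolding linfun_sum[OF ph(1)[OF j]] using ph(2)[OF j] by (intro sum.cong) auto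
   thus ?thesis using lin_isoD(1)[OF i xS] kapz[OF xS] j basis_onD(1)[OF e] by (simp add: f_def)
  qed
  thus "EX x:carrier E. ALL j:J. f j x = c j" using lin_isoD(1)[OF i xS] by blast
 qed (rule basis_onD(1)[OF e])
 moreover have "f k (pz (e j)) = (if k = j then 1 else 0)" if "j : J" "k : J" for j k
  using ph(2)[OF that(2,1)] lin_isoD(1)[OF i] kapz basis_on_mem[OF e that(1)] by (auto simp: f_def)
 ultimately show ?thesis using lin_isoD(1)[OF i] basis_on_mem[OF e] by blast
qed

lemma lin_iso_basis_family:
 assumes "vspace E" "subspace S" "lin_iso S pz E" "basis_on S J e"
 shows "basis_family E J (%j. pz (e j))"
proof -
 obtain f where f: "frame E J f" "!!j. j : J ==> pz (e j) : carrier E"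
  "!!j k. j : J ==> k : J ==> f k (pz (e j)) = (if k = j then 1 else 0)"
  using lin_iso_frame[OF assms] by blast
 show ?thesis by (rule frame_basis_family[OF assms(1) f])
qed

lemma lin_iso_basis_on:
 assumes E: "vspace E" and S: "subspace S" and i: "lin_iso S pz E" and J: "finite J"
  and b: "basis_family E J v" and e: "!!j. j : J ==> e j : S" "!!j. j : J ==> pz (e j) = v j"
 shows "basis_on S J e"
proof -
 obtain f where f: "frame E J f" and vE: "!!j. j : J ==> v j : carrier E"
  "!!j k. j : J ==> k : J ==> f k (v j) = (if k = j then 1 else 0)"
  using basis_family_frame[OF E J b] by blast
 have comb: "pz (SUM j:J. c j *s e j) = (\<Oplus>\<^bsub>E\<^esub>j\<in>J. c j \<odot>\<^bsub>E\<^esub> v j)" for c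
 proof -
  interpret E: vectorspace class_ring E by fact
  have "pz (SUM j:J. c j *s e j) = (\<Oplus>\<^bsub>E\<^esub>j\<in>J. pz (c j *s e j))"
   by (rule lin_iso_sum[OF E S i J subspace_scale[OF S e(1)]])
  also have "... = (\<Oplus>\<^bsub>E\<^esub>j\<in>J. c j \<odot>\<^bsub>E\<^esub> v j)"
   using vspaceD(3)[OF E vE(1)] lin_isoD(3)[OF i e(1)] e(2) by (intro E.finsum_cong') auto
  finally show ?thesis .
 qed
 have cl: "c j \<odot>\<^bsub>E\<^esub> v j : carrier E" if "j : J" for c j by (rule vspaceD(3)[OF E vE(1)[OF that]])
 have fc: "f k (\<Oplus>\<^bsub>E\<^esub>j\<in>J. c j \<odot>\<^bsub>E\<^esub> v j) = c k" if k: "k : J" for c k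
 proof -
  have "f k (\<Oplus>\<^bsub>E\<^esub>j\<in>J. c j \<odot>\<^bsub>E\<^esub> v j) = (SUM j:J. f k (c j \<odot>\<^bsub>E\<^esub> v j))"
   by (rule zfun_finsum(2)[OF E J cl frameD(2)[OF f k]])
  also have "... = (SUM j:J. if j = k then c k else 0)"
   using zfunD(3)[OF frameD(2)[OF f k] vE(1)] vE(2)[OF _ k] by (intro sum.cong) auto
  finally show ?thesis using k J by simp
 qed
 have cS: "(SUM j:J. c j *s e j) : S" for c using e(1) by (intro subspace_sum[OF S] subspace_scale[OF S])
 show ?thesis unfolding basis_on_def indep_fam_def
 proof (intro conjI ballI allI impI)
  fix c k assume z: "(SUM j:J. c j *s e j) = 0" and k: "k : J"
  have "(\<Oplus>\<^bsub>E\<^esub>j\<in>J. c j \<odot>\<^bsub>E\<^esub> v j) = \<zero>\<^bsub>E\<^esub>" using comb[of c] z lin_iso_zero[OF E S i] by simp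
  thus "c k = 0" using fc[OF k, of c] zfun_zero[OF E frameD(2)[OF f k]] by simp
 next
  fix x assume x: "x : S"
  let ?c = "%j. f j (pz x)"
  have "pz x = (\<Oplus>\<^bsub>E\<^esub>j\<in>J. ?c j \<odot>\<^bsub>E\<^esub> v j)"
   by (rule frameD(3)[OF f lin_isoD(1)[OF i x] zfun_finsum(1)[OF E J cl]]) (assumption, rule fc[of _ ?c, symmetric])
  hence "pz x = pz (SUM j:J. ?c j *s e j)" by (simp add: comb)
  thus "EX c. x = (SUM j:J. c j *s e j)" using lin_isoD(4)[OF i x cS] by (intro exI[of _ ?c])
 qed (use J e(1) in auto)
qed

end

lemma alternating_formD:
 assumes "alternating_form V om" "x : carrier V" "y : carrier V" "z : carrier V"
 shows "om (x \<oplus>\<^bsub>V\<^esub> y) z = om x z + om y z" "om z (x \<oplus>\<^bsub>V\<^esub> y) = om z x + om z y"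
  "om (c \<odot>\<^bsub>V\<^esub> x) y = c * om x y" "om x (c \<odot>\<^bsub>V\<^esub> y) = c * om x y" "om x x = 0"
 using assms unfolding alternating_form_def by blast+

lemma alternating_form_swap:
 assumes V: "vspace V" and w: "alternating_form V om" and xy: "x : carrier V" "y : carrier V"
 shows "om x y = - om y x"
proof -
 have s: "x \<oplus>\<^bsub>V\<^esub> y : carrier V" by (rule vspaceD(2)[OF V xy])
 have "om (x \<oplus>\<^bsub>V\<^esub> y) (x \<oplus>\<^bsub>V\<^esub> y) = 0" using alternating_formD(5)[OF w s s s] .
 hence "om x x + om x y + (om y x + om y y) = 0"
  using alternating_formD(1)[OF w xy s] alternating_formD(2)[OF w xy xy(1)] alternating_formD(2)[OF w xy xy(2)] by simp
 thus ?thesis using alternating_formD(5)[OF w xy(1,1,1)] alternating_formD(5)[OF w xy(2,2,2)]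
  by (simp add: eq_neg_iff_add_eq_0)
qed

text \<open>The model space consists of the families of scalars that vanish off I. Defined for all
  families, \<open>pz\<close> is linear on the whole type, so forms pulled back along it are
  globally bilinear.\<close>

lemma coordinate_iso:
 assumes V: "vspace V" and h: "frame V I h"
 shows "EX pz. (ALL a. pz a : carrier V & (ALL i:I. h i (pz a) = a i)) & (ALL a b. pz (a + b) = pz a \<oplus>\<^bsub>V\<^esub> pz b) &
  (ALL c a. pz (fscale c a) = c \<odot>\<^bsub>V\<^esub> pz a) & fs.lin_iso {a. ALL i. i \<notin> I --> a i = 0} pz V"
proof -
 have "ALL a. EX x. x : carrier V & (ALL i:I. h i x = a i)" using frameD(4)[OF h] by blast
 then obtain pz where pz: "!!a. pz a : carrier V" "!!a i. i : I ==> h i (pz a) = a i" by metis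
 have add: "pz (a + b) = pz a \<oplus>\<^bsub>V\<^esub> pz b" for a b
  by (rule frameD(3)[OF h pz(1) vspaceD(2)[OF V pz(1) pz(1)]]) (simp add: pz zfunD(2)[OF frameD(2)[OF h]])
 have sc: "pz (fscale c a) = c \<odot>\<^bsub>V\<^esub> pz a" for c a
  by (rule frameD(3)[OF h pz(1) vspaceD(3)[OF V pz(1)]]) (simp add: pz zfunD(3)[OF frameD(2)[OF h]])
 have "fs.lin_iso {a. ALL i. i \<notin> I --> a i = 0} pz V" unfolding fs.lin_iso_def
 proof (intro conjI ballI allI impI)
  fix x y assume xy: "x : {a. ALL i. i \<notin> I --> a i = 0}" "y : {a. ALL i. i \<notin> I --> a i = 0}" "pz x = pz y"
  show "x = y"
  proof
   fix i show "x i = y i" using xy pz(2)[of i x] pz(2)[of i y] by (cases "i : I") auto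
  qed
 next
  fix v assume v: "v : carrier V"
  have "v = pz (%i. if i : I then h i v else 0)" by (rule frameD(3)[OF h v pz(1)]) (simp add: pz)
  thus "EX x:{a. ALL i. i \<notin> I --> a i = 0}. v = pz x" by (intro bexI) auto
 qed (use pz add sc in auto)
 thus ?thesis using pz add sc by blast
qed

lemma coordinate_space_fin_sub:
 fixes I :: "'i set"
 assumes "finite I"
 shows "fs.fin_sub {a :: 'i => 'k::field. ALL i. i \<notin> I --> a i = 0}"
proof -
 let ?S = "{a :: 'i => 'k. ALL i. i \<notin> I --> a i = 0}"
 have sub: "fs.subspace ?S" by (rule fs.subspaceI) auto
 have "fs.basis_on ?S I (%i j. if j = i then 1 else 0)"
  unfolding fs.basis_on_def fs.indep_fam_def
 proof (intro conjI ballI allI impI)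
  fix c :: "'i => 'k" and i assume z: "(SUM i:I. fscale (c i) (%j. if j = i then 1 else 0)) = 0" and i: "i : I"
  show "c i = 0" using fun_cong[OF z, of i] i assms by (simp add: sum_fun_apply if_distrib cong: if_cong)
 next
  fix a assume a: "a : ?S"
  have "a = (SUM i:I. fscale (a i) (%j. if j = i then 1 else 0))"
   using a assms by (auto simp: fun_eq_iff sum_fun_apply if_distrib cong: if_cong)
  thus "EX c. a = (SUM i:I. fscale (c i) (%j. if j = i then 1 else 0))" by (intro exI[of _ a])
 qed (use assms in auto)
 thus ?thesis by (rule fs.basis_on_fin_sub[OF sub])
qed

section \<open>Darboux bases and dual bivectors\<close>

definition flat :: "('k::field, 'v) module => ('v => 'v => 'k) => 'v => 'v => 'k" where
 "flat V om x = (\<lambda>y\<in>carrier V. om x y)"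

lemma flat_functional: "vspace V ==> alternating_form V om ==> x : carrier V ==> flat V om x : functionals V"
 using vspaceD[of V] by (auto simp: functionals_iff flat_def alternating_formD)

lemma zfun_flat: "vspace V ==> alternating_form V om ==> x : carrier V ==> zx V (flat V om x) : zfun V"
 by (intro zx_zfun flat_functional)

lemma half_index:
 fixes j k :: nat
 assumes "1 <= j" "1 <= k"
 shows "2*k ~= 2*j-1" "2*j-1 ~= 2*k" "2*j-1 = 2*k-1 \<longleftrightarrow> j = k"
 using assms by presburger+

lemma darboux_basis_frame:
 assumes V: "vspace V" and d: "darboux_basis V om n e"
 shows "EX a. frame V {1..2*n} a & (ALL i:{1..2*n}. e i : carrier V & (ALL j:{1..2*n}. a j (e i) = (if j = i then 1 else 0))) &
  (ALL x:carrier V. ALL y:carrier V. om x y = (SUM j=1..n. a (2*j-1) x * a (2*j) y - a (2*j) x * a (2*j-1) y)) &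
  (ALL x:carrier V. ALL j:{1..n}. om x (e (2*j-1)) = - a (2*j) x & om x (e (2*j)) = a (2*j-1) x)"
proof -
 have b: "basis_family V {1..2*n} e" using d by (simp add: darboux_basis_def)
 obtain a where a: "frame V {1..2*n} a" and e: "!!i. i : {1..2*n} ==> e i : carrier V"
  "!!i j. i : {1..2*n} ==> j : {1..2*n} ==> a j (e i) = (if j = i then 1 else 0)"
  using basis_family_frame[OF V _ b] by auto
 have db: "dual_basis V {1..2*n} e i = res V (a i)" if "i : {1..2*n}" for i
  by (rule dual_basis_eq[OF V a e that])
 have rng: "2*j-1 : {1..2*n}" "2*j : {1..2*n}" if "j : {1..n}" for j using that by auto
 have w: "om x y = (SUM j=1..n. a (2*j-1) x * a (2*j) y - a (2*j) x * a (2*j-1) y)"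
  if xy: "x : carrier V" "y : carrier V" for x y
 proof -
  have "om x y = wedge_sum n (%_. 1) (dual_basis V {1..2*n} e) x y" using d xy by (simp add: darboux_basis_def)
  also have "... = (SUM j=1..n. a (2*j-1) x * a (2*j) y - a (2*j) x * a (2*j-1) y)"
   unfolding wedge_sum_def
  proof (rule sum.cong[OF refl])
   fix j assume j: "j : {1..n}"
   show "1 * (dual_basis V {1..2*n} e (2*j-1) x * dual_basis V {1..2*n} e (2*j) y -
    dual_basis V {1..2*n} e (2*j) x * dual_basis V {1..2*n} e (2*j-1) y) =
    a (2*j-1) x * a (2*j) y - a (2*j) x * a (2*j-1) y"
    unfolding db[OF rng(1)[OF j]] db[OF rng(2)[OF j]] using xy by simp
  qed
  finally show ?thesis .
 qed
 have we: "om x (e (2*j-1)) = - a (2*j) x & om x (e (2*j)) = a (2*j-1) x" if x: "x : carrier V" and j: "j : {1..n}" for x j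
 proof
  have "om x (e (2*j-1)) = (SUM k=1..n. if k = j then - a (2*j) x else 0)"
   unfolding w[OF x e(1)[OF rng(1)[OF j]]]
  proof (rule sum.cong[OF refl])
   fix k assume k: "k : {1..n}"
   have "a (2*k) (e (2*j-1)) = 0" "a (2*k-1) (e (2*j-1)) = (if k = j then 1 else 0)"
    using e(2)[OF rng(1)[OF j] rng(2)[OF k]] e(2)[OF rng(1)[OF j] rng(1)[OF k]] j k half_index[of j k] half_index[of k j]
    by (auto simp del: One_nat_def)
   thus "a (2*k-1) x * a (2*k) (e (2*j-1)) - a (2*k) x * a (2*k-1) (e (2*j-1)) = (if k = j then - a (2*j) x else 0)" by simp
  qed
  thus "om x (e (2*j-1)) = - a (2*j) x" using j by simp
  have "om x (e (2*j)) = (SUM k=1..n. if k = j then a (2*j-1) x else 0)"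
   unfolding w[OF x e(1)[OF rng(2)[OF j]]]
  proof (rule sum.cong[OF refl])
   fix k assume k: "k : {1..n}"
   have "a (2*k) (e (2*j)) = (if k = j then 1 else 0)" "a (2*k-1) (e (2*j)) = 0"
    using e(2)[OF rng(2)[OF j] rng(2)[OF k]] e(2)[OF rng(2)[OF j] rng(1)[OF k]] j k half_index[of j k] half_index[of k j]
    by (auto simp del: One_nat_def)
   thus "a (2*k-1) x * a (2*k) (e (2*j)) - a (2*k) x * a (2*k-1) (e (2*j)) = (if k = j then a (2*j-1) x else 0)" by simp
  qed
  thus "om x (e (2*j)) = a (2*j-1) x" using j by simp
 qed
 show ?thesis using a e w we by blast
qed

lemma nat_half_cases:
 assumes "i : {1..2*n::nat}" obtains j where "j : {1..n}" "i = 2*j-1" | j where "j : {1..n}" "i = 2*j"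
proof (cases "even i")
 case True
 then obtain j where "i = 2*j" by blast
 thus thesis using that(2)[of j] assms by auto
next
 case False
 then obtain j where "i = 2*j+1" by (auto elim: oddE)
 thus thesis using that(1)[of "Suc j"] assms by auto
qed

text \<open>The form is pulled back to the coordinate space, where
  \<open>symplectic_basis_exists\<close> applies, and the basis found there is pushed
  forward.\<close>

lemma darboux_basis_exists:
 assumes V: "vspace V" and h: "frame V I h" and w: "symplectic_form V om"
 shows "EX n e. darboux_basis V om n e"
proof -
 have alt: "alternating_form V om" and ker: "form_kernel V om = {\<zero>\<^bsub>V\<^esub>}" using w by (auto simp: symplectic_form_def)
 let ?S = "{a :: 'c => 'a. ALL i. i \<notin> I --> a i = 0}"
 obtain pz where pz: "!!a. pz a : carrier V" "!!a b. pz (a + b) = pz a \<oplus>\<^bsub>V\<^esub> pz b" "!!c a. pz (fscale c a) = c \<odot>\<^bsub>V\<^esub> pz a"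
  and iso: "fs.lin_iso ?S pz V" using coordinate_iso[OF V h] by blast
 have fS: "fs.fin_sub ?S" by (rule coordinate_space_fin_sub[OF frameD(1)[OF h]])
 hence sS: "fs.subspace ?S" by (simp add: fs.fin_sub_def)
 define Om where "Om a b = om (pz a) (pz b)" for a b
 have bO: "fs.alt_bilin Om" unfolding fs.alt_bilin_def fs.linfun_def Om_def pz(2,3)
  using alternating_formD[OF alt pz(1) pz(1) pz(1)] by simp
 have nd: "fs.nondeg_on ?S Om" unfolding fs.nondeg_on_def
 proof (intro ballI impI)
  fix a assume a: "a : ?S" and z: "ALL b:?S. Om a b = 0"
  have "om (pz a) v = 0" if "v : carrier V" for v using fs.lin_isoD(5)[OF iso that] z by (auto simp: Om_def)
  hence "pz a : form_kernel V om" using pz(1) by (simp add: form_kernel_def)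
  hence "pz a = pz 0" using ker fs.lin_iso_zero[OF V sS iso] by simp
  thus "a = 0" using fs.lin_isoD(4)[OF iso a] fs.subspace_0[OF sS] by blast
 qed
 obtain n :: nat and e where e: "fs.basis_on ?S {1..2*n} e"
  and g: "!!j k. j : {1..n} ==> k : {1..n} ==> Om (e (2*j-1)) (e (2*k)) = (if j = k then 1 else 0) &
    Om (e (2*j-1)) (e (2*k-1)) = 0 & Om (e (2*j)) (e (2*k)) = 0"
  using fs.symplectic_basis_exists[OF bO fS nd] by blast
 define E where "E i = pz (e i)" for i
 obtain f where f: "frame V {1..2*n} f" and E: "!!i. i : {1..2*n} ==> E i : carrier V"
  "!!i j. i : {1..2*n} ==> j : {1..2*n} ==> f j (E i) = (if j = i then 1 else 0)"
  using fs.lin_iso_frame[OF V sS iso e] unfolding E_def by blast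
 have rng: "2*j-1 : {1..2*n}" "2*j : {1..2*n}" if "j : {1..n}" for j using that by auto
 have G: "om (E (2*j-1)) (E (2*k)) = (if j = k then 1 else 0)" "om (E (2*j-1)) (E (2*k-1)) = 0"
  "om (E (2*j)) (E (2*k)) = 0" "om (E (2*j)) (E (2*k-1)) = - (if j = k then 1 else 0)" if "j : {1..n}" "k : {1..n}" for j k
 proof -
  show "om (E (2*j-1)) (E (2*k)) = (if j = k then 1 else 0)" "om (E (2*j-1)) (E (2*k-1)) = 0"
   "om (E (2*j)) (E (2*k)) = 0" using g[OF that] by (auto simp: Om_def E_def)
  show "om (E (2*j)) (E (2*k-1)) = - (if j = k then 1 else 0)"
   using g[OF that(2,1)] alternating_form_swap[OF V alt E(1)[OF rng(2)[OF that(1)]] E(1)[OF rng(1)[OF that(2)]]]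
   by (auto simp: Om_def E_def)
 qed
 have fo: "f (2*j-1) x = om x (E (2*j))" "f (2*j) x = - om x (E (2*j-1))" if j: "j : {1..n}" and x: "x : carrier V" for j x
 proof -
  have sw: "om x (E i) = - om (E i) x" if "i : {1..2*n}" for i by (rule alternating_form_swap[OF V alt x E(1)[OF that]])
  have ev: "zx V (flat V om (E k)) x = (SUM i=1..2*n. f i x * om (E k) (E i))" if "k : {1..2*n}" for k
   using frame_expand(1)[OF V f E zfun_flat[OF V alt E(1)[OF that]] x] E(1) by (simp add: zx_apply flat_def)
  have split: "(SUM i=1..2*n. F i) = (SUM j=1..n. F (2*j-1) + F (2*j))" for F :: "nat => 'a"
   by (induction n) simp_all
  have "om (E (2*j)) x = (SUM k=1..n. f (2*k-1) x * om (E (2*j)) (E (2*k-1)) + f (2*k) x * om (E (2*j)) (E (2*k)))"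
   using ev[OF rng(2)[OF j]] x unfolding split zx_apply[OF x] flat_def by simp
  also have "... = (SUM k=1..n. if k = j then - f (2*j-1) x else 0)"
   by (rule sum.cong[OF refl], unfold G(3)[OF j] G(4)[OF j]) auto
  finally have "om (E (2*j)) x = (SUM k=1..n. if k = j then - f (2*j-1) x else 0)" .
  thus "f (2*j-1) x = om x (E (2*j))" using sw[OF rng(2)[OF j]] j by simp
  have "om (E (2*j-1)) x = (SUM k=1..n. f (2*k-1) x * om (E (2*j-1)) (E (2*k-1)) + f (2*k) x * om (E (2*j-1)) (E (2*k)))"
   using ev[OF rng(1)[OF j]] x unfolding split zx_apply[OF x] flat_def by simp
  also have "... = (SUM k=1..n. if k = j then f (2*j) x else 0)"
   by (rule sum.cong[OF refl], unfold G(1)[OF j] G(2)[OF j]) auto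
  finally have "om (E (2*j-1)) x = (SUM k=1..n. if k = j then f (2*j) x else 0)" .
  thus "f (2*j) x = - om x (E (2*j-1))" using sw[OF rng(1)[OF j]] j by simp
 qed
 have "darboux_basis V om n E" unfolding darboux_basis_def
 proof (intro conjI ballI)
  show "basis_family V {1..2*n} E" by (rule frame_basis_family[OF V f E])
  fix x y assume x: "x : carrier V" and y: "y : carrier V"
  have db: "dual_basis V {1..2*n} E i = res V (f i)" if "i : {1..2*n}" for i by (rule dual_basis_eq[OF V f E that])
  have "om x y = (SUM i=1..2*n. f i y * om x (E i))"
   using frame_expand(1)[OF V f E zfun_flat[OF V alt x] y] E(1) y by (simp add: zx_apply flat_def)
  also have "... = (SUM j=1..n. f (2*j-1) y * om x (E (2*j-1)) + f (2*j) y * om x (E (2*j)))"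
   by (induction n) simp_all
  also have "... = (SUM j=1..n. f (2*j-1) x * f (2*j) y - f (2*j) x * f (2*j-1) y)"
   using fo(1)[OF _ x] fo(2)[OF _ x] by (intro sum.cong) auto
  also have "... = wedge_sum n (%_. 1) (dual_basis V {1..2*n} E) x y"
   unfolding wedge_sum_def
  proof (rule sum.cong[OF refl])
   fix j assume j: "j : {1..n}"
   show "f (2*j-1) x * f (2*j) y - f (2*j) x * f (2*j-1) y =
    1 * (dual_basis V {1..2*n} E (2*j-1) x * dual_basis V {1..2*n} E (2*j) y -
    dual_basis V {1..2*n} E (2*j) x * dual_basis V {1..2*n} E (2*j-1) y)"
    unfolding db[OF rng(1)[OF j]] db[OF rng(2)[OF j]] using x y by simp
  qed
  finally show "om x y = wedge_sum n (%_. 1) (dual_basis V {1..2*n} E) x y" .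
 qed
 thus ?thesis by blast
qed

lemma wedge_eval_bivector:
 assumes V: "vspace V" and e: "!!i. i : {1..2*n} ==> e i : carrier V"
 shows "bivector V (wedge_sum n c (%i av. av (e i)))"
proof -
 have e': "e (2*j-1) : carrier V" "e (2*j) : carrier V" if "j : {1..n}" for j by (rule e, use that in auto)+
 have l: "wedge_sum n c (%i av. av (e i)) (av \<oplus>\<^bsub>dual_space V\<^esub> bv) ga = wedge_sum n c (%i av. av (e i)) av ga + wedge_sum n c (%i av. av (e i)) bv ga"
  "wedge_sum n c (%i av. av (e i)) ga (av \<oplus>\<^bsub>dual_space V\<^esub> bv) = wedge_sum n c (%i av. av (e i)) ga av + wedge_sum n c (%i av. av (e i)) ga bv"
  "wedge_sum n c (%i av. av (e i)) (d \<odot>\<^bsub>dual_space V\<^esub> av) ga = d * wedge_sum n c (%i av. av (e i)) av ga"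
  "wedge_sum n c (%i av. av (e i)) ga (d \<odot>\<^bsub>dual_space V\<^esub> av) = d * wedge_sum n c (%i av. av (e i)) ga av" for av bv ga d
  unfolding wedge_sum_def sum.distrib[symmetric] sum_distrib_left
  by (rule sum.cong[OF refl], frule e'(1), drule e'(2), simp add: algebra_simps)+
 show ?thesis unfolding bivector_def alternating_form_def using l by (simp add: wedge_sum_def mult.commute)
qed

text \<open>The second and third claims describe the dual bivector with no reference to the chosen
  Darboux basis: every functional is om(x, .) for some x, and on these the bivector takes the values
  of \<open>om\<close>. Later arguments use only this.\<close>

lemma dual_bivector_props:
 assumes V: "vspace V" and h: "frame V I h" and w: "symplectic_form V om"
 shows "bivector V (dual_bivector V om)"
  "x : carrier V ==> y : carrier V ==> dual_bivector V om (flat V om x) (flat V om y) = om x y"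
  "av : functionals V ==> EX x:carrier V. flat V om x = av"
proof -
 have alt: "alternating_form V om" using w by (auto simp: symplectic_form_def)
 define p where "p = (SOME (n, e). darboux_basis V om n e)"
 obtain n e where p: "p = (n, e)" by (cases p)
 have "case p of (n, e) => darboux_basis V om n e"
  unfolding p_def using darboux_basis_exists[OF V h w] by (intro someI_ex[of "%p. case p of (n, e) => darboux_basis V om n e"]) auto
 hence d: "darboux_basis V om n e" by (simp add: p)
 have L: "dual_bivector V om = wedge_sum n (%_. 1) (%i av. av (e i))"
  unfolding dual_bivector_def p_def[symmetric] by (simp add: p)
 obtain a where a: "frame V {1..2*n} a" and e: "!!i. i : {1..2*n} ==> e i : carrier V"
  "!!i j. i : {1..2*n} ==> j : {1..2*n} ==> a j (e i) = (if j = i then 1 else 0)"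
  and wa: "!!x y. x : carrier V ==> y : carrier V ==> om x y = (SUM j=1..n. a (2*j-1) x * a (2*j) y - a (2*j) x * a (2*j-1) y)"
  and we: "!!x j. x : carrier V ==> j : {1..n} ==> om x (e (2*j-1)) = - a (2*j) x & om x (e (2*j)) = a (2*j-1) x"
  using darboux_basis_frame[OF V d] by blast
 have rng: "2*j-1 : {1..2*n}" "2*j : {1..2*n}" if "j : {1..n}" for j using that by auto
 show "bivector V (dual_bivector V om)" unfolding L by (rule wedge_eval_bivector[OF V e(1)])
 have fe: "flat V om x (e (2*j-1)) = - a (2*j) x" "flat V om x (e (2*j)) = a (2*j-1) x" if "x : carrier V" "j : {1..n}" for x j
  using we[OF that] e(1)[OF rng(1)[OF that(2)]] e(1)[OF rng(2)[OF that(2)]] by (simp_all add: flat_def)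
 show "dual_bivector V om (flat V om x) (flat V om y) = om x y" if xy: "x : carrier V" "y : carrier V"
  unfolding L wedge_sum_def wa[OF xy] using fe[OF xy(1)] fe[OF xy(2)] by (intro sum.cong refl) simp
 assume al: "av : functionals V"
 \<comment> \<open>The equation om(x, .) = \<open>av\<close> in Darboux coordinates: the two members
   of each pair are exchanged, with a sign on the even ones.\<close>
 obtain x where x: "x : carrier V" "ALL i:{1..2*n}. a i x = (if even i then - av (e (i - 1)) else av (e (i + 1)))"
  using frameD(4)[OF a, of "%i. if even i then - av (e (i - 1)) else av (e (i + 1))"] by blast
 have eq: "flat V om x (e i) = av (e i)" if "i : {1..2*n}" for i
  using that
 proof (cases rule: nat_half_cases)
  case (1 j)
  thus ?thesis using fe(1)[OF x(1) 1(1)] x(2) rng(2)[OF 1(1)] by simp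
 next
  case (2 j)
  have "odd (2*j-1)" "2*j-1+1 = 2*j" using 2 by auto
  thus ?thesis using fe(2)[OF x(1) 2(1)] x(2) rng(1)[OF 2(1)] 2 by simp
 qed
 have "flat V om x = av"
 proof (rule functional_eqI[OF flat_functional[OF V alt x(1)] al])
  fix y assume y: "y : carrier V"
  have "zx V ga y = (SUM i=1..2*n. a i y * ga (e i))" if "ga : functionals V" for ga
   using frame_expand(1)[OF V a e zx_zfun[OF V that] y] e(1) by (simp add: zx_apply)
  note ex = this
  have "(SUM i=1..2*n. a i y * flat V om x (e i)) = (SUM i=1..2*n. a i y * av (e i))" using eq by (intro sum.cong) auto
  thus "flat V om x y = av y" using ex[OF al] ex[OF flat_functional[OF V alt x(1)]] y by (simp add: zx_apply)
 qed
 thus "EX x:carrier V. flat V om x = av" using x(1) by blast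
qed

section \<open>The 2-form associated to a bivector\<close>

locale represented_bivector =
 fixes V :: "('k::field, 'v) module" and La :: "('k, 'v) bivec" and C :: "('v => 'k) => ('v => 'k) => 'k"
 assumes vs: "vspace V" and fd: "vfin_dim V" and rep: "represents V La C"
begin

lemma bil: "fs.alt_bilin C"
 using rep by (simp add: represents_def)

definition sh :: "('v => 'k) => 'v" where "sh f = sharp V La (res V f)"

lemma sh_in: "f : zfun V ==> sh f : carrier V"
 unfolding sh_def by (rule sharp_res(1)[OF vs fd rep])

lemma sh_eval: "f : zfun V ==> g : zfun V ==> g (sh f) = C f g"
 unfolding sh_def by (rule sharp_res(2)[OF vs fd rep])

lemma separates: "x : carrier V ==> y : carrier V ==> (!!g. g : zfun V ==> g x = g y) ==> x = y"
proof -
 assume a: "x : carrier V" "y : carrier V" "!!g. g : zfun V ==> g x = g y"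
 obtain N :: nat and h where "frame V {..<N} h" using fin_dim_frame[OF vs fd] by blast
 thus ?thesis using a by (rule zfun_separates)
qed

lemma sh_eqI: "f : zfun V ==> x : carrier V ==> (!!g. g : zfun V ==> g x = C f g) ==> sh f = x"
 by (rule separates[OF sh_in]) (simp_all add: sh_eval)

lemma zfun_closed: "f : zfun V ==> g : zfun V ==> f + g : zfun V" "f : zfun V ==> fscale c f : zfun V"
 "f : zfun V ==> - f : zfun V" "f : zfun V ==> g : zfun V ==> f - g : zfun V" "0 : zfun V"
 by (simp_all add: fs.subspace_add[OF zfun_subspace] fs.subspace_scale[OF zfun_subspace]
  fs.subspace_neg[OF zfun_subspace] fs.subspace_diff[OF zfun_subspace] fs.subspace_0[OF zfun_subspace])

lemma sh_add: "f : zfun V ==> g : zfun V ==> sh (f + g) = sh f \<oplus>\<^bsub>V\<^esub> sh g"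
 by (rule sh_eqI) (simp_all add: zfun_closed vspaceD[OF vs] sh_in zfunD(2) sh_eval fs.alt_bilinD(1)[OF bil])

lemma sh_scale: "f : zfun V ==> sh (fscale c f) = c \<odot>\<^bsub>V\<^esub> sh f"
 by (rule sh_eqI) (simp_all add: zfun_closed vspaceD[OF vs] sh_in zfunD(3) sh_eval fs.alt_bilinD(3)[OF bil])

lemma sh_eq_iff: "f : zfun V ==> f' : zfun V ==> sh f = sh f' \<longleftrightarrow> (ALL g:zfun V. C f g = C f' g)"
 using sh_eval[of f] sh_eval[of f'] by (metis sh_eqI sh_in)

lemma sh_zero: "sh 0 = \<zero>\<^bsub>V\<^esub>"
 by (rule sh_eqI) (simp_all add: zfun_closed vspaceD[OF vs] zfun_zero[OF vs] fs.alt_bilinD(7)[OF bil])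

lemma image_sh: "bivector_image V La = sh ` zfun V"
 unfolding bivector_image_def functionals_res[OF vs] image_image sh_def ..

lemma image_ann: "bivector_image V La = ann V (fs.rad (zfun V) C)"
 by (rule bivector_image_ann[OF vs fd rep])

lemma rad_zfun: "fs.rad (zfun V) C <= zfun V"
 by (auto simp: fs.rad_def)

abbreviation Im :: "('k, 'v) module" where "Im \<equiv> on_subspace V (bivector_image V La)"

lemma Im_vspace: "vspace Im"
 using ann_vspace[OF vs _ rad_zfun] fin_dim_frame[OF vs fd] unfolding image_ann by blast

lemma Im_frame: "EX (K :: nat set) h. frame Im K h"
proof -
 obtain k u m g where u: "fs.basis_on (fs.rad (zfun V) C) {..<k::nat} u"
  and g: "frame V ({..<k} <+> {..<m::nat}) (case_sum u g)"
  by (rule frame_extend[OF vs fd fs.rad_subspace[OF zfun_subspace bil] rad_zfun])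
 from ann_frame[OF vs rad_zfun u g finite_lessThan] show ?thesis unfolding image_ann by blast
qed

lemma bivector_sh: "f : zfun V ==> g : zfun V ==> La (res V f) (res V g) = C f g"
 using rep by (simp add: represents_def)

lemma pushforward_incl:
 assumes "f : zfun V" "g : zfun V"
 shows "pushforward Im (%x. x) Ga (res V f) (res V g) = Ga (res Im f) (res Im g)"
proof -
 have "compose (carrier Im) (res V h) (%x. x) = res Im h" for h :: "'v => 'k"
  using sh_in by (auto simp: compose_def image_sh fun_eq_iff restrict_def)
 thus ?thesis by (simp add: pushforward_def)
qed

lemma res_Im: "f : zfun V ==> res Im f : functionals Im"
proof -
 assume f: "f : zfun V"
 have "cut (bivector_image V La) f : zfun Im"
  using ann_closed[OF vs rad_zfun] unfolding image_ann by (intro cut_zfun[OF f]) auto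
 from res_functional[OF Im_vspace this] show ?thesis by (simp add: cut_def cong: restrict_cong)
qed

lemma Im_add: "x : carrier Im ==> y : carrier Im ==> x \<oplus>\<^bsub>V\<^esub> y : carrier Im" "x : carrier Im ==> c \<odot>\<^bsub>V\<^esub> x : carrier Im"
 using vspaceD(2,3)[OF Im_vspace, of x] by auto

text \<open>Whatever form \<open>associated_form\<close> selects, its values on sharps are forced.
  The functional f restricted to the image is om(x, .) for a unique x, and comparing with the dual
  bivector identifies x as minus the sharp of f.\<close>

lemma associated_form_unique:
 assumes w: "symplectic_form Im om"
  and L: "ALL av:functionals V. ALL bv:functionals V. La av bv = pushforward Im (%x. x) (dual_bivector Im om) av bv"
  and fg: "f : zfun V" "g : zfun V"
 shows "om (sh f) (sh g) = C f g"
proof -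
 obtain K :: "nat set" and h where h: "frame Im K h" using Im_frame by blast
 note dp = dual_bivector_props[OF Im_vspace h w]
 have alt: "alternating_form Im om" using w by (simp add: symplectic_form_def)
 have ex: "EX x:carrier Im. flat Im om x = res Im f" if "f : zfun V" for f by (rule dp(3)[OF res_Im[OF that]])
 \<comment> \<open>For every f, the dual bivector evaluates the pair (f, g) as f x, while the
   bivector itself gives C f g = - C g f, which is minus f at the sharp of g.\<close>
 have key: "x = (-1) \<odot>\<^bsub>V\<^esub> sh g" if x: "x : carrier Im" "flat Im om x = res Im g" and g: "g : zfun V" for x g
 proof (rule separates)
  show "x : carrier V" using x(1) sh_in by (auto simp: image_sh)
  show "(-1) \<odot>\<^bsub>V\<^esub> sh g : carrier V" using vspaceD(3)[OF vs sh_in[OF g]] .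
  fix f assume f: "f : zfun V"
  obtain y where y: "y : carrier Im" "flat Im om y = res Im f" using ex[OF f] by blast
  have "C f g = La (res V f) (res V g)" using bivector_sh[OF f g] by simp
  also have "... = dual_bivector Im om (res Im f) (res Im g)"
   using L res_functional[OF vs f] res_functional[OF vs g] pushforward_incl[OF f g] by simp
  also have "... = om y x" using dp(2)[OF y(1) x(1)] unfolding y(2) x(2) .
  also have "... = f x" using fun_cong[OF y(2), of x] x(1) by (simp add: flat_def)
  finally have "f x = C f g" by simp
  thus "f x = f ((-1) \<odot>\<^bsub>V\<^esub> sh g)"
   using zfunD(3)[OF f sh_in[OF g], of "-1"] sh_eval[OF g f] fs.alt_bilinD(6)[OF bil, of g f] by simp
 qed
 obtain x y where x: "x : carrier Im" "flat Im om x = res Im f" and y: "y : carrier Im" "flat Im om y = res Im g"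
  using ex fg by meson
 have sI: "sh f : carrier Im" "sh g : carrier Im" using fg by (auto simp: image_sh)
 have "C f g = f y"
  using key[OF y fg(2)] zfunD(3)[OF fg(1) sh_in[OF fg(2)], of "-1"] sh_eval[OF fg(2,1)] fs.alt_bilinD(6)[OF bil, of g f] by simp
 also have "... = om x y" using fun_cong[OF x(2), of y] y(1) by (simp add: flat_def)
 also have "... = (-1) * ((-1) * om (sh f) (sh g))"
  unfolding key[OF x fg(1)] key[OF y fg(2)]
  using alternating_formD(3)[OF alt sI(1) Im_add(2)[OF sI(2), of "-1"] sI(1), of "-1"] alternating_formD(4)[OF alt sI sI(1), of "-1"] by simp
 finally show ?thesis by simp
qed

text \<open>The form takes sharps to values of C on chosen preimages; the choice is immaterial,
  since functionals with equal sharps differ by an element of the radical.\<close>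

lemma associated_form_exists:
 "EX om. symplectic_form Im om & (ALL av:functionals V. ALL bv:functionals V.
   La av bv = pushforward Im (%x. x) (dual_bivector Im om) av bv)"
proof -
 obtain K :: "nat set" and h where h: "frame Im K h" using Im_frame by blast
 define pre where "pre x = (SOME f. f : zfun V & sh f = x)" for x
 have pre: "pre x : zfun V" "sh (pre x) = x" if "x : carrier Im" for x
 proof -
  have "EX f. f : zfun V & sh f = x" using that by (auto simp: image_sh)
  hence "pre x : zfun V & sh (pre x) = x" unfolding pre_def by (rule someI_ex)
  thus "pre x : zfun V" "sh (pre x) = x" by auto
 qed
 define om where "om x y = C (pre x) (pre y)" for x y
 have shI: "sh f : carrier Im" if "f : zfun V" for f using that by (simp add: image_sh)
 have w: "om (sh f) (sh g) = C f g" if fg: "f : zfun V" "g : zfun V" for f g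
 proof -
  note p = pre[OF shI[OF fg(1)]] pre[OF shI[OF fg(2)]]
  have "C (pre (sh f)) (pre (sh g)) = C f (pre (sh g))"
   using p(2) p(3) sh_eq_iff[OF p(1) fg(1)] by blast
  also have "... = - C (pre (sh g)) f" by (rule fs.alt_bilinD(6)[OF bil])
  also have "... = - C g f" using p(4) fg(1) sh_eq_iff[OF p(3) fg(2)] by simp
  also have "... = C f g" using fs.alt_bilinD(6)[OF bil, of f g] by simp
  finally show ?thesis by (simp add: om_def)
 qed
 have alt: "alternating_form Im om" unfolding alternating_form_def
  by (auto simp: image_sh sh_add[symmetric] sh_scale[symmetric] w zfun_closed fs.alt_bilinD(1-5)[OF bil])
 have sym: "symplectic_form Im om" unfolding symplectic_form_def
 proof (intro conjI alt equalityI subsetI)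
  fix x assume x: "x : form_kernel Im om"
  then obtain f where f: "f : zfun V" "x = sh f" by (auto simp: form_kernel_def image_sh)
  have "C f g = C 0 g" if "g : zfun V" for g
   using x w[OF f(1) that] shI[OF that] by (auto simp: form_kernel_def f(2) fs.alt_bilinD(7)[OF bil])
  thus "x : {\<zero>\<^bsub>Im\<^esub>}" using sh_eq_iff[OF f(1) zfun_closed(5)] f(2) sh_zero by simp
 next
  fix x assume "x : {\<zero>\<^bsub>Im\<^esub>}"
  hence x: "x = sh 0" by (simp add: sh_zero)
  show "x : form_kernel Im om" unfolding form_kernel_def x
   using shI[OF zfun_closed(5)] w[OF zfun_closed(5)] by (auto simp: image_sh fs.alt_bilinD(7)[OF bil])
 qed
 \<comment> \<open>The sign is due to the sharp filling the first slot: om(sh (- f), sh g) = - C f g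
   = C g f = f(sh g).\<close>
 have flat: "flat Im om (sh (- f)) = res Im f" if f: "f : zfun V" for f
 proof -
  have "om (sh (- f)) y = f y" if y: "y : carrier Im" for y
  proof -
   obtain g where g: "g : zfun V" "y = sh g" using y by (auto simp: image_sh)
   show ?thesis unfolding g(2) w[OF zfun_closed(3)[OF f] g(1)] sh_eval[OF g(1) f]
    using fs.alt_bilinD(6)[OF bil, of g f] by (simp add: fs.alt_bilinD(9)[OF bil])
  qed
  thus ?thesis unfolding flat_def by (intro restrict_ext)
 qed
 have "La (res V f) (res V g) = pushforward Im (%x. x) (dual_bivector Im om) (res V f) (res V g)"
  if fg: "f : zfun V" "g : zfun V" for f g
  unfolding pushforward_incl[OF fg] bivector_sh[OF fg] flat[OF fg(1), symmetric] flat[OF fg(2), symmetric]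
  using dual_bivector_props(2)[OF Im_vspace h sym shI[OF zfun_closed(3)[OF fg(1)]] shI[OF zfun_closed(3)[OF fg(2)]]]
   w[OF zfun_closed(3)[OF fg(1)] zfun_closed(3)[OF fg(2)]] by (simp add: fs.alt_bilinD(9,10)[OF bil])
 thus ?thesis using sym unfolding functionals_res[OF vs] by blast
qed

lemma associated_form_sh:
 assumes "f : zfun V" "g : zfun V"
 shows "associated_form V La (sh f) (sh g) = C f g"
proof -
 have "symplectic_form Im (associated_form V La) & (ALL av:functionals V. ALL bv:functionals V.
   La av bv = pushforward Im (%x. x) (dual_bivector Im (associated_form V La)) av bv)"
  unfolding associated_form_def Let_def by (rule someI_ex[OF associated_form_exists])
 thus ?thesis using associated_form_unique[OF _ _ assms] by blast
qed

end

section \<open>Quotient spaces\<close>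

locale quotient =
 fixes V :: "('k::field, 'v) module" and L :: "'v set"
 assumes vs: "vspace V" and L_sub: "L <= carrier V" and L_0: "\<zero>\<^bsub>V\<^esub> : L"
  and L_add: "x : L ==> y : L ==> x \<oplus>\<^bsub>V\<^esub> y : L" and L_scale: "x : L ==> c \<odot>\<^bsub>V\<^esub> x : L"
begin

abbreviation Q :: "('k, 'v set) module" where "Q \<equiv> quotient_space V L"
abbreviation pr :: "'v => 'v set" where "pr \<equiv> projection V L"

lemma mem_pr: "z : pr x \<longleftrightarrow> (EX l:L. z = l \<oplus>\<^bsub>V\<^esub> x)"
 by (auto simp: a_r_coset_def')

lemma pr_eq_iff:
 assumes x: "x : carrier V" and y: "y : carrier V"
 shows "pr x = pr y \<longleftrightarrow> (EX l:L. x = l \<oplus>\<^bsub>V\<^esub> y)"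
proof
 interpret vectorspace class_ring V by (rule vs)
 assume "pr x = pr y"
 moreover have "x : pr x" using x by (auto simp: mem_pr intro!: bexI[OF _ L_0])
 ultimately show "EX l:L. x = l \<oplus>\<^bsub>V\<^esub> y" by (simp add: mem_pr)
next
 interpret vectorspace class_ring V by (rule vs)
 have sub: "pr x <= pr y" if "l : L" "x = l \<oplus>\<^bsub>V\<^esub> y" "y : carrier V" for l x y
 proof
  fix z assume "z : pr x"
  then obtain k where k: "k : L" "z = k \<oplus>\<^bsub>V\<^esub> x" by (auto simp: mem_pr)
  hence "z = (k \<oplus>\<^bsub>V\<^esub> l) \<oplus>\<^bsub>V\<^esub> y" using that L_sub by (simp add: a_assoc subset_iff)
  thus "z : pr y" using L_add[OF k(1) that(1)] by (auto simp: mem_pr)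
 qed
 assume "EX l:L. x = l \<oplus>\<^bsub>V\<^esub> y"
 then obtain l where l: "l : L" "x = l \<oplus>\<^bsub>V\<^esub> y" by blast
 have lc: "l : carrier V" using l L_sub by blast
 let ?m = "(-1) \<odot>\<^bsub>V\<^esub> l"
 have m: "?m : L" "?m : carrier V" using L_scale[OF l(1)] L_sub by auto
 have "?m \<oplus>\<^bsub>V\<^esub> l = \<zero>\<^bsub>V\<^esub>"
  using smult_l_distr[of "-1" 1 l] lc smult_one[OF lc] lmult_0[OF lc] by simp
 hence "y = ?m \<oplus>\<^bsub>V\<^esub> x" using l(2) lc m(2) y by (simp add: a_assoc[symmetric])
 thus "pr x = pr y" using sub[OF l y] sub[OF m(1) _ x] by blast
qed

lemma carrier_Q: "carrier Q = pr ` carrier V"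
 by (auto simp: quotient_space_def A_RCOSETS_def')

lemma pr_in: "x : carrier V ==> pr x : carrier Q"
 by (simp add: carrier_Q)

lemma zero_Q: "\<zero>\<^bsub>Q\<^esub> = pr \<zero>\<^bsub>V\<^esub>"
proof -
 interpret vectorspace class_ring V by (rule vs)
 have "L = pr \<zero>\<^bsub>V\<^esub>"
 proof (intro equalityI subsetI)
  fix z assume z: "z : L"
  hence "z = z \<oplus>\<^bsub>V\<^esub> \<zero>\<^bsub>V\<^esub>" using L_sub by auto
  thus "z : pr \<zero>\<^bsub>V\<^esub>" using z by (auto simp: mem_pr)
 qed (use L_sub in \<open>auto simp: mem_pr\<close>)
 thus ?thesis by (simp add: quotient_space_def)
qed

lemma add_Q:
 assumes x: "x : carrier V" and y: "y : carrier V"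
 shows "pr x \<oplus>\<^bsub>Q\<^esub> pr y = pr (x \<oplus>\<^bsub>V\<^esub> y)"
proof -
 interpret vectorspace class_ring V by (rule vs)
 have "z : pr x <+>\<^bsub>V\<^esub> pr y \<longleftrightarrow> z : pr (x \<oplus>\<^bsub>V\<^esub> y)" for z
 proof
  assume "z : pr x <+>\<^bsub>V\<^esub> pr y"
  then obtain k l where kl: "k : L" "l : L" "z = (k \<oplus>\<^bsub>V\<^esub> x) \<oplus>\<^bsub>V\<^esub> (l \<oplus>\<^bsub>V\<^esub> y)" by (auto simp: set_add_def' mem_pr)
  hence "z = (k \<oplus>\<^bsub>V\<^esub> l) \<oplus>\<^bsub>V\<^esub> (x \<oplus>\<^bsub>V\<^esub> y)" using x y L_sub by (simp add: a_ac subset_iff)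
  thus "z : pr (x \<oplus>\<^bsub>V\<^esub> y)" using L_add[OF kl(1,2)] by (auto simp: mem_pr)
 next
  assume "z : pr (x \<oplus>\<^bsub>V\<^esub> y)"
  then obtain l where l: "l : L" "z = l \<oplus>\<^bsub>V\<^esub> (x \<oplus>\<^bsub>V\<^esub> y)" by (auto simp: mem_pr)
  hence "z = (l \<oplus>\<^bsub>V\<^esub> x) \<oplus>\<^bsub>V\<^esub> (\<zero>\<^bsub>V\<^esub> \<oplus>\<^bsub>V\<^esub> y)" using x y L_sub by (simp add: a_assoc subset_iff)
  moreover have "l \<oplus>\<^bsub>V\<^esub> x : pr x" "\<zero>\<^bsub>V\<^esub> \<oplus>\<^bsub>V\<^esub> y : pr y" using l(1) L_0 by (auto simp: mem_pr)
  ultimately show "z : pr x <+>\<^bsub>V\<^esub> pr y" unfolding set_add_def' by blast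
 qed
 thus ?thesis by (simp add: quotient_space_def set_eq_iff)
qed

lemma smult_Q:
 assumes x: "x : carrier V"
 shows "c \<odot>\<^bsub>Q\<^esub> pr x = pr (c \<odot>\<^bsub>V\<^esub> x)"
proof -
 interpret vectorspace class_ring V by (rule vs)
 have eq: "pr (c \<odot>\<^bsub>V\<^esub> z) = pr (c \<odot>\<^bsub>V\<^esub> x)" if z: "z : pr x" for z
 proof -
  obtain l where l: "l : L" "z = l \<oplus>\<^bsub>V\<^esub> x" using z by (auto simp: mem_pr)
  have lc: "l : carrier V" using l(1) L_sub by auto
  have "c \<odot>\<^bsub>V\<^esub> z = c \<odot>\<^bsub>V\<^esub> l \<oplus>\<^bsub>V\<^esub> c \<odot>\<^bsub>V\<^esub> x" using smult_r_distr[of c l x] lc x l(2) by simp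
  thus ?thesis using L_scale[OF l(1)] x lc l(2) vspaceD(2,3)[OF vs] by (subst pr_eq_iff) auto
 qed
 have "x : pr x" using x by (auto simp: mem_pr intro!: bexI[OF _ L_0])
 hence "(\<Union>z\<in>pr x. pr (c \<odot>\<^bsub>V\<^esub> z)) = pr (c \<odot>\<^bsub>V\<^esub> x)" using eq by blast
 thus ?thesis by (simp add: quotient_space_def)
qed

lemma Q_vspace: "vspace Q"
proof -
 interpret vectorspace class_ring V by (rule vs)
 note cl = vspaceD[OF vs]
 show ?thesis
 proof (rule vs_criteria[OF class_field])
  show "ALL v:carrier Q. EX neg_v:carrier Q. v \<oplus>\<^bsub>Q\<^esub> neg_v = \<zero>\<^bsub>Q\<^esub>"
  proof
   fix v assume "v : carrier Q"
   then obtain x where x: "x : carrier V" "v = pr x" by (auto simp: carrier_Q)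
   have "v \<oplus>\<^bsub>Q\<^esub> pr (\<ominus>\<^bsub>V\<^esub> x) = \<zero>\<^bsub>Q\<^esub>" using x by (simp add: add_Q zero_Q r_neg)
   thus "EX neg_v:carrier Q. v \<oplus>\<^bsub>Q\<^esub> neg_v = \<zero>\<^bsub>Q\<^esub>" using x pr_in by blast
  qed
  show "ALL a b v. a : carrier class_ring & b : carrier class_ring & v : carrier Q -->
    (a \<otimes>\<^bsub>class_ring\<^esub> b) \<odot>\<^bsub>Q\<^esub> v = a \<odot>\<^bsub>Q\<^esub> (b \<odot>\<^bsub>Q\<^esub> v)"
   using smult_assoc1 cl(3) by (auto simp: carrier_Q smult_Q)
  show "ALL a b v. a : carrier class_ring & b : carrier class_ring & v : carrier Q -->
    (a \<oplus>\<^bsub>class_ring\<^esub> b) \<odot>\<^bsub>Q\<^esub> v = a \<odot>\<^bsub>Q\<^esub> v \<oplus>\<^bsub>Q\<^esub> b \<odot>\<^bsub>Q\<^esub> v"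
   using smult_l_distr cl(3) by (auto simp: carrier_Q add_Q smult_Q)
  show "ALL a v w. a : carrier class_ring & v : carrier Q & w : carrier Q -->
    a \<odot>\<^bsub>Q\<^esub> (v \<oplus>\<^bsub>Q\<^esub> w) = a \<odot>\<^bsub>Q\<^esub> v \<oplus>\<^bsub>Q\<^esub> a \<odot>\<^bsub>Q\<^esub> w"
   using smult_r_distr cl(2,3) by (auto simp: carrier_Q add_Q smult_Q)
 qed (use cl smult_one in \<open>auto simp: carrier_Q add_Q smult_Q zero_Q a_ac\<close>)
qed

text \<open>The functional induced on the quotient; the choice of representative is harmless when f
  vanishes on \<open>L\<close>.\<close>

definition qf :: "('v => 'k) => 'v set => 'k" where
 "qf f X = (if X : carrier Q then f (SOME x. x : carrier V & X = pr x) else 0)"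

context
 fixes f assumes f: "f : zfun V" and fL: "!!x. x : L ==> f x = 0"
begin

lemma qf_pr: "x : carrier V ==> qf f (pr x) = f x"
proof -
 assume x: "x : carrier V"
 define y where "y = (SOME y. y : carrier V & pr x = pr y)"
 have "y : carrier V & pr x = pr y" unfolding y_def using x by (intro someI_ex[of "%y. y : carrier V & pr x = pr y"]) blast
 then obtain l where "l : L" "y : carrier V" "x = l \<oplus>\<^bsub>V\<^esub> y" using pr_eq_iff[OF x] by blast
 hence "f x = f y" using zfunD(2)[OF f, of l y] L_sub fL by auto
 thus ?thesis using pr_in[OF x] by (simp add: qf_def y_def)
qed

lemma qf_zfun: "qf f : zfun Q"
proof (rule zfunI)
 show "qf f X = 0" if "X \<notin> carrier Q" for X using that by (simp add: qf_def)
qed (auto simp: carrier_Q add_Q smult_Q qf_pr vspaceD[OF vs] zfunD(2,3)[OF f])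

lemma compose_qf: "compose (carrier V) (res Q (qf f)) pr = res V f"
 by (auto simp: compose_def fun_eq_iff pr_in qf_pr)

end

lemma quotient_frame:
 assumes J: "finite J" and f: "!!j. j : J ==> f j : zfun V" "!!j x. j : J ==> x : L ==> f j x = 0"
  and sep: "!!x. x : carrier V ==> (!!j. j : J ==> f j x = 0) ==> x : L"
  and ex: "!!c. EX x:carrier V. ALL j:J. f j x = c j"
 shows "frame Q J (%j. qf (f j))"
 unfolding frame_def
proof (intro conjI ballI allI impI)
 fix X Y assume XY: "X : carrier Q" "Y : carrier Q" "ALL j:J. qf (f j) X = qf (f j) Y"
 then obtain x y where xy: "x : carrier V" "X = pr x" "y : carrier V" "Y = pr y" by (auto simp: carrier_Q)
 interpret vectorspace class_ring V by (rule vs)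
 let ?m = "(-1) \<odot>\<^bsub>V\<^esub> y"
 have m: "?m : carrier V" by (rule vspaceD(3)[OF vs xy(3)])
 have "x \<oplus>\<^bsub>V\<^esub> ?m : L"
 proof (rule sep[OF vspaceD(2)[OF vs xy(1) m]])
  fix j assume j: "j : J"
  have "qf (f j) X = qf (f j) Y" using XY(3) j by blast
  moreover have "qf (f j) X = f j x" unfolding xy(2) by (rule qf_pr[OF f(1)[OF j] f(2)[OF j] xy(1)])
  moreover have "qf (f j) Y = f j y" unfolding xy(4) by (rule qf_pr[OF f(1)[OF j] f(2)[OF j] xy(3)])
  ultimately have "f j x = f j y" by simp
  thus "f j (x \<oplus>\<^bsub>V\<^esub> ?m) = 0" using zfunD(2)[OF f(1)[OF j] xy(1) m] zfunD(3)[OF f(1)[OF j] xy(3), of "-1"] by simp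
 qed
 moreover have "?m \<oplus>\<^bsub>V\<^esub> y = \<zero>\<^bsub>V\<^esub>"
  using smult_l_distr[of "-1" 1 y] xy(3) smult_one[OF xy(3)] lmult_0[OF xy(3)] by simp
 hence "x = (x \<oplus>\<^bsub>V\<^esub> ?m) \<oplus>\<^bsub>V\<^esub> y" using xy(1,3) m by (simp add: a_assoc)
 ultimately show "X = Y" unfolding xy(2,4) using pr_eq_iff[OF xy(1,3)] by blast
next
 fix c
 obtain x where x: "x : carrier V" "ALL j:J. f j x = c j" using ex by blast
 hence "ALL j:J. qf (f j) (pr x) = c j" using qf_pr f by simp
 thus "EX X:carrier Q. ALL j:J. qf (f j) X = c j" using pr_in[OF x(1)] by blast
qed (use J qf_zfun f in auto)

end

lemma Inl_mem_Plus [simp]: "Inl x : X <+> Y \<longleftrightarrow> x : X" and Inr_mem_Plus [simp]: "Inr y : X <+> Y \<longleftrightarrow> y : Y"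
 by auto

section \<open>The complement of the Kronecker part and its operator\<close>

locale kron_decomp = kron_family scale D A B r n bv
 for scale :: "'k::field_char_0 => 'b::ab_group_add => 'b" (infixr "*s" 75) and D A B r n bv +
 fixes av :: "nat => nat => 'b" and m :: nat and sg :: "nat => 'b"
 assumes kb: "kron_basis n bv av m sg"
begin

lemma kb_basis: "basis_on D (kidx r n m) (kron_fam bv av sg)"
 using kb unfolding kron_basis_def by blast

lemma kb_D: "(l, k) : cidx r n ==> av l k : D" "q < m ==> sg q : D"
 using basis_onD(2)[OF kb_basis, of "Inr (Inl (l, k))"] basis_onD(2)[OF kb_basis, of "Inr (Inr q)"] by auto

lemma kb_beta_beta: "(j, i) : idx r n ==> (l, k) : idx r n ==> A (bv j i) (bv l k) = 0 & B (bv j i) (bv l k) = 0"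
 and kb_beta_alpha: "(j, i) : idx r n ==> (l, k) : cidx r n ==> A (bv j i) (av l k) = (if j = l & i = Suc k then 1 else 0) &
    B (bv j i) (av l k) = - (if j = l & i = k then 1 else 0)"
 and kb_alpha_alpha: "(j, i) : cidx r n ==> (l, k) : cidx r n ==> A (av j i) (av l k) = 0 & B (av j i) (av l k) = 0"
 and kb_beta_sigma: "(j, i) : idx r n ==> q < m ==> A (bv j i) (sg q) = 0 & B (bv j i) (sg q) = 0"
 and kb_alpha_sigma: "(j, i) : cidx r n ==> q < m ==> A (av j i) (sg q) = 0 & B (av j i) (sg q) = 0"
 using kb unfolding kron_basis_def by blast+

definition S :: "'b set" where "S = span (sg ` {..<m})"

lemma sub_S: "subspace S"
 by (simp add: S_def)

lemma basis_S: "basis_on S {..<m} sg"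
 unfolding basis_on_def indep_fam_def
proof (intro conjI ballI allI impI)
 fix c i assume z: "(SUM i<m. c i *s sg i) = 0" and i: "i : {..<m}"
 have "(SUM k:kidx r n m. case_sum (%_. 0) (case_sum (%_. 0) c) k *s
   kron_fam bv av sg k) = 0"
  using z by (simp add: sum.Plus)
 from indep_famD[OF basis_onD(3)[OF kb_basis] this, of "Inr (Inr i)"] show "c i = 0" using i by simp
next
 show "EX c. x = (SUM i<m. c i *s sg i)" if "x : S" for x
  using that unfolding S_def by (auto simp: span_fam[OF finite_lessThan, of sg m])
qed (auto simp: S_def intro!: span_base)

lemma fin_S: "fin_sub S"
 by (rule basis_on_fin_sub[OF sub_S basis_S])

lemma sigma_S: "q < m ==> sg q : S"
 by (simp add: S_def span_base)

lemma S_D: "S <= D"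
 unfolding S_def by (rule span_minimal[OF _ sub_D]) (auto simp: kb_D)

lemma S_cases: "s : S ==> EX c. s = (SUM q<m. c q *s sg q)"
 by (rule basis_onD(4)[OF basis_S])

lemma U_S: "u : U ==> s : S ==> A u s = 0" "u : U ==> s : S ==> B u s = 0"
proof -
 assume "u : U" "s : S"
 then obtain c d where "u = (SUM p:idx r n. c p *s (case p of (j, i) => bv j i))" "s = (SUM q<m. d q *s sg q)"
  using basis_onD(4)[OF basis_U] S_cases by blast
 thus "A u s = 0" "B u s = 0" using kb_beta_sigma by (auto simp: A_simps B_simps intro!: sum.neutral)
qed

lemma alpha_S: "(l, k) : cidx r n ==> s : S ==> A (av l k) s = 0" "(l, k) : cidx r n ==> s : S ==> B (av l k) s = 0"
proof -
 assume lk: "(l, k) : cidx r n" and "s : S"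
 then obtain d where "s = (SUM q<m. d q *s sg q)" using S_cases by blast
 thus "A (av l k) s = 0" "B (av l k) s = 0" using kb_alpha_sigma[OF lk] by (auto simp: A_simps B_simps intro!: sum.neutral)
qed

lemma decomp: "y : D ==> EX u:U. EX s:S. EX c. y = u + (SUM p:cidx r n. c p *s (case p of (l, k) => av l k)) + s"
proof -
 assume "y : D"
 then obtain c where c: "y = (SUM k:kidx r n m. c k *s
   kron_fam bv av sg k)" using basis_onD(4)[OF kb_basis] by blast
 have u: "(SUM p:idx r n. c (Inl p) *s (case p of (j, i) => bv j i)) : U"
  using basis_onD(2)[OF basis_U] by (intro subspace_sum[OF sub_U] subspace_scale[OF sub_U]) auto
 have s: "(SUM q<m. c (Inr (Inr q)) *s sg q) : S"
  using sigma_S by (intro subspace_sum[OF sub_S] subspace_scale[OF sub_S]) auto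
 have "y = (SUM p:idx r n. c (Inl p) *s (case p of (j, i) => bv j i)) +
   (SUM p:cidx r n. c (Inr (Inl p)) *s (case p of (l, k) => av l k)) + (SUM q<m. c (Inr (Inr q)) *s sg q)"
  unfolding c by (simp add: sum.Plus add.assoc)
 thus ?thesis by (intro bexI[OF _ u] bexI[OF _ s] exI[of _ "%p. c (Inr (Inl p))"])
qed

text \<open>The orthogonal of the chain space, for \<open>A\<close> and by \<open>P_B\<close>
  equally for \<open>B\<close>. Its sharps will be \<open>L0\<close>.\<close>

definition P :: "'b set" where "P = {y : D. ALL u:U. A u y = 0}"

lemma P_B: "y : P \<longleftrightarrow> y : D & (ALL u:U. B u y = 0)"
 unfolding P_def using image_AB image_BA by (smt (verit, ccfv_SIG) mem_Collect_eq)

lemma P_I: "u : U ==> s : S ==> u + s : P"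
 using U_D S_D isotropic(1) U_S(1) subspace_add[OF sub_D] by (auto simp: P_def A_simps subset_iff)

lemma P_U: "u : U ==> u : P" and P_S: "s : S ==> s : P"
 using P_I[of u 0] P_I[of 0 s] subspace_0[OF sub_S] subspace_0[OF sub_U] by auto

lemma P_D: "P <= D"
 by (auto simp: P_def)

lemma sub_P: "subspace P"
 using subspace_0[OF sub_D] subspace_add[OF sub_D] subspace_scale[OF sub_D] by (intro subspaceI) (auto simp: P_def A_simps)

text \<open>Pairing with \<open>bv l (Suc k)\<close> reads off the coefficient along
  \<open>av l k\<close>, which orthogonality to \<open>U\<close> makes zero.\<close>

lemma P_cases: "y : P ==> EX u:U. EX s:S. y = u + s"
proof -
 assume y: "y : P"
 then obtain u s c where us: "u : U" "s : S" "y = u + (SUM p:cidx r n. c p *s (case p of (l, k) => av l k)) + s"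
  using decomp[of y] P_D by blast
 have "c (l, k) = 0" if lk: "(l, k) : cidx r n" for l k
 proof -
  have ix: "(l, Suc k) : idx r n" using lk by auto
  hence bU: "bv l (Suc k) : U" by (auto intro: beta_U)
  have "0 = A (bv l (Suc k)) y" using y bU by (simp add: P_def)
  also have "... = (SUM p:cidx r n. c p * A (bv l (Suc k)) (case p of (l, k) => av l k))"
   unfolding us(3) using isotropic(1)[OF bU us(1)] U_S(1)[OF bU us(2)] by (simp add: A_simps)
  also have "... = (SUM p:cidx r n. if p = (l, k) then c (l, k) else 0)"
   using kb_beta_alpha[OF ix] by (intro sum.cong refl) (auto split: prod.splits)
  finally show ?thesis using lk finite_cidx by simp
 qed
 hence "(SUM p:cidx r n. c p *s (case p of (l, k) => av l k)) = 0" by (intro sum.neutral) auto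
 thus ?thesis using us by auto
qed

lemma isotropic_C: "C = A \<or> C = B ==> u : U ==> y : P ==> C u y = 0" "C = A \<or> C = B ==> u : U ==> y : P ==> C y u = 0"
proof -
 assume C: "C = A \<or> C = B" and u: "u : U" and y: "y : P"
 show uy: "C u y = 0" using C u y P_B[of y] by (auto simp: P_def)
 show "C y u = 0" using C uy alt_bilin_eq0[OF bil_A] alt_bilin_eq0[OF bil_B] by auto
qed

lemma bil_C: "C = A \<or> C = B ==> alt_bilin C"
 using bil_A bil_B by auto

lemma nondeg_S: "C = A \<or> C = B ==> nondeg_on S C"
 unfolding nondeg_on_def
proof (intro ballI impI)
 fix s assume C: "C = A \<or> C = B" and s: "s : S" and z: "ALL y:S. C s y = 0"
 obtain c where c: "s = (SUM q<m. c q *s sg q)" using S_cases[OF s] by blast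
 have "c p = 0" if "p < m" for p
 proof (rule kron_basis_nondegenerate[OF kfam kb C _ that])
  fix q assume "q < m"
  thus "(SUM p<m. c p * C (sg p) (sg q)) = 0"
   using z sigma_S[of q] alt_bilin_sum(1)[OF bil_C[OF C], of c sg "{..<m}" "sg q"] unfolding c by auto
 qed
 thus "s = 0" by (simp add: c)
qed

text \<open>The component in \<open>S\<close> would be orthogonal to \<open>S\<close>, where both
  forms are nondegenerate.\<close>

lemma kernel_P:
 assumes C: "C = A \<or> C = B" and y: "y : P" and z: "!!z. z : P ==> C y z = 0"
 shows "y : U"
proof -
 obtain u s where us: "u : U" "s : S" "y = u + s" using P_cases[OF y] by blast
 have "C s s' = 0" if "s' : S" for s'
  using z[OF P_S[OF that]] isotropic_C(1)[OF C us(1) P_S[OF that]] unfolding us(3) by (simp add: alt_bilinD(1)[OF bil_C[OF C]])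
 hence "s = 0" using nondeg_S[OF C] us(2) by (simp add: nondeg_on_def)
 thus ?thesis using us by simp
qed

lemma U_Int_S: "x : U ==> x : S ==> x = 0"
 using nondeg_S[of A] U_S(1) by (auto simp: nondeg_on_def)

text \<open>Vectors of \<open>S\<close> pair to zero with the chains and the dual chains under both
  forms, so an identity tested on \<open>S\<close> holds on all of \<open>D\<close>.\<close>

lemma S_ext:
 assumes C: "C = A \<or> C = B" and C': "C' = A \<or> C' = B" and s: "s : S" "t : S" and e: "!!y. y : S ==> C s y = a * C' t y" and y: "y : D"
 shows "C s y = a * C' t y"
proof -
 obtain u s' c where y: "u : U" "s' : S" "y = u + (SUM p:cidx r n. c p *s (case p of (l, k) => av l k)) + s'"
  using decomp[OF y] by blast
 have z: "F x u = 0" "F x (case p of (l, k) => av l k) = 0" if "F = A \<or> F = B" "x : S" "p : cidx r n" for F x p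
  using isotropic_C(2)[OF that(1) y(1) P_S[OF that(2)]] that alpha_S[of _ _ x] alt_bilin_eq0[OF bil_C[OF that(1)]]
  by (auto split: prod.splits)
 have z0: "F x u = 0" if "F = A \<or> F = B" "x : S" for F x
  using isotropic_C(2)[OF that(1) y(1) P_S[OF that(2)]] .
 have Fy: "F x y = F x s'" if F: "F = A \<or> F = B" "x : S" for F x
  unfolding y(3) alt_bilinD(2)[OF bil_C[OF F(1)]] alt_bilin_sum(2)[OF bil_C[OF F(1)]] using z0[OF F] z(2)[OF F] by simp
 show ?thesis unfolding Fy[OF C s(1)] Fy[OF C' s(2)] by (rule e[OF y(2)])
qed

text \<open>The recursion operator B^(-1) A on \<open>S\<close>, chosen linear on the whole type. It
  is self-adjoint for both forms.\<close>

definition T :: "'b => 'b" where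
 "T = (SOME T. linop T & (ALL s:S. T s : S & (ALL y:D. A s y = B (T s) y)))"

lemma solve_S: "C = A \<or> C = B ==> linfun w ==> EX t:S. ALL y:S. w y = C t y"
proof -
 assume C: "C = A \<or> C = B" and w: "linfun w"
 have "w z = 0" if "z : rad S C" for z using that nondeg_S[OF C] linfun_zero[OF w] by (auto simp: rad_def nondeg_on_def)
 from fredholm[OF fin_S bil_C[OF C] w this] show ?thesis by metis
qed

lemma T_spec: "linop T & (ALL s:S. T s : S & (ALL y:D. A s y = B (T s) y))"
proof -
 have "ALL q. EX t. t : S & (ALL y:S. A (sg q) y = B t y)" using solve_S[of B] alt_bilinD(13)[OF bil_A] by blast
 then obtain t where t: "!!q. t q : S" "!!q y. y : S ==> A (sg q) y = B (t q) y" by metis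
 obtain f where f: "!!i. i : {..<m} ==> linfun (f i)" "!!x. x : S ==> x = (SUM i<m. f i x *s sg i)"
  using basis_on_coords[OF basis_S] by metis
 define R where "R x = (SUM i<m. f i x *s t i)" for x
 have l: "linop R" unfolding linop_def R_def using f(1)
  by (auto simp: linfun_def scale_left_distrib sum.distrib scale_sum_right)
 have RS: "R s : S" for s unfolding R_def using t(1) by (intro subspace_sum[OF sub_S] subspace_scale[OF sub_S])
 have "A s y = B (R s) y" if "s : S" "y : S" for s y
  using t(2)[OF that(2)] by (subst f(2)[OF that(1)]) (simp add: R_def A_simps B_simps)
 hence "A s y = B (R s) y" if "s : S" "y : D" for s y
  using S_ext[of A B s "R s" 1 y] RS that by simp
 hence "EX R. linop R & (ALL s:S. R s : S & (ALL y:D. A s y = B (R s) y))" using l RS by blast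
 thus ?thesis unfolding T_def by (rule someI_ex)
qed

lemma T_lin: "linop T" and T_S: "s : S ==> T s : S" and T_eq: "s : S ==> y : D ==> A s y = B (T s) y"
 using T_spec by auto

lemma B_T: "x : S ==> y : S ==> B (T x) y = B x (T y)"
 using T_eq[of x y] T_eq[of y x] S_D A_swap[of x y] B_swap[of x "T y"] by (auto simp: subset_iff)

lemma A_T: "x : S ==> y : S ==> A (T x) y = A x (T y)"
 using T_eq[of "T x" y] T_eq[of x "T y"] B_T[of "T x" y] T_S S_D by (auto simp: subset_iff)

lemma B_TT: "x : S ==> y : S ==> B (T x) (T y) = A (T x) y"
 using T_eq[of x "T y"] A_T T_S S_D by (auto simp: subset_iff)

lemma T_inj: "x : S ==> T x = 0 ==> x = 0"
 using T_eq[of x] nondeg_S[of A] S_D alt_bilinD(7)[OF bil_B] by (auto simp: nondeg_on_def subset_iff)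

lemma T_surj: "t : S ==> EX s:S. T s = t"
proof -
 assume t: "t : S"
 obtain s where s: "s : S" "ALL y:S. B t y = A s y" using solve_S[of A "B t"] alt_bilinD(13)[OF bil_B] by blast
 have "B (T s - t) y = 0" if "y : S" for y using s that T_eq[OF s(1), of y] S_D by (auto simp: B_simps)
 moreover have "T s - t : S" by (rule subspace_diff[OF sub_S T_S[OF s(1)] t])
 ultimately have "T s - t = 0" using nondeg_S[of B] unfolding nondeg_on_def by blast
 thus ?thesis using s(1) by auto
qed

lemma sympl_op_T: "sympl_op S B T"
 unfolding sympl_op_def using fin_S bil_B nondeg_S[of B] T_lin T_S B_T by auto

text \<open>Induction down each chain from its zero end. If z is A-orthogonal to
  \<open>bv j (i + 1)\<close>, the recursion makes it B-orthogonal to \<open>bv j i\<close>, and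
  then the radical equation makes it A-orthogonal to \<open>bv j i\<close>. There is no division by
  t, so every t is covered.\<close>

lemma rad_pencil_P:
 assumes z: "z : rad D (pen t)"
 shows "z : P"
proof -
 have zD: "z : D" and z0: "y : D ==> A z y + t * B z y = 0" for y using z by (auto simp: rad_def)
 have "A (bv j (n j + 1 - k)) z = 0" if j: "j : {1..r}" for j k
 proof (induction k)
  case 0
  thus ?case using beta_gt[OF j] by (simp add: A_simps)
 next
  case (Suc k)
  show ?case
  proof (cases "k <= n j")
   case True
   let ?i = "n j - k"
   have i: "n j + 1 - k = Suc ?i" "n j + 1 - Suc k = ?i" using True by auto
   have "B (bv j ?i) z = 0" using Suc beta_B[OF j zD, of ?i] unfolding i by simp
   thus ?thesis unfolding i using z0[OF beta_D[OF j, of ?i]] alt_bilin_eq0[OF bil_B] A_swap[of z] by simp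
  next
   case False
   thus ?thesis using beta_0[OF j] by (simp add: A_simps)
  qed
 qed
 note a = this
 have b: "A (bv j i) z = 0" if j: "j : {1..r}" "i : {1..n j}" for j i
  using a[OF j(1), of "n j + 1 - i"] j(2) by simp
 have "A u z = 0" if u: "u : U" for u
 proof -
  obtain c where "u = (SUM j=1..r. SUM i=1..n j. c j i *s bv j i)" using U_repr[OF u] by blast
  thus ?thesis using b by (simp add: A_simps)
 qed
 thus ?thesis using zD by (simp add: P_def)
qed

text \<open>\<open>U\<close> and \<open>S\<close> are orthogonal for both forms, so the radical
  equation splits; on \<open>S\<close> it reads B(T s + t s, .) = 0, which nondegeneracy turns into
  an eigenvector equation.\<close>

lemma rad_pencil_cases:
 assumes z: "z : rad D (pen t)"
 shows "EX u:U. EX s:S. z = u + s & u : rad D (pen t) & T s = (- t) *s s"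
proof -
 obtain u s where us: "u : U" "s : S" "z = u + s" using P_cases[OF rad_pencil_P[OF z]] by blast
 have s0: "A s y = (- t) * B s y" if y: "y : S" for y
 proof -
  have "A z y + t * B z y = 0" using z y S_D by (auto simp: rad_def)
  thus ?thesis using U_S[OF us(1) y] unfolding us(3) by (simp add: A_simps B_simps eq_neg_iff_add_eq_0)
 qed
 have sD: "A s y = (- t) * B s y" if "y : D" for y using S_ext[of A B s s "-t" y] s0 us(2) that by simp
 have "u : rad D (pen t)"
  unfolding rad_def
 proof (intro CollectI conjI ballI)
  fix y assume y: "y : D"
  hence "A z y + t * B z y = 0" using z by (auto simp: rad_def)
  thus "A u y + t * B u y = 0" using sD[OF y] unfolding us(3) by (simp add: A_simps B_simps algebra_simps)
 qed (use us U_D in auto)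
 moreover have "B (T s - (- t) *s s) y = 0" if y: "y : S" for y
 proof -
  have "y : D" using y S_D by auto
  thus ?thesis using s0[OF y] T_eq[OF us(2), of y] by (simp add: B_simps)
 qed
 hence "T s - (- t) *s s = 0"
  using nondeg_S[of B] T_S[OF us(2)] us(2) subspace_diff[OF sub_S _ subspace_scale[OF sub_S]] unfolding nondeg_on_def by blast
 hence "T s = (- t) *s s" by (simp only: right_minus_eq)
 ultimately show ?thesis using us(3) by (intro bexI[OF _ us(1)] bexI[OF _ us(2)] conjI)
qed

lemma rad_pencil_eigen:
 assumes s: "s : S" "T s = (- t) *s s"
 shows "s : rad D (pen t)"
 unfolding rad_def using T_eq[OF s(1)] s S_D by (auto simp: B_simps)

text \<open>The curves \<open>ga t j\<close> always supply r independent vectors, and they exhaust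
  the radical within \<open>U\<close>. A larger radical therefore needs an eigenvector in
  \<open>S\<close>; conversely, an eigenvector lies in the radical and outside \<open>U\<close>,
  which is impossible in dimension r.\<close>

lemma rad_pencil_dim:
 "dim (rad D (pen t)) > r \<longleftrightarrow> (EX s:S. s ~= 0 & T s = (- t) *s s)"
proof -
 let ?R = "rad D (pen t)"
 note bil = alt_bilin_pencil[OF bil_A bil_B, of t]
 have fR: "fin_sub ?R" by (rule rad_fin_sub[OF fin_D bil])
 have le: "r <= dim ?R" using indep_fam_card_le(1)[OF fR _ gamma_indep gamma_rad] by simp
 show ?thesis
 proof
  assume gt: "r < dim ?R"
  show "EX s:S. s ~= 0 & T s = (- t) *s s"
  proof (rule ccontr)
   assume no: "\<not> (EX s:S. s ~= 0 & T s = (- t) *s s)"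
   have "EX a. z = (SUM j=1..r. a j *s ga t j)" if z: "z : ?R" for z
   proof -
    obtain u s where us: "u : U" "s : S" "z = u + s" "u : ?R" "T s = (- t) *s s" using rad_pencil_cases[OF z] by blast
    hence "z = u" using no by auto
    thus ?thesis using rad_in_U[OF us(1,4)] by simp
   qed
   hence "basis_on ?R {1..r} (ga t)" unfolding basis_on_def using gamma_indep gamma_rad by auto
   hence "dim ?R = card {1..r}" by (rule basis_on_dim[OF rad_subspace[OF sub_D bil]])
   thus False using gt by simp
  qed
 next
  assume "EX s:S. s ~= 0 & T s = (- t) *s s"
  then obtain s where s: "s : S" "s ~= 0" "T s = (- t) *s s" by blast
  have "dim ?R ~= r" using rad_generic_U[of t] rad_pencil_eigen[OF s(1,3)] U_Int_S[OF _ s(1)] s(2) by auto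
  thus "r < dim ?R" using le by simp
 qed
qed

end

section \<open>From a maximal pair of bivectors to a pencil of forms\<close>

locale max_pair =
 fixes W :: "('k::field_char_0, 'w) module" and La Lb :: "('k, 'w) bivec" and r :: nat
  and A B :: "('w => 'k) => ('w => 'k) => 'k"
 assumes vs: "vspace W" and fd: "vfin_dim W" and rep_A: "represents W La A" and rep_B: "represents W Lb B"
  and maximal: "maximal_pair W La Lb" and r: "r = pair_corank W La Lb"

sublocale max_pair < LA: represented_bivector W La A
 by (rule represented_bivector.intro[OF vs fd rep_A])

sublocale max_pair < LB: represented_bivector W Lb B
 by (rule represented_bivector.intro[OF vs fd rep_B])

context max_pair
begin

abbreviation "SP \<equiv> symplectic_part W La Lb"
abbreviation "LW \<equiv> L0 W La Lb"
abbreviation "MW \<equiv> L1 W La Lb"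

lemma rep_pencil: "represents W (pencil La Lb t) (%x y. A x y + t * B x y)"
 using rep_A rep_B fs.alt_bilin_pencil by (auto simp: represents_def pencil_def)

lemma rep_comb: "represents W (%av bv. (1 - t) * La av bv + t * Lb av bv) (%x y. (1 - t) * A x y + t * B x y)"
 using rep_A rep_B fs.alt_bilin_comb by (auto simp: represents_def)

lemma corank_rad: "represents W Ga C ==> corank W Ga = fs.dim (fs.rad (zfun W) C)"
 using rank_rad[OF vs fd, of Ga C] by (simp add: corank_def)

lemma alt_pencil: "alt_pencil fscale (zfun W) A B r"
proof -
 let ?f = "%t. rank W (%av bv. (1 - t) * La av bv + t * Lb av bv)"
 have le: "?f t <= vdim W" for t using rank_rad[OF vs fd rep_comb[of t]] by simp
 \<comment> \<open>\<open>Max\<close> is informative only on finite sets; here the ranks are bounded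
   by the dimension.\<close>
 have fin: "finite (range ?f)" by (rule finite_subset[of _ "{..vdim W}"]) (use le in auto)
 have mx: "?f t <= pair_rank W La Lb" for t unfolding pair_rank_def by (rule Max_ge[OF fin]) auto
 show ?thesis
 proof
  show "fs.fin_sub (zfun W)" by (rule zfun_fin_sub[OF vs fd])
  show "fs.dim (fs.rad (zfun W) A) = r" using maximal corank_rad[OF rep_A] by (simp add: maximal_pair_def r pair_corank_def corank_def)
  show "fs.dim (fs.rad (zfun W) B) = r" using maximal corank_rad[OF rep_B] by (simp add: maximal_pair_def r pair_corank_def corank_def)
  fix t
  show "r <= fs.dim (fs.rad (zfun W) (%x y. (1 - t) * A x y + t * B x y))"
   using mx[of t] unfolding corank_rad[OF rep_comb[of t], symmetric] by (simp add: r pair_corank_def corank_def)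
 qed (use rep_A rep_B in \<open>auto simp: represents_def\<close>)
qed

end

context fam_space
begin

lemma lin_iso_symplectic:
 assumes E: "vspace E" and S: "subspace S" and i: "lin_iso S pz E" and F: "alt_bilin F" "nondeg_on S F"
  and w: "!!s s'. s : S ==> s' : S ==> om (pz s) (pz s') = F s s'"
 shows "symplectic_form E om"
proof -
 have cE: "carrier E = pz ` S" using lin_isoD(1,5)[OF i] by blast
 note cl = subspace_add[OF S] subspace_scale[OF S] subspace_0[OF S]
 have alt: "alternating_form E om" unfolding alternating_form_def cE
  by (auto simp: lin_isoD(2,3)[OF i, symmetric] w cl alt_bilinD(1-5)[OF F(1)])
 have z: "\<zero>\<^bsub>E\<^esub> = pz 0" using lin_iso_zero[OF E S i] by simp
 show ?thesis unfolding symplectic_form_def z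
 proof (intro conjI alt equalityI subsetI)
  fix x assume x: "x : form_kernel E om"
  then obtain s where s: "s : S" "x = pz s" by (auto simp: form_kernel_def cE)
  have "F s s' = 0" if "s' : S" for s' using x that w[OF s(1) that] by (auto simp: form_kernel_def cE s(2))
  hence "s = 0" using F(2) s(1) by (auto simp: nondeg_on_def)
  thus "x : {pz 0}" using s by simp
 next
  fix x assume "x : {pz 0}"
  thus "x : form_kernel E om" using w cl alt_bilinD(7)[OF F(1)] by (auto simp: form_kernel_def cE)
 qed
qed

text \<open>In the basis selected by \<open>endo_char_poly\<close>, pulled back to \<open>S\<close>,
  the matrix of K is that of T, and roots of its characteristic polynomial are eigenvalues.\<close>

lemma lin_iso_eigen:
 assumes E: "vspace E" and S: "subspace S" and i: "lin_iso S pz E" and b: "basis_on S {..<m::nat} sg"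
  and T: "linop T" "!!s. s : S ==> T s : S" and K: "!!s. s : S ==> K (pz s) = pz (T s)"
 shows "poly (endo_char_poly E K) x = 0 \<longleftrightarrow> (EX s:S. s ~= 0 & T s = x *s s)"
proof -
 define p where "p = (SOME (m, e). basis_family E {..<m::nat} e)"
 obtain N e where p: "p = (N, e)" by (cases p)
 have "case p of (m, e) => basis_family E {..<m} e"
  unfolding p_def using lin_iso_basis_family[OF E S i b]
  by (intro someI_ex[of "%p. case p of (m, e) => basis_family E {..<m} e"]) auto
 hence be: "basis_family E {..<N} e" by (simp add: p)
 obtain f where f: "frame E {..<N} f" and e: "!!i. i : {..<N} ==> e i : carrier E"
  "!!i j. i : {..<N} ==> j : {..<N} ==> f j (e i) = (if j = i then 1 else 0)"
  using basis_family_frame[OF E _ be] by blast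
 have "ALL j:{..<N}. EX s. s : S & pz s = e j" using lin_isoD(5)[OF i e(1)] by metis
 then obtain s where s: "!!j. j : {..<N} ==> s j : S" "!!j. j : {..<N} ==> pz (s j) = e j" by metis
 have bs: "basis_on S {..<N} s" by (rule lin_iso_basis_on[OF E S i _ be s]) auto
 define t where "t i j = f i (K (e j))" for i j
 have Ts: "T (s j) = (SUM i<N. t i j *s s i)" if j: "j < N" for j
 proof -
  obtain c where c: "T (s j) = (SUM i<N. c i *s s i)" using basis_onD(4)[OF bs T(2)[OF s(1)]] j by blast
  have "f k (pz (T (s j))) = c k" if k: "k < N" for k
  proof -
   have "pz (T (s j)) = (\<Oplus>\<^bsub>E\<^esub>i\<in>{..<N}. pz (c i *s s i))"
    unfolding c using s(1) subspace_scale[OF S] by (intro lin_iso_sum[OF E S i]) auto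
   hence "f k (pz (T (s j))) = (SUM i<N. f k (pz (c i *s s i)))"
    using zfun_finsum(2)[OF E _ _ frameD(2)[OF f], of "{..<N}" "%i. pz (c i *s s i)" k] k
     lin_isoD(1)[OF i subspace_scale[OF S s(1)]] by simp
   also have "... = (SUM i<N. if i = k then c k else 0)"
    using e k s lin_isoD(3)[OF i s(1)] zfunD(3)[OF frameD(2)[OF f] e(1)] by (intro sum.cong) auto
   finally show ?thesis using k by simp
  qed
  hence "t k j = c k" if "k < N" for k using K[OF s(1)] s(2) j that by (simp add: t_def)
  thus ?thesis unfolding c by (intro sum.cong) auto
 qed
 let ?M = "mat N N (%(i, j). t i j)"
 have "endo_char_poly E K = char_poly (mat N N (%(i, j). dual_basis E {..<N} e i (K (e j))))"
  unfolding endo_char_poly_def p_def[symmetric] by (simp add: p)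
 also have "mat N N (%(i, j). dual_basis E {..<N} e i (K (e j))) = ?M"
 proof (rule cong_mat, simp_all, goal_cases)
  case (1 k j)
  have "K (e j) : carrier E" using K[OF s(1)] s(2) lin_isoD(1)[OF i T(2)[OF s(1)]] 1 by simp
  thus ?case using dual_basis_eq[OF E f e, of k] 1 by (simp add: t_def)
 qed
 finally have "poly (endo_char_poly E K) x = 0 \<longleftrightarrow> eigenvalue ?M x"
  using eigenvalue_root_char_poly[of ?M N x] by simp
 also have "... \<longleftrightarrow> (EX v. dim_vec v = N & v ~= 0\<^sub>v N & (ALL i<N. (SUM j<N. t i j * v $ j) = x * v $ i))"
 proof -
  have "?M *\<^sub>v v = x \<cdot>\<^sub>v v \<longleftrightarrow> (ALL i<N. (SUM j<N. t i j * v $ j) = x * v $ i)" if "dim_vec v = N" for v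
   using that by (auto simp: vec_eq_iff scalar_prod_def atLeast0LessThan)
  thus ?thesis unfolding eigenvalue_def eigenvector_def carrier_vec_def by auto
 qed
 also have "... \<longleftrightarrow> (EX v. (EX i<N. v i ~= 0) & (ALL i<N. (SUM j<N. t i j * v j) = x * v i))"
 proof
  assume "EX v. dim_vec v = N & v ~= 0\<^sub>v N & (ALL i<N. (SUM j<N. t i j * v $ j) = x * v $ i)"
  then obtain v where "dim_vec v = N" "v ~= 0\<^sub>v N" "ALL i<N. (SUM j<N. t i j * v $ j) = x * v $ i" by blast
  thus "EX v. (EX i<N. v i ~= 0) & (ALL i<N. (SUM j<N. t i j * v j) = x * v i)"
   by (intro exI[of _ "%i. v $ i"]) (auto simp: vec_eq_iff)
 next
  assume "EX v. (EX i<N. v i ~= 0) & (ALL i<N. (SUM j<N. t i j * v j) = x * v i)"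
  then obtain v where "EX i<N. v i ~= 0" "ALL i<N. (SUM j<N. t i j * v j) = x * v i" by blast
  thus "EX v. dim_vec v = N & v ~= 0\<^sub>v N & (ALL i<N. (SUM j<N. t i j * v $ j) = x * v $ i)"
   by (intro exI[of _ "vec N v"]) (auto simp: vec_eq_iff)
 qed
 also have "... \<longleftrightarrow> (EX s:S. s ~= 0 & T s = x *s s)"
 proof -
  have comb: "T (SUM j<N. v j *s s j) = (SUM i<N. (SUM j<N. t i j * v j) *s s i)" for v
  proof -
   have "T (SUM j<N. v j *s s j) = (SUM j<N. SUM i<N. (t i j * v j) *s s i)"
    unfolding linop_sum[OF T(1)] by (intro sum.cong refl) (simp add: Ts scale_sum_right mult.commute)
   also have "... = (SUM i<N. (SUM j<N. t i j * v j) *s s i)"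
    unfolding scale_sum_left by (rule sum.swap)
   finally show ?thesis .
  qed
  have sc: "x *s (SUM j<N. v j *s s j) = (SUM j<N. (x * v j) *s s j)" for v by (simp add: scale_sum_right)
  have in_S: "(SUM j<N. v j *s s j) : S" for v using s(1) by (intro subspace_sum[OF S] subspace_scale[OF S]) auto
  show ?thesis
  proof
   assume "EX v. (EX i<N. v i ~= 0) & (ALL i<N. (SUM j<N. t i j * v j) = x * v i)"
   then obtain v k where v: "k < N" "v k ~= 0" "!!i. i < N ==> (SUM j<N. t i j * v j) = x * v i" by blast
   have "(SUM j<N. v j *s s j) ~= 0" using indep_famD[OF basis_onD(3)[OF bs], of v k] v by auto
   moreover have "T (SUM j<N. v j *s s j) = x *s (SUM j<N. v j *s s j)"
    unfolding comb sc using v(3) by (intro sum.cong) auto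
   ultimately show "EX s:S. s ~= 0 & T s = x *s s" using in_S by blast
  next
   assume "EX s:S. s ~= 0 & T s = x *s s"
   then obtain y where y: "y : S" "y ~= 0" "T y = x *s y" by blast
   obtain v where v: "y = (SUM j<N. v j *s s j)" using basis_onD(4)[OF bs y(1)] by blast
   have "EX i<N. v i ~= 0" using y(2) unfolding v by (metis (no_types, lifting) lessThan_iff scale_zero_left sum.neutral)
   moreover have "(SUM j<N. t k j * v j) = x * v k" if "k < N" for k
    using basis_coords_eq[OF bs, of "%i. SUM j<N. t i j * v j" "%i. x * v i" k] y(3) that unfolding v comb sc by simp
   ultimately show "EX v. (EX i<N. v i ~= 0) & (ALL i<N. (SUM j<N. t i j * v j) = x * v i)" by blast
  qed
 qed
 finally show ?thesis .
qed

end

section \<open>The subspaces L0 and L1, the reduced forms and the exceptional members\<close>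

locale max_pair_kron = max_pair W La Lb r A B + kron_decomp fscale "zfun W" A B r n bv av m sg
 for W :: "('k::field_char_0, 'w) module" and La Lb r A B n bv av m sg
begin

lemma corank_pencil: "corank W (pencil La Lb t) = fs.dim (fs.rad (zfun W) (pen t))"
 by (rule corank_rad[OF rep_pencil])

lemma image_pencil: "bivector_image W (pencil La Lb t) = ann W (fs.rad (zfun W) (pen t))"
 by (rule bivector_image_ann[OF vs fd rep_pencil])

text \<open>Members of corank r have their radical inside \<open>U\<close>, which gives one
  inclusion. For the other, a point of \<open>L0\<close> kills the curves \<open>ga t j\<close> for
  infinitely many t, hence by \<open>vanish_generic\<close> all of \<open>U\<close>.\<close>

lemma L0_ann: "LW = ann W U"
proof (intro equalityI subsetI)
 fix w assume w: "w : ann W U"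
 show "w : LW" unfolding L0_def
 proof (intro InterI)
  fix X assume "X : {bivector_image W (pencil La Lb t) |t. corank W (pencil La Lb t) = pair_corank W La Lb}"
  then obtain t where t: "X = bivector_image W (pencil La Lb t)" "corank W (pencil La Lb t) = r" by (auto simp: r)
  show "w : X" using w rad_generic_U[of t] t(2) unfolding t(1) corank_pencil image_pencil by (auto simp: ann_def)
 qed
next
 fix w assume w: "w : LW"
 define T where "T = {t. fs.dim (fs.rad (zfun W) (pen t)) = r}"
 have "finite (- T)" using generic unfolding T_def by (simp add: Collect_neg_eq[symmetric])
 hence T: "infinite T" using infinite_UNIV_char_0[where 'a = 'k] by (metis Compl_partition finite_UnI)
 have wT: "u w = 0" if "t : T" "u : fs.rad (zfun W) (pen t)" for t u
 proof -
  have "w : bivector_image W (pencil La Lb t)"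
   using w that(1) unfolding L0_def T_def corank_pencil[symmetric] by (auto simp: r)
  thus ?thesis using that(2) unfolding image_pencil by (auto simp: ann_def)
 qed
 \<comment> \<open>An empty intersection would be the whole type; one regular member is what places
   w in the carrier.\<close>
 have "T ~= {}" using T by auto
 then obtain t where "t : T" by blast
 hence "w : bivector_image W (pencil La Lb t)"
  using w unfolding L0_def T_def corank_pencil[symmetric] by (auto simp: r)
 hence wW: "w : carrier W" unfolding image_pencil by (auto simp: ann_def)
 define ew where "ew g = g w" for g :: "'w => 'k"
 have lw: "fs.linfun ew" by (simp add: fs.linfun_def ew_def)
 have "ew u = 0" if u: "u : U" for u
  by (rule vanish_generic[OF lw T _ u]) (use wT gamma_rad in \<open>auto simp: ew_def\<close>)
 thus "w : ann W U" using wW by (simp add: ann_def ew_def)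
qed

lemma L0_sub: "LW <= carrier W"
 by (auto simp: L0_ann ann_def)

lemma annihilator_L0: "annihilator W LW = res W ` U"
proof -
 have "{f : zfun W. ALL x:ann W U. f x = 0} = U"
  using ann_ann[OF vs fd sub_U U_D] U_D by (auto simp: ann_def)
 thus ?thesis unfolding annihilator_res[OF vs L0_sub] unfolding L0_ann by simp
qed

lemma sh_AB:
 assumes "f : zfun W" "g : zfun W" "!!d. d : zfun W ==> A f d = B g d"
 shows "LA.sh f = LB.sh g"
 by (rule LA.sh_eqI[OF assms(1)]) (use assms LB.sh_in LB.sh_eval in auto)

lemma L1_A: "MW = LA.sh ` U" and sharp_B: "sharp W Lb ` annihilator W LW = LB.sh ` U"
 unfolding L1_def annihilator_L0 image_image LA.sh_def LB.sh_def by (rule refl)+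

lemma sh_U: "LA.sh ` U = LB.sh ` U"
proof (intro equalityI subsetI)
 fix x assume "x : LA.sh ` U"
 then obtain u where u: "u : U" "x = LA.sh u" by blast
 obtain u' where u': "u' : U" "ALL d:zfun W. A u d = B u' d" using image_AB[OF u(1)] by blast
 hence "LA.sh u = LB.sh u'" using u(1) U_D by (intro sh_AB) auto
 thus "x : LB.sh ` U" using u u' by auto
next
 fix x assume "x : LB.sh ` U"
 then obtain u where u: "u : U" "x = LB.sh u" by blast
 obtain u' where u': "u' : U" "ALL d:zfun W. B u d = A u' d" using image_BA[OF u(1)] by blast
 hence "LA.sh u' = LB.sh u" using u(1) U_D by (intro sh_AB) auto
 thus "x : LA.sh ` U" using u'(1) unfolding u(2) by (rule image_eqI[OF sym])
qed

lemma L1_B: "MW = LB.sh ` U"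
 by (simp add: L1_A sh_U)

lemma conclusion_a:
 "LW <= bivector_image W La" "LW <= bivector_image W Lb"
 "sharp W La ` annihilator W LW = sharp W Lb ` annihilator W LW"
 using rad_A_U rad_B_U L1_A[unfolded L1_def] sharp_B sh_U unfolding LA.image_ann LB.image_ann L0_ann by (auto simp: ann_def)

text \<open>Lets the arguments that are the same for the two bivectors be given once.\<close>

definition side :: "('k, 'w) bivec => (('w => 'k) => ('w => 'k) => 'k) => bool" where
 "side Ga C \<longleftrightarrow> Ga = La & C = A \<or> Ga = Lb & C = B"

abbreviation shp :: "('k, 'w) bivec => ('w => 'k) => 'w" where "shp Ga \<equiv> represented_bivector.sh W Ga"

lemma side_rep: "side Ga C ==> represented_bivector W Ga C"
 using LA.represented_bivector_axioms LB.represented_bivector_axioms by (auto simp: side_def)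

lemma side_C: "side Ga C ==> C = A \<or> C = B"
 by (auto simp: side_def)

lemma side_L1: "side Ga C ==> MW = shp Ga ` U"
 using L1_A L1_B by (auto simp: side_def)

text \<open>A sharp of y is annihilated by \<open>U\<close> exactly when y is orthogonal to
  \<open>U\<close>, and being orthogonal means the same for both forms.\<close>

lemma L0_sh:
 assumes s: "side Ga C"
 shows "LW = shp Ga ` P"
proof -
 interpret X: represented_bivector W Ga C by (rule side_rep[OF s])
 have P: "y : P \<longleftrightarrow> y : zfun W & (ALL u:U. C u y = 0)" for y using side_C[OF s] P_B[of y] by (auto simp: P_def)
 show ?thesis
 proof (intro equalityI subsetI)
  fix w assume w: "w : LW"
  hence "w : bivector_image W Ga" using conclusion_a(1,2) s by (auto simp: side_def)
  then obtain y where y: "y : zfun W" "w = X.sh y" by (auto simp: X.image_sh)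
  have "C u y = 0" if "u : U" for u
  proof -
   have "u w = 0" using w that by (simp add: L0_ann ann_def)
   hence "C y u = 0" using X.sh_eval[OF y(1), of u] y(2) that U_D by auto
   thus ?thesis by (rule fs.alt_bilin_eq0[OF X.bil])
  qed
  thus "w : X.sh ` P" using y P by blast
 next
  fix w assume "w : X.sh ` P"
  then obtain y where y: "y : P" "w = X.sh y" by blast
  have "u w = 0" if "u : U" for u
   using X.sh_eval[of y u] y that P[of y] U_D fs.alt_bilin_eq0[OF X.bil, of u y] by auto
  thus "w : LW" using y P[of y] X.sh_in by (simp add: L0_ann ann_def)
 qed
qed

text \<open>On sharps of \<open>P\<close> the associated form is C, whose kernel on \<open>P\<close>
  is \<open>U\<close>; and the sharps of \<open>U\<close> are \<open>L1\<close>.\<close>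

lemma form_kernel_L0:
 assumes s: "side Ga C"
 shows "form_kernel (on_subspace W LW) (associated_form W Ga) = MW"
proof -
 interpret X: represented_bivector W Ga C by (rule side_rep[OF s])
 have w: "associated_form W Ga (X.sh y) (X.sh z) = C y z" if "y : P" "z : P" for y z
  using that P_D by (intro X.associated_form_sh) auto
 show ?thesis unfolding side_L1[OF s] form_kernel_def
 proof (intro equalityI subsetI)
  fix x assume x: "x : {u : carrier (on_subspace W LW). ALL v:carrier (on_subspace W LW). associated_form W Ga u v = 0}"
  then obtain y where y: "y : P" "x = X.sh y" by (auto simp: L0_sh[OF s])
  have "C y z = 0" if "z : P" for z using x w[OF y(1) that] that by (auto simp: y(2) L0_sh[OF s])
  hence "y : U" by (rule kernel_P[OF side_C[OF s] y(1)])
  thus "x : X.sh ` U" using y(2) by blast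
 next
  fix x assume "x : X.sh ` U"
  then obtain u where u: "u : U" "x = X.sh u" by blast
  show "x : {u : carrier (on_subspace W LW). ALL v:carrier (on_subspace W LW). associated_form W Ga u v = 0}"
   using u P_U w isotropic_C(1)[OF side_C[OF s]] by (auto simp: L0_sh[OF s])
 qed
qed

lemma L0_vspace: "vspace (on_subspace W LW)"
 using ann_vspace[OF vs _ U_D] fin_dim_frame[OF vs fd] unfolding L0_ann by blast

lemma symplectic_quotient: "quotient (on_subspace W LW) MW"
proof (rule quotient.intro[OF L0_vspace])
 have sA: "side La A" by (simp add: side_def)
 show "MW <= carrier (on_subspace W LW)" using P_U by (auto simp: L1_A L0_sh[OF sA])
 show "\<zero>\<^bsub>on_subspace W LW\<^esub> : MW" using LA.sh_zero fs.subspace_0[OF sub_U] by (auto simp: L1_A intro: rev_image_eqI)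
 show "x \<oplus>\<^bsub>on_subspace W LW\<^esub> y : MW" if xy: "x : MW" "y : MW" for x y
 proof -
  obtain u v where uv: "u : U" "v : U" "x = LA.sh u" "y = LA.sh v" using xy by (auto simp: L1_A)
  hence "x \<oplus>\<^bsub>W\<^esub> y = LA.sh (u + v)" using U_D by (simp add: LA.sh_add subset_iff)
  thus ?thesis using fs.subspace_add[OF sub_U uv(1,2)] by (simp add: L1_A)
 qed
 show "c \<odot>\<^bsub>on_subspace W LW\<^esub> x : MW" if x: "x : MW" for x c
 proof -
  obtain u where u: "u : U" "x = LA.sh u" using x by (auto simp: L1_A)
  hence "c \<odot>\<^bsub>W\<^esub> x = LA.sh (fscale c u)" using U_D by (simp add: LA.sh_scale subset_iff)
  thus ?thesis using fs.subspace_scale[OF sub_U u(1)] by (simp add: L1_A)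
 qed
qed

sublocale E: quotient "on_subspace W LW" "MW"
 by (rule symplectic_quotient)

lemma E_eq: "SP = E.Q"
 by (simp add: symplectic_part_def)

lemma E_vspace: "vspace SP"
 unfolding E_eq by (rule E.Q_vspace)

text \<open>Changing representatives adds elements of \<open>U\<close>, which pair to zero with
  \<open>P\<close>, so the value over two classes is constant.\<close>

lemma reduced_form_sh:
 assumes s: "side Ga C" and y: "y : P" "z : P"
 shows "reduced_form W Ga (E.pr (shp Ga y)) (E.pr (shp Ga z)) = C y z"
 unfolding reduced_form_def projected_form_def
proof (rule the_equality)
 interpret X: represented_bivector W Ga C by (rule side_rep[OF s])
 have mem: "EX u:U. x = X.sh (u + y)" if x: "x : E.pr (X.sh y)" and y: "y : P" for x y
 proof -
  obtain l where "l : MW" "x = l \<oplus>\<^bsub>W\<^esub> X.sh y" using x unfolding E.mem_pr by auto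
  then obtain u where "u : U" "x = X.sh u \<oplus>\<^bsub>W\<^esub> X.sh y" unfolding side_L1[OF s] by blast
  thus ?thesis using X.sh_add[of u y] U_D P_D y by (intro bexI[of _ u]) (auto simp: subset_iff)
 qed
 have val: "associated_form W Ga (X.sh (u + y)) (X.sh (v + z)) = C y z" if uv: "u : U" "v : U" for u v
 proof -
  have "associated_form W Ga (X.sh (u + y)) (X.sh (v + z)) = C (u + y) (v + z)"
   using uv y fs.subspace_add[OF sub_P P_U] P_D by (intro X.associated_form_sh) auto
  thus ?thesis using isotropic_C[OF side_C[OF s]] uv y P_U by (simp add: fs.alt_bilinD(1,2)[OF X.bil])
 qed
 show all: "ALL x:E.pr (X.sh y). ALL w:E.pr (X.sh z). associated_form W Ga x w = C y z"
  using mem[OF _ y(1)] mem[OF _ y(2)] val by blast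
 interpret Wv: vectorspace class_ring W by (rule vs)
 have self: "X.sh y : E.pr (X.sh y)" if "y : P" for y
  unfolding E.mem_pr using E.L_0 Wv.l_zero[OF X.sh_in[of y]] P_D that by (intro bexI[of _ "\<zero>\<^bsub>W\<^esub>"]) auto
 fix c assume "ALL x:E.pr (X.sh y). ALL w:E.pr (X.sh z). associated_form W Ga x w = c"
 thus "c = C y z" using all self y by metis
qed

text \<open>Identifies \<open>S\<close> with the symplectic quotient through the first bivector; by
  \<open>pz_B\<close> the second bivector gives the same class after applying
  \<open>T\<close>.\<close>

definition pz :: "('w => 'k) => 'w set" where "pz s = E.pr (LA.sh s)"

lemma pz_B: "s : S ==> pz s = E.pr (LB.sh (T s))"
 unfolding pz_def using S_D T_S T_eq by (subst sh_AB[of s "T s"]) auto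

lemma sh_A_L0: "y : P ==> LA.sh y : carrier (on_subspace W LW)"
 using L0_sh[of La A] by (simp add: side_def)

lemma pz_iso: "fs.lin_iso S pz SP"
 unfolding fs.lin_iso_def E_eq
proof (intro conjI ballI allI impI)
 fix s t assume st: "s : S" "t : S"
 have D: "s : zfun W" "t : zfun W" using st S_D by auto
 show "pz (s + t) = pz s \<oplus>\<^bsub>E.Q\<^esub> pz t"
  unfolding pz_def LA.sh_add[OF D] E.add_Q[OF sh_A_L0[OF P_S[OF st(1)]] sh_A_L0[OF P_S[OF st(2)]]] by simp
 show "s = t" if h: "pz s = pz t"
 proof -
  obtain l where "l : MW" "LA.sh s = l \<oplus>\<^bsub>on_subspace W LW\<^esub> LA.sh t"
   using h E.pr_eq_iff[OF sh_A_L0[OF P_S[OF st(1)]] sh_A_L0[OF P_S[OF st(2)]]] unfolding pz_def by blast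
  then obtain u where u: "u : U" "LA.sh s = LA.sh u \<oplus>\<^bsub>W\<^esub> LA.sh t" by (auto simp: L1_A)
  hence "LA.sh s = LA.sh (u + t)" using LA.sh_add[of u t] U_D D by auto
  hence "A s g = A (u + t) g" if "g : zfun W" for g
   using LA.sh_eq_iff[of s "u + t"] LA.zfun_closed(1) D u(1) U_D that by auto
  hence "A (s - t) y = 0" if "y : S" for y
   using U_S(1)[OF u(1) that] S_D that by (auto simp: fs.alt_bilinD[OF bil_A] simp del: fs.alt_bilinD(6)[OF bil_A])
  thus ?thesis using nondeg_S[of A] fs.subspace_diff[OF sub_S st] by (auto simp: fs.nondeg_on_def)
 qed
next
 fix s assume s: "s : S"
 show "pz s : carrier E.Q" unfolding pz_def by (rule E.pr_in[OF sh_A_L0[OF P_S[OF s]]])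
 have sD: "s : zfun W" using s S_D by auto
 show "pz (fscale c s) = c \<odot>\<^bsub>E.Q\<^esub> pz s" for c
  unfolding pz_def LA.sh_scale[OF sD] E.smult_Q[OF sh_A_L0[OF P_S[OF s]]] by simp
next
 fix v assume "v : carrier E.Q"
 then obtain x where x: "x : carrier (on_subspace W LW)" "v = E.pr x" unfolding E.carrier_Q by blast
 then obtain y where y: "y : P" "x = LA.sh y" using L0_sh[of La A] by (auto simp: side_def)
 obtain u s where us: "u : U" "s : S" "y = u + s" using P_cases[OF y(1)] by blast
 have "LA.sh y = LA.sh u \<oplus>\<^bsub>W\<^esub> LA.sh s" unfolding us(3) using us U_D S_D by (intro LA.sh_add) auto
 moreover have "LA.sh u : MW" using us by (simp add: L1_A)
 ultimately have "v = pz s" unfolding x(2) y(2) pz_def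
  using E.pr_eq_iff[OF sh_A_L0[OF y(1)] sh_A_L0[OF P_S[OF us(2)]]] by auto
 thus "EX s:S. v = pz s" using us(2) by blast
qed

lemma reduced_pz: "s : S ==> s' : S ==> reduced_form W La (pz s) (pz s') = A s s'"
 "s : S ==> s' : S ==> reduced_form W Lb (pz s) (pz s') = B (T s) (T s')"
proof -
 assume s: "s : S" "s' : S"
 show "reduced_form W La (pz s) (pz s') = A s s'" unfolding pz_def
  using reduced_form_sh[of La A, OF _ P_S[OF s(1)] P_S[OF s(2)]] by (simp add: side_def)
 show "reduced_form W Lb (pz s) (pz s') = B (T s) (T s')" unfolding pz_B[OF s(1)] pz_B[OF s(2)]
  using reduced_form_sh[of Lb B, OF _ P_S[OF T_S[OF s(1)]] P_S[OF T_S[OF s(2)]]] by (simp add: side_def)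
qed

lemma BTT: "fs.alt_bilin (%x y. B (T x) (T y))" "fs.nondeg_on S (%x y. B (T x) (T y))"
proof -
 show "fs.alt_bilin (%x y. B (T x) (T y))"
  unfolding fs.alt_bilin_def fs.linfun_def fs.linopD[OF T_lin] by (simp add: fs.alt_bilinD(1-5)[OF bil_B])
 show "fs.nondeg_on S (%x y. B (T x) (T y))" unfolding fs.nondeg_on_def
 proof (intro ballI impI)
  fix x assume x: "x : S" and z: "ALL y:S. B (T x) (T y) = 0"
  have "B (T x) t = 0" if "t : S" for t using T_surj[OF that] z by auto
  hence "T x = 0" using nondeg_S[of B] T_S[OF x] by (auto simp: fs.nondeg_on_def)
  thus "x = 0" by (rule T_inj[OF x])
 qed
qed

lemma reduced_symplectic:
 "symplectic_form SP (reduced_form W La)"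
 "symplectic_form SP (reduced_form W Lb)"
proof -
 show "symplectic_form SP (reduced_form W La)"
  by (rule fs.lin_iso_symplectic[OF E_vspace sub_S pz_iso bil_A nondeg_S]) (simp_all add: reduced_pz)
 show "symplectic_form SP (reduced_form W Lb)"
  by (rule fs.lin_iso_symplectic[OF E_vspace sub_S pz_iso BTT]) (simp_all add: reduced_pz)
qed

text \<open>In terms of \<open>S\<close> the reduced forms are A(s, s') and B(T s, T s') = A(T s,
  s'), so the operator relating them is T.\<close>

lemma reduced_operator_pz:
 assumes s: "s : S"
 shows "reduced_operator W La Lb (pz s) = pz (T s)"
 unfolding reduced_operator_def pair_operator_def
proof (rule the_equality)
 note cE = fs.lin_isoD(1,5)[OF pz_iso]
 have "reduced_form W Lb (pz s) (pz t) = reduced_form W La (pz (T s)) (pz t)" if "t : S" for t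
  using reduced_pz(1)[OF T_S[OF s] that] reduced_pz(2)[OF s that] B_TT[OF s that] by simp
 thus main: "pz (T s) : carrier SP &
   (ALL v:carrier SP. reduced_form W Lb (pz s) v = reduced_form W La (pz (T s)) v)"
  using cE(1)[OF T_S[OF s]] cE(2) by metis
 fix x assume x: "x : carrier SP &
   (ALL v:carrier SP. reduced_form W Lb (pz s) v = reduced_form W La x v)"
 obtain t where t: "t : S" "x = pz t" using cE(2) x by blast
 have "A (t - T s) y = 0" if y: "y : S" for y
 proof -
  have "reduced_form W La (pz t) (pz y) = reduced_form W La (pz (T s)) (pz y)" using x main cE(1)[OF y] unfolding t(2) by metis
  thus ?thesis using reduced_pz(1)[OF t(1) y] reduced_pz(1)[OF T_S[OF s] y] by (simp add: fs.alt_bilinD(11)[OF bil_A])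
 qed
 hence "t - T s = 0" using nondeg_S[of A] fs.subspace_diff[OF sub_S t(1) T_S[OF s]] unfolding fs.nondeg_on_def by blast
 thus "x = pz (T s)" using t(2) by simp
qed

lemma conclusion_e:
 "corank W (pencil La Lb a) > r \<longleftrightarrow> poly (endo_char_poly SP (reduced_operator W La Lb)) (- a) = 0"
proof -
 have "poly (endo_char_poly SP (reduced_operator W La Lb)) (- a) = 0 \<longleftrightarrow>
   (EX s:S. s ~= 0 & T s = fscale (- a) s)"
  by (rule fs.lin_iso_eigen[OF E_vspace sub_S pz_iso basis_S T_lin]) (simp_all add: T_S reduced_operator_pz)
 thus ?thesis unfolding corank_pencil using rad_pencil_dim by blast
qed

end

section \<open>The Veronese web\<close>

text \<open>A common zero of the factors puts a zero column in the determinant. If some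
  \<open>g k v\<close> is nonzero, v can be completed by vectors dual to the factors so that the
  determinant does not vanish.\<close>

lemma wedge_kernel:
 fixes V :: "('k::field, 'v) module"
 assumes r: "1 <= r" and d: "!!k. k : {1..r} ==> EX d:carrier V. ALL j:{1..r}. g j d = (if j = k then 1 else 0)"
 shows "multiform_kernel V r (wedge_form r g) = {v : carrier V. ALL j:{1..r}. g j v = 0}"
proof (intro equalityI subsetI)
 fix v assume v: "v : {v : carrier V. ALL j:{1..r}. g j v = 0}"
 have "wedge_form r g x = 0" if x: "x 1 = v" for x
  unfolding wedge_form_def det_mat_0_iff
 proof (intro exI[of _ "%j. if j = 0 then 1 else 0"] conjI allI impI)
  show "EX j<r. (if j = 0 then 1 else 0 :: 'k) ~= 0" using r by (intro exI[of _ 0]) auto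
  fix i assume "i < r"
  thus "(SUM j<r. (case (i, j) of (i, j) => g (i + 1) (x (j + 1))) * (if j = 0 then 1 else 0)) = 0"
   using v x by (intro sum.neutral) auto
 qed
 thus "v : multiform_kernel V r (wedge_form r g)" using v by (simp add: multiform_kernel_def)
next
 fix v assume v: "v : multiform_kernel V r (wedge_form r g)"
 hence vV: "v : carrier V" by (simp add: multiform_kernel_def)
 have "ALL k:{1..r}. EX d. d : carrier V & (ALL j:{1..r}. g j d = (if j = k then 1 else 0))" using d by blast
 then obtain e where e: "!!k. k : {1..r} ==> e k : carrier V"
  "!!k j. k : {1..r} ==> j : {1..r} ==> g j (e k) = (if j = k then 1 else 0)" by metis
 have "g k v = 0" if k: "k : {1..r}" for k
 proof (rule ccontr)
  assume nz: "g k v ~= 0"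
  \<comment> \<open>v is in slot 1 and \<open>e 1\<close> takes the slot of \<open>e k\<close>. Row
    k then has the single entry \<open>g k v\<close>, and the determinant equals it up to
    sign.\<close>
  define x where "x j = (if j = 1 then v else if j = k then e 1 else e j)" for j
  have xV: "x j : carrier V" if "j : {1..r}" for j using e(1) vV that r by (auto simp: x_def)
  have "wedge_form r g x = 0" using v xV by (simp add: multiform_kernel_def x_def)
  then obtain a where a: "EX j<r. a j ~= 0" "!!i. i < r ==> (SUM j<r. g (i + 1) (x (j + 1)) * a j) = 0"
   unfolding wedge_form_def det_mat_0_iff by auto
  have one: "g (Suc i) (x (Suc j)) = (if j = 0 then g (Suc i) v else if Suc j = k then (if i = 0 then 1 else 0) else if i = j then 1 else 0)"
   if "i < r" "j < r" for i j using that e(2) by (auto simp: x_def)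
  obtain l where l: "k = Suc l" "l < r" using k by (cases k) auto
  have rowk: "(SUM j<r. g (Suc l) (x (Suc j)) * a j) = (SUM j<r. if j = 0 then g k v * a 0 else 0)"
   using l by (intro sum.cong refl) (auto simp: one)
  have a0: "a 0 = 0" using a(2)[of l] l nz rowk by simp
  have "a i = 0" if i: "i < r" for i
  proof (cases "i = 0")
   case False
   let ?i = "if Suc i = k then 0 else i"
   have "?i < r" using i by auto
   hence "(SUM j<r. g (Suc ?i) (x (Suc j)) * a j) = (SUM j<r. if j = i then a i else 0)"
    using i False by (intro sum.cong refl) (simp add: one a0)
   thus ?thesis using a(2)[OF `?i < r`] i by simp
  qed (simp add: a0)
  thus False using a(1) by blast
 qed
 thus "v : {v : carrier V. ALL j:{1..r}. g j v = 0}" using vV by blast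
qed

lemma basis_family_reindex:
 assumes "basis_family V I e" "bij_betw g J I"
 shows "basis_family V J (e \<circ> g)"
proof -
 have "inj_on (e \<circ> g) J" using assms comp_inj_on[of g J e] by (auto simp: basis_family_def bij_betw_def)
 moreover have "(e \<circ> g) ` J = e ` I" using assms(2) by (auto simp: bij_betw_def)
 ultimately show ?thesis using assms(1) by (simp add: basis_family_def)
qed

text \<open>The left side is a polynomial in t with coefficients a (i + 1) + b i, zero for all t in
  an infinite field. This is how a curve in the radicals is turned back into a chain.\<close>

lemma pencil_coefficients:
 fixes a b :: "nat => 'k::field_char_0"
 assumes z: "!!t. (SUM i=1..n. t ^ (i - 1) * a i) + t * (SUM i=1..n. t ^ (i - 1) * b i) = 0"
  and a: "a 0 = 0" "!!i. n < i ==> a i = 0" and b: "b 0 = 0" "!!i. n < i ==> b i = 0"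
 shows "a (Suc i) = - b i"
proof -
 define p where "p = (SUM i<=n. monom (a (Suc i) + b i) i)"
 have "poly p t = 0" for t
 proof -
  have "poly p t = (SUM i<=n. t ^ i * a (Suc i)) + (SUM i<=n. t ^ i * b i)"
   by (simp add: p_def poly_sum poly_monom algebra_simps sum.distrib)
  also have "(SUM i<=n. t ^ i * a (Suc i)) = (SUM i=1..n. t ^ (i - 1) * a i)"
   using a(2)[of "Suc n"] by (simp add: sum.atLeast1_atMost_eq lessThan_Suc_atMost[symmetric])
  also have "(SUM i<=n. t ^ i * b i) = t * (SUM i=1..n. t ^ (i - 1) * b i)"
  proof -
   have "(SUM i<=n. t ^ i * b i) = (SUM i<n. t ^ Suc i * b (Suc i))"
    using b(1) by (simp add: lessThan_Suc_atMost[symmetric] sum.lessThan_Suc_shift del: sum.lessThan_Suc)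
   thus ?thesis by (simp add: sum.atLeast1_atMost_eq sum_distrib_left mult.assoc)
  qed
  finally show ?thesis using z[of t] by simp
 qed
 hence "p = 0" using poly_all_0_iff_0[of p] by blast
 hence "coeff p i = 0" by simp
 thus ?thesis using a(2)[of "Suc i"] b(2)[of i]
  by (cases "i <= n") (auto simp: p_def coeff_sum eq_neg_iff_add_eq_0 split: if_splits)
qed

context max_pair_kron
begin

lemma kb_frame: "frame W (kidx r n m) (kron_fam bv av sg)"
 using basis_on_frame[OF vs _ kb_basis] fin_dim_frame[OF vs fd] by blast

sublocale Kq: quotient W "LW"
 by (rule quotient.intro[OF vs]) (use ann_closed[OF vs U_D] in \<open>simp_all add: L0_ann\<close>)

lemma K_eq: "kronecker_part W La Lb = Kq.Q"
 by (simp add: kronecker_part_def)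

lemma U_L0: "u : U ==> x : LW ==> u x = 0"
 by (simp add: L0_ann ann_def)

lemma qf_U: "u : U ==> x : carrier W ==> Kq.qf u (Kq.pr x) = u x"
 using U_D U_L0 by (intro Kq.qf_pr) auto

lemma beta_mem: "(j, i) : idx r n ==> bv j i : U"
 by (auto intro: beta_U)

text \<open>The dual of \<open>W\<close> modulo \<open>L0\<close> is the annihilator of
  \<open>L0\<close>, that is \<open>U\<close>, with the chain vectors as basis.\<close>

lemma kronecker_frame: "frame Kq.Q (idx r n) (%(j, i). Kq.qf (bv j i))"
proof -
 have "frame Kq.Q (idx r n) (%p. Kq.qf (case p of (j, i) => bv j i))"
 proof (rule Kq.quotient_frame[OF finite_idx])
  fix x assume x: "x : carrier W" "!!p. p : idx r n ==> (case p of (j, i) => bv j i) x = 0"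
  have "u x = 0" if u: "u : U" for u
  proof -
   obtain c where "u = (SUM p:idx r n. fscale (c p) (case p of (j, i) => bv j i))" using basis_onD(4)[OF basis_U u] by blast
   thus ?thesis using x(2) by (simp add: sum_fun_apply)
  qed
  thus "x : LW" using x(1) by (simp add: L0_ann ann_def)
 next
  fix c
  obtain x where x: "x : carrier W" "ALL k:kidx r n m.
    kron_fam bv av sg k x = case_sum c (%_. 0) k"
   using frameD(4)[OF kb_frame] by blast
  have "(case p of (j, i) => bv j i) x = c p" if "p : idx r n" for p using x(2)[rule_format, of "Inl p"] that by simp
  thus "EX x:carrier W. ALL p:idx r n. (case p of (j, i) => bv j i) x = c p" using x(1) by blast
 qed (use beta_U U_D U_L0 in auto)
 moreover have "(%p. Kq.qf (case p of (j, i) => bv j i)) = (%(j, i). Kq.qf (bv j i))" by auto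
 ultimately show ?thesis by simp
qed

text \<open>This includes the exceptional t: the extra radical vectors come from \<open>S\<close>
  and are invisible modulo \<open>L0\<close>.\<close>

lemma pair_web_eq:
 "pair_web W La Lb t = {X : carrier Kq.Q. ALL j:{1..r}. Kq.qf (ga t j) X = 0}"
 unfolding pair_web_def image_pencil
proof (intro equalityI subsetI)
 fix X assume "X : Kq.pr ` ann W (fs.rad (zfun W) (pen t))"
 then obtain x where x: "x : ann W (fs.rad (zfun W) (pen t))" "X = Kq.pr x" by blast
 have xW: "x : carrier W" using x(1) by (simp add: ann_def)
 show "X : {X : carrier Kq.Q. ALL j:{1..r}. Kq.qf (ga t j) X = 0}"
  using x gamma_rad Kq.pr_in[OF xW] qf_U[OF gamma_U xW] by (auto simp: ann_def)
next
 fix X assume X: "X : {X : carrier Kq.Q. ALL j:{1..r}. Kq.qf (ga t j) X = 0}"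
 then obtain x where x: "x : carrier W" "X = Kq.pr x" unfolding Kq.carrier_Q by blast
 have gx: "ga t j x = 0" if j: "j : {1..r}" for j
 proof -
  have "Kq.qf (ga t j) X = 0" using X j by blast
  thus ?thesis using qf_U[OF gamma_U[OF j] x(1)] x(2) by simp
 qed
 \<comment> \<open>Another representative of the class of x: the same values on \<open>U\<close>,
   but zero on \<open>S\<close>. It is killed by the whole radical, whose elements are sums of a
   combination of the \<open>ga t j\<close> and a vector of \<open>S\<close>.\<close>
 obtain y where y: "y : carrier W" "ALL k:kidx r n m.
   kron_fam bv av sg k y = (case k of Inl (j, i) => bv j i x | Inr _ => 0)"
  using frameD(4)[OF kb_frame] by blast
 have yb: "bv j i y = bv j i x" if "(j, i) : idx r n" for j i using y(2)[rule_format, of "Inl (j, i)"] that by simp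
 have ys: "sg q y = 0" if "q < m" for q using y(2)[rule_format, of "Inr (Inr q)"] that by simp
 have yU: "u y = u x" if "u : U" for u
 proof -
  obtain c where "u = (SUM p:idx r n. fscale (c p) (case p of (j, i) => bv j i))" using basis_onD(4)[OF basis_U `u : U`] by blast
  thus ?thesis using yb by (auto simp: sum_fun_apply intro!: sum.cong)
 qed
 have yS: "s y = 0" if "s : S" for s
 proof -
  obtain c where "s = (SUM q<m. fscale (c q) (sg q))" using S_cases[OF `s : S`] by blast
  thus ?thesis using ys by (simp add: sum_fun_apply)
 qed
 have "z y = 0" if z: "z : fs.rad (zfun W) (pen t)" for z
 proof -
  obtain u s where us: "u : U" "s : S" "z = u + s" "u : fs.rad (zfun W) (pen t)"
   using rad_pencil_cases[OF z] by blast
  obtain a where "u = (SUM j=1..r. fscale (a j) (ga t j))" using rad_in_U[OF us(1,4)] by blast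
  hence "u x = 0" using gx by (simp add: sum_fun_apply)
  thus ?thesis using yU[OF us(1)] yS[OF us(2)] us(3) by simp
 qed
 hence "y : ann W (fs.rad (zfun W) (pen t))" using y(1) by (simp add: ann_def)
 moreover have "X = Kq.pr y" unfolding x(2)
 proof (rule frameD(3)[OF kronecker_frame Kq.pr_in[OF x(1)] Kq.pr_in[OF y(1)]])
  fix p assume "p : idx r n"
  thus "(case p of (j, i) => Kq.qf (bv j i)) (Kq.pr x) = (case p of (j, i) => Kq.qf (bv j i)) (Kq.pr y)"
   using yb qf_U[OF beta_mem x(1)] qf_U[OF beta_mem y(1)] by auto
 qed
 ultimately show "X : Kq.pr ` ann W (fs.rad (zfun W) (pen t))" by blast
qed

lemma swap_idx: "bij_betw (%(i, j). (j, i)) {(i, j). j : {1..r} & i : {1..n' j}} (idx r n')"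
 by (rule bij_betwI[of _ _ _ "%(i, j). (j, i)"]) auto

lemma conclusion_c:
 assumes r: "1 <= r"
 shows "veronese_web_with (kronecker_part W La Lb) r (pair_web W La Lb) n"
 unfolding veronese_web_with_def K_eq
proof (intro conjI r ballI exI[of _ "%i j. res Kq.Q (Kq.qf (bv j i))"] allI)
 show "1 <= n j" if "j : {1..r}" for j using n_pos[OF that] .
 have "basis_family (dual_space Kq.Q) {(i, j). j : {1..r} & i : {1..n j}}
   ((%p. res Kq.Q (case p of (j, i) => Kq.qf (bv j i))) \<circ> (%(i, j). (j, i)))"
  by (rule basis_family_reindex[OF frame_dual_basis_family[OF Kq.Q_vspace kronecker_frame] swap_idx])
 moreover have "(%p. res Kq.Q (case p of (j, i) => Kq.qf (bv j i))) \<circ> (%(i, j). (j, i)) = (%(i, j). res Kq.Q (Kq.qf (bv j i)))"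
  by (auto simp: fun_eq_iff)
 ultimately show "basis_family (dual_space Kq.Q) {(i, j). j : {1..r} & i : {1..n j}} (%(i, j). res Kq.Q (Kq.qf (bv j i)))" by metis
 fix t
 let ?g = "%j. \<lambda>X\<in>carrier Kq.Q. SUM i=1..n j. t ^ (i - 1) * res Kq.Q (Kq.qf (bv j i)) X"
 have g: "?g j X = Kq.qf (ga t j) X" if j: "j : {1..r}" and X: "X : carrier Kq.Q" for j X
 proof -
  obtain x where x: "x : carrier W" "X = Kq.pr x" using X unfolding Kq.carrier_Q by blast
  have "?g j X = (SUM i=1..n j. t ^ (i - 1) * bv j i x)"
   using X qf_U[OF beta_U[OF j] x(1)] x(2) by simp
  thus ?thesis using qf_U[OF gamma_U[OF j] x(1)] x(2) by (simp add: ga_def sum_fun_apply)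
 qed
 have "multiform_kernel Kq.Q r (wedge_form r ?g) = {X : carrier Kq.Q. ALL j:{1..r}. ?g j X = 0}"
 proof (rule wedge_kernel[OF r])
  fix k assume k: "k : {1..r}"
  \<comment> \<open>Only the constant term of each curve sees this point, so it is dual to curve k
    for every t at once.\<close>
  obtain X where X: "X : carrier Kq.Q" "ALL p:idx r n. (case p of (j, i) => Kq.qf (bv j i)) X = (if p = (k, 1) then 1 else 0)"
   using frameD(4)[OF kronecker_frame, of "%p. if p = (k, 1) then 1 else 0"] by blast
  have "?g j X = (if j = k then 1 else 0)" if j: "j : {1..r}" for j
  proof -
   have "Kq.qf (bv j i) X = (if j = k & i = 1 then 1 else 0)" if "i : {1..n j}" for i
    using X(2)[rule_format, of "(j, i)"] that j by auto
   hence "?g j X = (SUM i=1..n j. if i = 1 then (if j = k then 1 else 0) else 0)"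
    unfolding restrict_apply'[OF X(1)] by (intro sum.cong) auto
   thus ?thesis using n_pos[OF j] by simp
  qed
  thus "EX d:carrier Kq.Q. ALL j:{1..r}. ?g j d = (if j = k then 1 else 0)" using X(1) by blast
 qed
 also have "... = pair_web W La Lb t"
 proof -
  have "(ALL j:{1..r}. ?g j X = 0) \<longleftrightarrow> (ALL j:{1..r}. Kq.qf (ga t j) X = 0)" if X: "X : carrier Kq.Q" for X
   by (rule ball_cong[OF refl]) (simp only: g[OF _ X])
  thus ?thesis unfolding pair_web_eq by blast
 qed
 finally show "pair_web W La Lb t = multiform_kernel Kq.Q r (wedge_form r ?g)" by (rule sym)
qed

text \<open>Any presentation of the web, with whatever numbers n', comes from chains of these
  lengths. Hence prescribed characteristic numbers can be realised by a normal form of the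
  pair.\<close>

lemma web_kfam:
 assumes w: "veronese_web_with (kronecker_part W La Lb) r (pair_web W La Lb) n'"
 shows "EX bv'. kfam n' bv'"
proof -
 obtain b where b: "basis_family (dual_space Kq.Q) {(i, j). j : {1..r} & i : {1..n' j}} (%(i, j). b i j)"
  and r: "1 <= r" and pos: "!!j. j : {1..r} ==> 1 <= n' j"
  and web: "!!t. pair_web W La Lb t = multiform_kernel Kq.Q r
   (wedge_form r (%j. \<lambda>x\<in>carrier Kq.Q. SUM i=1..n' j. t ^ (i - 1) * b i j x))"
  using w unfolding veronese_web_with_def K_eq by blast
 let ?J = "{(i, j). j : {1..r} & i : {1..n' j}}"
 have finJ: "finite ?J" using bij_betw_finite[OF swap_idx] by auto
 note fr = dual_basis_family_frame[OF Kq.Q_vspace kronecker_frame finJ b]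
 have bQ: "zx Kq.Q (b i j) : zfun Kq.Q" if "j : {1..r}" "i : {1..n' j}" for i j
  using frameD(2)[OF fr, of "(i, j)"] that by simp
 define bv' where "bv' j i x = (if x : carrier W & j : {1..r} & i : {1..n' j} then zx Kq.Q (b i j) (Kq.pr x) else 0)" for j i x
 have bv'_in: "bv' j i : zfun W" for j i
 proof (cases "j : {1..r} & i : {1..n' j}")
  case True
  hence T: "j : {1..r}" "i : {1..n' j}" by auto
  show ?thesis
  proof (rule zfunI)
   fix x y assume xy: "x : carrier W" "y : carrier W"
   thus "bv' j i (x \<oplus>\<^bsub>W\<^esub> y) = bv' j i x + bv' j i y"
    using zfunD(2)[OF bQ[OF T] Kq.pr_in[OF xy(1)] Kq.pr_in[OF xy(2)]] vspaceD(2)[OF vs xy] by (simp add: bv'_def Kq.add_Q)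
  next
   fix c x assume x: "x : carrier W"
   thus "bv' j i (c \<odot>\<^bsub>W\<^esub> x) = c * bv' j i x"
    using zfunD(3)[OF bQ[OF T] Kq.pr_in[OF x], of c] vspaceD(3)[OF vs x] by (simp add: bv'_def Kq.smult_Q)
  qed (simp add: bv'_def)
 next
  case False
  hence "bv' j i = 0" by (auto simp: bv'_def fun_eq_iff)
  thus ?thesis by (simp add: LA.zfun_closed)
 qed
 \<comment> \<open>The covector vanishes on the image of the member at t, and the annihilator of
   that image is its radical by \<open>ann_ann\<close>.\<close>
 have rad: "(SUM i=1..n' j. fscale (t ^ (i - 1)) (bv' j i)) : fs.rad (zfun W) (pen t)" if j: "j : {1..r}" for j t
 proof (rule ann_ann[OF vs fd])
  note bil = fs.alt_bilin_pencil[OF bil_A bil_B, of t]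
  show "fs.subspace (fs.rad (zfun W) (pen t))" by (rule fs.rad_subspace[OF zfun_subspace bil])
  show "fs.rad (zfun W) (pen t) <= zfun W" by (auto simp: fs.rad_def)
  show "(SUM i=1..n' j. fscale (t ^ (i - 1)) (bv' j i)) : zfun W"
   using bv'_in by (intro fs.subspace_sum[OF zfun_subspace] LA.zfun_closed(2))
  fix x assume x: "x : ann W (fs.rad (zfun W) (pen t))"
  hence xW: "x : carrier W" by (simp add: ann_def)
  let ?g = "%j. \<lambda>x\<in>carrier Kq.Q. SUM i=1..n' j. t ^ (i - 1) * b i j x"
  have "multiform_kernel Kq.Q r (wedge_form r ?g) = {X : carrier Kq.Q. ALL j:{1..r}. ?g j X = 0}"
  proof (rule wedge_kernel[OF r])
   fix k assume k: "k : {1..r}"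
   obtain X where X: "X : carrier Kq.Q" "ALL p:?J. zx Kq.Q (case p of (i, j) => b i j) X = (if p = (1, k) then 1 else 0)"
    using frameD(4)[OF fr, of "%p. if p = (1, k) then 1 else 0"] by blast
   have "?g j X = (if j = k then 1 else 0)" if j: "j : {1..r}" for j
   proof -
    have "b i j X = (if j = k & i = 1 then 1 else 0)" if "i : {1..n' j}" for i
     using X(2)[rule_format, of "(i, j)"] that j X(1) by (auto simp: zx_apply)
    hence "?g j X = (SUM i=1..n' j. if i = 1 then (if j = k then 1 else 0) else 0)"
     unfolding restrict_apply'[OF X(1)] by (intro sum.cong) auto
    thus ?thesis using pos[OF j] by simp
   qed
   thus "EX d:carrier Kq.Q. ALL j:{1..r}. ?g j d = (if j = k then 1 else 0)" using X(1) by blast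
  qed
  moreover have "Kq.pr x : pair_web W La Lb t" using x unfolding pair_web_def image_pencil by blast
  ultimately have "?g j (Kq.pr x) = 0" using j unfolding web by blast
  thus "(SUM i=1..n' j. fscale (t ^ (i - 1)) (bv' j i)) x = 0"
   using Kq.pr_in[OF xW] xW j by (simp add: sum_fun_apply bv'_def zx_apply)
 qed
 have rec: "A (bv' j (Suc i)) d = - B (bv' j i) d" if j: "j : {1..r}" and d: "d : zfun W" for j i d
 proof (rule pencil_coefficients[where a = "%i. A (bv' j i) d" and b = "%i. B (bv' j i) d" and n = "n' j"])
  fix t
  have "A (SUM i=1..n' j. fscale (t ^ (i - 1)) (bv' j i)) d + t * B (SUM i=1..n' j. fscale (t ^ (i - 1)) (bv' j i)) d = 0"
   using rad[OF j, of t] d by (simp add: fs.rad_def)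
  thus "(SUM i=1..n' j. t ^ (i - 1) * A (bv' j i) d) + t * (SUM i=1..n' j. t ^ (i - 1) * B (bv' j i) d) = 0"
   unfolding fs.alt_bilin_sum(1)[OF bil_A] fs.alt_bilin_sum(1)[OF bil_B] .
 next
  have z: "bv' j i = 0" if "i = 0 \<or> n' j < i" for i using that by (auto simp: bv'_def fun_eq_iff)
  show "A (bv' j 0) d = 0" "B (bv' j 0) d = 0" using z[of 0] by (simp_all add: fs.alt_bilinD(7)[OF bil_A] fs.alt_bilinD(7)[OF bil_B])
  show "A (bv' j i) d = 0" "B (bv' j i) d = 0" if "n' j < i" for i
   using z[of i] that by (simp_all add: fs.alt_bilinD(7)[OF bil_A] fs.alt_bilinD(7)[OF bil_B])
 qed
 have "chain (n' j) (bv' j)" if j: "j : {1..r}" for j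
  unfolding chain_def using bv'_in rec[OF j] by (auto simp: bv'_def fun_eq_iff)
 moreover have "fs.indep_fam (idx r n') (%(j, i). bv' j i)" unfolding fs.indep_fam_def
 proof (intro allI impI ballI)
  fix c p assume z: "(SUM p:idx r n'. fscale (c p) (case p of (j, i) => bv' j i)) = 0" and p: "p : idx r n'"
  obtain X where X: "X : carrier Kq.Q" "ALL q:?J. zx Kq.Q (case q of (i, j) => b i j) X = (if q = (snd p, fst p) then 1 else 0)"
   using frameD(4)[OF fr, of "%q. if q = (snd p, fst p) then 1 else 0"] by blast
  obtain x where x: "x : carrier W" "X = Kq.pr x" using X(1) unfolding Kq.carrier_Q by blast
  have "0 = (SUM q:idx r n'. c q * (case q of (j, i) => bv' j i) x)" using fun_cong[OF z, of x] by (simp add: sum_fun_apply)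
  also have "... = (SUM q:idx r n'. if q = p then c p else 0)"
  proof (rule sum.cong[OF refl])
   fix q assume q: "q : idx r n'"
   obtain j i where ji: "q = (j, i)" by (cases q)
   have "bv' j i x = (if (i, j) = (snd p, fst p) then 1 else 0)"
    using q X(2)[rule_format, of "(i, j)"] x by (simp add: ji bv'_def)
   thus "c q * (case q of (j, i) => bv' j i) x = (if q = p then c p else 0)" using ji by (cases p) auto
  qed
  finally show "c p = 0" using p by simp
 qed
 ultimately have "kfam n' bv'" using pos by (auto simp: kfam_def)
 thus ?thesis by blast
qed

text \<open>For r = 0 there is no web and the empty family serves.\<close>

lemma char_numbers_kfam: "pair_char_numbers W La Lb r n' ==> EX bv'. kfam n' bv'"
proof (cases "1 <= r")
 case True
 thus "pair_char_numbers W La Lb r n' ==> EX bv'. kfam n' bv'" using web_kfam by (auto simp: pair_char_numbers_def)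
next
 case False
 hence "kfam n' (%_ _. 0)" by (simp add: kfam_def fs.indep_fam_def)
 thus "EX bv'. kfam n' bv'" by blast
qed

end

section \<open>Isomorphism by Gram matrices; sums and products\<close>

lemma bivector_zero:
 assumes V: "vspace V" and b: "bivector V La" and a: "av : functionals V"
 shows "La (\<lambda>x\<in>carrier V. 0) av = 0" "La av (\<lambda>x\<in>carrier V. 0) = 0"
 using alternating_formD(3,4)[OF b[unfolded bivector_def] a a a, of 0] by simp_all

lemma pushforward_bivector:
 fixes V :: "('k::field, 'v) module" and U :: "('k, 'u) module"
 assumes V: "vspace V" and ph: "!!x. x : carrier V ==> ph x : carrier U"
  "!!x y. x : carrier V ==> y : carrier V ==> ph (x \<oplus>\<^bsub>V\<^esub> y) = ph x \<oplus>\<^bsub>U\<^esub> ph y"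
  "!!c x. x : carrier V ==> ph (c \<odot>\<^bsub>V\<^esub> x) = c \<odot>\<^bsub>U\<^esub> ph x"
  and b: "bivector V La"
 shows "bivector U (pushforward V ph La)"
proof -
 let ?c = "%av. compose (carrier V) av ph"
 have c: "?c av : functionals V" if "av : functionals U" for av
  using that ph vspaceD[OF V] by (auto simp: functionals_iff compose_def)
 have add: "?c (av \<oplus>\<^bsub>dual_space U\<^esub> bv) = ?c av \<oplus>\<^bsub>dual_space V\<^esub> ?c bv" for av bv
  using ph(1) by (auto simp: compose_def fun_eq_iff restrict_def)
 have sc: "?c (r \<odot>\<^bsub>dual_space U\<^esub> av) = r \<odot>\<^bsub>dual_space V\<^esub> ?c av" for r av
  using ph(1) by (auto simp: compose_def fun_eq_iff restrict_def)
 note D = alternating_formD[OF b[unfolded bivector_def]]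
 show ?thesis unfolding bivector_def alternating_form_def pushforward_def add sc
 proof (intro conjI ballI allI)
  fix x y z r assume xyz: "x : functionals U" "y : functionals U" "z : functionals U"
  show "La (?c x \<oplus>\<^bsub>dual_space V\<^esub> ?c y) (?c z) = La (?c x) (?c z) + La (?c y) (?c z)"
   "La (?c z) (?c x \<oplus>\<^bsub>dual_space V\<^esub> ?c y) = La (?c z) (?c x) + La (?c z) (?c y)"
   using D(1,2)[OF c[OF xyz(1)] c[OF xyz(2)] c[OF xyz(3)]] .
 next
  fix x y r assume xy: "x : functionals U" "y : functionals U"
  show "La (r \<odot>\<^bsub>dual_space V\<^esub> ?c x) (?c y) = r * La (?c x) (?c y)"
   "La (?c x) (r \<odot>\<^bsub>dual_space V\<^esub> ?c y) = r * La (?c x) (?c y)"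
   using D(3,4)[OF c[OF xy(1)] c[OF xy(2)] c[OF xy(1)]] .
 next
  fix x assume x: "x : functionals U"
  show "La (?c x) (?c x) = 0" by (rule D(5)[OF c[OF x] c[OF x] c[OF x]])
 qed
qed

lemma bivector_sum:
 assumes "!!i. i : I ==> bivector V (La i)"
 shows "bivector V (%av bv. SUM i:I. La i av bv)"
proof -
 note D = alternating_formD[OF assms[unfolded bivector_def]]
 show ?thesis unfolding bivector_def alternating_form_def
 proof (intro conjI ballI allI)
  fix x y z assume xyz: "x : functionals V" "y : functionals V" "z : functionals V"
  show "(SUM i:I. La i (x \<oplus>\<^bsub>dual_space V\<^esub> y) z) = (SUM i:I. La i x z) + (SUM i:I. La i y z)"
   unfolding sum.distrib[symmetric] by (rule sum.cong[OF refl], erule D(1)[OF _ xyz])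
  show "(SUM i:I. La i z (x \<oplus>\<^bsub>dual_space V\<^esub> y)) = (SUM i:I. La i z x) + (SUM i:I. La i z y)"
   unfolding sum.distrib[symmetric] by (rule sum.cong[OF refl], erule D(2)[OF _ xyz])
 next
  fix x y r assume xy: "x : functionals V" "y : functionals V"
  show "(SUM i:I. La i (r \<odot>\<^bsub>dual_space V\<^esub> x) y) = r * (SUM i:I. La i x y)"
   unfolding sum_distrib_left by (rule sum.cong[OF refl], erule D(3)[OF _ xy xy(1)])
  show "(SUM i:I. La i x (r \<odot>\<^bsub>dual_space V\<^esub> y)) = r * (SUM i:I. La i x y)"
   unfolding sum_distrib_left by (rule sum.cong[OF refl], erule D(4)[OF _ xy xy(1)])
 next
  fix x assume x: "x : functionals V"
  show "(SUM i:I. La i x x) = 0" using D(5)[OF _ x x x] by simp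
 qed
qed

lemma bivector_add: "bivector V La ==> bivector V Ga ==> bivector V (%av bv. La av bv + Ga av bv)"
 using bivector_sum[of "{True, False}" V "%b. if b then La else Ga"] by simp

text \<open>The map that preserves coordinates is a linear bijection, and a bivector is determined
  by its values on the coordinate functionals. Every isomorphism in part (d) is obtained this
  way.\<close>

lemma gram_isomorphic:
 fixes V :: "('k::field, 'v) module" and U :: "('k, 'u) module"
 assumes V: "vspace V" and U: "vspace U" and f: "frame V I f" and g: "frame U I g"
  and L: "bivector V La" "bivector V Lb" and G: "bivector U Ga" "bivector U Ga\<^sub>1"
  and gram: "!!i j. i : I ==> j : I ==> La (res V (f i)) (res V (f j)) = Ga (res U (g i)) (res U (g j))"
   "!!i j. i : I ==> j : I ==> Lb (res V (f i)) (res V (f j)) = Ga\<^sub>1 (res U (g i)) (res U (g j))"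
 shows "pair_isomorphic V La Lb U Ga Ga\<^sub>1"
proof -
 have "ALL x. EX y. y : carrier U & (ALL i:I. g i y = f i x)"
 proof
  fix x
  from frameD(4)[OF g, of "%i. f i x"] show "EX y. y : carrier U & (ALL i:I. g i y = f i x)" by blast
 qed
 then obtain ph where ph: "!!x. ph x : carrier U" "!!x i. i : I ==> g i (ph x) = f i x" by metis
 have add: "ph (x \<oplus>\<^bsub>V\<^esub> y) = ph x \<oplus>\<^bsub>U\<^esub> ph y" if "x : carrier V" "y : carrier V" for x y
  by (rule frameD(3)[OF g ph(1) vspaceD(2)[OF U ph(1) ph(1)]])
   (simp add: ph zfunD(2)[OF frameD(2)[OF g]] zfunD(2)[OF frameD(2)[OF f]] that)
 have sc: "ph (c \<odot>\<^bsub>V\<^esub> x) = c \<odot>\<^bsub>U\<^esub> ph x" if "x : carrier V" for x c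
  by (rule frameD(3)[OF g ph(1) vspaceD(3)[OF U ph(1)]])
   (simp add: ph zfunD(3)[OF frameD(2)[OF g]] zfunD(3)[OF frameD(2)[OF f]] that)
 have lin: "linear_map class_ring V U ph"
  using V U ph(1) add sc by (auto simp: linear_map_def mod_hom_def mod_hom_axioms_def LinearCombinations.module_hom_def vectorspace_def)
 have "inj_on ph (carrier V)"
 proof (rule inj_onI)
  fix x y assume "x : carrier V" "y : carrier V" "ph x = ph y"
  thus "x = y" using ph(2)[of _ x] ph(2)[of _ y] by (intro frameD(3)[OF f]) auto
 qed
 moreover have "y : ph ` carrier V" if y: "y : carrier U" for y
 proof -
  obtain x where x: "x : carrier V" "ALL i:I. f i x = g i y" using frameD(4)[OF f, of "%i. g i y"] by blast
  have "y = ph x" by (rule frameD(3)[OF g y ph(1)]) (simp add: ph x)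
  thus ?thesis using x by blast
 qed
 ultimately have bij: "bij_betw ph (carrier V) (carrier U)" using ph(1) by (auto simp: bij_betw_def)
 have eq: "pushforward V ph L av bv = G av bv"
  if L: "bivector V L" and G: "bivector U G" and gr: "!!i j. i : I ==> j : I ==> L (res V (f i)) (res V (f j)) = G (res U (g i)) (res U (g j))"
   and ab: "av : functionals U" "bv : functionals U" for L G av bv
 proof -
  obtain A where A: "represents V L A" using bivector_represented[OF V frame_dim(2)[OF V f] L] by blast
  obtain C where C: "represents U G C" using bivector_represented[OF U frame_dim(2)[OF U g] G] by blast
  have bil: "fs.alt_bilin A" "fs.alt_bilin C" using A C by (auto simp: represents_def)
  note fV = frameD(2)[OF f] and gU = frameD(2)[OF g]
  have AC: "A (f i) (f j) = C (g i) (g j)" if "i : I" "j : I" for i j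
   using gr[OF that] A C fV gU that by (simp add: represents_def)
  have comb: "EX c. av = res U (SUM i:I. fscale (c i) (g i)) & compose (carrier V) av ph = res V (SUM i:I. fscale (c i) (f i))"
   if a: "av : functionals U" for av
  proof -
   obtain c where c: "zx U av = (SUM i:I. fscale (c i) (g i))"
    using fs.basis_onD(4)[OF frame_basis_on[OF U g] zx_zfun[OF U a]] by blast
   have e: "av = res U (SUM i:I. fscale (c i) (g i))" using res_zx[OF a] c by simp
   thus ?thesis using ph by (intro exI[of _ c]) (auto simp: compose_def fun_eq_iff restrict_def sum_fun_apply)
  qed
  obtain c where c: "av = res U (SUM i:I. fscale (c i) (g i))" "compose (carrier V) av ph = res V (SUM i:I. fscale (c i) (f i))"
   using comb[OF ab(1)] by blast
  obtain d where d: "bv = res U (SUM i:I. fscale (d i) (g i))" "compose (carrier V) bv ph = res V (SUM i:I. fscale (d i) (f i))"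
   using comb[OF ab(2)] by blast
  have inV: "(SUM i:I. fscale (c i) (f i)) : zfun V" and inU: "(SUM i:I. fscale (c i) (g i)) : zfun U" for c
   using fV gU by (auto intro!: fs.subspace_sum[OF zfun_subspace] fs.subspace_scale[OF zfun_subspace])
  have "pushforward V ph L av bv = A (SUM i:I. fscale (c i) (f i)) (SUM i:I. fscale (d i) (f i))"
   using A inV unfolding pushforward_def c(2) d(2) represents_def by blast
  also have "... = C (SUM i:I. fscale (c i) (g i)) (SUM i:I. fscale (d i) (g i))"
   unfolding fs.alt_bilin_sum(1)[OF bil(1)] fs.alt_bilin_sum(2)[OF bil(1)] fs.alt_bilin_sum(1)[OF bil(2)] fs.alt_bilin_sum(2)[OF bil(2)]
   using AC by (intro sum.cong refl arg_cong2[where f = "(*)"]) auto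
  also have "... = G av bv"
  proof -
   have "G (res U (SUM i:I. fscale (c i) (g i))) (res U (SUM i:I. fscale (d i) (g i))) =
     C (SUM i:I. fscale (c i) (g i)) (SUM i:I. fscale (d i) (g i))"
    using C inU unfolding represents_def by blast
   thus ?thesis unfolding c(1) d(1) by (rule sym)
  qed
  finally show ?thesis .
 qed
 show ?thesis unfolding pair_isomorphic_def
  using lin bij eq[OF L(1) G(1) gram(1)] eq[OF L(2) G(2) gram(2)] by blast
qed

definition lft :: "('k::field, 'v) module => ('k, 'u) module => ('v => 'k) => 'v \<times> 'u => 'k" where
 "lft V U f = (%z. if z : carrier V \<times> carrier U then f (fst z) else 0)"

definition rgt :: "('k::field, 'v) module => ('k, 'u) module => ('u => 'k) => 'v \<times> 'u => 'k" where
 "rgt V U f = (%z. if z : carrier V \<times> carrier U then f (snd z) else 0)"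

lemma direct_sum_frame:
 assumes V: "vspace V" and U: "vspace U" and f: "frame V (I :: 'i set) f" and g: "frame U (J :: 'j set) g"
 shows "frame (direct_sum V U) (I <+> J) (case_sum (%i. lft V U (f i)) (%j. rgt V U (g j)))"
 unfolding frame_def
proof (intro conjI ballI allI impI)
 note cV = vspaceD[OF V] and cU = vspaceD[OF U]
 fix k assume "k : I <+> J"
 thus "case_sum (%i. lft V U (f i)) (%j. rgt V U (g j)) k : zfun (direct_sum V U)"
  using zfunD(2,3)[OF frameD(2)[OF f]] zfunD(2,3)[OF frameD(2)[OF g]] cV cU
  by (auto intro!: zfunI simp: direct_sum_def lft_def rgt_def)
next
 fix x y assume xy: "x : carrier (direct_sum V U)" "y : carrier (direct_sum V U)"
  "ALL k:I <+> J. case_sum (%i. lft V U (f i)) (%j. rgt V U (g j)) k x = case_sum (%i. lft V U (f i)) (%j. rgt V U (g j)) k y"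
 have c: "fst x : carrier V" "snd x : carrier U" "fst y : carrier V" "snd y : carrier U" using xy(1,2) by (auto simp: direct_sum_def)
 have "fst x = fst y"
 proof (rule frameD(3)[OF f c(1,3)])
  fix i assume "i : I"
  thus "f i (fst x) = f i (fst y)" using xy(3)[rule_format, of "Inl i"] c by (simp add: lft_def mem_Times_iff)
 qed
 moreover have "snd x = snd y"
 proof (rule frameD(3)[OF g c(2,4)])
  fix i assume "i : J"
  thus "g i (snd x) = g i (snd y)" using xy(3)[rule_format, of "Inr i"] c by (simp add: rgt_def mem_Times_iff)
 qed
 ultimately show "x = y" by (rule prod_eqI)
next
 fix c :: "'i + 'j => _"
 obtain x where x: "x : carrier V" "ALL i:I. f i x = c (Inl i)" using frameD(4)[OF f, of "%i. c (Inl i)"] by blast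
 obtain y where y: "y : carrier U" "ALL i:J. g i y = c (Inr i)" using frameD(4)[OF g, of "%i. c (Inr i)"] by blast
 show "EX z:carrier (direct_sum V U). ALL k:I <+> J. case_sum (%i. lft V U (f i)) (%j. rgt V U (g j)) k z = c k"
  using x y by (intro bexI[of _ "(x, y)"]) (auto simp: direct_sum_def lft_def rgt_def)
qed (use frameD(1)[OF f] frameD(1)[OF g] in simp)

lemma direct_sum_gram:
 fixes V :: "('k::field, 'v) module" and U :: "('k, 'u) module"
 assumes V: "vspace V" and U: "vspace U" and L: "bivector V La" and G: "bivector U Ga"
 shows "bivector (direct_sum V U) (direct_sum_bivector V La U Ga)"
  "f : zfun V ==> f' : zfun V ==> direct_sum_bivector V La U Ga (res (direct_sum V U) (lft V U f)) (res (direct_sum V U) (lft V U f')) = La (res V f) (res V f')"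
  "f : zfun V ==> g : zfun U ==> direct_sum_bivector V La U Ga (res (direct_sum V U) (lft V U f)) (res (direct_sum V U) (rgt V U g)) = 0"
  "f : zfun V ==> g : zfun U ==> direct_sum_bivector V La U Ga (res (direct_sum V U) (rgt V U g)) (res (direct_sum V U) (lft V U f)) = 0"
  "g : zfun U ==> g' : zfun U ==> direct_sum_bivector V La U Ga (res (direct_sum V U) (rgt V U g)) (res (direct_sum V U) (rgt V U g')) = Ga (res U g) (res U g')"
proof -
 note cV = vspaceD[OF V] and cU = vspaceD[OF U]
 have l1: "compose (carrier V) (res (direct_sum V U) (lft V U f)) (inj1 V U) = res V f" for f
  using cU(1) by (auto simp: compose_def fun_eq_iff inj1_def direct_sum_def lft_def)
 have l2: "compose (carrier U) (res (direct_sum V U) (lft V U f)) (inj2 V U) = (\<lambda>x\<in>carrier U. 0)" if "f : zfun V" for f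
  using cV(1) zfun_zero[OF V that] by (auto simp: compose_def fun_eq_iff inj2_def direct_sum_def lft_def)
 have r1: "compose (carrier V) (res (direct_sum V U) (rgt V U g)) (inj1 V U) = (\<lambda>x\<in>carrier V. 0)" if "g : zfun U" for g
  using cU(1) zfun_zero[OF U that] by (auto simp: compose_def fun_eq_iff inj1_def direct_sum_def rgt_def)
 have r2: "compose (carrier U) (res (direct_sum V U) (rgt V U g)) (inj2 V U) = res U g" for g
  using cV(1) by (auto simp: compose_def fun_eq_iff inj2_def direct_sum_def rgt_def)
 have z: "(\<lambda>x\<in>carrier V. 0) : functionals V" "(\<lambda>x\<in>carrier U. 0) : functionals U" using dual_closed(1)[OF V] dual_closed(1)[OF U] by simp_all
 interpret Vv: vectorspace class_ring V by (rule V)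
 interpret Uv: vectorspace class_ring U by (rule U)
 have "bivector (direct_sum V U) (pushforward V (inj1 V U) La)"
  by (rule pushforward_bivector[OF V _ _ _ L]) (use cV cU Uv.smult_r_null in \<open>auto simp: inj1_def direct_sum_def\<close>)
 moreover have "bivector (direct_sum V U) (pushforward U (inj2 V U) Ga)"
  by (rule pushforward_bivector[OF U _ _ _ G]) (use cV cU Vv.smult_r_null in \<open>auto simp: inj2_def direct_sum_def\<close>)
 ultimately show "bivector (direct_sum V U) (direct_sum_bivector V La U Ga)"
  unfolding direct_sum_bivector_def by (rule bivector_add)
 note rV = res_functional[OF V] and rU = res_functional[OF U] and zL = bivector_zero[OF V L] and zG = bivector_zero[OF U G]
 show "f : zfun V ==> f' : zfun V ==> direct_sum_bivector V La U Ga (res (direct_sum V U) (lft V U f)) (res (direct_sum V U) (lft V U f')) = La (res V f) (res V f')"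
  unfolding direct_sum_bivector_def pushforward_def l1 l2 using zG[OF z(2)] by simp
 show "f : zfun V ==> g : zfun U ==> direct_sum_bivector V La U Ga (res (direct_sum V U) (lft V U f)) (res (direct_sum V U) (rgt V U g)) = 0"
  "f : zfun V ==> g : zfun U ==> direct_sum_bivector V La U Ga (res (direct_sum V U) (rgt V U g)) (res (direct_sum V U) (lft V U f)) = 0"
  unfolding direct_sum_bivector_def pushforward_def l1 r2 l2 r1 using zG[OF rU] zL[OF rV] by simp_all
 show "g : zfun U ==> g' : zfun U ==> direct_sum_bivector V La U Ga (res (direct_sum V U) (rgt V U g)) (res (direct_sum V U) (rgt V U g')) = Ga (res U g) (res U g')"
  unfolding direct_sum_bivector_def pushforward_def r1 r2 using zL[OF z(1)] by simp
qed

definition cmp :: "'i set => ('i => ('k::field, 'v) module) => 'i => ('v => 'k) => ('i => 'v) => 'k" where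
 "cmp I V i f = (%z. if z : (\<Pi>\<^sub>E i\<in>I. carrier (V i)) then f (z i) else 0)"

context
 fixes I :: "'i set" and V :: "'i => ('k::field, 'v) module" and J :: "'i => 'j set" and f :: "'i => 'j => 'v => 'k"
 assumes I: "finite I" and V: "!!i. i : I ==> vspace (V i)" and f: "!!i. i : I ==> frame (V i) (J i) (f i)"
begin

lemma product_closed:
 "x : carrier (product_space I V) ==> y : carrier (product_space I V) ==> x \<oplus>\<^bsub>product_space I V\<^esub> y : carrier (product_space I V)"
 "x : carrier (product_space I V) ==> c \<odot>\<^bsub>product_space I V\<^esub> x : carrier (product_space I V)"
 "\<zero>\<^bsub>product_space I V\<^esub> : carrier (product_space I V)"
 using vspaceD[OF V] by (auto simp: product_space_def PiE_iff)

lemma cmp_zfun: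
 assumes i: "i : I" and h: "h : zfun (V i)"
 shows "cmp I V i h : zfun (product_space I V)"
proof (rule zfunI)
 fix x y assume xy: "x : carrier (product_space I V)" "y : carrier (product_space I V)"
 have c: "x i : carrier (V i)" "y i : carrier (V i)" using xy i by (auto simp: product_space_def)
 show "cmp I V i h (x \<oplus>\<^bsub>product_space I V\<^esub> y) = cmp I V i h x + cmp I V i h y"
  using product_closed(1)[OF xy] xy zfunD(2)[OF h c] i by (simp add: cmp_def product_space_def)
next
 fix x c assume x: "x : carrier (product_space I V)"
 have c: "x i : carrier (V i)" using x i by (auto simp: product_space_def)
 show "cmp I V i h (c \<odot>\<^bsub>product_space I V\<^esub> x) = c * cmp I V i h x"
  using product_closed(2)[OF x, of c] x zfunD(3)[OF h c] i by (simp add: cmp_def product_space_def)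
qed (simp add: cmp_def product_space_def)

lemma product_eqI:
 assumes x: "x : carrier (product_space I V)" and y: "y : carrier (product_space I V)"
  and e: "!!i j. i : I ==> j : J i ==> cmp I V i (f i j) x = cmp I V i (f i j) y"
 shows "x = y"
proof (rule PiE_ext[of _ I "%i. carrier (V i)"])
 show P: "x : (\<Pi>\<^sub>E i\<in>I. carrier (V i))" "y : (\<Pi>\<^sub>E i\<in>I. carrier (V i))" using x y by (auto simp: product_space_def)
 fix i assume i: "i : I"
 show "x i = y i"
 proof (rule frameD(3)[OF f[OF i]])
  fix j assume "j : J i"
  thus "f i j (x i) = f i j (y i)" using e[OF i, of j] P by (simp add: cmp_def)
 qed (use P i in auto)
qed

lemma product_vspace: "vspace (product_space I V)"
proof (rule vspace_sep[where F = "{cmp I V i (f i j) | i j. i : I & j : J i}"])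
 show "!!h. h : {cmp I V i (f i j) | i j. i : I & j : J i} ==> h : zfun (product_space I V)"
  using cmp_zfun frameD(2)[OF f] by auto
 show "!!h. h : {cmp I V i (f i j) | i j. i : I & j : J i} ==> h \<zero>\<^bsub>product_space I V\<^esub> = 0"
  using zfun_zero[OF V frameD(2)[OF f]] by (auto simp: cmp_def product_space_def)
 show "!!x y. x : carrier (product_space I V) ==> y : carrier (product_space I V) ==>
   (!!h. h : {cmp I V i (f i j) | i j. i : I & j : J i} ==> h x = h y) ==> x = y"
  by (rule product_eqI) blast+
qed (rule product_closed; assumption)+

lemma product_frame: "frame (product_space I V) (SIGMA i:I. J i) (%(i, j). cmp I V i (f i j))"
 unfolding frame_def
proof (intro conjI ballI allI impI)
 show "finite (SIGMA i:I. J i)" using I frameD(1)[OF f] by (intro finite_SigmaI)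
 fix p assume "p : (SIGMA i:I. J i)"
 thus "(case p of (i, j) => cmp I V i (f i j)) : zfun (product_space I V)" using cmp_zfun frameD(2)[OF f] by auto
next
 fix x y assume "x : carrier (product_space I V)" "y : carrier (product_space I V)"
  "ALL p:SIGMA i:I. J i. (case p of (i, j) => cmp I V i (f i j)) x = (case p of (i, j) => cmp I V i (f i j)) y"
 thus "x = y" by (intro product_eqI) auto
next
 fix c
 have "ALL i:I. EX y. y : carrier (V i) & (ALL j:J i. f i j y = c (i, j))"
 proof
  fix i assume "i : I"
  from frameD(4)[OF f[OF this], of "%j. c (i, j)"] show "EX y. y : carrier (V i) & (ALL j:J i. f i j y = c (i, j))" by blast
 qed
 then obtain y where y: "ALL i:I. y i : carrier (V i) & (ALL j:J i. f i j (y i) = c (i, j))" by metis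
 thus "EX x:carrier (product_space I V). ALL p:SIGMA i:I. J i. (case p of (i, j) => cmp I V i (f i j)) x = c p"
  by (intro bexI[of _ "restrict y I"]) (auto simp: product_space_def cmp_def)
qed

text \<open>Restricted to a factor, a functional read off from factor i is itself on that factor and
  zero on the others, so the Gram matrix is block diagonal.\<close>

lemma product_gram:
 assumes L: "!!i. i : I ==> bivector (V i) (La i)"
 shows "bivector (product_space I V) (product_bivector I V La)"
  "i : I ==> k : I ==> h : zfun (V i) ==> h' : zfun (V k) ==>
   product_bivector I V La (res (product_space I V) (cmp I V i h)) (res (product_space I V) (cmp I V k h')) =
   (if i = k then La i (res (V i) h) (res (V i) h') else 0)"
proof -
 have inc: "inclusion I V i x : (\<Pi>\<^sub>E i\<in>I. carrier (V i))" if "x : carrier (V i)" for i x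
  using that vspaceD(1)[OF V] by (auto simp: inclusion_def)
 have c: "compose (carrier (V l)) (res (product_space I V) (cmp I V i h)) (inclusion I V l) =
   (if l = i then res (V i) h else (\<lambda>x\<in>carrier (V l). 0))" if "i : I" "h : zfun (V i)" for i h l
  using inc that(1) zfun_zero[OF V[OF that(1)] that(2)]
  by (auto simp: compose_def fun_eq_iff product_space_def cmp_def inclusion_def)
 show "bivector (product_space I V) (product_bivector I V La)"
  unfolding product_bivector_def
 proof (rule bivector_sum)
  fix l assume l: "l : I"
  show "bivector (product_space I V) (pushforward (V l) (inclusion I V l) (La l))"
  proof (rule pushforward_bivector[OF V[OF l] _ _ _ L[OF l]])
   fix x y c assume x: "x : carrier (V l)"
   show "inclusion I V l x : carrier (product_space I V)" using inc[OF x] by (simp add: product_space_def)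
   show "inclusion I V l (c \<odot>\<^bsub>V l\<^esub> x) = c \<odot>\<^bsub>product_space I V\<^esub> inclusion I V l x"
   proof -
    have "c \<odot>\<^bsub>V i\<^esub> \<zero>\<^bsub>V i\<^esub> = \<zero>\<^bsub>V i\<^esub>" if "i : I" for i
    proof -
     interpret vectorspace class_ring "V i" by (rule V[OF that])
     show ?thesis using smult_r_null[of c] by simp
    qed
    thus ?thesis by (auto simp: inclusion_def product_space_def fun_eq_iff)
   qed
   assume y: "y : carrier (V l)"
   have "\<zero>\<^bsub>V i\<^esub> \<oplus>\<^bsub>V i\<^esub> \<zero>\<^bsub>V i\<^esub> = \<zero>\<^bsub>V i\<^esub>" if "i : I" for i
   proof -
    interpret vectorspace class_ring "V i" by (rule V[OF that])
    show ?thesis by simp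
   qed
   thus "inclusion I V l (x \<oplus>\<^bsub>V l\<^esub> y) = inclusion I V l x \<oplus>\<^bsub>product_space I V\<^esub> inclusion I V l y"
    by (auto simp: inclusion_def product_space_def fun_eq_iff)
  qed
 qed
 assume ik: "i : I" "k : I" "h : zfun (V i)" "h' : zfun (V k)"
 have z: "La l (\<lambda>x\<in>carrier (V l). 0) (if l = k then res (V k) h' else (\<lambda>x\<in>carrier (V l). 0)) = 0" if l: "l : I" for l
  using bivector_zero(1)[OF V[OF l] L[OF l]] res_functional[OF V[OF ik(2)] ik(4)] dual_closed(1)[OF V[OF l]] by (cases "l = k") auto
 have "product_bivector I V La (res (product_space I V) (cmp I V i h)) (res (product_space I V) (cmp I V k h')) =
   (SUM l:I. if l = i then (if i = k then La i (res (V i) h) (res (V i) h') else 0) else 0)"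
  unfolding product_bivector_def pushforward_def c[OF ik(1,3)] c[OF ik(2,4)]
  using z bivector_zero(2)[OF V[OF ik(1)] L[OF ik(1)] res_functional[OF V[OF ik(1)] ik(3)]]
  by (intro sum.cong refl) auto
 thus "product_bivector I V La (res (product_space I V) (cmp I V i h)) (res (product_space I V) (cmp I V k h')) =
   (if i = k then La i (res (V i) h) (res (V i) h') else 0)" using ik(1) I by simp
qed

end

section \<open>The Kronecker elementary pair in normal form\<close>

text \<open>Passing to the dual bivector inverts the weights. This is why the scalars b of the
  Kronecker pair enter below through 1 / b.\<close>

lemma weighted_form_dual:
 fixes V :: "('k::field, 'v) module" and n :: nat
 assumes V: "vspace V" and f: "frame V {1..2*n} f" and e: "!!i. i : {1..2*n} ==> e i : carrier V"
  "!!i j. i : {1..2*n} ==> j : {1..2*n} ==> f j (e i) = (if j = i then 1 else 0)"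
  and c: "!!j. j : {1..n} ==> c j ~= 0"
  and w: "!!x y. x : carrier V ==> y : carrier V ==> om x y = (SUM j=1..n. c j * (f (2*j-1) x * f (2*j) y - f (2*j) x * f (2*j-1) y))"
 shows "symplectic_form V om"
  "F : zfun V ==> G : zfun V ==> dual_bivector V om (res V F) (res V G) =
   (SUM j=1..n. 1 / c j * (F (e (2*j-1)) * G (e (2*j)) - F (e (2*j)) * G (e (2*j-1))))"
proof -
 have rng: "2*j-1 : {1..2*n}" "2*j : {1..2*n}" if "j : {1..n}" for j using that by auto
 note cl = vspaceD[OF V]
 have fl: "f (2*j-1) (x \<oplus>\<^bsub>V\<^esub> y) = f (2*j-1) x + f (2*j-1) y" "f (2*j) (x \<oplus>\<^bsub>V\<^esub> y) = f (2*j) x + f (2*j) y"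
  "f (2*j-1) (a \<odot>\<^bsub>V\<^esub> x) = a * f (2*j-1) x" "f (2*j) (a \<odot>\<^bsub>V\<^esub> x) = a * f (2*j) x"
  if "j : {1..n}" "x : carrier V" "y : carrier V" for j x y a
  using zfunD(2,3)[OF frameD(2)[OF f rng(1)[OF that(1)]]] zfunD(2,3)[OF frameD(2)[OF f rng(2)[OF that(1)]]] that(2,3) by auto
 have alt: "alternating_form V om" unfolding alternating_form_def
 proof (intro conjI ballI allI)
  fix x y z assume xyz: "x : carrier V" "y : carrier V" "z : carrier V"
  show "om (x \<oplus>\<^bsub>V\<^esub> y) z = om x z + om y z"
   unfolding w[OF cl(2)[OF xyz(1,2)] xyz(3)] w[OF xyz(1,3)] w[OF xyz(2,3)] sum.distrib[symmetric]
   by (intro sum.cong refl) (simp only: fl[OF _ xyz(1,2)], simp add: algebra_simps)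
  show "om z (x \<oplus>\<^bsub>V\<^esub> y) = om z x + om z y"
   unfolding w[OF xyz(3) cl(2)[OF xyz(1,2)]] w[OF xyz(3,1)] w[OF xyz(3,2)] sum.distrib[symmetric]
   by (intro sum.cong refl) (simp only: fl[OF _ xyz(1,2)], simp add: algebra_simps)
 next
  fix a x y assume xy: "x : carrier V" "y : carrier V"
  show "om (a \<odot>\<^bsub>V\<^esub> x) y = a * om x y"
   unfolding w[OF cl(3)[OF xy(1)] xy(2)] w[OF xy] sum_distrib_left
   by (intro sum.cong refl) (simp only: fl[OF _ xy(1,1)], simp add: algebra_simps)
  show "om x (a \<odot>\<^bsub>V\<^esub> y) = a * om x y"
   unfolding w[OF xy(1) cl(3)[OF xy(2)]] w[OF xy] sum_distrib_left
   by (intro sum.cong refl) (simp only: fl[OF _ xy(2,2)], simp add: algebra_simps)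
 next
  fix x assume x: "x : carrier V"
  show "om x x = 0" unfolding w[OF x x] by simp
 qed
 have we: "om x (e (2*j)) = c j * f (2*j-1) x" "om x (e (2*j-1)) = - (c j * f (2*j) x)" if x: "x : carrier V" and j: "j : {1..n}" for x j
 proof -
  have v: "f (2*k) (e (2*j)) = (if k = j then 1 else 0)" "f (2*k-1) (e (2*j)) = 0"
   "f (2*k) (e (2*j-1)) = 0" "f (2*k-1) (e (2*j-1)) = (if k = j then 1 else 0)" if k: "k : {1..n}" for k
   using e(2)[OF rng(2)[OF j] rng(2)[OF k]] e(2)[OF rng(2)[OF j] rng(1)[OF k]] e(2)[OF rng(1)[OF j] rng(2)[OF k]]
    e(2)[OF rng(1)[OF j] rng(1)[OF k]] j k half_index[of j k] half_index[of k j] by (auto simp del: One_nat_def)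
  have "om x (e (2*j)) = (SUM k=1..n. if k = j then c j * f (2*j-1) x else 0)"
   unfolding w[OF x e(1)[OF rng(2)[OF j]]] by (intro sum.cong refl) (simp only: v, auto)
  thus "om x (e (2*j)) = c j * f (2*j-1) x" using j by simp
  have "om x (e (2*j-1)) = (SUM k=1..n. if k = j then - (c j * f (2*j) x) else 0)"
   unfolding w[OF x e(1)[OF rng(1)[OF j]]] by (intro sum.cong refl) (simp only: v, auto)
  thus "om x (e (2*j-1)) = - (c j * f (2*j) x)" using j by simp
 qed
 have feq: "x = y" if xy: "x : carrier V" "y : carrier V" and a: "!!j. j : {1..n} ==> f (2*j-1) x = f (2*j-1) y & f (2*j) x = f (2*j) y" for x y
 proof (rule frameD(3)[OF f xy])
  fix i assume "i : {1..2*n}"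
  thus "f i x = f i y" by (cases rule: nat_half_cases) (use a in auto)
 qed
 show sy: "symplectic_form V om" unfolding symplectic_form_def
 proof (intro conjI alt equalityI subsetI)
  fix x assume x: "x : form_kernel V om"
  have z0: "f (2*j-1) \<zero>\<^bsub>V\<^esub> = 0" "f (2*j) \<zero>\<^bsub>V\<^esub> = 0" if "j : {1..n}" for j
   using zfun_zero[OF V frameD(2)[OF f rng(1)[OF that]]] zfun_zero[OF V frameD(2)[OF f rng(2)[OF that]]] by auto
  have xV: "x : carrier V" using x by (simp add: form_kernel_def)
  have "f (2*j-1) x = 0 & f (2*j) x = 0" if j: "j : {1..n}" for j
   using x we[OF xV j] e(1)[OF rng(1)[OF j]] e(1)[OF rng(2)[OF j]] c[OF j] by (simp add: form_kernel_def)
  hence "x = \<zero>\<^bsub>V\<^esub>" using z0 by (intro feq[OF xV cl(1)]) simp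
  thus "x : {\<zero>\<^bsub>V\<^esub>}" by simp
 next
  fix x assume "x : {\<zero>\<^bsub>V\<^esub>}"
  moreover have "om \<zero>\<^bsub>V\<^esub> v = 0" if "v : carrier V" for v
   using zfun_zero[OF V zfun_flat[OF V alt that]] alternating_form_swap[OF V alt that cl(1)] cl(1) by (simp add: zx_apply flat_def)
  ultimately show "x : form_kernel V om" using cl(1) by (simp add: form_kernel_def)
 qed
 have ex: "EX x:carrier V. flat V om x = res V F & (ALL j:{1..n}. f (2*j-1) x = F (e (2*j)) / c j & f (2*j) x = - (F (e (2*j-1)) / c j))"
  if F: "F : zfun V" for F
 proof -
  \<comment> \<open>Solution of om(x, .) = F in coordinates: each pair is exchanged with a sign and
    divided by its weight.\<close>
  define co where "co i = (if even i then - (F (e (i-1)) / c (i div 2)) else F (e (i+1)) / c ((i+1) div 2))" for i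
  obtain x where x: "x : carrier V" "ALL i:{1..2*n}. f i x = co i" using frameD(4)[OF f, of co] by blast
  have fx: "f (2*j-1) x = F (e (2*j)) / c j" "f (2*j) x = - (F (e (2*j-1)) / c j)" if j: "j : {1..n}" for j
  proof -
   have "odd (2*j-1)" "2*j-1+1 = 2*j" using j by auto
   thus "f (2*j-1) x = F (e (2*j)) / c j" using x(2) rng(1)[OF j] by (simp add: co_def)
   show "f (2*j) x = - (F (e (2*j-1)) / c j)" using x(2) rng(2)[OF j] by (simp add: co_def)
  qed
  have "flat V om x y = F y" if y: "y : carrier V" for y
  proof -
   have "F y = (SUM i=1..2*n. f i y * F (e i))" by (rule frame_expand(1)[OF V f e F y])
   also have "... = (SUM j=1..n. f (2*j-1) y * F (e (2*j-1)) + f (2*j) y * F (e (2*j)))"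
    by (induction n) simp_all
   also have "... = om x y" unfolding w[OF x(1) y]
   proof (rule sum.cong[OF refl])
    fix j assume j: "j : {1..n}"
    show "f (2*j-1) y * F (e (2*j-1)) + f (2*j) y * F (e (2*j)) = c j * (f (2*j-1) x * f (2*j) y - f (2*j) x * f (2*j-1) y)"
     unfolding fx[OF j] using c[OF j] by (simp add: field_simps)
   qed
   finally show ?thesis using y by (simp add: flat_def)
  qed
  hence "flat V om x = res V F"
   by (intro functional_eqI[OF flat_functional[OF V alt x(1)] res_functional[OF V F]]) simp
  thus ?thesis using x(1) fx by blast
 qed
 assume F: "F : zfun V" and G: "G : zfun V"
 obtain x where x: "x : carrier V" "flat V om x = res V F"
  "!!j. j : {1..n} ==> f (2*j-1) x = F (e (2*j)) / c j & f (2*j) x = - (F (e (2*j-1)) / c j)" using ex[OF F] by blast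
 obtain y where y: "y : carrier V" "flat V om y = res V G"
  "!!j. j : {1..n} ==> f (2*j-1) y = G (e (2*j)) / c j & f (2*j) y = - (G (e (2*j-1)) / c j)" using ex[OF G] by blast
 have "dual_bivector V om (res V F) (res V G) = om x y"
  using dual_bivector_props(2)[OF V f sy x(1) y(1)] unfolding x(2) y(2) .
 also have "... = (SUM j=1..n. 1 / c j * (F (e (2*j-1)) * G (e (2*j)) - F (e (2*j)) * G (e (2*j-1))))"
  unfolding w[OF x(1) y(1)]
 proof (rule sum.cong[OF refl])
  fix j assume j: "j : {1..n}"
  have a: "f (2*j-1) x = F (e (2*j)) / c j" "f (2*j) x = - (F (e (2*j-1)) / c j)"
   "f (2*j-1) y = G (e (2*j)) / c j" "f (2*j) y = - (G (e (2*j-1)) / c j)" using x(3)[OF j] y(3)[OF j] by auto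
  show "c j * (f (2*j-1) x * f (2*j) y - f (2*j) x * f (2*j-1) y) =
    1 / c j * (F (e (2*j-1)) * G (e (2*j)) - F (e (2*j)) * G (e (2*j-1)))"
   unfolding a using c[OF j] by (simp add: field_simps)
 qed
 finally show "dual_bivector V om (res V F) (res V G) =
   (SUM j=1..n. 1 / c j * (F (e (2*j-1)) * G (e (2*j)) - F (e (2*j)) * G (e (2*j-1))))" .
qed

text \<open>The polynomials \<open>\<Prod>\<^bsub>l~=j\<^esub> (1 + c\<^sub>l t)\<close> are, up to scaling, the Lagrange basis for the nodes
 \<open>- 1 / c\<^sub>j\<close>. Their coefficients give the covectors of the Kronecker chain, and the expansions of
 the monomials in this basis the dual chain.\<close>

lemma kron_coefficients:
 fixes c :: "nat => 'k::field" and n :: nat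
 assumes inj: "inj_on c {1..n}" and nz: "!!j. j : {1..n} ==> c j ~= 0"
 obtains p q :: "nat => nat => 'k" where
  "!!i k. i : {1..n} ==> k < n ==> (SUM j=1..n. p i j * q k j) = (if i = Suc k then 1 else 0)"
  "!!i k. i : {1..n} ==> k : {1..<n} ==> (SUM j=1..n. c j * p i j * q k j) = - (if i = k then 1 else 0)"
  "!!k. k : {1..<n} ==> (SUM j=1..n. q k j) = 0"
  "!!j. j : {1..n} ==> p 1 j = 1"
  "!!l j. l : {1..n} ==> j : {1..n} ==> (SUM k<n. q k l * p (Suc k) j) = (if l = j then 1 else 0)"
proof -
 define P where "P j = (\<Prod>l\<in>{1..n} - {j}. [:1, c l:])" for j
 \<comment> \<open>p holds the coefficients of the polynomials P j, and q k j the Lagrange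
   coefficient of t^k at the node - 1 / c j.\<close>
 define p where "p i j = coeff (P j) (i - 1)" for i j
 define q where "q k j = (- 1 / c j) ^ k / poly (P j) (- 1 / c j)" for k j
 have dP: "degree (P j) < n" if j: "j : {1..n}" for j
 proof -
  have "degree (P j) <= (SUM l:{1..n} - {j}. degree [:1, c l:])" unfolding P_def using degree_prod_sum_le[of "{1..n} - {j}" "%l. [:1, c l:]"] by (simp add: o_def)
  also have "... <= (SUM l:{1..n} - {j}. 1)" by (rule sum_mono) simp
  also have "... < n" using j by simp
  finally show ?thesis .
 qed
 have Pz: "poly (P j) (- 1 / c l) = 0" if "l : {1..n}" "l ~= j" for l j
  using that nz by (auto simp: P_def poly_prod intro!: prod_zero bexI[of _ l])
 have Pn: "poly (P j) (- 1 / c j) ~= 0" if j: "j : {1..n}" for j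
  using inj_onD[OF inj] j nz by (auto simp: P_def poly_prod field_simps)
 \<comment> \<open>The interpolation formula: R k and t^k have degree below n and agree at the n
   distinct nodes.\<close>
 define R where "R k = (SUM j=1..n. Polynomial.smult (q k j) (P j))" for k
 have R: "R k = monom 1 k" if k: "k < n" for k
 proof (rule ccontr)
  assume "R k ~= monom 1 k"
  hence D0: "R k - monom 1 k ~= 0" by simp
  have "degree (P j) <= n - 1" if "j : {1..n}" for j using dP[OF that] by simp
  hence d1: "degree (R k) <= n - 1" unfolding R_def
   by (intro degree_sum_le order_trans[OF degree_smult_le]) auto
  have d2: "degree (monom (1::'k) k) <= n - 1" using k by (simp add: degree_monom_eq)
  have deg: "degree (R k - monom 1 k) < n" using degree_diff_le[OF d1 d2] k by linarith
  have "(%l. - 1 / c l) ` {1..n} <= {x. poly (R k - monom 1 k) x = 0}"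
  proof clarify
   fix l assume l: "l : {1..n}"
   have "poly (R k) (- 1 / c l) = (SUM j=1..n. if j = l then (- 1 / c l) ^ k else 0)"
    unfolding R_def poly_sum poly_smult using Pz[OF l] Pn[OF l] by (intro sum.cong) (auto simp: q_def)
   thus "poly (R k - monom 1 k) (- 1 / c l) = 0" using l by (simp add: poly_monom)
  qed
  from card_mono[OF poly_roots_finite[OF D0] this] have "card ((%l. - 1 / c l) ` {1..n}) <= degree (R k - monom 1 k)"
   using card_poly_roots_bound[OF D0] by linarith
  moreover have "inj_on (%l. - 1 / c l) {1..n}"
  proof (rule inj_onI)
   fix x y assume xy: "x : {1..n}" "y : {1..n}" "- 1 / c x = - 1 / c y"
   hence "c x = c y" using nz[OF xy(1)] nz[OF xy(2)] by (simp add: field_simps)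
   thus "x = y" using inj_onD[OF inj _ xy(1,2)] by blast
  qed
  ultimately show False using deg by (simp add: card_image)
 qed
 have cf: "(SUM j=1..n. p i j * q k j) = (if i = Suc k then 1 else 0)" if "i : {1..n}" "k < n" for i k
 proof -
  have "(SUM j=1..n. p i j * q k j) = coeff (R k) (i - 1)" unfolding R_def coeff_sum p_def by (simp add: mult.commute)
  also have "... = (if i = Suc k then 1 else 0)" unfolding R[OF that(2)] using that(1) by auto
  finally show ?thesis .
 qed
 \<comment> \<open>Weights c j are absorbed by the identity c_j t P_j = (product of all 1 + c_l t) -
   P_j. For k >= 1 the constant term shows that the q k j sum to 0, so the full product disappears
   and t X k = - t^k.\<close>
 define X where "X k = (SUM j=1..n. Polynomial.smult (c j * q k j) (P j))" for k
 have XR: "pCons 0 (X k) = Polynomial.smult (SUM j=1..n. q k j) (PROD l=1..n. [:1, c l:]) - R k" for k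
 proof -
  have e: "pCons 0 (Polynomial.smult (c j * q k j) (P j)) = Polynomial.smult (q k j) (PROD l=1..n. [:1, c l:]) - Polynomial.smult (q k j) (P j)" if "j : {1..n}" for j
  proof -
   have "(PROD l=1..n. [:1, c l:]) = [:1, c j:] * P j" unfolding P_def using that by (simp add: prod.remove)
   thus ?thesis by (simp add: smult_add_right mult.commute)
  qed
  have "pCons 0 (X k) = (SUM j=1..n. pCons 0 (Polynomial.smult (c j * q k j) (P j)))"
   unfolding X_def by (rule poly_eqI) (auto simp: coeff_sum coeff_pCons split: nat.split)
  also have "... = (SUM j=1..n. Polynomial.smult (q k j) (PROD l=1..n. [:1, c l:]) - Polynomial.smult (q k j) (P j))" using e by (intro sum.cong) auto
  also have "... = Polynomial.smult (SUM j=1..n. q k j) (PROD l=1..n. [:1, c l:]) - R k"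
   by (simp add: sum_subtractf R_def smult_sum)
  finally show ?thesis .
 qed
 have q0: "(SUM j=1..n. q k j) = 0" if "k : {1..<n}" for k
 proof -
  have "poly (pCons 0 (X k)) 0 = (SUM j=1..n. q k j) * (PROD l=1..n. poly [:1, c l:] 0) - poly (R k) 0"
   unfolding XR by (simp add: poly_prod)
  thus ?thesis using R[of k] that by (simp add: poly_monom)
 qed
 have cf2: "(SUM j=1..n. c j * p i j * q k j) = - (if i = k then 1 else 0)" if "i : {1..n}" "k : {1..<n}" for i k
 proof -
  have "(SUM j=1..n. c j * p i j * q k j) = coeff (X k) (i - 1)" unfolding X_def coeff_sum p_def by (simp add: ac_simps)
  also have "... = coeff (pCons 0 (X k)) i" using that(1) by (cases i) auto
  also have "... = - (if i = k then 1 else 0)" unfolding XR q0[OF that(2)] using R[of k] that by auto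
  finally show ?thesis .
 qed
 have p1: "p 1 j = 1" for j
  by (simp add: p_def P_def poly_0_coeff_0[symmetric] poly_prod)
 \<comment> \<open>The first identity says that the matrices p and q are inverse on one side; the
   last claim is the other side.\<close>
 let ?A = "mat n n (%(i, j). p (Suc i) (Suc j))" and ?B = "mat n n (%(j, k). q k (Suc j))"
 have "?A * ?B = 1\<^sub>m n"
 proof (rule eq_matI)
  fix i k assume ik: "i < dim_row (1\<^sub>m n :: 'k mat)" "k < dim_col (1\<^sub>m n :: 'k mat)"
  have "(?A * ?B) $$ (i, k) = (SUM j<n. p (Suc i) (Suc j) * q k (Suc j))"
   using ik by (simp add: scalar_prod_def atLeast0LessThan)
  also have "... = (SUM j=1..n. p (Suc i) j * q k j)" by (simp add: sum.atLeast1_atMost_eq)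
  finally show "(?A * ?B) $$ (i, k) = 1\<^sub>m n $$ (i, k)" using cf[of "Suc i" k] ik by simp
 qed auto
 hence BA: "?B * ?A = 1\<^sub>m n" by (rule mat_mult_left_right_inverse[OF mat_carrier mat_carrier])
 have inv: "(SUM k<n. q k l * p (Suc k) j) = (if l = j then 1 else 0)" if lj: "l : {1..n}" "j : {1..n}" for l j
 proof -
  obtain l' j' where lj': "l = Suc l'" "j = Suc j'" "l' < n" "j' < n" using lj by (cases l; cases j) auto
  have "(?B * ?A) $$ (l', j') = (SUM k<n. q k l * p (Suc k) j)"
   using lj' by (simp add: scalar_prod_def atLeast0LessThan)
  thus ?thesis unfolding BA using lj' by auto
 qed
 show thesis by (rule that[OF cf cf2 q0 p1 inv])
qed

text \<open>The normal form of \<open>kron_basis\<close> for a single chain of length n and no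
  remaining block.\<close>

definition kron_frame :: "nat => (nat => 'k) => (nat => 'k vec set => 'k) => (nat => 'k vec set => 'k::field) => bool" where
 "kron_frame n b bv av \<longleftrightarrow>
   vspace (kron_space n :: ('k, 'k vec set) module) & frame (kron_space n) ({1..n} <+> {1..<n}) (case_sum bv av) &
   bivector (kron_space n) (kron_bivector n (%_. 1 :: 'k)) & bivector (kron_space n) (kron_bivector n b) &
   (ALL i:{1..n}. ALL k:{1..n}. kron_bivector n (%_. 1) (res (kron_space n) (bv i)) (res (kron_space n) (bv k)) = 0 &
    kron_bivector n b (res (kron_space n) (bv i)) (res (kron_space n) (bv k)) = 0) &
   (ALL i:{1..<n}. ALL k:{1..<n}. kron_bivector n (%_. 1) (res (kron_space n) (av i)) (res (kron_space n) (av k)) = 0 &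
    kron_bivector n b (res (kron_space n) (av i)) (res (kron_space n) (av k)) = 0) &
   (ALL i:{1..n}. ALL k:{1..<n}. kron_bivector n (%_. 1) (res (kron_space n) (bv i)) (res (kron_space n) (av k)) = (if i = Suc k then 1 else 0) &
    kron_bivector n b (res (kron_space n) (bv i)) (res (kron_space n) (av k)) = - (if i = k then 1 else 0))"

text \<open>\<open>kron_coefficients\<close> is applied to c = 1 / b, the weights of the second dual
  bivector: its first identity is the pairing for the weights 1, its second the pairing for the
  weights 1 / b.\<close>

lemma kron_frame_exists:
 fixes b :: "nat => 'k::field" and n :: nat
 assumes inj: "inj_on b {1..n}" and nz: "!!j. j : {1..n} ==> b j ~= 0"
 shows "EX bv av. kron_frame n b bv av"
proof -
 let ?V = "kron_ambient n :: ('k, 'k vec) module"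
 have amb: "carrier ?V = carrier_vec (2*n)" "x \<oplus>\<^bsub>?V\<^esub> y = x + y" "c \<odot>\<^bsub>?V\<^esub> x = c \<cdot>\<^sub>v x" "\<zero>\<^bsub>?V\<^esub> = 0\<^sub>v (2*n)" for x y c
  by (simp_all add: kron_ambient_def module_vec_simps)
 have V: "vspace ?V" unfolding kron_ambient_def by (rule vec_vs)
 interpret Vv: vectorspace class_ring ?V by (rule V)
 define f :: "nat => 'k vec => 'k" where "f i x = (if x : carrier_vec (2*n) then x $ (i - 1) else 0)" for i x
 have f: "frame ?V {1..2*n} f" unfolding frame_def
 proof (intro conjI ballI allI impI)
  fix i assume i: "i : {1..2*n}"
  hence "i - 1 < 2*n" by auto
  thus "f i : zfun ?V" by (intro zfunI) (auto simp: f_def amb)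
 next
  fix x y :: "'k vec" assume xy: "x : carrier ?V" "y : carrier ?V" "ALL i:{1..2*n}. f i x = f i y"
  show "x = y"
  proof (rule eq_vecI)
   show "dim_vec x = dim_vec y" using xy(1,2) by (simp add: amb)
   fix i assume "i < dim_vec y"
   thus "x $ i = y $ i" using xy(1,2) xy(3)[rule_format, of "Suc i"] by (simp add: amb f_def)
  qed
 next
  fix c :: "nat => 'k"
  show "EX x:carrier ?V. ALL i:{1..2*n}. f i x = c i"
   by (intro bexI[of _ "vec (2*n) (%i. c (Suc i))"]) (auto simp: amb f_def)
 qed simp
 let ?e = "kron_basis n :: nat => 'k vec"
 have e: "?e i : carrier ?V" "j : {1..2*n} ==> i : {1..2*n} ==> f j (?e i) = (if j = i then 1 else 0)" for i j
  by (auto simp: amb kron_basis_def f_def unit_vec_def)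
 have rng: "2*j-1 : {1..2*n}" "2*j : {1..2*n}" if "j : {1..n}" for j using that by auto
 have fe: "f (2*k) (?e (2*j)) = (if k = j then 1 else 0)" "f (2*k-1) (?e (2*j)) = 0"
  "f (2*k) (?e (2*j-1)) = 0" "f (2*k-1) (?e (2*j-1)) = (if k = j then 1 else 0)" if k: "k : {1..n}" and j: "j : {1..n}" for k j
  using e(2)[OF rng(2)[OF k] rng(2)[OF j]] e(2)[OF rng(1)[OF k] rng(2)[OF j]] e(2)[OF rng(2)[OF k] rng(1)[OF j]]
   e(2)[OF rng(1)[OF k] rng(1)[OF j]] j k half_index[of j k] half_index[of k j] by (auto simp del: One_nat_def)
 define d where "d = \<ominus>\<^bsub>?V\<^esub> (\<Oplus>\<^bsub>?V\<^esub> j\<in>{1..n}. ?e (2*j))"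
 have sV: "(\<Oplus>\<^bsub>?V\<^esub> j\<in>{1..n}. ?e (2*j)) : carrier ?V" by (rule zfun_finsum(1)[OF V]) (use e in auto)
 have dV: "d : carrier ?V" unfolding d_def using sV by (rule Vv.a_inv_closed)
 have gd: "g d = - (SUM j=1..n. g (?e (2*j)))" if g: "g : zfun ?V" for g
 proof -
  let ?s = "\<Oplus>\<^bsub>?V\<^esub> j\<in>{1..n}. ?e (2*j)"
  have "g (d \<oplus>\<^bsub>?V\<^esub> ?s) = g d + g ?s" by (rule zfunD(2)[OF g dV sV])
  moreover have "d \<oplus>\<^bsub>?V\<^esub> ?s = \<zero>\<^bsub>?V\<^esub>" unfolding d_def using sV by (rule Vv.l_neg)
  ultimately have "0 = g d + g ?s" using zfun_zero[OF V g] by simp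
  moreover have "g ?s = (SUM j=1..n. g (?e (2*j)))" by (rule zfun_finsum(2)[OF V]) (use e g in auto)
  ultimately show ?thesis by (simp add: eq_neg_iff_add_eq_0)
 qed
 have L: "kron_line n = range (%c. c \<odot>\<^bsub>?V\<^esub> d)" by (simp add: kron_line_def d_def Let_def)
 have quot: "quotient ?V (kron_line n)"
 proof (rule quotient.intro[OF V])
  show "kron_line n <= carrier ?V" unfolding L using vspaceD(3)[OF V dV] by auto
  have mem: "c \<odot>\<^bsub>?V\<^esub> d : kron_line n" for c unfolding L by (rule rangeI)
  show "\<zero>\<^bsub>?V\<^esub> : kron_line n" using Vv.lmult_0[OF dV] mem[of 0] by simp
  show "x \<oplus>\<^bsub>?V\<^esub> y : kron_line n" if xy: "x : kron_line n" "y : kron_line n" for x y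
  proof -
   obtain a c where ac: "x = a \<odot>\<^bsub>?V\<^esub> d" "y = c \<odot>\<^bsub>?V\<^esub> d" using xy unfolding L by blast
   have "(a + c) \<odot>\<^bsub>?V\<^esub> d = x \<oplus>\<^bsub>?V\<^esub> y" using Vv.smult_l_distr[of a c d] dV unfolding ac by simp
   thus ?thesis using mem[of "a + c"] by simp
  qed
  show "c \<odot>\<^bsub>?V\<^esub> x : kron_line n" if x: "x : kron_line n" for c x
  proof -
   obtain a where a: "x = a \<odot>\<^bsub>?V\<^esub> d" using x unfolding L by blast
   have "(c * a) \<odot>\<^bsub>?V\<^esub> d = c \<odot>\<^bsub>?V\<^esub> x" using Vv.smult_assoc1[of c a d] dV unfolding a by simp
   thus ?thesis using mem[of "c * a"] by simp
  qed
 qed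
 interpret Q: quotient ?V "kron_line n" by (rule quot)
 have Qe: "kron_space n = Q.Q" by (simp add: kron_space_def)
 have "inj_on (%j. 1 / b j) {1..n}"
 proof (rule inj_onI)
  fix x y assume xy: "x : {1..n}" "y : {1..n}" "1 / b x = 1 / b y"
  hence "b x = b y" using nz[OF xy(1)] nz[OF xy(2)] by (simp add: field_simps)
  thus "x = y" using inj_onD[OF inj _ xy(1,2)] by blast
 qed
 then obtain p q :: "nat => nat => 'k" where
  pq: "!!i k. i : {1..n} ==> k < n ==> (SUM j=1..n. p i j * q k j) = (if i = Suc k then 1 else 0)"
  and cpq: "!!i k. i : {1..n} ==> k : {1..<n} ==> (SUM j=1..n. 1 / b j * p i j * q k j) = - (if i = k then 1 else 0)"
  and q0: "!!k. k : {1..<n} ==> (SUM j=1..n. q k j) = 0" and p1: "!!j. j : {1..n} ==> p 1 j = 1"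
  and qp: "!!l j. l : {1..n} ==> j : {1..n} ==> (SUM k<n. q k l * p (Suc k) j) = (if l = j then 1 else 0)"
  by (rule kron_coefficients[of "%j. 1 / b j" n]) (use nz in auto)
 \<comment> \<open>\<open>Bt\<close> uses only the odd coordinates, hence vanishes on the line
   spanned by the even vector e. \<open>Al k\<close> uses the even ones and vanishes there for k >=
   1, because the q k j sum to 0.\<close>
 define Bt where "Bt i = (SUM j=1..n. fscale (p i j) (f (2*j-1)))" for i
 define Al where "Al k = (SUM j=1..n. fscale (q k j) (f (2*j)))" for k
 have BtV: "Bt i : zfun ?V" and AlV: "Al k : zfun ?V" for i k
  unfolding Bt_def Al_def using frameD(2)[OF f rng(1)] frameD(2)[OF f rng(2)]
  by (auto intro!: fs.subspace_sum[OF zfun_subspace] fs.subspace_scale[OF zfun_subspace])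
 have Bt: "Bt i x = (SUM j=1..n. p i j * f (2*j-1) x)" and Al: "Al k x = (SUM j=1..n. q k j * f (2*j) x)" for i k x
  by (simp_all add: Bt_def Al_def sum_fun_apply)
 have Bte: "Bt i (?e (2*j-1)) = p i j" "Bt i (?e (2*j)) = 0" "Al k (?e (2*j-1)) = 0" "Al k (?e (2*j)) = q k j" if j: "j : {1..n}" for i k j
 proof -
  have "Bt i (?e (2*j-1)) = (SUM l=1..n. if l = j then p i j else 0)" unfolding Bt using fe(4)[OF _ j] by (intro sum.cong refl) auto
  thus "Bt i (?e (2*j-1)) = p i j" using j by simp
  show "Bt i (?e (2*j)) = 0" unfolding Bt using fe(2)[OF _ j] by (intro sum.neutral) auto
  show "Al k (?e (2*j-1)) = 0" unfolding Al using fe(3)[OF _ j] by (intro sum.neutral) auto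
  have "Al k (?e (2*j)) = (SUM l=1..n. if l = j then q k j else 0)" unfolding Al using fe(1)[OF _ j] by (intro sum.cong refl) auto
  thus "Al k (?e (2*j)) = q k j" using j by simp
 qed
 have BtL: "Bt i x = 0" if "x : kron_line n" for i x
  using that gd[OF BtV] Bte(2) zfunD(3)[OF BtV dV] unfolding L by auto
 have AlL: "Al k x = 0" if "x : kron_line n" "k : {1..<n}" for k x
  using that gd[OF AlV] Bte(4) zfunD(3)[OF AlV dV] q0[OF that(2)] unfolding L by auto
 let ?J = "{1..n} <+> {1..<n}"
 have fr: "frame Q.Q ?J (%j. Q.qf (case_sum Bt Al j))"
 proof (rule Q.quotient_frame)
  fix x assume x: "x : carrier ?V" "!!j. j : ?J ==> case_sum Bt Al j x = 0"
  have B0: "Bt i x = 0" if "i : {1..n}" for i using x(2)[of "Inl i"] that by simp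
  have A0: "Al k x = 0" if "k : {1..<n}" for k using x(2)[of "Inr k"] that by simp
  have od: "f (2*l-1) x = 0" if l: "l : {1..n}" for l
  proof -
   have "f (2*l-1) x = (SUM j=1..n. (SUM k<n. q k l * p (Suc k) j) * f (2*j-1) x)"
    using l qp[OF l] by (simp add: if_distrib[of "%a. a * _"] cong: if_cong)
   also have "... = (SUM k<n. q k l * Bt (Suc k) x)"
    unfolding Bt sum_distrib_right sum_distrib_left by (subst sum.swap) (simp add: mult.assoc)
   also have "... = 0" using B0 by (intro sum.neutral) auto
   finally show ?thesis .
  qed
  \<comment> \<open>The conditions leave k = 0 free, and p 1 j = 1 makes all even coordinates equal.
    With the odd ones zero, x is a multiple of the vector that is divided out.\<close>
  have ev: "f (2*l) x = Al 0 x" if l: "l : {1..n}" for l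
  proof -
   have "f (2*l) x = (SUM j=1..n. (if j = l then 1 else 0) * f (2*j) x)" using l by (simp add: if_distrib[of "%a. a * _"] cong: if_cong)
   also have "... = (SUM j=1..n. (SUM k<n. q k j * p (Suc k) l) * f (2*j) x)" using qp[OF _ l] by (intro sum.cong refl) simp
   also have "... = (SUM k<n. p (Suc k) l * Al k x)"
    unfolding Al sum_distrib_right sum_distrib_left by (subst sum.swap) (simp add: ac_simps)
   also have "... = (SUM k<n. if k = 0 then Al 0 x else 0)" using A0 p1[OF l] by (intro sum.cong refl) auto
   finally show ?thesis using l by simp
  qed
  have "x = (- Al 0 x) \<odot>\<^bsub>?V\<^esub> d"
  proof (rule frameD(3)[OF f x(1) vspaceD(3)[OF V dV]])
   fix i assume i: "i : {1..2*n}"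
   have fd: "f i d = - (SUM j=1..n. f i (?e (2*j)))" by (rule gd[OF frameD(2)[OF f i]])
   have sc: "f i ((- Al 0 x) \<odot>\<^bsub>?V\<^esub> d) = (- Al 0 x) * f i d" by (rule zfunD(3)[OF frameD(2)[OF f i] dV])
   show "f i x = f i ((- Al 0 x) \<odot>\<^bsub>?V\<^esub> d)" unfolding sc fd using i
   proof (cases rule: nat_half_cases)
    case (1 j)
    have "(SUM l=1..n. f (2*j-1) (?e (2*l))) = 0" using fe(2)[OF 1(1)] by (intro sum.neutral) auto
    thus "f i x = - Al 0 x * - (SUM j=1..n. f i (?e (2*j)))" using 1 od[OF 1(1)] by simp
   next
    case (2 j)
    have "(SUM l=1..n. f (2*j) (?e (2*l))) = (SUM l=1..n. if l = j then 1 else 0)" using fe(1)[OF 2(1)] by (intro sum.cong refl) auto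
    thus "f i x = - Al 0 x * - (SUM j=1..n. f i (?e (2*j)))" using 2 ev[OF 2(1)] by simp
   qed
  qed
  thus "x : kron_line n" unfolding L by blast
 next
  fix c :: "nat + nat => 'k"
  \<comment> \<open>The two systems are inverted by exchanging the roles of p and q.\<close>
  define co where "co i = (if even i then SUM k:{1..<n}. c (Inr k) * p (Suc k) (i div 2)
   else SUM k<n. c (Inl (Suc k)) * q k ((i+1) div 2))" for i
  obtain x where x: "x : carrier ?V" "ALL i:{1..2*n}. f i x = co i" using frameD(4)[OF f, of co] by blast
  have fx: "f (2*j-1) x = (SUM k<n. c (Inl (Suc k)) * q k j)" "f (2*j) x = (SUM k:{1..<n}. c (Inr k) * p (Suc k) j)" if j: "j : {1..n}" for j
  proof -
   have "odd (2*j-1)" "2*j-1+1 = 2*j" using j by auto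
   thus "f (2*j-1) x = (SUM k<n. c (Inl (Suc k)) * q k j)" using x(2) rng(1)[OF j] by (simp add: co_def)
   show "f (2*j) x = (SUM k:{1..<n}. c (Inr k) * p (Suc k) j)" using x(2) rng(2)[OF j] by (simp add: co_def)
  qed
  have "Bt i x = c (Inl i)" if i: "i : {1..n}" for i
  proof -
   have "Bt i x = (SUM j=1..n. SUM k<n. c (Inl (Suc k)) * (p i j * q k j))"
    unfolding Bt by (intro sum.cong refl) (simp only: fx, simp add: sum_distrib_left ac_simps)
   also have "... = (SUM k<n. c (Inl (Suc k)) * (SUM j=1..n. p i j * q k j))" by (subst sum.swap) (simp add: sum_distrib_left)
   also have "... = (SUM k<n. if k = i - 1 then c (Inl i) else 0)" using pq[OF i] i by (intro sum.cong refl) auto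
   moreover have "i - 1 < n" using i by auto
   ultimately show ?thesis by simp
  qed
  moreover have "Al k x = c (Inr k)" if k: "k : {1..<n}" for k
  proof -
   have "Al k x = (SUM j=1..n. SUM l:{1..<n}. c (Inr l) * (p (Suc l) j * q k j))"
    unfolding Al by (intro sum.cong refl) (simp only: fx, simp add: sum_distrib_left ac_simps)
   also have "... = (SUM l:{1..<n}. c (Inr l) * (SUM j=1..n. p (Suc l) j * q k j))" by (subst sum.swap) (simp add: sum_distrib_left)
   also have "... = (SUM l:{1..<n}. if l = k then c (Inr k) else 0)" using pq[of "Suc _" k] k by (intro sum.cong refl) auto
   finally show ?thesis using k by simp
  qed
  ultimately show "EX x:carrier ?V. ALL j:?J. case_sum Bt Al j x = c j" using x(1) by (intro bexI[of _ x]) auto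
 qed (use BtV AlV BtL AlL in auto)
 have form: "kron_form n a x y = (SUM j=1..n. a j * (f (2*j-1) x * f (2*j) y - f (2*j) x * f (2*j-1) y))"
  if xy: "x : carrier ?V" "y : carrier ?V" for a x y
  unfolding kron_form_def wedge_sum_def
 proof (rule sum.cong[OF refl])
  fix j assume j: "j : {1..n}"
  have db: "dual_basis ?V {1..2*n} ?e i = res ?V (f i)" if "i : {1..2*n}" for i by (rule dual_basis_eq[OF V f e(1) _ that]) (rule e(2))
  show "a j * (dual_basis ?V {1..2*n} ?e (2*j-1) x * dual_basis ?V {1..2*n} ?e (2*j) y -
    dual_basis ?V {1..2*n} ?e (2*j) x * dual_basis ?V {1..2*n} ?e (2*j-1) y) = a j * (f (2*j-1) x * f (2*j) y - f (2*j) x * f (2*j-1) y)"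
   unfolding db[OF rng(1)[OF j]] db[OF rng(2)[OF j]] using xy by simp
 qed
 have biv: "bivector Q.Q (kron_bivector n a)" if a: "!!j. j : {1..n} ==> a j ~= 0" for a
 proof -
  have sf: "symplectic_form ?V (kron_form n a)"
   by (rule weighted_form_dual(1)[where e = ?e, OF V f _ _ _ form]) (use e a in auto)
  show ?thesis unfolding kron_bivector_def
   by (rule pushforward_bivector[OF V _ _ _ dual_bivector_props(1)[OF V f sf]])
    (simp_all add: Q.pr_in Q.add_Q Q.smult_Q)
 qed
 have gram: "kron_bivector n a (res Q.Q (Q.qf F)) (res Q.Q (Q.qf G)) = (SUM j=1..n. 1 / a j * (u j * v' j - u' j * v j))"
  if a: "!!j. j : {1..n} ==> a j ~= 0" and F: "F : zfun ?V" "!!x. x : kron_line n ==> F x = 0"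
   and G: "G : zfun ?V" "!!x. x : kron_line n ==> G x = 0"
   and uv: "!!j. j : {1..n} ==> F (?e (2*j-1)) = u j & F (?e (2*j)) = u' j & G (?e (2*j-1)) = v j & G (?e (2*j)) = v' j"
  for a F G u u' v v'
 proof -
  have c: "compose (carrier ?V) (res Q.Q (Q.qf F)) Q.pr = res ?V F" "compose (carrier ?V) (res Q.Q (Q.qf G)) Q.pr = res ?V G"
   using Q.compose_qf[of F] Q.compose_qf[of G] F G by blast+
  have "dual_bivector ?V (kron_form n a) (res ?V F) (res ?V G) =
    (SUM j=1..n. 1 / a j * (F (?e (2*j-1)) * G (?e (2*j)) - F (?e (2*j)) * G (?e (2*j-1))))"
   by (rule weighted_form_dual(2)[OF V f _ _ _ form F(1) G(1)]) (use e a in auto)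
  also have "... = (SUM j=1..n. 1 / a j * (u j * v' j - u' j * v j))"
   by (rule sum.cong[OF refl]) (drule uv, simp del: One_nat_def)
  finally show ?thesis unfolding kron_bivector_def pushforward_def c .
 qed
 have cs: "(%j. Q.qf (case_sum Bt Al j)) = case_sum (%i. Q.qf (Bt i)) (%k. Q.qf (Al k))" by (auto simp: fun_eq_iff split: sum.split)
 have Qb: "bivector Q.Q (kron_bivector n (%_. 1))" "bivector Q.Q (kron_bivector n b)" using biv nz by auto
 have Qf: "frame Q.Q ?J (case_sum (%i. Q.qf (Bt i)) (%k. Q.qf (Al k)))" using fr unfolding cs .
  have BB: "kron_bivector n a (res Q.Q (Q.qf (Bt i))) (res Q.Q (Q.qf (Bt k))) = (SUM j=1..n. 1 / a j * (p i j * 0 - 0 * p k j))"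
   if "!!j. j : {1..n} ==> a j ~= 0" for a i k
   by (rule gram[OF that BtV BtL BtV BtL]) (simp_all only: Bte simp_thms)
  have AA: "kron_bivector n a (res Q.Q (Q.qf (Al i))) (res Q.Q (Q.qf (Al k))) = (SUM j=1..n. 1 / a j * (0 * q k j - q i j * 0))"
   if "!!j. j : {1..n} ==> a j ~= 0" "i : {1..<n}" "k : {1..<n}" for a i k
   by (rule gram[OF that(1) AlV AlL[OF _ that(2)] AlV AlL[OF _ that(3)]]) (simp_all only: Bte simp_thms)
  have BA: "kron_bivector n a (res Q.Q (Q.qf (Bt i))) (res Q.Q (Q.qf (Al k))) = (SUM j=1..n. 1 / a j * (p i j * q k j - 0 * 0))"
   if "!!j. j : {1..n} ==> a j ~= 0" "k : {1..<n}" for a i k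
   by (rule gram[OF that(1) BtV BtL AlV AlL[OF _ that(2)]]) (simp_all only: Bte simp_thms)
  have g1: "kron_bivector n (%_. 1) (res Q.Q (Q.qf (Bt i))) (res Q.Q (Q.qf (Bt k))) = 0 &
    kron_bivector n b (res Q.Q (Q.qf (Bt i))) (res Q.Q (Q.qf (Bt k))) = 0" for i k
     proof -
   have "kron_bivector n b (res Q.Q (Q.qf (Bt i))) (res Q.Q (Q.qf (Bt k))) = (SUM j=1..n. 1 / b j * (p i j * 0 - 0 * p k j))"
    by (rule BB) (rule nz)
   thus ?thesis by (simp add: BB)
  qed
  have g2: "kron_bivector n (%_. 1) (res Q.Q (Q.qf (Al i))) (res Q.Q (Q.qf (Al k))) = 0 &
    kron_bivector n b (res Q.Q (Q.qf (Al i))) (res Q.Q (Q.qf (Al k))) = 0" if ik: "i : {1..<n}" "k : {1..<n}" for i k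
     proof -
   have "kron_bivector n b (res Q.Q (Q.qf (Al i))) (res Q.Q (Q.qf (Al k))) = (SUM j=1..n. 1 / b j * (0 * q k j - q i j * 0))"
    by (rule AA[OF _ ik]) (rule nz)
   thus ?thesis using ik by (simp add: AA)
  qed
  have g3: "kron_bivector n (%_. 1) (res Q.Q (Q.qf (Bt i))) (res Q.Q (Q.qf (Al k))) = (if i = Suc k then 1 else 0) &
    kron_bivector n b (res Q.Q (Q.qf (Bt i))) (res Q.Q (Q.qf (Al k))) = - (if i = k then 1 else 0)"
   if ik: "i : {1..n}" "k : {1..<n}" for i k
     proof -
   have "kron_bivector n b (res Q.Q (Q.qf (Bt i))) (res Q.Q (Q.qf (Al k))) = (SUM j=1..n. 1 / b j * (p i j * q k j - 0 * 0))"
    by (rule BA[OF _ ik(2)]) (rule nz)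
   thus ?thesis using pq[OF ik(1), of k] cpq[OF ik] ik(2) by (simp add: BA)
  qed
 show ?thesis unfolding kron_frame_def Qe
  by (intro exI[of _ "%i. Q.qf (Bt i)"] exI[of _ "%k. Q.qf (Al k)"] conjI ballI Q.Q_vspace Qb Qf
   conjunct1[OF g1] conjunct2[OF g1] conjunct1[OF g2] conjunct2[OF g2] conjunct1[OF g3] conjunct2[OF g3])
qed

section \<open>The invariants determine the pair\<close>

type_synonym block_index = "nat \<times> nat + (nat \<times> nat + nat)"

text \<open>The Gram matrix of the normal form, with v the pairing of chains with dual chains and s
  the remaining block. Abstracting from the vectors lets different pairs be compared.\<close>

definition block_gram :: "(nat \<times> nat => nat \<times> nat => 'k) => (nat => nat => 'k) => block_index => block_index => 'k::ring_1" where
 "block_gram v s i j = (case i of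
   Inl a => (case j of Inr (Inl c) => v a c | _ => 0)
  | Inr (Inl c) => (case j of Inl a => - v a c | _ => 0)
  | Inr (Inr p) => (case j of Inr (Inr q) => s p q | _ => 0))"

definition val_A :: "nat \<times> nat => nat \<times> nat => 'k::ring_1" where
 "val_A a c = (if fst a = fst c & snd a = Suc (snd c) then 1 else 0)"

definition val_B :: "nat \<times> nat => nat \<times> nat => 'k::ring_1" where
 "val_B a c = - (if fst a = fst c & snd a = snd c then 1 else 0)"

lemma block_gramI:
 assumes "!!a a'. a : I ==> a' : I ==> G (Inl a) (Inl a') = 0"
  "!!a c. a : I ==> c : K ==> G (Inl a) (Inr (Inl c)) = v a c"
  "!!a c. a : I ==> c : K ==> G (Inr (Inl c)) (Inl a) = - v a c"
  "!!c c'. c : K ==> c' : K ==> G (Inr (Inl c)) (Inr (Inl c')) = 0"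
  "!!a q. a : I ==> q < m ==> G (Inl a) (Inr (Inr q)) = 0 & G (Inr (Inr q)) (Inl a) = 0"
  "!!c q. c : K ==> q < m ==> G (Inr (Inl c)) (Inr (Inr q)) = 0 & G (Inr (Inr q)) (Inr (Inl c)) = 0"
  "!!p q. p < m ==> q < m ==> G (Inr (Inr p)) (Inr (Inr q)) = s p q"
  and ij: "i : I <+> (K <+> {..<m})" "j : I <+> (K <+> {..<m})"
 shows "G i j = block_gram v s i j"
proof (cases i)
 case (Inl a)
 show ?thesis
 proof (cases j)
  case (Inl a')
  thus ?thesis using `i = Inl a` assms(1)[of a a'] ij by (simp add: block_gram_def)
 next
  case (Inr y)
  thus ?thesis using `i = Inl a` assms(2)[of a] assms(5)[of a] ij by (cases y) (simp_all add: block_gram_def)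
 qed
next
 case (Inr x)
 show ?thesis
 proof (cases x)
  case (Inl c)
  show ?thesis
  proof (cases j)
   case (Inl a)
   thus ?thesis using Inr `x = Inl c` assms(3)[of a c] ij by (simp add: block_gram_def)
  next
   case (Inr y)
   thus ?thesis using `i = Inr x` `x = Inl c` assms(4)[of c] assms(6)[of c] ij by (cases y) (simp_all add: block_gram_def)
  qed
 next
  case (Inr p)
  show ?thesis
  proof (cases j)
   case (Inl a)
   thus ?thesis using `i = Inr x` `x = Inr p` assms(5)[of a p] ij by (simp add: block_gram_def)
  next
   case (Inr y)
   thus ?thesis using `i = Inr x` `x = Inr p` assms(6)[of _ p] assms(7)[of p] ij by (cases y) (simp_all add: block_gram_def)
  qed
 qed
qed

context kron_decomp
begin

definition kb_fam :: "block_index => 'b" where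
 "kb_fam = kron_fam bv av sg"

lemma kb_gram:
 assumes C: "C = A & v = val_A \<or> C = B & v = val_B"
  and ij: "i : kidx r n m" "j : kidx r n m"
 shows "C (kb_fam i) (kb_fam j) = block_gram v (%p q. C (sg p) (sg q)) i j"
proof -
 have bC: "alt_bilin C" using C bil_A bil_B by auto
 show ?thesis
 proof (rule block_gramI[OF _ _ _ _ _ _ _ ij, where G = "%i j. C (kb_fam i) (kb_fam j)"], goal_cases)
  case (1 a a')
  thus ?case using C kb_beta_beta[of "fst a" "snd a" "fst a'" "snd a'"] by (auto simp: kb_fam_def case_prod_unfold)
 next
  case (2 a c)
  thus ?case using C kb_beta_alpha[of "fst a" "snd a" "fst c" "snd c"] by (auto simp: kb_fam_def case_prod_unfold val_A_def val_B_def)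
 next
  case (3 a c)
  thus ?case using C kb_beta_alpha[of "fst a" "snd a" "fst c" "snd c"] alt_bilinD(6)[OF bC, of "av (fst c) (snd c)" "bv (fst a) (snd a)"]
   by (auto simp: kb_fam_def case_prod_unfold val_A_def val_B_def)
 next
  case (4 c c')
  thus ?case using C kb_alpha_alpha[of "fst c" "snd c" "fst c'" "snd c'"] by (auto simp: kb_fam_def case_prod_unfold)
 next
  case (5 a q)
  thus ?case using C kb_beta_sigma[of "fst a" "snd a" q] alt_bilin_eq0[OF bC] by (auto simp: kb_fam_def case_prod_unfold)
 next
  case (6 c q)
  thus ?case using C kb_alpha_sigma[of "fst c" "snd c" q] alt_bilin_eq0[OF bC] by (auto simp: kb_fam_def case_prod_unfold)
 qed (simp add: kb_fam_def)
qed

text \<open>\<open>S\<close> is orthogonal to the rest, so the basis of the last block is free; this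
  is where the basis from the classification is inserted.\<close>

lemma replace_sigma:
 assumes e: "basis_on S {..<N} e"
 shows "kron_basis n bv av N e"
proof -
 have eS: "e q : S" if "q < N" for q using basis_onD(2)[OF e] that by simp
 have "basis_on D (kidx r n N) (kron_fam bv av e)"
  unfolding basis_on_def indep_fam_def
 proof (intro conjI ballI allI impI)
  show "finite (kidx r n N)" using finite_idx finite_cidx by simp
  fix i assume "i : kidx r n N"
  thus "kron_fam bv av e i : D"
   using beta_D kb_D(1) eS S_D by (auto simp: subset_iff)
 next
  fix c i assume z: "(SUM i:kidx r n N. c i *s kron_fam bv av e i) = 0"
   and i: "i : kidx r n N"
  have "(SUM q<N. c (Inr (Inr q)) *s e q) : S" using eS by (intro subspace_sum[OF sub_S] subspace_scale[OF sub_S]) auto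
  then obtain d where d: "(SUM q<N. c (Inr (Inr q)) *s e q) = (SUM q<m. d q *s sg q)" using S_cases by blast
  define c' where "c' = case_sum (%p. c (Inl p)) (case_sum (%p. c (Inr (Inl p))) d)"
  have "(SUM i:kidx r n m. c' i *s kron_fam bv av sg i) = 0"
   using z d by (simp add: sum.Plus c'_def)
  note c0 = indep_famD[OF basis_onD(3)[OF kb_basis] this]
  have "c (Inl p) = 0" if "p : idx r n" for p using c0[of "Inl p"] that by (simp add: c'_def)
  moreover have "c (Inr (Inl p)) = 0" if "p : cidx r n" for p using c0[of "Inr (Inl p)"] that by (simp add: c'_def)
  moreover have "c (Inr (Inr q)) = 0" if "q < N" for q
  proof -
   have "d q = 0" if "q < m" for q using c0[of "Inr (Inr q)"] that by (simp add: c'_def)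
   hence "(SUM q<N. c (Inr (Inr q)) *s e q) = 0" unfolding d by simp
   from indep_famD[OF basis_onD(3)[OF e] this, of q] show ?thesis using that by simp
  qed
  ultimately show "c i = 0" using i by (auto elim!: PlusE)
 next
  fix y assume "y : D"
  then obtain u s c where y: "u : U" "s : S" "y = u + (SUM p:cidx r n. c p *s (case p of (l, k) => av l k)) + s"
   using decomp[of y] by blast
  obtain a where a: "u = (SUM p:idx r n. a p *s (case p of (j, i) => bv j i))" using basis_onD(4)[OF basis_U y(1)] by blast
  obtain d where d: "s = (SUM q<N. d q *s e q)" using basis_onD(4)[OF e y(2)] by blast
  show "EX c. y = (SUM i:kidx r n N. c i *s kron_fam bv av e i)"
   by (rule exI[of _ "case_sum a (case_sum c d)"]) (simp add: y(3) a d sum.Plus add.assoc)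
 qed
 moreover have "A (bv j i) (e q) = 0 & B (bv j i) (e q) = 0" if "(j, i) : idx r n" "q < N" for i j q
  using U_S[OF beta_U eS[OF that(2)]] that by auto
 moreover have "A (av j i) (e q) = 0 & B (av j i) (e q) = 0" if "(j, i) : cidx r n" "q < N" for i j q
  using alpha_S[OF that(1) eS[OF that(2)]] by auto
 ultimately show ?thesis using kb_beta_beta kb_beta_alpha kb_alpha_alpha unfolding kron_basis_def by blast
qed

end

context fam_space
begin

text \<open>Besides the transport to \<open>S\<close>, the cyclic generators are permuted: the
  multiset fixes the list of divisors only up to order, and two operators are to be compared along
  the same list.\<close>

lemma lin_iso_elementary:
 assumes E: "vspace E" and S: "subspace S" and i: "lin_iso S pz E"
  and T: "linop T" "!!s. s : S ==> T s : S" and K: "!!s. s : S ==> K (pz s) = pz (T s)"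
  and el: "has_elementary_divisors E K (mset q)"
 shows "EX s. (ALL i<length q. lead_coeff (q ! i) = 1 & s i : S & pact T (q ! i) (s i) = 0) &
  basis_on S {(i, j). i < length q & j < degree (q ! i)} (%(i, j). (T ^^ j) (s i))"
proof -
 interpret E: vectorspace class_ring E by (rule E)
 obtain q' v where q': "mset q = mset q'"
  and qv: "!!i. i < length q' ==> (EX p k. Factorial_Ring.irreducible p & lead_coeff p = 1 & 1 <= k & q' ! i = p ^ k) &
     v i : carrier E & poly_action E K (q' ! i) (v i) = \<zero>\<^bsub>E\<^esub>"
  and bas: "basis_family E {(i, j). i < length q' & j < degree (q' ! i)} (%(i, j). (K ^^ j) (v i))"
  using el unfolding has_elementary_divisors_def by blast
 obtain \<pi> where \<pi>: "\<pi> permutes {..<length q'}" "permute_list \<pi> q' = q" using mset_eq_permutation[OF q'] by blast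
 have len: "length q = length q'" using \<pi>(2) by auto
 have qi: "q ! i = q' ! \<pi> i" if "i < length q" for i using permute_list_nth[OF \<pi>(1), of i] that len unfolding \<pi>(2) by simp
 have \<pi>lt: "\<pi> i < length q'" if "i < length q" for i using permutes_in_image[OF \<pi>(1), of i] that len by simp
 have "ALL i. EX x. i < length q --> x : S & v (\<pi> i) = pz x"
 proof
  fix k
  show "EX x. k < length q --> x : S & v (\<pi> k) = pz x"
   using lin_isoD(5)[OF i, of "v (\<pi> k)"] qv[OF \<pi>lt, of k] by blast
 qed
 from choice[OF this] obtain s where s: "!!i. i < length q ==> s i : S" "!!i. i < length q ==> v (\<pi> i) = pz (s i)" by blast
 have TS: "(T ^^ j) x : S" if "x : S" for j x using funpow_in[of S T] T(2) that by blast
 have KT: "(K ^^ j) (pz x) = pz ((T ^^ j) x)" if "x : S" for j x by (induction j) (simp_all add: K TS that)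
 have "lead_coeff (q ! i) = 1 & s i : S & pact T (q ! i) (s i) = 0" if i': "i < length q" for i
 proof (intro conjI s(1) i')
  show "lead_coeff (q ! i) = 1" using qv[OF \<pi>lt[OF i']] unfolding qi[OF i'] by (auto simp: lead_coeff_power)
  let ?p = "q ! i"
  have "pz (pact T ?p (s i)) = (\<Oplus>\<^bsub>E\<^esub>j\<in>{..degree ?p}. pz (coeff ?p j *s (T ^^ j) (s i)))"
   unfolding pact_def by (rule lin_iso_sum[OF E S i]) (auto intro: subspace_scale[OF S] TS[OF s(1)[OF i']])
  also have "... = (\<Oplus>\<^bsub>E\<^esub>j\<in>{..degree ?p}. coeff ?p j \<odot>\<^bsub>E\<^esub> (K ^^ j) (v (\<pi> i)))"
   unfolding s(2)[OF i'] using lin_isoD(3)[OF i TS[OF s(1)[OF i']]] KT[OF s(1)[OF i']]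
    vspaceD(3)[OF E lin_isoD(1)[OF i TS[OF s(1)[OF i']]]] by (intro E.finsum_cong') auto
  also have "... = pz 0" using qv[OF \<pi>lt[OF i']] unfolding qi[OF i'] poly_action_def lin_iso_zero[OF E S i] by blast
  finally have "pz (pact T ?p (s i)) = pz 0" .
  moreover have "pact T ?p (s i) : S" by (rule pact_in[OF S _ s(1)[OF i']]) (rule T(2))
  ultimately show "pact T ?p (s i) = 0" using lin_isoD(4)[OF i _ subspace_0[OF S]] by blast
 qed
 moreover have "basis_on S {(i, j). i < length q & j < degree (q ! i)} (%(i, j). (T ^^ j) (s i))"
 proof (rule lin_iso_basis_on[OF E S i])
  have "{(i, j). i < length q & j < degree (q ! i)} = (SIGMA i:{..<length q}. {..<degree (q ! i)})" by auto
  thus "finite {(i, j). i < length q & j < degree (q ! i)}" by simp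
  have "bij_betw (%(i, j). (\<pi> i, j)) {(i, j). i < length q & j < degree (q ! i)} {(i, j). i < length q' & j < degree (q' ! i)}"
  proof (rule bij_betwI[of _ _ _ "%(i, j). (inv_into UNIV \<pi> i, j)"])
   have inv: "inv_into UNIV \<pi> permutes {..<length q'}" by (rule permutes_inv[OF \<pi>(1)])
   have lt: "inv_into UNIV \<pi> i < length q" if "i < length q'" for i using permutes_in_image[OF inv, of i] that len by simp
   show "(%(i, j). (inv_into UNIV \<pi> i, j)) : {(i, j). i < length q' & j < degree (q' ! i)} \<rightarrow> {(i, j). i < length q & j < degree (q ! i)}"
    using lt qi permutes_inverses(1)[OF \<pi>(1)] by auto
  qed (use \<pi>lt qi permutes_inverses[OF \<pi>(1)] in auto)
  from basis_family_reindex[OF bas this]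
  show "basis_family E {(i, j). i < length q & j < degree (q ! i)} ((%(i, j). (K ^^ j) (v i)) \<circ> (%(i, j). (\<pi> i, j)))" .
  fix p assume "p : {(i, j). i < length q & j < degree (q ! i)}"
  thus "(%(i, j). (T ^^ j) (s i)) p : S"
   "pz ((%(i, j). (T ^^ j) (s i)) p) = ((%(i, j). (K ^^ j) (v i)) \<circ> (%(i, j). (\<pi> i, j))) p"
   using TS s KT by auto
 qed
 ultimately show ?thesis by blast
qed

text \<open>The block matrix of T in the basis T^j s_i, with rows as images; it depends on the list
  of divisors alone.\<close>

definition companion :: "'a poly list => nat \<times> nat => nat \<times> nat => 'a" where
 "companion q p p' = (if fst p = fst p' then
   (if Suc (snd p) < degree (q ! fst p) then (if snd p' = Suc (snd p) then 1 else 0) else - coeff (q ! fst p) (snd p')) else 0)"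

lemma companion_matrix:
 assumes T: "linop T" and q: "!!i. i < length q ==> lead_coeff (q ! i) = 1 & pact T (q ! i) (s i) = 0"
  and p: "p : {(i, j). i < length q & j < degree (q ! i)}"
 shows "T ((%(i, j). (T ^^ j) (s i)) p) =
  (SUM p':{(i, j). i < length q & j < degree (q ! i)}. companion q p p' *s (%(i, j). (T ^^ j) (s i)) p')"
proof -
 obtain i j where ij: "p = (i, j)" "i < length q" "j < degree (q ! i)" using p by auto
 let ?d = "degree (q ! i)"
 have J: "{(i, j). i < length q & j < degree (q ! i)} = (SIGMA i:{..<length q}. {..<degree (q ! i)})" by auto
 have "(SUM p':{(i, j). i < length q & j < degree (q ! i)}. companion q p p' *s (%(i, j). (T ^^ j) (s i)) p') =
   (SUM i'<length q. SUM j'<degree (q ! i'). companion q p (i', j') *s (T ^^ j') (s i'))"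
  unfolding J by (subst sum.Sigma) (auto intro!: sum.cong)
 also have "... = (SUM i'<length q. if i' = i then (SUM j'<?d. companion q p (i, j') *s (T ^^ j') (s i)) else 0)"
  by (intro sum.cong refl) (auto simp: ij companion_def)
 also have "... = (SUM j'<?d. companion q p (i, j') *s (T ^^ j') (s i))" using ij(2) by simp
 also have "... = (T ^^ Suc j) (s i)"
 proof (cases "Suc j < ?d")
  case True
  hence "(SUM j'<?d. companion q p (i, j') *s (T ^^ j') (s i)) = (SUM j'<?d. if j' = Suc j then (T ^^ Suc j) (s i) else 0)"
   by (intro sum.cong refl) (auto simp: ij companion_def)
  thus ?thesis using True by simp
 next
  case False
  hence d: "?d = Suc j" using ij(3) by simp
  have "(SUM j'<?d. companion q p (i, j') *s (T ^^ j') (s i)) = (SUM j'<?d. (- coeff (q ! i) j') *s (T ^^ j') (s i))"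
   using False by (intro sum.cong refl) (auto simp: ij companion_def)
  thus ?thesis using monic_pact_0[OF T _ d, of "s i"] q[OF ij(2)] unfolding d by simp
 qed
 finally show ?thesis by (simp add: ij)
qed

end

interpretation fp: fam_space_pair "fscale :: 'k::field => ('v => 'k) => 'v => 'k" "fscale :: 'k => ('u => 'k) => 'u => 'k"
 by (rule fam_space_pair.intro) (rule fs.fam_space_axioms)+

lemma (in max_pair_kron) kb_fam_frame: "frame W (kidx r n m) kb_fam"
 using kb_frame unfolding kb_fam_def .

lemma (in max_pair_kron) kb_fam_gram:
 assumes "i : kidx r n m" "j : kidx r n m"
 shows "La (res W (kb_fam i)) (res W (kb_fam j)) = block_gram val_A (%p q. A (sg p) (sg q)) i j"
  "Lb (res W (kb_fam i)) (res W (kb_fam j)) = block_gram val_B (%p q. B (sg p) (sg q)) i j"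
 using LA.bivector_sh LB.bivector_sh frameD(2)[OF kb_fam_frame] assms
  kb_gram[of A val_A, OF _ assms] kb_gram[of B val_B, OF _ assms] by auto

text \<open>Equal elementary divisors give equal matrices, hence equal kernel dimensions of all
  p(T), hence by classification bases of the two complements with equal Gram matrices. The chain
  blocks agree because the lengths n do.\<close>

lemma conclusion_d_unique:
 fixes W :: "('k::field_char_0, 'w) module" and W' :: "('k, 'u) module"
 assumes X: "max_pair_kron W La Lb r A B n bv av m sg" and Y: "max_pair_kron W' La' Lb' r A' B' n bv' av' m' sg'"
  and biv: "bivector W La" "bivector W Lb" "bivector W' La'" "bivector W' Lb'"
  and el: "has_elementary_divisors (symplectic_part W La Lb) (reduced_operator W La Lb) M"
   "has_elementary_divisors (symplectic_part W' La' Lb') (reduced_operator W' La' Lb') M"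
 shows "pair_isomorphic W La Lb W' La' Lb'"
proof -
 interpret X: max_pair_kron W La Lb r A B n bv av m sg by (rule X)
 interpret Y: max_pair_kron W' La' Lb' r A' B' n bv' av' m' sg' by (rule Y)
 obtain q where q: "M = mset q" by (metis ex_mset)
 let ?J = "{(i, j). i < length q & j < degree (q ! i)}"
 have ex1: "EX s. (ALL i<length q. lead_coeff (q ! i) = 1 & s i : X.S & fs.pact X.T (q ! i) (s i) = 0) &
   fs.basis_on X.S ?J (%(i, j). (X.T ^^ j) (s i))"
  by (rule fs.lin_iso_elementary[OF X.E_vspace X.sub_S X.pz_iso X.T_lin _ _ el(1)[unfolded q]])
   (simp_all add: X.T_S X.reduced_operator_pz)
 obtain s where s: "!!i. i < length q ==> lead_coeff (q ! i) = 1 & s i : X.S & fs.pact X.T (q ! i) (s i) = 0"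
  "fs.basis_on X.S ?J (%(i, j). (X.T ^^ j) (s i))"
  using ex1 by blast
 have ex2: "EX s. (ALL i<length q. lead_coeff (q ! i) = 1 & s i : Y.S & fs.pact Y.T (q ! i) (s i) = 0) &
   fs.basis_on Y.S ?J (%(i, j). (Y.T ^^ j) (s i))"
  by (rule fs.lin_iso_elementary[OF Y.E_vspace Y.sub_S Y.pz_iso Y.T_lin _ _ el(2)[unfolded q]])
   (simp_all add: Y.T_S Y.reduced_operator_pz)
 obtain s' where s': "!!i. i < length q ==> lead_coeff (q ! i) = 1 & s' i : Y.S & fs.pact Y.T (q ! i) (s' i) = 0"
  "fs.basis_on Y.S ?J (%(i, j). (Y.T ^^ j) (s' i))"
  using ex2 by blast
 have dim: "fs.dim (fs.pker X.S X.T p) = fs.dim (fs.pker Y.S Y.T p)" for p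
 proof (rule fp.pker_transfer[OF X.fin_S Y.fin_S s(2) s'(2) X.T_lin Y.T_lin])
  show "X.T ((%(i, j). (X.T ^^ j) (s i)) p) = (SUM p':?J. fscale (fs.companion q p p') ((%(i, j). (X.T ^^ j) (s i)) p'))"
   if "p : ?J" for p by (rule fs.companion_matrix[OF X.T_lin _ that]) (use s(1) in blast)
  show "Y.T ((%(i, j). (Y.T ^^ j) (s' i)) p) = (SUM p':?J. fscale (fs.companion q p p') ((%(i, j). (Y.T ^^ j) (s' i)) p'))"
   if "p : ?J" for p by (rule fs.companion_matrix[OF Y.T_lin _ that]) (use s'(1) in blast)
 qed
 obtain N e e' where e: "fs.basis_on X.S {..<N::nat} e" "fs.basis_on Y.S {..<N} e'"
  and g: "!!i j. i < N ==> j < N ==> B (e i) (e j) = B' (e' i) (e' j) & B (X.T (e i)) (e j) = B' (Y.T (e' i)) (e' j)"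
  using fp.sympl_op_classification[OF _ X.sympl_op_T Y.sympl_op_T dim] by auto
 \<comment> \<open>A(e i, e j) = B(T (e i), e j), so the second Gram matrix of the classification is
   the one of \<open>A\<close>.\<close>
 have gA: "A (e i) (e j) = A' (e' i) (e' j)" if ij: "i < N" "j < N" for i j
 proof -
  have "e i : X.S" "e j : X.S" "e' i : Y.S" "e' j : Y.S" using fs.basis_onD(2)[OF e(1)] fs.basis_onD(2)[OF e(2)] ij by auto
  moreover from this have "e j : zfun W" "e' j : zfun W'" using X.S_D Y.S_D by blast+
  ultimately show ?thesis using g[OF ij] X.T_eq[of "e i" "e j"] Y.T_eq[of "e' i" "e' j"] by simp
 qed
 interpret X': max_pair_kron W La Lb r A B n bv av N e
  by (intro max_pair_kron.intro kron_decomp.intro kron_decomp_axioms.intro X.max_pair_axioms X.kron_family_axioms X.replace_sigma e)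
 interpret Y': max_pair_kron W' La' Lb' r A' B' n bv' av' N e'
  by (intro max_pair_kron.intro kron_decomp.intro kron_decomp_axioms.intro Y.max_pair_axioms Y.kron_family_axioms Y.replace_sigma e)
 have cong: "block_gram v t i j = block_gram v t' i j"
  if "i : kidx r n N" "j : kidx r n N" "!!p q. p < N ==> q < N ==> t p q = t' p q"
  for v :: "nat \<times> nat => nat \<times> nat => 'k" and t t' i j
  using that by (auto simp: block_gram_def split: sum.splits)
 show ?thesis
 proof (rule gram_isomorphic[OF X.vs Y.vs X'.kb_fam_frame Y'.kb_fam_frame biv])
  fix i j assume ij: "i : kidx r n N" "j : kidx r n N"
  show "La (res W (X'.kb_fam i)) (res W (X'.kb_fam j)) = La' (res W' (Y'.kb_fam i)) (res W' (Y'.kb_fam j))"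
   unfolding X'.kb_fam_gram(1)[OF ij] Y'.kb_fam_gram(1)[OF ij] by (rule cong[OF ij gA])
  show "Lb (res W (X'.kb_fam i)) (res W (X'.kb_fam j)) = Lb' (res W' (Y'.kb_fam i)) (res W' (Y'.kb_fam j))"
   unfolding X'.kb_fam_gram(2)[OF ij] Y'.kb_fam_gram(2)[OF ij] by (rule cong[OF ij]) (use g in blast)
 qed
qed

section \<open>The decomposition into a symplectic and Kronecker factors\<close>

lemma frame_reindex:
 assumes V: "vspace V" and f: "frame V I f" and g: "bij_betw g J I"
 shows "frame V J (f \<circ> g)"
 by (rule basis_on_frame[OF V f fs.basis_on_reindex[OF frame_basis_on[OF V f] g]])

context max_pair_kron
begin

text \<open>Identifies \<open>S\<close> with the dual of the symplectic part, so that the dual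
  bivectors of the two reduced forms become \<open>A\<close> and \<open>B\<close>.\<close>

definition ph :: "('w => 'k) => 'w set => 'k" where
 "ph s = flat SP (reduced_form W La) (pz s)"

lemma ph_functional: "s : S ==> ph s : functionals SP"
 unfolding ph_def using reduced_symplectic(1) fs.lin_isoD(1)[OF pz_iso]
 by (intro flat_functional[OF E_vspace]) (auto simp: symplectic_form_def)

lemma ph_eval: "s : S ==> t : S ==> ph s (pz t) = A s t"
 using reduced_pz(1) fs.lin_isoD(1)[OF pz_iso] by (simp add: ph_def flat_def)

lemma E_has_frame: "EX h. frame SP {..<m} h"
 using fs.lin_iso_frame[OF E_vspace sub_S pz_iso basis_S] by blast

text \<open>For the first form this is the description of the dual bivector on flats. For the
  second, the flat of \<open>pz x\<close> is \<open>ph (T x)\<close>, and as T is onto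
  \<open>S\<close> every pair of arguments arises so: B(T x, T y) is the value required.\<close>

lemma dual_bivector_ph:
 assumes s: "s : S" "t : S"
 shows "dual_bivector SP (reduced_form W La) (ph s) (ph t) = A s t"
  "dual_bivector SP (reduced_form W Lb) (ph s) (ph t) = B s t"
proof -
 obtain h where h: "frame SP {..<m} h" using E_has_frame by blast
 note cE = fs.lin_isoD(1)[OF pz_iso]
 show "dual_bivector SP (reduced_form W La) (ph s) (ph t) = A s t"
  unfolding ph_def dual_bivector_props(2)[OF E_vspace h reduced_symplectic(1) cE[OF s(1)] cE[OF s(2)]] by (rule reduced_pz(1)[OF s])
 have fl: "ph (T x) = flat SP (reduced_form W Lb) (pz x)" if x: "x : S" for x
 proof -
  have "reduced_form W La (pz (T x)) v = reduced_form W Lb (pz x) v" if v: "v : carrier SP" for v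
  proof -
   obtain y where y: "y : S" "v = pz y" using fs.lin_isoD(5)[OF pz_iso v] by blast
   show ?thesis unfolding y(2) reduced_pz(1)[OF T_S[OF x] y(1)] reduced_pz(2)[OF x y(1)] using B_TT[OF x y(1)] by simp
  qed
  thus ?thesis unfolding ph_def flat_def by (rule restrict_ext)
 qed
 obtain x y where xy: "x : S" "T x = s" "y : S" "T y = t" using T_surj s by metis
 show "dual_bivector SP (reduced_form W Lb) (ph s) (ph t) = B s t"
  unfolding xy(2,4)[symmetric] fl[OF xy(1)] fl[OF xy(3)]
   dual_bivector_props(2)[OF E_vspace h reduced_symplectic(2) cE[OF xy(1)] cE[OF xy(3)]] by (rule reduced_pz(2)[OF xy(1,3)])
qed

text \<open>\<open>A\<close> is nondegenerate on \<open>S\<close>: this gives separation of points,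
  and solvability for prescribed values.\<close>

lemma symplectic_part_frame: "frame SP {..<m} (%q. zx SP (ph (sg q)))"
 unfolding frame_def
proof (intro conjI ballI allI impI)
 fix q assume "q : {..<m}"
 thus "zx SP (ph (sg q)) : zfun SP"
  using ph_functional[OF sigma_S] by (intro zx_zfun[OF E_vspace]) auto
next
 fix x y assume xy: "x : carrier SP" "y : carrier SP"
  "ALL q:{..<m}. zx SP (ph (sg q)) x = zx SP (ph (sg q)) y"
 obtain s t where st: "s : S" "x = pz s" "t : S" "y = pz t" using fs.lin_isoD(5)[OF pz_iso] xy(1,2) by meson
 have "A (sg q) s = A (sg q) t" if "q < m" for q
  using xy(3)[rule_format, of q] xy(1,2) that ph_eval[OF sigma_S[OF that]] st by (simp add: zx_apply)
 hence q0: "A (s - t) (sg q) = 0" if "q < m" for q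
  using that A_swap[of "s - t" "sg q"] by (simp add: fs.alt_bilinD(12)[OF bil_A])
 have "A (s - t) y = 0" if "y : S" for y
 proof -
  obtain c where "y = (SUM q<m. fscale (c q) (sg q))" using S_cases[OF `y : S`] by blast
  thus ?thesis using q0 by (simp add: fs.alt_bilin_sum(2)[OF bil_A])
 qed
 hence "s - t = 0" using nondeg_S[of A] fs.subspace_diff[OF sub_S st(1,3)] unfolding fs.nondeg_on_def by blast
 thus "x = y" using st by simp
next
 fix c
 obtain w where w: "fs.linfun w" "!!q. q : {..<m} ==> w (sg q) = - c q"
  using fs.linfun_extend[OF finite_lessThan fs.basis_onD(3)[OF basis_S], of "%q. - c q"] by blast
 obtain s where s: "s : S" "ALL y:S. w y = A s y" using solve_S[OF disjI1[OF refl] w(1)] by blast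
 have "zx SP (ph (sg q)) (pz s) = c q" if "q < m" for q
  using ph_eval[OF sigma_S[OF that] s(1)] fs.lin_isoD(1)[OF pz_iso s(1)] s(2) w(2)[of q] sigma_S[OF that] that A_swap[of "sg q" s]
  by (simp add: zx_apply)
 thus "EX x:carrier SP. ALL q:{..<m}. zx SP (ph (sg q)) x = c q"
  using fs.lin_isoD(1)[OF pz_iso s(1)] by (intro bexI[of _ "pz s"]) auto
qed simp

text \<open>The product has a coordinate system with the same block Gram matrices as the normal form
  of the given pair, whatever nonzero distinct scalars each factor uses.\<close>

lemma conclusion_d_decomposition:
 assumes biv: "bivector W La" "bivector W Lb"
  and b: "ALL l:{1..r}. inj_on (b l) {1..n l} & (ALL j:{1..n l}. b l j ~= 0)"
 shows "pair_isomorphic W La Lb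
   (direct_sum SP (product_space {1..r} (%l. kron_space (n l))))
   (direct_sum_bivector SP (dual_bivector SP (reduced_form W La))
    (product_space {1..r} (%l. kron_space (n l))) (product_bivector {1..r} (%l. kron_space (n l)) (%l. kron_bivector (n l) (%_. 1))))
   (direct_sum_bivector SP (dual_bivector SP (reduced_form W Lb))
    (product_space {1..r} (%l. kron_space (n l))) (product_bivector {1..r} (%l. kron_space (n l)) (%l. kron_bivector (n l) (b l))))"
proof -
 define E where "E = SP"
 define KS :: "nat => ('k, 'k vec set) module" where "KS l = kron_space (n l)" for l
 define PS where "PS = product_space {1..r} KS"
 define DS where "DS = direct_sum E PS"
 have "ALL l. EX bt al. l : {1..r} --> kron_frame (n l) (b l) bt al"
  using kron_frame_exists b by blast
 then obtain bm am where Pk: "!!l. l : {1..r} ==> kron_frame (n l) (b l) (bm l) (am l)" by metis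
 have kV: "vspace (KS l)" and kF: "frame (KS l) ({1..n l} <+> {1..<n l}) (case_sum (bm l) (am l))"
  and k1: "bivector (KS l) (kron_bivector (n l) (%_. 1))" and kb: "bivector (KS l) (kron_bivector (n l) (b l))" if "l : {1..r}" for l
  using Pk[OF that] unfolding kron_frame_def KS_def by blast+
 have BB: "kron_bivector (n l) (%_. 1) (res (KS l) (bm l i)) (res (KS l) (bm l k)) = 0 & kron_bivector (n l) (b l) (res (KS l) (bm l i)) (res (KS l) (bm l k)) = 0"
  if "l : {1..r}" "i : {1..n l}" "k : {1..n l}" for l i k using Pk[OF that(1)] that unfolding kron_frame_def KS_def by blast
 have AA: "kron_bivector (n l) (%_. 1) (res (KS l) (am l i)) (res (KS l) (am l k)) = 0 & kron_bivector (n l) (b l) (res (KS l) (am l i)) (res (KS l) (am l k)) = 0"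
  if "l : {1..r}" "i : {1..<n l}" "k : {1..<n l}" for l i k using Pk[OF that(1)] that unfolding kron_frame_def KS_def by blast
 have BA: "kron_bivector (n l) (%_. 1) (res (KS l) (bm l i)) (res (KS l) (am l k)) = val_A (l, i) (l, k) &
   kron_bivector (n l) (b l) (res (KS l) (bm l i)) (res (KS l) (am l k)) = val_B (l, i) (l, k)"
  if "l : {1..r}" "i : {1..n l}" "k : {1..<n l}" for l i k
  using Pk[OF that(1)] that unfolding kron_frame_def KS_def by (simp add: val_A_def val_B_def)
 have bmV: "bm l i : zfun (KS l)" if "l : {1..r}" "i : {1..n l}" for l i using frameD(2)[OF kF[OF that(1)], of "Inl i"] that by simp
 have amV: "am l i : zfun (KS l)" if "l : {1..r}" "i : {1..<n l}" for l i using frameD(2)[OF kF[OF that(1)], of "Inr i"] that by simp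
 have Ev: "vspace E" unfolding E_def by (rule E_vspace)
 have Ef: "frame E {..<m} (%q. zx E (ph (sg q)))" unfolding E_def by (rule symplectic_part_frame)
 have PSv: "vspace PS" unfolding PS_def by (rule product_vspace[OF _ kV kF]) auto
 have PSf: "frame PS (SIGMA l:{1..r}. {1..n l} <+> {1..<n l}) (%(l, j). cmp {1..r} KS l (case_sum (bm l) (am l) j))"
  unfolding PS_def by (rule product_frame[OF _ kV kF]) auto
 have DSv: "vspace DS" unfolding DS_def by (rule direct_sum_is_vs[OF Ev PSv])
 have DSf: "frame DS ({..<m} <+> (SIGMA l:{1..r}. {1..n l} <+> {1..<n l}))
   (case_sum (%q. lft E PS (zx E (ph (sg q)))) (%p. rgt E PS (case p of (l, j) => cmp {1..r} KS l (case_sum (bm l) (am l) j))))"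
  unfolding DS_def by (rule direct_sum_frame[OF Ev PSv Ef PSf])
 \<comment> \<open>Relabelling: the normal form is sorted by type of covector, the product by
   factor.\<close>
 define g :: "block_index => nat + nat \<times> (nat + nat)" where
  "g = case_sum (%(l, i). Inr (l, Inl i)) (case_sum (%(l, k). Inr (l, Inr k)) Inl)"
 define g' :: "nat + nat \<times> (nat + nat) => block_index" where
  "g' = case_sum (%q. Inr (Inr q)) (%(l, j). case j of Inl i => Inl (l, i) | Inr k => Inr (Inl (l, k)))"
 let ?I = "kidx r n m"
 have "bij_betw g ?I ({..<m} <+> (SIGMA l:{1..r}. {1..n l} <+> {1..<n l}))"
  by (rule bij_betwI[of _ _ _ g']) (auto simp: g_def g'_def split: sum.splits)
 note Tf = frame_reindex[OF DSv DSf this]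
 define Tt where "Tt = case_sum (%q. lft E PS (zx E (ph (sg q)))) (%p. rgt E PS (case p of (l, j) => cmp {1..r} KS l (case_sum (bm l) (am l) j))) \<circ> g"
 have Tt: "Tt (Inl (l, i)) = rgt E PS (cmp {1..r} KS l (bm l i))" "Tt (Inr (Inl (l, k))) = rgt E PS (cmp {1..r} KS l (am l k))"
  "Tt (Inr (Inr q)) = lft E PS (zx E (ph (sg q)))" for l i k q by (simp_all add: Tt_def g_def)
 \<comment> \<open>One computation for both bivectors; the bivectors D and KB, the pairing v and the
   block s are specialised afterwards.\<close>
 have gen: "direct_sum_bivector E D PS (product_bivector {1..r} KS KB) (res DS (Tt i)) (res DS (Tt j)) = block_gram v s i j"
  "bivector DS (direct_sum_bivector E D PS (product_bivector {1..r} KS KB))"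
  if D: "bivector E D" and KB: "!!l. l : {1..r} ==> bivector (KS l) (KB l)"
   and Ds: "!!p q. p < m ==> q < m ==> D (ph (sg p)) (ph (sg q)) = s p q"
   and BB: "!!l i k. l : {1..r} ==> i : {1..n l} ==> k : {1..n l} ==> KB l (res (KS l) (bm l i)) (res (KS l) (bm l k)) = 0"
   and AA: "!!l i k. l : {1..r} ==> i : {1..<n l} ==> k : {1..<n l} ==> KB l (res (KS l) (am l i)) (res (KS l) (am l k)) = 0"
   and BA: "!!l i k. l : {1..r} ==> i : {1..n l} ==> k : {1..<n l} ==> KB l (res (KS l) (bm l i)) (res (KS l) (am l k)) = v (l, i) (l, k)"
   and v: "!!a c. fst a ~= fst c ==> v a c = 0"
   and ij: "i : ?I" "j : ?I"
  for D KB s v i j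
 proof -
  let ?P = "product_bivector {1..r} KS KB"
  have bP: "bivector PS ?P" unfolding PS_def by (rule product_gram(1)[OF _ kV kF KB]) auto
  have pg: "?P (res PS (cmp {1..r} KS l h)) (res PS (cmp {1..r} KS l' h')) = (if l = l' then KB l (res (KS l) h) (res (KS l) h') else 0)"
   if "l : {1..r}" "l' : {1..r}" "h : zfun (KS l)" "h' : zfun (KS l')" for l l' h h'
   unfolding PS_def by (rule product_gram(2)[OF _ kV kF KB that]) auto
  have pz: "cmp {1..r} KS l h : zfun PS" if "l : {1..r}" "h : zfun (KS l)" for l h
   unfolding PS_def by (rule cmp_zfun[where J = "%l. {1..n l} <+> {1..<n l}" and f = "%l. case_sum (bm l) (am l)", OF _ kV kF that]) auto
  note dg = direct_sum_gram[OF Ev PSv D bP, folded DS_def]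
  have ez: "zx E (ph (sg q)) : zfun E" if "q < m" for q using frameD(2)[OF Ef, of q] that by simp
  have er: "res E (zx E (ph (sg q))) = ph (sg q)" if "q < m" for q
   unfolding E_def by (rule res_zx[OF ph_functional[OF sigma_S[OF that]]])
  have AB: "KB l (res (KS l) (am l k)) (res (KS l) (bm l i)) = - v (l, i) (l, k)" if "l : {1..r}" "i : {1..n l}" "k : {1..<n l}" for l i k
   using alternating_form_swap[OF dual_vspace[OF kV[OF that(1)]] KB[OF that(1), unfolded bivector_def]
     res_functional[OF kV[OF that(1)] amV[OF that(1,3)]] res_functional[OF kV[OF that(1)] bmV[OF that(1,2)]]] BA[OF that] by simp
  show "bivector DS (direct_sum_bivector E D PS ?P)" by (rule dg(1))
  show "direct_sum_bivector E D PS ?P (res DS (Tt i)) (res DS (Tt j)) = block_gram v s i j"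
  proof (rule block_gramI[OF _ _ _ _ _ _ _ ij, where G = "%i j. direct_sum_bivector E D PS ?P (res DS (Tt i)) (res DS (Tt j))"], goal_cases)
   case (1 a a')
   obtain l i l' i' where a: "a = (l, i)" "a' = (l', i')" "l : {1..r}" "i : {1..n l}" "l' : {1..r}" "i' : {1..n l'}" using 1 by auto
   show ?case unfolding a Tt dg(5)[OF pz[OF a(3) bmV[OF a(3,4)]] pz[OF a(5) bmV[OF a(5,6)]]] pg[OF a(3,5) bmV[OF a(3,4)] bmV[OF a(5,6)]]
    using BB a by auto
  next
   case (2 a c)
   obtain l i l' k where a: "a = (l, i)" "c = (l', k)" "l : {1..r}" "i : {1..n l}" "l' : {1..r}" "k : {1..<n l'}" using 2 by auto
   show ?case unfolding a Tt dg(5)[OF pz[OF a(3) bmV[OF a(3,4)]] pz[OF a(5) amV[OF a(5,6)]]] pg[OF a(3,5) bmV[OF a(3,4)] amV[OF a(5,6)]]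
    using BA[OF a(3,4), of k] a(6) v[of "(l, i)" "(l', k)"] by auto
  next
   case (3 a c)
   obtain l i l' k where a: "a = (l, i)" "c = (l', k)" "l : {1..r}" "i : {1..n l}" "l' : {1..r}" "k : {1..<n l'}" using 3 by auto
   show ?case unfolding a Tt dg(5)[OF pz[OF a(5) amV[OF a(5,6)]] pz[OF a(3) bmV[OF a(3,4)]]] pg[OF a(5,3) amV[OF a(5,6)] bmV[OF a(3,4)]]
    using AB[OF a(3,4), of k] a(6) v[of "(l, i)" "(l', k)"] by auto
  next
   case (4 c c')
   obtain l i l' i' where a: "c = (l, i)" "c' = (l', i')" "l : {1..r}" "i : {1..<n l}" "l' : {1..r}" "i' : {1..<n l'}" using 4 by auto
   show ?case unfolding a Tt dg(5)[OF pz[OF a(3) amV[OF a(3,4)]] pz[OF a(5) amV[OF a(5,6)]]] pg[OF a(3,5) amV[OF a(3,4)] amV[OF a(5,6)]]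
    using AA a by auto
  next
   case (5 a q)
   obtain l i where a: "a = (l, i)" "l : {1..r}" "i : {1..n l}" using 5 by auto
   show ?case unfolding a Tt using dg(3,4)[OF ez[OF 5(2)] pz[OF a(2) bmV[OF a(2,3)]]] by simp
  next
   case (6 c q)
   obtain l i where a: "c = (l, i)" "l : {1..r}" "i : {1..<n l}" using 6 by auto
   show ?case unfolding a Tt using dg(3,4)[OF ez[OF 6(2)] pz[OF a(2) amV[OF a(2,3)]]] by simp
  next
   case (7 p q)
   show ?case unfolding Tt dg(2)[OF ez[OF 7(1)] ez[OF 7(2)]] er[OF 7(1)] er[OF 7(2)] by (rule Ds[OF 7])
  qed
 qed
 obtain h where h: "frame E {..<m} h" using Ef by blast
 have bD: "bivector E (dual_bivector E (reduced_form W La))" "bivector E (dual_bivector E (reduced_form W Lb))"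
  using dual_bivector_props(1)[OF Ev h] reduced_symplectic unfolding E_def by blast+
 have dD: "dual_bivector E (reduced_form W La) (ph (sg p)) (ph (sg q)) = A (sg p) (sg q)"
  "dual_bivector E (reduced_form W Lb) (ph (sg p)) (ph (sg q)) = B (sg p) (sg q)" if "p < m" "q < m" for p q
  unfolding E_def using dual_bivector_ph[OF sigma_S[OF that(1)] sigma_S[OF that(2)]] by auto
 have gA: "direct_sum_bivector E (dual_bivector E (reduced_form W La)) PS (product_bivector {1..r} KS (%l. kron_bivector (n l) (%_. 1)))
    (res DS (Tt i)) (res DS (Tt j)) = block_gram val_A (%p q. A (sg p) (sg q)) i j" if ij: "i : ?I" "j : ?I" for i j
 proof (rule gen(1)[OF bD(1) _ dD(1) _ _ _ _ ij])
  show "bivector (KS l) (kron_bivector (n l) (%_. 1))" if "l : {1..r}" for l by (rule k1[OF that])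
 qed (simp_all add: BB AA BA val_A_def)
 have gB: "direct_sum_bivector E (dual_bivector E (reduced_form W Lb)) PS (product_bivector {1..r} KS (%l. kron_bivector (n l) (b l)))
    (res DS (Tt i)) (res DS (Tt j)) = block_gram val_B (%p q. B (sg p) (sg q)) i j" if ij: "i : ?I" "j : ?I" for i j
 proof (rule gen(1)[OF bD(2) _ dD(2) _ _ _ _ ij])
  show "bivector (KS l) (kron_bivector (n l) (b l))" if "l : {1..r}" for l by (rule kb[OF that])
 qed (simp_all add: BB AA BA val_B_def)
 have "pair_isomorphic W La Lb DS
   (direct_sum_bivector E (dual_bivector E (reduced_form W La)) PS (product_bivector {1..r} KS (%l. kron_bivector (n l) (%_. 1))))
   (direct_sum_bivector E (dual_bivector E (reduced_form W Lb)) PS (product_bivector {1..r} KS (%l. kron_bivector (n l) (b l))))"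
 proof (rule gram_isomorphic[OF vs DSv kb_fam_frame Tf[folded Tt_def] biv])
  have bP: "bivector PS (product_bivector {1..r} KS (%l. kron_bivector (n l) (%_. 1)))"
   "bivector PS (product_bivector {1..r} KS (%l. kron_bivector (n l) (b l)))"
   unfolding PS_def by (rule product_gram(1)[OF _ kV kF k1], simp_all) (rule product_gram(1)[OF _ kV kF kb], simp_all)
  show "bivector DS (direct_sum_bivector E (dual_bivector E (reduced_form W La)) PS (product_bivector {1..r} KS (%l. kron_bivector (n l) (%_. 1))))"
   "bivector DS (direct_sum_bivector E (dual_bivector E (reduced_form W Lb)) PS (product_bivector {1..r} KS (%l. kron_bivector (n l) (b l))))"
   unfolding DS_def using direct_sum_gram(1)[OF Ev PSv bD(1) bP(1)] direct_sum_gram(1)[OF Ev PSv bD(2) bP(2)] .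
 qed (simp_all only: kb_fam_gram gA gB)
 thus ?thesis unfolding DS_def PS_def KS_def E_def .
qed

end

section \<open>Normal forms with prescribed characteristic numbers and the proof of all
  parts\<close>

lemma (in max_pair) max_pair_kron_exists:
 assumes "alt_pencil.kfam fscale (zfun W) A B r n bv"
 shows "EX av m sg. max_pair_kron W La Lb r A B n bv av m sg"
proof -
 interpret K: kron_family fscale "zfun W" A B r n bv
  by (rule kron_family.intro[OF alt_pencil kron_family_axioms.intro[OF assms]])
 obtain av m sg where "K.kron_basis n bv av m sg" using K.kron_basis_exists by blast
 hence "kron_decomp fscale (zfun W) A B r n bv av m sg"
  by (intro kron_decomp.intro K.kron_family_axioms kron_decomp_axioms.intro)
 thus ?thesis using max_pair_kron.intro[OF max_pair_axioms] by blast
qed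

lemma max_pair_exists:
 assumes "vspace W" "vfin_dim W" "bivector W La" "bivector W Lb" "maximal_pair W La Lb" "r = pair_corank W La Lb"
 shows "EX A B n bv av m sg. max_pair W La Lb r A B & max_pair_kron W La Lb r A B n bv av m sg"
proof -
 obtain A B where "represents W La A" "represents W Lb B" using bivector_represented assms by blast
 hence M: "max_pair W La Lb r A B" using assms by (intro max_pair.intro)
 obtain n bv where "alt_pencil.kfam fscale (zfun W) A B r n bv"
  using alt_pencil.kfam_exists[OF max_pair.alt_pencil[OF M]] by blast
 thus ?thesis using max_pair.max_pair_kron_exists[OF M] M by blast
qed

text \<open>A first normal form with some chain lengths gives access to the quotient by
  \<open>L0\<close>; the given presentation of the web then yields chains of exactly the lengths n,
  and a second normal form.\<close>

lemma max_pair_char_numbers: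
 assumes "vspace W" "vfin_dim W" "bivector W La" "bivector W Lb" "maximal_pair W La Lb" and n: "pair_char_numbers W La Lb r n"
 shows "EX A B bv av m sg. max_pair_kron W La Lb r A B n bv av m sg"
proof -
 have r: "r = pair_corank W La Lb" using n by (simp add: pair_char_numbers_def)
 obtain A B n' bv' av m sg where M: "max_pair W La Lb r A B" and X: "max_pair_kron W La Lb r A B n' bv' av m sg"
  using max_pair_exists[OF assms(1-5) r] by blast
 obtain bv where "alt_pencil.kfam fscale (zfun W) A B r n bv" using max_pair_kron.char_numbers_kfam[OF X n] by blast
 thus ?thesis using max_pair.max_pair_kron_exists[OF M] by blast
qed

theorem proposition1p4:
  fixes W :: "('k::real_or_complex, 'w) module"
    and \<Lambda> \<Lambda>\<^sub>1 :: "('k, 'w) bivec"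
    and r :: nat
  assumes "vspace W" and "vfin_dim W"
    and "bivector W \<Lambda>" and "bivector W \<Lambda>\<^sub>1"
    and "maximal_pair W \<Lambda> \<Lambda>\<^sub>1"
    and "r = pair_corank W \<Lambda> \<Lambda>\<^sub>1"
  shows
    \<comment> \<open>(a)\<close>
    "(L0 W \<Lambda> \<Lambda>\<^sub>1 \<subseteq> bivector_image W \<Lambda>\<^sub>1 \<and>
      sharp W \<Lambda> ` annihilator W (L0 W \<Lambda> \<Lambda>\<^sub>1) = sharp W \<Lambda>\<^sub>1 ` annihilator W (L0 W \<Lambda> \<Lambda>\<^sub>1)) \<and>
     \<comment> \<open>(b)\<close>
     (L0 W \<Lambda> \<Lambda>\<^sub>1 \<subseteq> bivector_image W \<Lambda> \<inter> bivector_image W \<Lambda>\<^sub>1 \<and>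
      form_kernel (on_subspace W (L0 W \<Lambda> \<Lambda>\<^sub>1)) (associated_form W \<Lambda>) = L1 W \<Lambda> \<Lambda>\<^sub>1 \<and>
      form_kernel (on_subspace W (L0 W \<Lambda> \<Lambda>\<^sub>1)) (associated_form W \<Lambda>\<^sub>1) = L1 W \<Lambda> \<Lambda>\<^sub>1 \<and>
      symplectic_form (symplectic_part W \<Lambda> \<Lambda>\<^sub>1) (reduced_form W \<Lambda>) \<and>
      symplectic_form (symplectic_part W \<Lambda> \<Lambda>\<^sub>1) (reduced_form W \<Lambda>\<^sub>1)) \<and>
     \<comment> \<open>(c)\<close>
     (1 \<le> r \<longrightarrow> veronese_web (kronecker_part W \<Lambda> \<Lambda>\<^sub>1) r (pair_web W \<Lambda> \<Lambda>\<^sub>1)) \<and>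
     \<comment> \<open>(d), the invariants determine the pair up to isomorphism\<close>
     (\<forall>(W' :: ('k, 'v) module) \<Lambda>' \<Lambda>\<^sub>1' M n.
        vspace W' \<and> vfin_dim W' \<and> bivector W' \<Lambda>' \<and> bivector W' \<Lambda>\<^sub>1' \<and> maximal_pair W' \<Lambda>' \<Lambda>\<^sub>1' \<and>
        pair_char_numbers W \<Lambda> \<Lambda>\<^sub>1 r n \<and> pair_char_numbers W' \<Lambda>' \<Lambda>\<^sub>1' r n \<and>
        has_elementary_divisors (symplectic_part W \<Lambda> \<Lambda>\<^sub>1) (reduced_operator W \<Lambda> \<Lambda>\<^sub>1) M \<and>
        has_elementary_divisors (symplectic_part W' \<Lambda>' \<Lambda>\<^sub>1') (reduced_operator W' \<Lambda>' \<Lambda>\<^sub>1') M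
        \<longrightarrow> pair_isomorphic W \<Lambda> \<Lambda>\<^sub>1 W' \<Lambda>' \<Lambda>\<^sub>1') \<and>
     \<comment> \<open>(d), the decomposition\<close>
     (\<forall>n (b :: nat \<Rightarrow> nat \<Rightarrow> 'k).
        pair_char_numbers W \<Lambda> \<Lambda>\<^sub>1 r n \<and>
        (\<forall>l\<in>{1..r}. inj_on (b l) {1..n l} \<and> (\<forall>j\<in>{1..n l}. b l j \<noteq> 0))
        \<longrightarrow> pair_isomorphic W \<Lambda> \<Lambda>\<^sub>1
              (direct_sum (symplectic_part W \<Lambda> \<Lambda>\<^sub>1)
                 (product_space {1..r} (\<lambda>l. kron_space (n l))))
              (direct_sum_bivector
                 (symplectic_part W \<Lambda> \<Lambda>\<^sub>1)
                 (dual_bivector (symplectic_part W \<Lambda> \<Lambda>\<^sub>1) (reduced_form W \<Lambda>))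
                 (product_space {1..r} (\<lambda>l. kron_space (n l)))
                 (product_bivector {1..r} (\<lambda>l. kron_space (n l))
                    (\<lambda>l. kron_bivector (n l) (\<lambda>_. 1))))
              (direct_sum_bivector
                 (symplectic_part W \<Lambda> \<Lambda>\<^sub>1)
                 (dual_bivector (symplectic_part W \<Lambda> \<Lambda>\<^sub>1) (reduced_form W \<Lambda>\<^sub>1))
                 (product_space {1..r} (\<lambda>l. kron_space (n l)))
                 (product_bivector {1..r} (\<lambda>l. kron_space (n l))
                    (\<lambda>l. kron_bivector (n l) (b l))))) \<and>
     \<comment> \<open>(e)\<close>
     (\<forall>a. corank W (pencil \<Lambda> \<Lambda>\<^sub>1 a) > r \<longleftrightarrow>
        poly (endo_char_poly (symplectic_part W \<Lambda> \<Lambda>\<^sub>1) (reduced_operator W \<Lambda> \<Lambda>\<^sub>1)) (- a) = 0)"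
proof -
 obtain A B n \<beta> \<alpha> m \<sigma> where "max_pair_kron W \<Lambda> \<Lambda>\<^sub>1 r A B n \<beta> \<alpha> m \<sigma>"
  using max_pair_exists[OF assms] by blast
 then interpret X: max_pair_kron W \<Lambda> \<Lambda>\<^sub>1 r A B n \<beta> \<alpha> m \<sigma> .
 have b: "form_kernel (on_subspace W (L0 W \<Lambda> \<Lambda>\<^sub>1)) (associated_form W \<Lambda>) = L1 W \<Lambda> \<Lambda>\<^sub>1"
  "form_kernel (on_subspace W (L0 W \<Lambda> \<Lambda>\<^sub>1)) (associated_form W \<Lambda>\<^sub>1) = L1 W \<Lambda> \<Lambda>\<^sub>1"
  using X.form_kernel_L0[of \<Lambda> A] X.form_kernel_L0[of \<Lambda>\<^sub>1 B] by (simp_all add: X.side_def)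
 show ?thesis
 proof (intro conjI allI impI X.conclusion_a X.reduced_symplectic b X.conclusion_e Int_greatest; (elim conjE)?)
  fix W' :: "('k, 'v) module" and \<Lambda>' \<Lambda>\<^sub>1' M n
  assume W': "vspace W'" "vfin_dim W'" "bivector W' \<Lambda>'" "bivector W' \<Lambda>\<^sub>1'" "maximal_pair W' \<Lambda>' \<Lambda>\<^sub>1'"
   and n: "pair_char_numbers W \<Lambda> \<Lambda>\<^sub>1 r n" and n': "pair_char_numbers W' \<Lambda>' \<Lambda>\<^sub>1' r n"
   and el: "has_elementary_divisors (symplectic_part W \<Lambda> \<Lambda>\<^sub>1) (reduced_operator W \<Lambda> \<Lambda>\<^sub>1) M"
    "has_elementary_divisors (symplectic_part W' \<Lambda>' \<Lambda>\<^sub>1') (reduced_operator W' \<Lambda>' \<Lambda>\<^sub>1') M"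
  \<comment> \<open>The interpretation X has its own chain lengths; both pairs are put anew into
    normal form with the common numbers n.\<close>
  obtain A B \<beta> \<alpha> m \<sigma> where X: "max_pair_kron W \<Lambda> \<Lambda>\<^sub>1 r A B n \<beta> \<alpha> m \<sigma>"
   using max_pair_char_numbers[OF assms(1-5) n] by blast
  obtain A' B' \<beta>' \<alpha>' m' \<sigma>' where Y: "max_pair_kron W' \<Lambda>' \<Lambda>\<^sub>1' r A' B' n \<beta>' \<alpha>' m' \<sigma>'"
   using max_pair_char_numbers[OF W' n'] by blast
  show "pair_isomorphic W \<Lambda> \<Lambda>\<^sub>1 W' \<Lambda>' \<Lambda>\<^sub>1'"
   by (rule conclusion_d_unique[OF X Y assms(3,4) W'(3,4) el])
 next
  assume "1 <= r"
  thus "veronese_web (kronecker_part W \<Lambda> \<Lambda>\<^sub>1) r (pair_web W \<Lambda> \<Lambda>\<^sub>1)"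
   unfolding veronese_web_def using X.conclusion_c by blast
 next
  fix n and b :: "nat => nat => 'k"
  assume n: "pair_char_numbers W \<Lambda> \<Lambda>\<^sub>1 r n" and b: "ALL l:{1..r}. inj_on (b l) {1..n l} & (ALL j:{1..n l}. b l j ~= 0)"
  obtain A B \<beta> \<alpha> m \<sigma> where X: "max_pair_kron W \<Lambda> \<Lambda>\<^sub>1 r A B n \<beta> \<alpha> m \<sigma>"
   using max_pair_char_numbers[OF assms(1-5) n] by blast
  show "pair_isomorphic W \<Lambda> \<Lambda>\<^sub>1
    (direct_sum (symplectic_part W \<Lambda> \<Lambda>\<^sub>1) (product_space {1..r} (%l. kron_space (n l))))
    (direct_sum_bivector (symplectic_part W \<Lambda> \<Lambda>\<^sub>1) (dual_bivector (symplectic_part W \<Lambda> \<Lambda>\<^sub>1) (reduced_form W \<Lambda>))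
     (product_space {1..r} (%l. kron_space (n l))) (product_bivector {1..r} (%l. kron_space (n l)) (%l. kron_bivector (n l) (%_. 1))))
    (direct_sum_bivector (symplectic_part W \<Lambda> \<Lambda>\<^sub>1) (dual_bivector (symplectic_part W \<Lambda> \<Lambda>\<^sub>1) (reduced_form W \<Lambda>\<^sub>1))
     (product_space {1..r} (%l. kron_space (n l))) (product_bivector {1..r} (%l. kron_space (n l)) (%l. kron_bivector (n l) (b l))))"
   by (rule max_pair_kron.conclusion_d_decomposition[OF X assms(3,4) b])
 qed
qed

end
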